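(* Suppose $K\in\mathbb{R}^{r\times n}$ is chosen so that the structure conditions (S) hold for some invertible $M_1,N_1\in\mathbb{R}^{n\times n}$, together with the initial condition (I) on $x_0$ (both stated in the context). Then Problem (FSP) and Problem $\mathrm{(FP)_K}$ are equivalent, in the sense that, with $x_{10}=\begin{pmatrix}I_h&\mathbf{0}_{h\times(n-h)}\end{pmatrix}M_1x_0$, $$\inf_{(u(\cdot),x(\cdot))\in\mathcal{J}_{ad}[0,T]}J(u(\cdot),x(\cdot))=\inf_{v(\cdot)\in\mathcal{U}_{ad}[0,T]}J_1(v(\cdot)).$$
   Context: Probability setting: $(\Omega,\mathcal{F},\{\mathcal{F}_t\},\mathbb{P})$ is a complete filtered probability space with a one-dimensional standard Brownian motion $W$ and its augmented natural filtration; $L^2_{\mathcal{F}_t}(0,T;\mathbb{R}^k)$ is the space of adapted $\mathbb{R}^k$-valued processes with $\mathbb{E}\int_0^T|x(t)|^2dt<\infty$. $T>0$ is fixed. All matrices are constant. State equation: $E\,dx(t)=[Ax(t)+Bu(t)]dt+[Cx(t)+Du(t)]dW(t)$, $t\in(0,T]$, $Ex(0)=x_0$, with $E,A,C\in\mathbb{R}^{n\times n}$, $\mathrm{rank}(E)=m<n$, $B,D\in\mathbb{R}^{n\times r}$, $x_0\in\mathbb{R}^n$. $\mathcal{J}_{ad}[0,T]$ is the set of pairs $(u(\cdot),x(\cdot))$ such that $u(\cdot)\in L^2_{\mathcal{F}_t}(0,T;\mathbb{R}^r)$ is such that the state equation admits a unique solution $x(\cdot)\in L^2_{\mathcal{F}_t}(0,T;\mathbb{R}^n)$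 under certain initial conditions (here: the given $x_0$, subject to the condition (I) below). Cost: for symmetric $Q,H\in\mathbb{R}^{n\times n}$, $R\in\mathbb{R}^{r\times r}$, $J(u,x)=\frac12\mathbb{E}\int_0^T(x^{\mathrm T}Qx+u^{\mathrm T}Ru)dt+\frac12\mathbb{E}[x^{\mathrm T}(T)E^{\mathrm T}HEx(T)]$. Problem (FSP): for given $x_0$, find $(\bar u,\bar x)\in\mathcal{J}_{ad}[0,T]$ attaining $V(0,x_0):=\inf_{\mathcal{J}_{ad}[0,T]}J(u,x)$. Feedback: controls are written $u=Kx+v$ with $v(\cdot)\in L^2_{\mathcal{F}_t}(0,T;\mathbb{R}^r)$, so $x$ satisfies $E\,dx=[(A+BK)x+Bv]dt+[(C+DK)x+Dv]dW$, $Ex(0)=x_0$. Conditions (S) on $K$: there are invertible $M_1,N_1\in\mathbb{R}^{n\times n}$ with $M_1EN_1=\mathrm{diag}(I_h,G)$, $M_1(A+BK)N_1=\mathrm{diag}(A_1,I_{n-h})$, $M_1B=\begin{pmatrix} B_1 \\ B_2 \end{pmatrix}$, $M_1(C+DK)N_1=\begin{pmatrix} C_{11}&C_{12} \\ \mathbf{0}_{(n-h)\times h}&C_{22} \end{pmatrix}$, $M_1D=\begin{pmatrix} D_1 \\ D_2 \end{pmatrix}$, where $C_{22}B_2=D_2$; $G=\mathrm{diag}(G_1,\dots,G_l)$ with $G_k\in\mathbb{R}^{m_k\times m_k}$ having $1$ on the first superdiagonal and $0$ elsewhere, $\sum_km_k=n-h$; $A_1,C_{11}\in\mathbb{R}^{h\times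 h}$, $C_{12}\in\mathbb{R}^{h\times(n-h)}$, $C_{22}\in\mathbb{R}^{(n-h)\times(n-h)}$, $B_1,D_1\in\mathbb{R}^{h\times r}$, $B_2,D_2\in\mathbb{R}^{(n-h)\times r}$; $B_2=(B_{21}^{\mathrm T},\dots,B_{2l}^{\mathrm T})^{\mathrm T}$ with each $B_{2k}\in\mathbb{R}^{m_k\times r}$ having only its first row possibly nonzero. Condition (I): $\begin{pmatrix}\mathbf{0}_{(n-h)\times h}&I_{n-h}\end{pmatrix}M_1x_0=\mathbf{0}_{(n-h)\times1}$. Problem $\mathrm{(FP)_K}$: $\tilde D_1=D_1-C_{12}B_2$; state $dx_1=[A_1x_1+B_1v]dt+[C_{11}x_1+\tilde D_1v]dW$, $x_1(0)=x_{10}$; $\mathcal{U}_{ad}[0,T]=L^2_{\mathcal{F}_t}(0,T;\mathbb{R}^r)$; cost $$J_1(v)=\frac12\mathbb{E}\int_0^T\begin{pmatrix} x_1 \\ v \end{pmatrix}^{\mathrm T}\begin{pmatrix} \hat Q&S^{\mathrm T} \\ S&\hat R \end{pmatrix}\begin{pmatrix} x_1 \\ v \end{pmatrix}dt+\frac12\mathbb{E}[x_1^{\mathrm T}(T)\hat Hx_1(T)],$$ where $\begin{pmatrix} \hat Q&S^{\mathrm T} \\ S&\hat R \end{pmatrix}=\Theta^{\mathrm T}\begin{pmatrix} Q&\mathbf{0} \\ \mathbf{0}&R \end{pmatrix}\Theta$ with $\Theta=\begin{pmatrix} N_1&\mathbf{0}_{n\times r} \\ KN_1&I_r \end{pmatrix}\begin{pmatrix}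 I_h&\mathbf{0}_{h\times r} \\ \mathbf{0}_{(n-h)\times h}&-B_2 \\ \mathbf{0}_{r\times h}&I_r \end{pmatrix}$, and $\hat H=\begin{pmatrix}I_h&\mathbf{0}\end{pmatrix}(M_1^{-1})^{\mathrm T}HM_1^{-1}\begin{pmatrix} I_h \\ \mathbf{0} \end{pmatrix}$. The problem is to find, for given $x_{10}\in\mathbb{R}^h$, $\bar v\in\mathcal{U}_{ad}[0,T]$ attaining $V_1(0,x_{10}):=\inf_{v\in\mathcal{U}_{ad}[0,T]}J_1(v)$.
   Formalization: Admissible pairs are read via feedback: u=Fx+v for some matrix F and some v, with x the unique solution of the resulting closed-loop equation; with uniqueness for fixed u the claim fails (E=A=C=D=0, B=K=1, n=1: the admissible set is empty). *)

theory Defs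
  imports
    "HOL-Probability.Probability"
    "Jordan_Normal_Form.Jordan_Normal_Form"
    "Jordan_Normal_Form.Gauss_Jordan_Elimination"
    "Jordan_Normal_Form.DL_Rank"
begin

unbundle no vec_syntax

text \<open>
  Vectors and matrices are those of \<^theory>\<open>Jordan_Normal_Form.Matrix\<close>, because the block sizes
  vary and may be zero. A process is a function of time and of the sample point; only its values at
  times in the interval from 0 to T matter.
\<close>


section \<open>Brownian motion and its augmented natural filtration\<close>

definition natural_events :: "'w measure \<Rightarrow> (real \<Rightarrow> 'w \<Rightarrow> real) \<Rightarrow> real \<Rightarrow> 'w set set" where
  "natural_events P W t =
     {W s -` S \<inter> space P | s S. 0 \<le> s \<and> s \<le> t \<and> S \<in> sets (borel :: real measure)}"

definition aug_filtration :: "'w measure \<Rightarrow> (real \<Rightarrow> 'w \<Rightarrow> real) \<Rightarrow> real \<Rightarrow> 'w measure" where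
  "aug_filtration P W t = sigma (space P) (natural_events P W t \<union> null_sets P)"

definition brownian_motion :: "'w measure \<Rightarrow> (real \<Rightarrow> 'w \<Rightarrow> real) \<Rightarrow> bool" where
  "brownian_motion P W \<longleftrightarrow>
     (\<forall>t\<ge>0. W t \<in> borel_measurable P) \<and>
     (AE \<omega> in P. W 0 \<omega> = 0) \<and>
     (AE \<omega> in P. continuous_on {0..} (\<lambda>t. W t \<omega>)) \<and>
     (\<forall>s t. 0 \<le> s \<and> s < t \<longrightarrow>
        distributed P lborel (\<lambda>\<omega>. W t \<omega> - W s \<omega>) (normal_density 0 (sqrt (t - s)))) \<and>
     (\<forall>s t. 0 \<le> s \<and> s < t \<longrightarrow>
        prob_space.indep_set P
          (sigma_sets (space P) (natural_events P W s))
          {(\<lambda>\<omega>. W t \<omega> - W s \<omega>) -` S \<inter> space P | S. S \<in> sets borel})"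


section \<open>Square-integrable adapted processes\<close>

definition L2_adapted ::
    "'w measure \<Rightarrow> (real \<Rightarrow> 'w \<Rightarrow> real) \<Rightarrow> real \<Rightarrow> nat \<Rightarrow> (real \<Rightarrow> 'w \<Rightarrow> real vec) set" where
  "L2_adapted P W T k = {x.
     (\<forall>t\<in>{0..T}. \<forall>\<omega>\<in>space P. x t \<omega> \<in> carrier_vec k) \<and>
     (\<forall>i<k. (\<lambda>(t, \<omega>). x t \<omega> $ i) \<in> borel_measurable (restrict_space borel {0..T} \<Otimes>\<^sub>M P)) \<and>
     (\<forall>t\<in>{0..T}. \<forall>i<k. (\<lambda>\<omega>. x t \<omega> $ i) \<in> borel_measurable (aug_filtration P W t)) \<and>
     (\<integral>\<^sup>+\<omega>. (\<integral>\<^sup>+t. ennreal (x t \<omega> \<bullet> x t \<omega>) * indicator {0..T} t \<partial>lborel) \<partial>P) < \<infinity>}"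


section \<open>The Ito integral\<close>

text \<open>
  The triple of k, \<open>\<tau>\<close> and \<open>\<xi>\<close> encodes the elementary process which takes the value \<open>\<xi> i\<close>
  on the interval from \<open>\<tau> i\<close> (excluded) to \<open>\<tau> (Suc i)\<close> (included), for i below k.
\<close>

definition elementary ::
    "'w measure \<Rightarrow> (real \<Rightarrow> 'w \<Rightarrow> real) \<Rightarrow> real \<Rightarrow> nat \<Rightarrow> (nat \<Rightarrow> real) \<Rightarrow> (nat \<Rightarrow> 'w \<Rightarrow> real) \<Rightarrow> bool" where
  "elementary P W t k \<tau> \<xi> \<longleftrightarrow>
     (\<forall>i\<le>k. \<tau> i \<in> {0..t}) \<and>
     (\<forall>i<k. \<tau> i \<le> \<tau> (Suc i)) \<and>
     (\<forall>i<k. \<xi> i \<in> borel_measurable (aug_filtration P W (\<tau> i))) \<and>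
     (\<forall>i<k. \<exists>c. \<forall>\<omega>\<in>space P. \<bar>\<xi> i \<omega>\<bar> \<le> c)"

definition elementary_process ::
    "nat \<Rightarrow> (nat \<Rightarrow> real) \<Rightarrow> (nat \<Rightarrow> 'w \<Rightarrow> real) \<Rightarrow> real \<Rightarrow> 'w \<Rightarrow> real" where
  "elementary_process k \<tau> \<xi> s \<omega> = (\<Sum>i<k. \<xi> i \<omega> * indicator {\<tau> i<..\<tau> (Suc i)} s)"

definition elementary_integral ::
    "(real \<Rightarrow> 'w \<Rightarrow> real) \<Rightarrow> nat \<Rightarrow> (nat \<Rightarrow> real) \<Rightarrow> (nat \<Rightarrow> 'w \<Rightarrow> real) \<Rightarrow> 'w \<Rightarrow> real" where
  "elementary_integral W k \<tau> \<xi> \<omega> = (\<Sum>i<k. \<xi> i \<omega> * (W (\<tau> (Suc i)) \<omega> - W (\<tau> i) \<omega>))"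

definition has_ito_integral ::
    "'w measure \<Rightarrow> (real \<Rightarrow> 'w \<Rightarrow> real) \<Rightarrow> (real \<Rightarrow> 'w \<Rightarrow> real) \<Rightarrow> real \<Rightarrow> ('w \<Rightarrow> real) \<Rightarrow> bool" where
  "has_ito_integral P W f t Y \<longleftrightarrow>
     Y \<in> borel_measurable P \<and>
     (\<exists>k \<tau> \<xi>.
        (\<forall>m::nat. elementary P W t (k m) (\<tau> m) (\<xi> m)) \<and>
        (\<lambda>m. \<integral>\<^sup>+\<omega>. (\<integral>\<^sup>+s. ennreal ((elementary_process (k m) (\<tau> m) (\<xi> m) s \<omega> - f s \<omega>)\<^sup>2)
                          * indicator {0..t} s \<partial>lborel) \<partial>P) \<longlonglongrightarrow> 0 \<and>
        (\<lambda>m. \<integral>\<^sup>+\<omega>. ennreal ((elementary_integral W (k m) (\<tau> m) (\<xi> m) \<omega> - Y \<omega>)\<^sup>2) \<partial>P) \<longlonglongrightarrow> 0)"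

text \<open>The integral of f over the interval from 0 to t; it is determined up to a null set.\<close>

definition ito_integral ::
    "'w measure \<Rightarrow> (real \<Rightarrow> 'w \<Rightarrow> real) \<Rightarrow> (real \<Rightarrow> 'w \<Rightarrow> real) \<Rightarrow> real \<Rightarrow> 'w \<Rightarrow> real" where
  "ito_integral P W f t = (SOME Y. has_ito_integral P W f t Y)"


section \<open>Linear singular stochastic equations\<close>

text \<open>
  The equation \<open>E dx = (A x + B u) dt + (C x + D u) dW\<close>, \<open>E x(0) = x0\<close> in integral form;
  the initial condition is the instance \<open>t = 0\<close>.
\<close>

definition sde_solution ::
    "'w measure \<Rightarrow> (real \<Rightarrow> 'w \<Rightarrow> real) \<Rightarrow> real \<Rightarrow>
     real mat \<Rightarrow> real mat \<Rightarrow> real mat \<Rightarrow> real mat \<Rightarrow> real mat \<Rightarrow> real vec \<Rightarrow>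
     (real \<Rightarrow> 'w \<Rightarrow> real vec) \<Rightarrow> (real \<Rightarrow> 'w \<Rightarrow> real vec) \<Rightarrow> bool" where
  "sde_solution P W T E A B C D x0 u x \<longleftrightarrow>
     x \<in> L2_adapted P W T (dim_col E) \<and>
     (\<forall>t\<in>{0..T}. AE \<omega> in P.
        E *\<^sub>v x t \<omega> =
          x0
          + vec (dim_row E) (\<lambda>i. LBINT s:{0..t}. (A *\<^sub>v x s \<omega> + B *\<^sub>v u s \<omega>) $ i)
          + vec (dim_row E) (\<lambda>i.
              ito_integral P W (\<lambda>s \<omega>'. (C *\<^sub>v x s \<omega>' + D *\<^sub>v u s \<omega>') $ i) t \<omega>))"

text \<open>Uniqueness is uniqueness as an element of the \<open>L\<^sup>2\<close> space of processes.\<close>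

definition unique_sde_solution ::
    "'w measure \<Rightarrow> (real \<Rightarrow> 'w \<Rightarrow> real) \<Rightarrow> real \<Rightarrow>
     real mat \<Rightarrow> real mat \<Rightarrow> real mat \<Rightarrow> real mat \<Rightarrow> real mat \<Rightarrow> real vec \<Rightarrow>
     (real \<Rightarrow> 'w \<Rightarrow> real vec) \<Rightarrow> (real \<Rightarrow> 'w \<Rightarrow> real vec) \<Rightarrow> bool" where
  "unique_sde_solution P W T E A B C D x0 u x \<longleftrightarrow>
     sde_solution P W T E A B C D x0 u x \<and>
     (\<forall>y. sde_solution P W T E A B C D x0 u y \<longrightarrow>
        (AE \<omega> in P. AE t in lborel. t \<in> {0..T} \<longrightarrow> y t \<omega> = x t \<omega>))"


section \<open>Problem (FSP)\<close>

text \<open>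
  Controls are written in feedback form \<open>u = F x + v\<close>, and solvability and uniqueness are those of
  the state equation that results, for the given v; the choice \<open>F = 0\<close> covers the open-loop
  controls. Uniqueness with u itself held fixed would be too strong for singular systems: for
  \<open>E = A = C = D = 0\<close> and \<open>B = 1\<close> in dimension one it fails for every control, although
  the feedback \<open>F = 1\<close> gives the well-posed equation \<open>0 = x + v\<close>.
\<close>

definition admissible_pairs ::
    "'w measure \<Rightarrow> (real \<Rightarrow> 'w \<Rightarrow> real) \<Rightarrow> real \<Rightarrow>
     real mat \<Rightarrow> real mat \<Rightarrow> real mat \<Rightarrow> real mat \<Rightarrow> real mat \<Rightarrow> real vec \<Rightarrow>
     ((real \<Rightarrow> 'w \<Rightarrow> real vec) \<times> (real \<Rightarrow> 'w \<Rightarrow> real vec)) set" where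
  "admissible_pairs P W T E A B C D x0 = {(u, x).
     u \<in> L2_adapted P W T (dim_col B) \<and>
     (\<exists>F\<in>carrier_mat (dim_col B) (dim_col E). \<exists>v\<in>L2_adapted P W T (dim_col B).
        (\<forall>t\<in>{0..T}. \<forall>\<omega>\<in>space P. u t \<omega> = F *\<^sub>v x t \<omega> + v t \<omega>) \<and>
        unique_sde_solution P W T E (A + B * F) B (C + D * F) D x0 v x)}"

definition fsp_cost ::
    "'w measure \<Rightarrow> real \<Rightarrow> real mat \<Rightarrow> real mat \<Rightarrow> real mat \<Rightarrow> real mat \<Rightarrow>
     (real \<Rightarrow> 'w \<Rightarrow> real vec) \<Rightarrow> (real \<Rightarrow> 'w \<Rightarrow> real vec) \<Rightarrow> real" where
  "fsp_cost P T E Q R H u x =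
     1/2 * (LINT \<omega>|P. (LBINT t:{0..T}. (x t \<omega> \<bullet> (Q *\<^sub>v x t \<omega>) + u t \<omega> \<bullet> (R *\<^sub>v u t \<omega>))))
     + 1/2 * (LINT \<omega>|P. x T \<omega> \<bullet> ((transpose_mat E * H * E) *\<^sub>v x T \<omega>))"


section \<open>The structure conditions on the feedback matrix\<close>

text \<open>
  The list ms contains the sizes of the blocks of \<open>G\<close>, and \<open>jordan_block m 0\<close> has ones on the first
  superdiagonal and zeros elsewhere.
\<close>

definition structure_conditions ::
    "nat \<Rightarrow> nat \<Rightarrow> real mat \<Rightarrow> real mat \<Rightarrow> real mat \<Rightarrow> real mat \<Rightarrow> real mat \<Rightarrow> real mat \<Rightarrow>
     real mat \<Rightarrow> real mat \<Rightarrow> nat \<Rightarrow> nat list \<Rightarrow> real mat \<Rightarrow> real mat \<Rightarrow> real mat \<Rightarrow>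
     real mat \<Rightarrow> real mat \<Rightarrow> real mat \<Rightarrow> real mat \<Rightarrow> real mat \<Rightarrow> bool" where
  "structure_conditions n r E A B C D K M1 N1 h ms A1 B1 B2 C11 C12 C22 D1 D2 \<longleftrightarrow>
     h \<le> n \<and>
     M1 \<in> carrier_mat n n \<and> invertible_mat M1 \<and> N1 \<in> carrier_mat n n \<and> invertible_mat N1 \<and>
     A1 \<in> carrier_mat h h \<and> C11 \<in> carrier_mat h h \<and> C12 \<in> carrier_mat h (n - h) \<and>
     C22 \<in> carrier_mat (n - h) (n - h) \<and> B1 \<in> carrier_mat h r \<and> D1 \<in> carrier_mat h r \<and>
     B2 \<in> carrier_mat (n - h) r \<and> D2 \<in> carrier_mat (n - h) r \<and>
     (\<forall>m\<in>set ms. 1 \<le> m) \<and> sum_list ms = n - h \<and>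
     M1 * E * N1 =
       four_block_mat (1\<^sub>m h) (0\<^sub>m h (n - h))
                      (0\<^sub>m (n - h) h) (diag_block_mat (map (\<lambda>m. jordan_block m 0) ms)) \<and>
     M1 * (A + B * K) * N1 =
       four_block_mat A1 (0\<^sub>m h (n - h)) (0\<^sub>m (n - h) h) (1\<^sub>m (n - h)) \<and>
     M1 * B = B1 @\<^sub>r B2 \<and>
     M1 * (C + D * K) * N1 = four_block_mat C11 C12 (0\<^sub>m (n - h) h) C22 \<and>
     M1 * D = D1 @\<^sub>r D2 \<and>
     C22 * B2 = D2 \<and>
     (\<forall>k<length ms. \<forall>i. 1 \<le> i \<and> i < ms ! k \<longrightarrow>
        (\<forall>j<r. B2 $$ (sum_list (take k ms) + i, j) = 0))"


section \<open>Problem (FP)_K\<close>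

definition fpk_state ::
    "'w measure \<Rightarrow> (real \<Rightarrow> 'w \<Rightarrow> real) \<Rightarrow> real \<Rightarrow> nat \<Rightarrow>
     real mat \<Rightarrow> real mat \<Rightarrow> real mat \<Rightarrow> real mat \<Rightarrow> real mat \<Rightarrow> real mat \<Rightarrow> real vec \<Rightarrow>
     (real \<Rightarrow> 'w \<Rightarrow> real vec) \<Rightarrow> (real \<Rightarrow> 'w \<Rightarrow> real vec)" where
  "fpk_state P W T h A1 B1 B2 C11 C12 D1 x10 v =
     (SOME x1. sde_solution P W T (1\<^sub>m h) A1 B1 C11 (D1 - C12 * B2) x10 v x1)"

definition fpk_Theta :: "nat \<Rightarrow> nat \<Rightarrow> nat \<Rightarrow> real mat \<Rightarrow> real mat \<Rightarrow> real mat \<Rightarrow> real mat" where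
  "fpk_Theta n r h K N1 B2 =
     four_block_mat N1 (0\<^sub>m n r) (K * N1) (1\<^sub>m r) *
     four_block_mat (1\<^sub>m h) (0\<^sub>m h r) (0\<^sub>m (n - h) h @\<^sub>r 0\<^sub>m r h) (- B2 @\<^sub>r 1\<^sub>m r)"

text \<open>The weight matrix of the running cost, with rows \<open>(Qhat, S\<^sup>T)\<close> and \<open>(S, Rhat)\<close>.\<close>

definition fpk_weight ::
    "nat \<Rightarrow> nat \<Rightarrow> nat \<Rightarrow> real mat \<Rightarrow> real mat \<Rightarrow> real mat \<Rightarrow> real mat \<Rightarrow> real mat \<Rightarrow> real mat" where
  "fpk_weight n r h K N1 B2 Q R =
     (let \<Theta> = fpk_Theta n r h K N1 B2
      in transpose_mat \<Theta> * four_block_mat Q (0\<^sub>m n r) (0\<^sub>m r n) R * \<Theta>)"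

definition fpk_Hhat :: "nat \<Rightarrow> nat \<Rightarrow> real mat \<Rightarrow> real mat \<Rightarrow> real mat" where
  "fpk_Hhat n h M1 H =
     (let J = 1\<^sub>m h @\<^sub>r 0\<^sub>m (n - h) h; M1inv = the (mat_inverse M1)
      in transpose_mat J * transpose_mat M1inv * H * M1inv * J)"

definition fpk_cost ::
    "'w measure \<Rightarrow> (real \<Rightarrow> 'w \<Rightarrow> real) \<Rightarrow> real \<Rightarrow> nat \<Rightarrow> nat \<Rightarrow> nat \<Rightarrow>
     real mat \<Rightarrow> real mat \<Rightarrow> real mat \<Rightarrow> real mat \<Rightarrow> real mat \<Rightarrow> real mat \<Rightarrow>
     real mat \<Rightarrow> real mat \<Rightarrow> real mat \<Rightarrow> real mat \<Rightarrow> real mat \<Rightarrow> real mat \<Rightarrow>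
     real vec \<Rightarrow> (real \<Rightarrow> 'w \<Rightarrow> real vec) \<Rightarrow> real" where
  "fpk_cost P W T n r h Q R H K M1 N1 A1 B1 B2 C11 C12 D1 x10 v =
     (let x1 = fpk_state P W T h A1 B1 B2 C11 C12 D1 x10 v in
      1/2 * (LINT \<omega>|P. (LBINT t:{0..T}.
               (x1 t \<omega> @\<^sub>v v t \<omega>) \<bullet> (fpk_weight n r h K N1 B2 Q R *\<^sub>v (x1 t \<omega> @\<^sub>v v t \<omega>))))
      + 1/2 * (LINT \<omega>|P. x1 T \<omega> \<bullet> (fpk_Hhat n h M1 H *\<^sub>v x1 T \<omega>)))"

end

theory Submission
  imports Defs
begin

text \<open>
  Premultiplying the closed-loop equation by \<open>M1\<close> and substituting \<open>x = N1 (z1, z2)\<close> splits it into an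
  ordinary linear SDE for \<open>z1\<close> and the singular system
  \<open>G dz2 = (z2 + B2 v) dt + (C22 z2 + D2 v) dW\<close>, \<open>G z2(0) = 0\<close>. An Ito process that vanishes has zero
  drift and zero diffusion, so, starting from the last row of each Jordan block and using that \<open>B2 v\<close>
  lives in the first rows, \<open>z2 = - B2 v\<close>; conversely this \<open>z2\<close> solves the system because
  \<open>C22 B2 = D2\<close>. Inserting it into the first equation gives the state equation of the reduced problem,
  which is well posed, and turns one cost into the other. A pair \<open>(u, x)\<close> that is admissible for some other feedback
  solves the closed-loop equation for \<open>K\<close> with \<open>v = u - K x\<close>, so both infima range over the same \<open>v\<close>.
\<close>

section \<open>Elementary integrals with respect to Brownian motion\<close>

text \<open>Solutions carry no path regularity: the equation holds almost surely at each fixed time,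
  and nothing more is known. Hence the algebraic part \<open>z2\<close> is determined only for
  almost every time, while the terminal cost looks at the single time \<open>T\<close>. Two facts
  bridge the gap. Both integrals are mean-square continuous, so an identity valid for almost every
  time extends to every time; and the terminal cost sees only \<open>E x(T)\<close>, which the
  equation determines although \<open>x(T)\<close> itself is not determined.

  The Ito integral is a Hilbert choice over approximations by elementary processes, so it has its
  meaning only once such approximations are shown to exist for every measurable adapted process.
  They are averages over past cells, and adaptedness of these averages is itself a point to be
  proved. Constants in the estimates are not sharp, since only vanishing and convergence matter.

  The costs are Bochner integrals, compared through almost sure equality of their integrands. The
  infima are taken in the extended reals because a cost may be unbounded below.\<close>

locale brownian = prob_space P for P :: "'w measure" +
  fixes W :: "real \<Rightarrow> 'w \<Rightarrow> real"
  assumes complete_P: "complete_measure P" and brownian_motion: "brownian_motion P W"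
begin

section \<open>The augmented filtration and the increments of \<open>W\<close>\<close>

abbreviation F :: "real \<Rightarrow> 'w measure" where
  "F \<equiv> aug_filtration P W"

lemma W_measurable [measurable]: "0 \<le> t \<Longrightarrow> W t \<in> borel_measurable P"
  using brownian_motion unfolding brownian_motion_def by blast

lemma natural_events_subset: "natural_events P W t \<subseteq> sets P"
  unfolding natural_events_def by (auto intro!: measurable_sets)

lemma space_F [simp]: "space (F t) = space P"
  unfolding aug_filtration_def by (simp add: space_measure_of_conv)

lemma sets_F: "sets (F t) = sigma_sets (space P) (natural_events P W t \<union> null_sets P)"
  unfolding aug_filtration_def
  using natural_events_subset[of t] sets.sets_into_space
  by (intro sets_measure_of) blast

lemma subalgebra_F: "subalgebra P (F t)"
proof -
  have "natural_events P W t \<union> null_sets P \<subseteq> sets P"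
    using natural_events_subset by auto
  then have "sigma_sets (space P) (natural_events P W t \<union> null_sets P) \<subseteq> sets P"
    by (rule sets.sigma_sets_subset)
  then show ?thesis
    unfolding subalgebra_def by (simp add: sets_F)
qed

lemma F_measurable_imp: "f \<in> borel_measurable (F t) \<Longrightarrow> f \<in> borel_measurable P"
  using measurable_from_subalg[OF subalgebra_F] .

lemma F_mono: "s \<le> t \<Longrightarrow> f \<in> borel_measurable (F s) \<Longrightarrow> f \<in> borel_measurable (F t)"
proof -
  assume "s \<le> t" and f: "f \<in> borel_measurable (F s)"
  then have "natural_events P W s \<subseteq> natural_events P W t"
    unfolding natural_events_def by fastforce
  then have "sets (F s) \<subseteq> sets (F t)"
    unfolding sets_F by (intro sigma_sets_mono') blast
  then have "subalgebra (F t) (F s)"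
    unfolding subalgebra_def by simp
  then show ?thesis
    using measurable_from_subalg f by blast
qed

lemma W_F_measurable: "0 \<le> s \<Longrightarrow> s \<le> t \<Longrightarrow> W s \<in> borel_measurable (F t)"
  by (rule measurableI) (auto simp: sets_F natural_events_def intro!: sigma_sets.Basic)

lemma null_sets_F: "N \<in> null_sets P \<Longrightarrow> N \<in> sets (F t)"
  by (auto simp: sets_F intro: sigma_sets.Basic)

text \<open>Completeness makes every subset of a null set an event, and the augmentation puts all
  null sets into every \<open>F t\<close>. Adaptedness therefore passes between versions of a random
  variable, which is how limits and conditional expectations are exchanged for the variables of
  interest.\<close>

lemma F_measurable_AE_cong:
  fixes f g :: "'w \<Rightarrow> real"
  assumes f: "f \<in> borel_measurable (F t)" and eq: "AE \<omega> in P. f \<omega> = g \<omega>"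
  shows "g \<in> borel_measurable (F t)"
proof (rule measurableI)
  fix S :: "real set" assume S: "S \<in> sets borel"
  obtain N where N: "N \<in> null_sets P" "{\<omega> \<in> space P. f \<omega> \<noteq> g \<omega>} \<subseteq> N"
    using AE_E[OF eq] by (auto simp: null_sets_def)
  have sub: "A \<in> sets (F t)" if "A \<subseteq> N" for A
    using complete_measure.complete2[OF complete_P that N(1)] by (rule null_sets_F)
  have "{\<omega> \<in> space P. f \<omega> \<noteq> g \<omega>} \<in> sets (F t)" "g -` S \<inter> {\<omega> \<in> space P. f \<omega> \<noteq> g \<omega>} \<in> sets (F t)"
    using N(2) by (auto intro: sub)
  note bad = this
  have "g -` S \<inter> space (F t) = ((f -` S \<inter> space (F t)) - {\<omega> \<in> space P. f \<omega> \<noteq> g \<omega>})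
      \<union> (g -` S \<inter> {\<omega> \<in> space P. f \<omega> \<noteq> g \<omega>})"
    by auto
  also have "\<dots> \<in> sets (F t)"
    by (rule sets.Un[OF sets.Diff[OF measurable_sets[OF f S] bad(1)] bad(2)])
  finally show "g -` S \<inter> space (F t) \<in> sets (F t)" .
qed simp

text \<open>\<open>brownian_motion\<close> makes increments independent of the natural events only,
  whereas adaptedness refers to the augmented filtration. Null generators are replaced by the empty
  set, and a countable union costs only countably many null sets.\<close>

lemma F_set_AE_natural:
  assumes "A \<in> sets (F t)"
  shows "\<exists>A'\<in>sigma_sets (space P) (natural_events P W t). AE \<omega> in P. \<omega> \<in> A \<longleftrightarrow> \<omega> \<in> A'"
  using assms unfolding sets_F
proof (induction rule: sigma_sets.induct)
  case (Basic a)
  then show ?case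
  proof
    assume "a \<in> null_sets P"
    then have "AE \<omega> in P. \<omega> \<in> a \<longleftrightarrow> \<omega> \<in> {}"
      by (simp add: AE_not_in)
    then show ?thesis by (blast intro: sigma_sets.Empty)
  qed (auto intro!: bexI[of _ a] sigma_sets.Basic)
next
  case Empty
  then show ?case by (auto intro!: bexI[of _ "{}"] sigma_sets.Empty)
next
  case (Compl a)
  then obtain a' where a': "a' \<in> sigma_sets (space P) (natural_events P W t)"
    "AE \<omega> in P. \<omega> \<in> a \<longleftrightarrow> \<omega> \<in> a'" by blast
  then have "AE \<omega> in P. \<omega> \<in> space P - a \<longleftrightarrow> \<omega> \<in> space P - a'"
    by (auto elim: eventually_mono)
  with a'(1) show ?case by (blast intro: sigma_sets.Compl)
next
  case (Union a)
  then have "\<forall>i. \<exists>A'. A' \<in> sigma_sets (space P) (natural_events P W t) \<and> (AE \<omega> in P. \<omega> \<in> a i \<longleftrightarrow> \<omega> \<in> A')"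
    by blast
  then obtain b where b: "\<And>i. b i \<in> sigma_sets (space P) (natural_events P W t)"
    "\<And>i. AE \<omega> in P. \<omega> \<in> a i \<longleftrightarrow> \<omega> \<in> b i" by metis
  have "AE \<omega> in P. \<forall>i::nat. \<omega> \<in> a i \<longleftrightarrow> \<omega> \<in> b i"
    using b(2) by (simp add: AE_all_countable)
  then have "AE \<omega> in P. \<omega> \<in> (\<Union>i. a i) \<longleftrightarrow> \<omega> \<in> (\<Union>i. b i)"
    by (auto elim: eventually_mono)
  with b(1) show ?case by (blast intro: sigma_sets.Union)
qed

text \<open>Replacing an event by an almost surely equal one changes no probability, so independence
  of the natural past extends to the augmented past.\<close>

lemma indep_var_increment:
  fixes X :: "'w \<Rightarrow> real"
  assumes st: "0 \<le> s" "s < t" and X: "X \<in> borel_measurable (F s)"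
  shows "indep_var borel X borel (\<lambda>\<omega>. W t \<omega> - W s \<omega>)"
proof -
  let ?D = "\<lambda>\<omega>. W t \<omega> - W s \<omega>"
  define N where "N = sigma_sets (space P) (natural_events P W s)"
  define S where "S = {?D -` S \<inter> space P | S. S \<in> sets (borel :: real measure)}"
  define G where "G = sigma_sets (space P) {X -` A \<inter> space P |A. A \<in> sets borel}"
  have D: "?D \<in> borel_measurable P"
    using st by (intro borel_measurable_diff W_measurable) auto
  have XP: "X \<in> borel_measurable P"
    using X by (rule F_measurable_imp)
  have FP: "sets (F s) \<subseteq> sets P"
    using subalgebra_F[of s] unfolding subalgebra_def by blast
  have ind: "indep_set N S"
    using brownian_motion st unfolding brownian_motion_def N_def S_def by blast
  then have sub: "N \<subseteq> sets P" "S \<subseteq> sets P"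
    and prod: "\<And>a b. a \<in> N \<Longrightarrow> b \<in> S \<Longrightarrow> prob (a \<inter> b) = prob a * prob b"
    unfolding indep_sets2_eq by auto
  have FS: "prob (A \<inter> B) = prob A * prob B" if A: "A \<in> sets (F s)" and B: "B \<in> S" for A B
  proof -
    obtain A' where A': "A' \<in> N" "AE \<omega> in P. \<omega> \<in> A \<longleftrightarrow> \<omega> \<in> A'"
      using F_set_AE_natural[OF A] unfolding N_def by blast
    have m: "A \<in> sets P" "A' \<in> sets P" "B \<in> sets P"
      using A A'(1) B sub FP by auto
    have "prob A = prob A'" "prob (A \<inter> B) = prob (A' \<inter> B)"
      using A'(2) m by (auto intro!: finite_measure_eq_AE elim: eventually_mono)
    then show ?thesis
      using prod[OF A'(1) B] by simp
  qed
  have "{X -` A \<inter> space P |A. A \<in> sets borel} \<subseteq> sets (F s)"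
    using measurable_sets[OF X] by auto
  then have GF: "G \<subseteq> sets (F s)"
    using sets.sigma_sets_subset[of _ "F s"] unfolding G_def by simp
  \<comment> \<open>\<open>indep_var_eq\<close> speaks of generated sigma-algebras; the preimages of
    Borel sets under one map form a sigma-algebra already.\<close>
  have "sigma_sets (space P) S = S"
    using sets_vimage_algebra2[of ?D "space P" borel] sets.sigma_sets_eq[of "vimage_algebra (space P) ?D borel"]
    unfolding S_def by simp
  moreover have "indep_set G S"
    unfolding indep_sets2_eq using GF FP sub(2) FS by blast
  ultimately show ?thesis
    unfolding indep_var_eq using XP D unfolding G_def S_def by simp
qed

lemma increment_distributed:
  "0 \<le> s \<Longrightarrow> s < t \<Longrightarrow> distributed P lborel (\<lambda>\<omega>. W t \<omega> - W s \<omega>) (normal_density 0 (sqrt (t - s)))"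
  using brownian_motion unfolding brownian_motion_def by blast

text \<open>The normal law is given for \<open>s < t\<close> only. Elementary processes may repeat a
  node, and stopping them creates such repetitions, so \<open>s = t\<close> has to be
  covered.\<close>

lemma increment_moments:
  assumes st: "0 \<le> s" "s \<le> t"
  shows "integrable P (\<lambda>\<omega>. W t \<omega> - W s \<omega>)" "expectation (\<lambda>\<omega>. W t \<omega> - W s \<omega>) = 0"
    "integrable P (\<lambda>\<omega>. (W t \<omega> - W s \<omega>)\<^sup>2)" "expectation (\<lambda>\<omega>. (W t \<omega> - W s \<omega>)\<^sup>2) = t - s"
proof -
  have "integrable P (\<lambda>\<omega>. W t \<omega> - W s \<omega>) \<and> expectation (\<lambda>\<omega>. W t \<omega> - W s \<omega>) = 0 \<and>
    integrable P (\<lambda>\<omega>. (W t \<omega> - W s \<omega>)\<^sup>2) \<and> expectation (\<lambda>\<omega>. (W t \<omega> - W s \<omega>)\<^sup>2) = t - s"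
  proof (cases "s = t")
    case False
    then have lt: "s < t" using st by simp
    note d = increment_distributed[OF st(1) lt]
    have pos: "0 < sqrt (t - s)" using lt by simp
    have i1: "integrable P (\<lambda>\<omega>. W t \<omega> - W s \<omega>)"
      using distributed_integrable[OF d, of "\<lambda>x. x"] integrable_normal_moment_nz_1[OF pos, of 0] by simp
    have i2: "integrable P (\<lambda>\<omega>. (W t \<omega> - W s \<omega>)\<^sup>2)"
      using distributed_integrable[OF d, of "\<lambda>x. x\<^sup>2"] integrable_normal_moment[OF pos, of 0 2] by simp
    have e: "expectation (\<lambda>\<omega>. W t \<omega> - W s \<omega>) = 0"
      using normal_distributed_expectation[OF pos d] .
    have "variance (\<lambda>\<omega>. W t \<omega> - W s \<omega>) = (sqrt (t - s))\<^sup>2"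
      using normal_distributed_variance[OF pos d] .
    with e i1 i2 lt show ?thesis by simp
  qed simp
  then show "integrable P (\<lambda>\<omega>. W t \<omega> - W s \<omega>)" "expectation (\<lambda>\<omega>. W t \<omega> - W s \<omega>) = 0"
    "integrable P (\<lambda>\<omega>. (W t \<omega> - W s \<omega>)\<^sup>2)" "expectation (\<lambda>\<omega>. (W t \<omega> - W s \<omega>)\<^sup>2) = t - s"
    by auto
qed

text \<open>The martingale property in the one form that is used: it removes the mixed terms when an
  elementary integral is squared.\<close>

lemma expectation_mult_increment:
  fixes X :: "'w \<Rightarrow> real"
  assumes st: "0 \<le> s" "s \<le> t" and X: "X \<in> borel_measurable (F s)" "integrable P X"
  shows "integrable P (\<lambda>\<omega>. X \<omega> * (W t \<omega> - W s \<omega>))"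
    "expectation (\<lambda>\<omega>. X \<omega> * (W t \<omega> - W s \<omega>)) = 0"
proof -
  have "integrable P (\<lambda>\<omega>. X \<omega> * (W t \<omega> - W s \<omega>)) \<and> expectation (\<lambda>\<omega>. X \<omega> * (W t \<omega> - W s \<omega>)) = 0"
  proof (cases "s = t")
    case False
    then have lt: "s < t" using st by simp
    note iv = indep_var_increment[OF st(1) lt X(1)]
    show ?thesis
      using indep_var_integrable[OF iv X(2)] indep_var_lebesgue_integral[OF iv X(2)]
        increment_moments[OF st] by simp
  qed simp
  then show "integrable P (\<lambda>\<omega>. X \<omega> * (W t \<omega> - W s \<omega>))"
    "expectation (\<lambda>\<omega>. X \<omega> * (W t \<omega> - W s \<omega>)) = 0" by auto
qed

text \<open>The same independence applied to the squared increment; it supplies the diagonal terms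
  of the isometry.\<close>

lemma expectation_mult_increment_sq:
  fixes X :: "'w \<Rightarrow> real"
  assumes st: "0 \<le> s" "s \<le> t" and X: "X \<in> borel_measurable (F s)" "integrable P X"
  shows "integrable P (\<lambda>\<omega>. X \<omega> * (W t \<omega> - W s \<omega>)\<^sup>2)"
    "expectation (\<lambda>\<omega>. X \<omega> * (W t \<omega> - W s \<omega>)\<^sup>2) = expectation X * (t - s)"
proof -
  have "integrable P (\<lambda>\<omega>. X \<omega> * (W t \<omega> - W s \<omega>)\<^sup>2) \<and>
    expectation (\<lambda>\<omega>. X \<omega> * (W t \<omega> - W s \<omega>)\<^sup>2) = expectation X * (t - s)"
  proof (cases "s = t")
    case False
    then have lt: "s < t" using st by simp
    have iv: "indep_var borel X borel (\<lambda>\<omega>. (W t \<omega> - W s \<omega>)\<^sup>2)"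
      using indep_var_compose[OF indep_var_increment[OF st(1) lt X(1)],
          of "\<lambda>x. x" borel "\<lambda>x. x\<^sup>2" borel] by (simp add: o_def)
    show ?thesis
      using indep_var_integrable[OF iv X(2)] indep_var_lebesgue_integral[OF iv X(2)]
        increment_moments[OF st] by simp
  qed simp
  then show "integrable P (\<lambda>\<omega>. X \<omega> * (W t \<omega> - W s \<omega>)\<^sup>2)"
    "expectation (\<lambda>\<omega>. X \<omega> * (W t \<omega> - W s \<omega>)\<^sup>2) = expectation X * (t - s)" by auto
qed

section \<open>The isometry for elementary integrals\<close>

lemma elementary_Suc:
  assumes "elementary P W t (Suc k) \<tau> \<xi>"
  shows "elementary P W t k \<tau> \<xi>" "0 \<le> \<tau> k" "\<tau> k \<le> \<tau> (Suc k)" "\<tau> (Suc k) \<le> t"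
    "\<xi> k \<in> borel_measurable (F (\<tau> k))" "\<exists>c. \<forall>\<omega>\<in>space P. \<bar>\<xi> k \<omega>\<bar> \<le> c"
  using assms unfolding elementary_def by (auto simp: less_Suc_eq)

lemma elementary_square_integrable:
  assumes "elementary P W t k \<tau> \<xi>" "i < k"
  shows "\<xi> i \<in> borel_measurable P" "integrable P (\<lambda>\<omega>. (\<xi> i \<omega>)\<^sup>2)"
proof -
  show m: "\<xi> i \<in> borel_measurable P"
    using assms F_measurable_imp unfolding elementary_def by blast
  obtain c where c: "\<forall>\<omega>\<in>space P. \<bar>\<xi> i \<omega>\<bar> \<le> c"
    using assms unfolding elementary_def by blast
  then show "integrable P (\<lambda>\<omega>. (\<xi> i \<omega>)\<^sup>2)"
    using m by (intro integrable_const_bound[where B="c\<^sup>2"]) (auto simp: abs_le_square_iff[symmetric] intro!: AE_I2 power2_mono)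
qed

lemma elementary_integral_F_measurable:
  assumes "elementary P W t k \<tau> \<xi>"
  shows "elementary_integral W k \<tau> \<xi> \<in> borel_measurable (F (\<tau> k))"
  using assms
proof (induction k)
  case 0
  then show ?case by (simp add: elementary_integral_def[abs_def])
next
  case (Suc k)
  note e = elementary_Suc[OF Suc.prems]
  have "\<xi> k \<in> borel_measurable (F (\<tau> (Suc k)))"
    "elementary_integral W k \<tau> \<xi> \<in> borel_measurable (F (\<tau> (Suc k)))"
    "W (\<tau> (Suc k)) \<in> borel_measurable (F (\<tau> (Suc k)))" "W (\<tau> k) \<in> borel_measurable (F (\<tau> (Suc k)))"
    using F_mono[OF e(3,5)] F_mono[OF e(3) Suc.IH[OF e(1)]] e(2,3) by (auto intro!: W_F_measurable)
  then show ?case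
    by (simp add: elementary_integral_def[abs_def])
qed

text \<open>With the last interval peeled off, the square of \<open>S + \<xi> k * D\<close> expands
  into the old square, a mixed term and a diagonal term. In the mixed term
  \<open>S * \<xi> k\<close> is known at time \<open>\<tau> k\<close>, so this term has mean
  zero.\<close>

lemma elementary_integral_moments:
  assumes "elementary P W t k \<tau> \<xi>"
  shows "integrable P (\<lambda>\<omega>. (elementary_integral W k \<tau> \<xi> \<omega>)\<^sup>2) \<and>
    expectation (\<lambda>\<omega>. (elementary_integral W k \<tau> \<xi> \<omega>)\<^sup>2) =
      expectation (\<lambda>\<omega>. \<Sum>i<k. (\<xi> i \<omega>)\<^sup>2 * (\<tau> (Suc i) - \<tau> i))"
  using assms
proof (induction k)
  case 0
  then show ?case by (simp add: elementary_integral_def)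
next
  case (Suc k)
  note e = elementary_Suc[OF Suc.prems]
  define S where "S = elementary_integral W k \<tau> \<xi>"
  define D where "D = (\<lambda>\<omega>. W (\<tau> (Suc k)) \<omega> - W (\<tau> k) \<omega>)"
  have S: "S \<in> borel_measurable (F (\<tau> k))" "S \<in> borel_measurable P"
    using elementary_integral_F_measurable[OF e(1)] F_measurable_imp unfolding S_def by auto
  have IH: "integrable P (\<lambda>\<omega>. (S \<omega>)\<^sup>2)"
    "expectation (\<lambda>\<omega>. (S \<omega>)\<^sup>2) = expectation (\<lambda>\<omega>. \<Sum>i<k. (\<xi> i \<omega>)\<^sup>2 * (\<tau> (Suc i) - \<tau> i))"
    using Suc.IH[OF e(1)] unfolding S_def by auto
  have iS: "integrable P S"
    using S(2) IH(1) by (rule square_integrable_imp_integrable)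
  obtain c where c: "\<forall>\<omega>\<in>space P. \<bar>\<xi> k \<omega>\<bar> \<le> c" using e(6) by blast
  have xi: "\<xi> k \<in> borel_measurable (F (\<tau> k))" "\<xi> k \<in> borel_measurable P"
    using e(5) F_measurable_imp by auto
  have xi2: "integrable P (\<lambda>\<omega>. (\<xi> k \<omega>)\<^sup>2)"
    using elementary_square_integrable[OF Suc.prems] by simp
  \<comment> \<open>Boundedness of \<open>\<xi> k\<close> is used here: the factor in front of the
    increment has to be integrable.\<close>
  have "integrable P (\<lambda>\<omega>. S \<omega> * \<xi> k \<omega>)"
  proof (rule Bochner_Integration.integrable_bound)
    show "integrable P (\<lambda>\<omega>. c * S \<omega>)" using iS by simp
    have "\<bar>S \<omega>\<bar> * \<bar>\<xi> k \<omega>\<bar> \<le> \<bar>S \<omega>\<bar> * \<bar>c\<bar>" if "\<omega> \<in> space P" for \<omega>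
      using c that by (intro mult_left_mono) fastforce+
    then show "AE \<omega> in P. norm (S \<omega> * \<xi> k \<omega>) \<le> norm (c * S \<omega>)"
      by (intro AE_I2) (simp add: abs_mult mult.commute)
  qed (use S xi in measurable)
  then have cross: "integrable P (\<lambda>\<omega>. S \<omega> * \<xi> k \<omega> * D \<omega>)" "expectation (\<lambda>\<omega>. S \<omega> * \<xi> k \<omega> * D \<omega>) = 0"
    unfolding D_def using e(2,3) S xi by (auto intro!: expectation_mult_increment borel_measurable_times)
  have sq: "integrable P (\<lambda>\<omega>. (\<xi> k \<omega>)\<^sup>2 * (D \<omega>)\<^sup>2)"
    "expectation (\<lambda>\<omega>. (\<xi> k \<omega>)\<^sup>2 * (D \<omega>)\<^sup>2) = expectation (\<lambda>\<omega>. (\<xi> k \<omega>)\<^sup>2) * (\<tau> (Suc k) - \<tau> k)"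
    unfolding D_def using e(2,3) xi xi2
    by (auto intro!: expectation_mult_increment_sq borel_measurable_power)
  have eq: "(elementary_integral W (Suc k) \<tau> \<xi> \<omega>)\<^sup>2 =
      (S \<omega>)\<^sup>2 + 2 * (S \<omega> * \<xi> k \<omega> * D \<omega>) + (\<xi> k \<omega>)\<^sup>2 * (D \<omega>)\<^sup>2" for \<omega>
    by (simp add: elementary_integral_def S_def D_def power2_eq_square algebra_simps)
  have i: "integrable P (\<lambda>\<omega>. \<Sum>i<k. (\<xi> i \<omega>)\<^sup>2 * (\<tau> (Suc i) - \<tau> i))"
    using elementary_square_integrable[OF e(1)] by auto
  show ?case
    unfolding eq using IH cross sq xi2 i by simp
qed

text \<open>The support of the first \<open>k\<close> summands ends where the next interval begins,
  so the square of an elementary process is the sum of the squares of its pieces.\<close>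

lemma elementary_process_beyond:
  assumes "elementary P W t k \<tau> \<xi>" "\<tau> k < s"
  shows "elementary_process k \<tau> \<xi> s \<omega> = 0"
  using assms
proof (induction k)
  case (Suc k)
  note e = elementary_Suc[OF Suc.prems(1)]
  show ?case
    using Suc.IH[OF e(1)] e(3) Suc.prems(2) by (simp add: elementary_process_def)
qed (simp add: elementary_process_def)

lemma elementary_process_energy:
  assumes "elementary P W t k \<tau> \<xi>"
  shows "(\<integral>\<^sup>+s. ennreal ((elementary_process k \<tau> \<xi> s \<omega>)\<^sup>2) * indicator {0..t} s \<partial>lborel) =
    ennreal (\<Sum>i<k. (\<xi> i \<omega>)\<^sup>2 * (\<tau> (Suc i) - \<tau> i))"
  using assms
proof (induction k)
  case (Suc k)
  note e = elementary_Suc[OF Suc.prems]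
  have mono: "\<And>i. i < k \<Longrightarrow> \<tau> i \<le> \<tau> (Suc i)"
    using e(1) unfolding elementary_def by auto
  have nonneg: "0 \<le> (\<Sum>i<k. (\<xi> i \<omega>)\<^sup>2 * (\<tau> (Suc i) - \<tau> i))"
    using mono by (intro sum_nonneg) simp
  have m: "(\<lambda>s. elementary_process k \<tau> \<xi> s \<omega>) \<in> borel_measurable lborel"
    unfolding elementary_process_def by measurable
  have eq: "(elementary_process (Suc k) \<tau> \<xi> s \<omega>)\<^sup>2 =
      (elementary_process k \<tau> \<xi> s \<omega>)\<^sup>2 + (\<xi> k \<omega>)\<^sup>2 * indicator {\<tau> k<..\<tau> (Suc k)} s" for s
    using elementary_process_beyond[OF e(1), of s \<omega>]
    by (auto simp: elementary_process_def indicator_def)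
  have "(\<integral>\<^sup>+s. ennreal ((elementary_process (Suc k) \<tau> \<xi> s \<omega>)\<^sup>2) * indicator {0..t} s \<partial>lborel) =
    (\<integral>\<^sup>+s. ennreal ((elementary_process k \<tau> \<xi> s \<omega>)\<^sup>2) * indicator {0..t} s
       + ennreal ((\<xi> k \<omega>)\<^sup>2) * indicator {\<tau> k<..\<tau> (Suc k)} s \<partial>lborel)"
    unfolding eq using e(2,4) by (intro nn_integral_cong) (auto simp: indicator_def ennreal_plus)
  also have "\<dots> = ennreal (\<Sum>i<k. (\<xi> i \<omega>)\<^sup>2 * (\<tau> (Suc i) - \<tau> i)) + ennreal ((\<xi> k \<omega>)\<^sup>2) * ennreal (\<tau> (Suc k) - \<tau> k)"
    using m e(3) Suc.IH[OF e(1)] by (subst nn_integral_add) (auto simp: nn_integral_cmult_indicator)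
  also have "\<dots> = ennreal (\<Sum>i<Suc k. (\<xi> i \<omega>)\<^sup>2 * (\<tau> (Suc i) - \<tau> i))"
    using e(3) nonneg by (simp add: ennreal_mult'[symmetric])
  finally show ?case .
qed (simp add: elementary_process_def)

lemma elementary_isometry:
  assumes "elementary P W t k \<tau> \<xi>"
  shows "(\<integral>\<^sup>+\<omega>. ennreal ((elementary_integral W k \<tau> \<xi> \<omega>)\<^sup>2) \<partial>P) =
    (\<integral>\<^sup>+\<omega>. (\<integral>\<^sup>+s. ennreal ((elementary_process k \<tau> \<xi> s \<omega>)\<^sup>2) * indicator {0..t} s \<partial>lborel) \<partial>P)"
proof -
  note m = elementary_integral_moments[OF assms]
  have i: "integrable P (\<lambda>\<omega>. \<Sum>i<k. (\<xi> i \<omega>)\<^sup>2 * (\<tau> (Suc i) - \<tau> i))"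
    using elementary_square_integrable[OF assms] by auto
  have mono: "\<And>i. i < k \<Longrightarrow> \<tau> i \<le> \<tau> (Suc i)"
    using assms unfolding elementary_def by auto
  have nonneg: "0 \<le> (\<Sum>i<k. (\<xi> i \<omega>)\<^sup>2 * (\<tau> (Suc i) - \<tau> i))" for \<omega>
    using mono by (intro sum_nonneg) simp
  show ?thesis
    unfolding elementary_process_energy[OF assms]
    using nn_integral_eq_integral[OF m[THEN conjunct1]] nn_integral_eq_integral[OF i] m nonneg by simp
qed

end

section \<open>Common refinements and linear combinations\<close>

text \<open>In a strictly increasing list the entries from \<open>x\<close> (included) to
  \<open>y\<close> (excluded) have consecutive indices, so the sum telescopes.\<close>

lemma sum_increments_between:
  fixes g :: "'a::linorder \<Rightarrow> 'b::ring_1"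
  assumes L: "sorted_wrt (<) L" and xy: "x \<in> set L" "y \<in> set L" "x \<le> y"
  shows "(\<Sum>i<length L - 1. of_bool (x \<le> L ! i \<and> L ! i < y) * (g (L ! Suc i) - g (L ! i))) = g y - g x"
proof -
  obtain p q where p: "p < length L" "x = L ! p" and q: "q < length L" "y = L ! q"
    using xy by (auto simp: in_set_conv_nth)
  have less: "L ! i < L ! j \<longleftrightarrow> i < j" if "i < length L" "j < length L" for i j
    using sorted_wrt_nth_less[OF L, of i j] sorted_wrt_nth_less[OF L, of j i] that
    by (metis linorder_neqE_nat order.asym less_irrefl)
  have pq: "p \<le> q" using xy(3) less p q by (metis linorder_not_less)
  have "(\<Sum>i<length L - 1. of_bool (x \<le> L ! i \<and> L ! i < y) * (g (L ! Suc i) - g (L ! i)))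
      = (\<Sum>i\<in>{p..<q}. g (L ! Suc i) - g (L ! i))"
    using p q less by (intro sum.mono_neutral_cong_right) (auto simp: not_less[symmetric])
  also have "\<dots> = g y - g x"
    using sum_Suc_diff'[OF pq, of "\<lambda>i. g (L ! i)"] p q by simp
  finally show ?thesis .
qed

context brownian
begin

text \<open>The identity is proved for an arbitrary function \<open>g\<close> of the nodes because
  it is used twice: a path of \<open>W\<close> gives the integrals, a step function of the node
  gives the values of the processes.\<close>

lemma elementary_common_refinement:
  assumes e1: "elementary P W t k1 \<tau>1 \<xi>1" and e2: "elementary P W t k2 \<tau>2 \<xi>2"
  shows "\<exists>k \<tau> \<xi>. elementary P W t k \<tau> \<xi> \<and>
    (\<forall>(g :: real \<Rightarrow> real) \<omega>. (\<Sum>i<k. \<xi> i \<omega> * (g (\<tau> (Suc i)) - g (\<tau> i))) =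
      a * (\<Sum>i<k1. \<xi>1 i \<omega> * (g (\<tau>1 (Suc i)) - g (\<tau>1 i))) +
      b * (\<Sum>i<k2. \<xi>2 i \<omega> * (g (\<tau>2 (Suc i)) - g (\<tau>2 i))))"
proof -
  \<comment> \<open>Forming a set removes repeated nodes, so the refined partition is strictly
    increasing.\<close>
  define L where "L = sorted_list_of_set (\<tau>1 ` {..k1} \<union> \<tau>2 ` {..k2})"
  have L: "sorted_wrt (<) L" and setL: "set L = \<tau>1 ` {..k1} \<union> \<tau>2 ` {..k2}"
    unfolding L_def by simp_all
  \<comment> \<open>The value on the refined cell starting at \<open>L ! i\<close> is that of the
    coarse interval containing it. Empty coarse intervals never match.\<close>
  define c where "c = (\<lambda>k \<tau> (\<xi> :: nat \<Rightarrow> 'w \<Rightarrow> real) i \<omega>.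
    \<Sum>j<k. \<xi> j \<omega> * of_bool (\<tau> j \<le> L ! i \<and> L ! i < \<tau> (Suc j)))"
  define \<xi> where "\<xi> = (\<lambda>i \<omega>. a * c k1 \<tau>1 \<xi>1 i \<omega> + b * c k2 \<tau>2 \<xi>2 i \<omega>)"
  define k where "k = length L - 1"
  have ne: "L \<noteq> []" using setL by auto
  have c_meas: "c k \<tau> \<xi>' i \<in> borel_measurable (F (L ! i))"
    and c_bdd: "\<exists>b. \<forall>\<omega>\<in>space P. \<bar>c k \<tau> \<xi>' i \<omega>\<bar> \<le> b"
    if e: "elementary P W t k \<tau> \<xi>'" for k \<tau> \<xi>' i
  proof -
    have "(\<lambda>\<omega>. \<xi>' j \<omega> * of_bool (\<tau> j \<le> L ! i \<and> L ! i < \<tau> (Suc j))) \<in> borel_measurable (F (L ! i))"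
      if "j < k" for j
    \<comment> \<open>A coarse value contributes only when its own node is not later than the
      refined one, so it is known in time.\<close>
    proof (cases "\<tau> j \<le> L ! i")
      case True
      then have "\<xi>' j \<in> borel_measurable (F (L ! i))"
        using e that F_mono unfolding elementary_def by blast
      then show ?thesis by measurable
    qed simp
    then show "c k \<tau> \<xi>' i \<in> borel_measurable (F (L ! i))"
      unfolding c_def by (intro borel_measurable_sum) auto
    have "\<forall>j. \<exists>b. j < k \<longrightarrow> (\<forall>\<omega>\<in>space P. \<bar>\<xi>' j \<omega>\<bar> \<le> b)"
      using e unfolding elementary_def by blast
    then obtain B where B: "\<And>j \<omega>. j < k \<Longrightarrow> \<omega> \<in> space P \<Longrightarrow> \<bar>\<xi>' j \<omega>\<bar> \<le> B j" by metis
    have "\<bar>c k \<tau> \<xi>' i \<omega>\<bar> \<le> (\<Sum>j<k. \<bar>B j\<bar>)" if "\<omega> \<in> space P" for \<omega>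
      unfolding c_def using B[OF _ that]
      by (intro order.trans[OF sum_abs] sum_mono) (force simp: abs_mult)
    then show "\<exists>b. \<forall>\<omega>\<in>space P. \<bar>c k \<tau> \<xi>' i \<omega>\<bar> \<le> b" by blast
  qed
  have "elementary P W t k (\<lambda>i. L ! i) \<xi>"
    unfolding elementary_def
  proof (intro conjI allI impI)
    fix i assume "i \<le> k"
    then have "L ! i \<in> set L" using ne unfolding k_def by (intro nth_mem) (cases L; simp)
    then show "L ! i \<in> {0..t}"
      using e1 e2 unfolding setL elementary_def by auto
  next
    fix i assume "i < k"
    then show "L ! i \<le> L ! Suc i"
      using sorted_wrt_nth_less[OF L, of i "Suc i"] unfolding k_def by (simp add: less_diff_conv less_imp_le)
  next
    fix i
    show "\<xi> i \<in> borel_measurable (F (L ! i))"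
      unfolding \<xi>_def using c_meas[OF e1] c_meas[OF e2] by measurable
    obtain b1 b2 where "\<forall>\<omega>\<in>space P. \<bar>c k1 \<tau>1 \<xi>1 i \<omega>\<bar> \<le> b1" "\<forall>\<omega>\<in>space P. \<bar>c k2 \<tau>2 \<xi>2 i \<omega>\<bar> \<le> b2"
      using c_bdd[OF e1] c_bdd[OF e2] by metis
    then have "\<forall>\<omega>\<in>space P. \<bar>\<xi> i \<omega>\<bar> \<le> \<bar>a\<bar> * b1 + \<bar>b\<bar> * b2"
      unfolding \<xi>_def
      by (auto intro!: order.trans[OF abs_triangle_ineq] add_mono mult_left_mono simp: abs_mult)
    then show "\<exists>c. \<forall>\<omega>\<in>space P. \<bar>\<xi> i \<omega>\<bar> \<le> c" by blast
  qed
  moreover have "(\<Sum>i<k. \<xi> i \<omega> * (g (L ! Suc i) - g (L ! i))) =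
      a * (\<Sum>i<k1. \<xi>1 i \<omega> * (g (\<tau>1 (Suc i)) - g (\<tau>1 i))) +
      b * (\<Sum>i<k2. \<xi>2 i \<omega> * (g (\<tau>2 (Suc i)) - g (\<tau>2 i)))" for g :: "real \<Rightarrow> real" and \<omega>
  proof -
    have one: "(\<Sum>i<k. c k' \<tau> \<xi>' i \<omega> * (g (L ! Suc i) - g (L ! i)))
        = (\<Sum>j<k'. \<xi>' j \<omega> * (g (\<tau> (Suc j)) - g (\<tau> j)))"
      if "\<tau> ` {..k'} \<subseteq> set L" "\<And>j. j < k' \<Longrightarrow> \<tau> j \<le> \<tau> (Suc j)" for k' \<tau> \<xi>'
    proof -
      have "(\<Sum>i<k. c k' \<tau> \<xi>' i \<omega> * (g (L ! Suc i) - g (L ! i))) =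
        (\<Sum>i<k. \<Sum>j<k'. \<xi>' j \<omega> * (of_bool (\<tau> j \<le> L ! i \<and> L ! i < \<tau> (Suc j)) * (g (L ! Suc i) - g (L ! i))))"
        by (simp only: c_def sum_distrib_right mult.assoc)
      also have "\<dots> = (\<Sum>j<k'. \<xi>' j \<omega> * (\<Sum>i<k. of_bool (\<tau> j \<le> L ! i \<and> L ! i < \<tau> (Suc j)) * (g (L ! Suc i) - g (L ! i))))"
        by (subst sum.swap) (simp only: sum_distrib_left)
      also have "\<dots> = (\<Sum>j<k'. \<xi>' j \<omega> * (g (\<tau> (Suc j)) - g (\<tau> j)))"
        unfolding k_def using that by (intro sum.cong refl, subst sum_increments_between[OF L]) auto
      finally show ?thesis .
    qed
    have "(\<Sum>i<k. \<xi> i \<omega> * (g (L ! Suc i) - g (L ! i))) =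
      a * (\<Sum>i<k. c k1 \<tau>1 \<xi>1 i \<omega> * (g (L ! Suc i) - g (L ! i))) +
      b * (\<Sum>i<k. c k2 \<tau>2 \<xi>2 i \<omega> * (g (L ! Suc i) - g (L ! i)))"
      unfolding sum_distrib_left sum.distrib[symmetric]
      by (intro sum.cong refl) (simp add: \<xi>_def algebra_simps)
    then show ?thesis
      using one[of \<tau>1 k1 \<xi>1] one[of \<tau>2 k2 \<xi>2] e1 e2 setL unfolding elementary_def by auto
  qed
  ultimately show ?thesis by blast
qed

text \<open>Reads the indicator of a half-open interval as an increment of the function
  \<open>\<lambda>x. of_bool (s \<le> x)\<close>, the shape that the common refinement
  accepts.\<close>

lemma elementary_process_alt:
  assumes "elementary P W t k \<tau> \<xi>"
  shows "elementary_process k \<tau> \<xi> s \<omega> = (\<Sum>i<k. \<xi> i \<omega> * (of_bool (s \<le> \<tau> (Suc i)) - of_bool (s \<le> \<tau> i)))"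
  unfolding elementary_process_def
  using assms by (intro sum.cong) (auto simp: elementary_def indicator_def)

lemma elementary_linear_combination:
  assumes e1: "elementary P W t k1 \<tau>1 \<xi>1" and e2: "elementary P W t k2 \<tau>2 \<xi>2"
  obtains k \<tau> \<xi> where "elementary P W t k \<tau> \<xi>"
    "\<And>s \<omega>. elementary_process k \<tau> \<xi> s \<omega> = a * elementary_process k1 \<tau>1 \<xi>1 s \<omega> + b * elementary_process k2 \<tau>2 \<xi>2 s \<omega>"
    "\<And>\<omega>. elementary_integral W k \<tau> \<xi> \<omega> = a * elementary_integral W k1 \<tau>1 \<xi>1 \<omega> + b * elementary_integral W k2 \<tau>2 \<xi>2 \<omega>"
proof -
  obtain k \<tau> \<xi> where e: "elementary P W t k \<tau> \<xi>"
    and g: "\<And>(g :: real \<Rightarrow> real) \<omega>. (\<Sum>i<k. \<xi> i \<omega> * (g (\<tau> (Suc i)) - g (\<tau> i))) =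
      a * (\<Sum>i<k1. \<xi>1 i \<omega> * (g (\<tau>1 (Suc i)) - g (\<tau>1 i))) +
      b * (\<Sum>i<k2. \<xi>2 i \<omega> * (g (\<tau>2 (Suc i)) - g (\<tau>2 i)))"
    using elementary_common_refinement[OF e1 e2, of a b] by blast
  show thesis
  proof (rule that[OF e])
    show "elementary_process k \<tau> \<xi> s \<omega> = a * elementary_process k1 \<tau>1 \<xi>1 s \<omega> + b * elementary_process k2 \<tau>2 \<xi>2 s \<omega>" for s \<omega>
      using g[of \<omega> "\<lambda>x. of_bool (s \<le> x)"] elementary_process_alt[OF e] elementary_process_alt[OF e1]
        elementary_process_alt[OF e2] by simp
    show "elementary_integral W k \<tau> \<xi> \<omega> = a * elementary_integral W k1 \<tau>1 \<xi>1 \<omega> + b * elementary_integral W k2 \<tau>2 \<xi>2 \<omega>" for \<omega>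
      using g[of \<omega> "\<lambda>x. W x \<omega>"] by (simp add: elementary_integral_def)
  qed
qed

text \<open>Values attached to nodes after \<open>t\<close> are replaced by zero, since they are not
  known at time \<open>t\<close>. Their capped intervals are empty, so neither the process up to
  \<open>t\<close> nor the integral notices.\<close>

lemma elementary_stopped:
  assumes e: "elementary P W T k \<tau> \<xi>" and t: "0 \<le> t" "t \<le> T"
  defines "\<tau>' \<equiv> \<lambda>i. min (\<tau> i) t" and "\<xi>' \<equiv> \<lambda>i \<omega>. if \<tau> i \<le> t then \<xi> i \<omega> else 0"
  shows "elementary P W t k \<tau>' \<xi>'"
    "\<And>s \<omega>. s \<le> t \<Longrightarrow> elementary_process k \<tau>' \<xi>' s \<omega> = elementary_process k \<tau> \<xi> s \<omega>"
    "\<And>\<omega>. elementary_integral W k \<tau>' \<xi>' \<omega> = (\<Sum>i<k. \<xi> i \<omega> * (W (min (\<tau> (Suc i)) t) \<omega> - W (min (\<tau> i) t) \<omega>))"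
proof -
  have mono: "\<And>i. i < k \<Longrightarrow> \<tau> i \<le> \<tau> (Suc i)"
    using e unfolding elementary_def by auto
  show "elementary P W t k \<tau>' \<xi>'"
    unfolding elementary_def
  proof (intro conjI allI impI)
    fix i
    show "\<tau>' i \<in> {0..t}" if "i \<le> k"
      using e t that unfolding elementary_def \<tau>'_def by auto
    show "\<tau>' i \<le> \<tau>' (Suc i)" if "i < k"
      using mono[OF that] unfolding \<tau>'_def by auto
    show "\<xi>' i \<in> borel_measurable (F (\<tau>' i))" if "i < k"
      using e that unfolding elementary_def \<tau>'_def \<xi>'_def by (cases "\<tau> i \<le> t") auto
    show "\<exists>c. \<forall>\<omega>\<in>space P. \<bar>\<xi>' i \<omega>\<bar> \<le> c" if "i < k"
      using e that unfolding elementary_def \<xi>'_def by (cases "\<tau> i \<le> t") auto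
  qed
  show "elementary_process k \<tau>' \<xi>' s \<omega> = elementary_process k \<tau> \<xi> s \<omega>" if "s \<le> t" for s \<omega>
    unfolding elementary_process_def \<tau>'_def \<xi>'_def using that mono
    by (intro sum.cong) (auto simp: indicator_def)
  show "elementary_integral W k \<tau>' \<xi>' \<omega> = (\<Sum>i<k. \<xi> i \<omega> * (W (min (\<tau> (Suc i)) t) \<omega> - W (min (\<tau> i) t) \<omega>))" for \<omega>
    unfolding elementary_integral_def \<tau>'_def \<xi>'_def using mono
    by (intro sum.cong) (force simp: min_def)+
qed

end

section \<open>Averages over past cells of a grid\<close>

lemma ennreal_tendsto_0I:
  fixes F :: "nat \<Rightarrow> ennreal"
  assumes "\<And>e. 0 < e \<Longrightarrow> eventually (\<lambda>n. F n \<le> ennreal e) sequentially"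
  shows "F \<longlonglongrightarrow> 0"
proof (rule order_tendstoI)
  fix a :: ennreal assume "0 < a"
  then obtain b where b: "0 < b" "b < a" using dense by blast
  then have "b < \<top>" using less_le_trans[OF b(2) top_greatest] by simp
  then obtain e where "0 \<le> e" "b = ennreal e" by (cases b) auto
  with b assms[of e] show "eventually (\<lambda>n. F n < a) sequentially"
    by (auto elim: eventually_mono)
qed simp

text \<open>\<open>measurable_on\<close> supplies continuous functions that converge off a
  negligible set. Clipping them to the bound of \<open>g\<close> keeps them continuous and makes
  dominated convergence applicable.\<close>

lemma L1_continuous_approximation:
  fixes g :: "real \<Rightarrow> real"
  assumes g: "g \<in> borel_measurable borel" and bdd: "\<And>x. \<bar>g x\<bar> \<le> c" and e: "0 < e"
  shows "\<exists>h. continuous_on UNIV h \<and> (\<forall>x. \<bar>h x\<bar> \<le> c) \<and>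
    (\<integral>\<^sup>+x. ennreal \<bar>g x - h x\<bar> * indicator {a..b} x \<partial>lborel) \<le> ennreal e"
proof -
  have "g \<in> borel_measurable (lebesgue_on UNIV)"
    using g by (intro measurable_restrict_space1 measurable_completion) simp
  then have "g measurable_on UNIV"
    by (subst measurable_on_iff_borel_measurable) auto
  then obtain N h where N: "negligible N" and h: "\<And>n::nat. continuous_on UNIV (h n)"
    and lim: "\<And>x. x \<notin> N \<Longrightarrow> (\<lambda>n. h n x) \<longlonglongrightarrow> g x"
    unfolding measurable_on_def by auto
  define k where "k = (\<lambda>n x. max (- c) (min c (h n x)))"
  have k: "continuous_on UNIV (k n)" for n
    unfolding k_def using h by (intro continuous_intros)
  have c0: "0 \<le> c" using bdd[of 0] by linarith
  have kb: "\<bar>k n x\<bar> \<le> c" for n x unfolding k_def using c0 by auto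
  have [measurable]: "k n \<in> borel_measurable borel" for n
    using k by (rule borel_measurable_continuous_onI)
  note g[measurable]
  have "AE x in lebesgue. x \<notin> N"
    using N by (simp add: negligible_iff_null_sets AE_not_in)
  then have AEN: "AE x in lborel. x \<notin> N"
    by (simp add: AE_completion_iff)
  have "(\<lambda>n. \<integral>\<^sup>+x. ennreal \<bar>g x - k n x\<bar> * indicator {a..b} x \<partial>lborel) \<longlonglongrightarrow> (\<integral>\<^sup>+x. 0 \<partial>(lborel :: real measure))"
  proof (rule nn_integral_dominated_convergence[where w="\<lambda>x. ennreal (2 * c) * indicator {a..b} x"])
    show "AE x in lborel. ennreal \<bar>g x - k n x\<bar> * indicator {a..b} x \<le> ennreal (2 * c) * indicator {a..b} x" for n
    proof (rule AE_I2)
      fix x show "ennreal \<bar>g x - k n x\<bar> * indicator {a..b} x \<le> ennreal (2 * c) * indicator {a..b} x"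
        using bdd[of x] kb[of n x] by (intro mult_right_mono ennreal_leI) auto
    qed
    show "(\<integral>\<^sup>+x. ennreal (2 * c) * indicator {a..b} x \<partial>lborel) < \<infinity>"
      using c0 by (cases "a \<le> b") (auto simp: nn_integral_cmult_indicator ennreal_mult_less_top)
    show "AE x in lborel. (\<lambda>n. ennreal \<bar>g x - k n x\<bar> * indicator {a..b} x) \<longlonglongrightarrow> 0"
      using AEN
    proof eventually_elim
      case (elim x)
      have "(\<lambda>n. k n x) \<longlonglongrightarrow> max (- c) (min c (g x))"
        unfolding k_def by (intro tendsto_intros lim[OF elim])
      moreover have "max (- c) (min c (g x)) = g x" using bdd[of x] by auto
      ultimately have kg: "(\<lambda>n. k n x) \<longlonglongrightarrow> g x" by simp
      have "(\<lambda>n. \<bar>g x - k n x\<bar>) \<longlonglongrightarrow> \<bar>g x - g x\<bar>"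
        by (intro tendsto_intros kg)
      then have "(\<lambda>n. ennreal \<bar>g x - k n x\<bar>) \<longlonglongrightarrow> ennreal 0" by (intro tendsto_ennrealI) simp
      then show ?case by (cases "x \<in> {a..b}") auto
    qed
  qed auto
  then have "eventually (\<lambda>n. (\<integral>\<^sup>+x. ennreal \<bar>g x - k n x\<bar> * indicator {a..b} x \<partial>lborel) < ennreal e) sequentially"
    using e by (intro order_tendstoD(2)[where y=0]) auto
  then obtain n where "(\<integral>\<^sup>+x. ennreal \<bar>g x - k n x\<bar> * indicator {a..b} x \<partial>lborel) < ennreal e"
    by (auto dest: eventually_happens)
  then show ?thesis using k kb by (intro exI[of _ "k n"]) auto
qed

text \<open>For \<open>k = 0\<close> the window lies to the left of time 0, up to its endpoint; the
  processes to be approximated are made zero there.\<close>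

definition lagged_mean :: "real \<Rightarrow> (real \<Rightarrow> real) \<Rightarrow> nat \<Rightarrow> real" where
  "lagged_mean \<delta> g k = (LINT s|lborel. indicator {(real k - 1) * \<delta><..real k * \<delta>} s * g s) / \<delta>"

text \<open>On each cell of the grid of width \<open>\<delta>\<close> the value is the mean over the previous cell, so that
  the step function of an adapted process is again adapted.\<close>

definition lagged_step :: "real \<Rightarrow> nat \<Rightarrow> (real \<Rightarrow> real) \<Rightarrow> real \<Rightarrow> real" where
  "lagged_step \<delta> n g t = (\<Sum>k<n. lagged_mean \<delta> g k * indicator {real k * \<delta><..real (Suc k) * \<delta>} t)"

lemma integrable_indicator_bounded:
  fixes g :: "real \<Rightarrow> real"
  assumes g: "g \<in> borel_measurable borel" and bdd: "\<And>x. a < x \<Longrightarrow> x \<le> b \<Longrightarrow> \<bar>g x\<bar> \<le> c"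
  shows "integrable lborel (\<lambda>x. indicator {a<..b} x * g x)"
proof (rule Bochner_Integration.integrable_bound)
  show "integrable lborel (\<lambda>x. c * indicator {a<..b} x :: real)"
    by (cases "a \<le> b") auto
  show "(\<lambda>x. indicator {a<..b} x * g x) \<in> borel_measurable lborel" using g by measurable
  show "AE x in lborel. norm (indicator {a<..b} x * g x) \<le> norm (c * indicator {a<..b} x)"
    using bdd by (intro AE_I2) (fastforce simp: indicator_def)
qed

lemma borel_measurable_lagged_step [measurable]: "lagged_step \<delta> n g \<in> borel_measurable borel"
  unfolding lagged_step_def[abs_def] by measurable

lemma lagged_mean_diff:
  assumes "g \<in> borel_measurable borel" "h \<in> borel_measurable borel" "\<And>x. \<bar>g x\<bar> \<le> c" "\<And>x. \<bar>h x\<bar> \<le> d"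
  shows "lagged_mean \<delta> (\<lambda>x. g x - h x) k = lagged_mean \<delta> g k - lagged_mean \<delta> h k"
  unfolding lagged_mean_def right_diff_distrib
  using integrable_indicator_bounded[OF assms(1,3)] integrable_indicator_bounded[OF assms(2,4)]
  by (simp add: diff_divide_distrib)

lemma lagged_step_diff:
  assumes "g \<in> borel_measurable borel" "h \<in> borel_measurable borel" "\<And>x. \<bar>g x\<bar> \<le> c" "\<And>x. \<bar>h x\<bar> \<le> d"
  shows "lagged_step \<delta> n (\<lambda>x. g x - h x) t = lagged_step \<delta> n g t - lagged_step \<delta> n h t"
  unfolding lagged_step_def lagged_mean_diff[OF assms] by (simp add: left_diff_distrib sum_subtractf)

text \<open>Used with \<open>y = 0\<close> to bound a mean, and with a value of a continuous
  function as \<open>y\<close> to show that a mean is close to it.\<close>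

lemma lagged_mean_near:
  assumes g: "g \<in> borel_measurable borel" and \<delta>: "0 < \<delta>"
    and near: "\<And>s. (real k - 1) * \<delta> < s \<Longrightarrow> s \<le> real k * \<delta> \<Longrightarrow> \<bar>g s - y\<bar> \<le> e"
  shows "\<bar>lagged_mean \<delta> g k - y\<bar> \<le> e"
proof -
  let ?I = "{(real k - 1) * \<delta><..real k * \<delta>}"
  have len: "real k * \<delta> - (real k - 1) * \<delta> = \<delta>" by (simp add: algebra_simps)
  have le: "(real k - 1) * \<delta> \<le> real k * \<delta>" using \<delta> by simp
  have i1: "integrable lborel (\<lambda>s. indicator ?I s * (g s - y))"
    using g near by (intro integrable_indicator_bounded) auto
  have i0: "integrable lborel (\<lambda>s. indicator ?I s * z)" for z :: real
    by (intro integrable_indicator_bounded[of _ _ _ "\<bar>z\<bar>"]) auto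
  have int0: "(LINT s|lborel. indicator ?I s * z) = \<delta> * z" for z :: real
    using le len by (simp add: mult.commute)
  have "(LINT s|lborel. indicator ?I s * g s) = (LINT s|lborel. indicator ?I s * (g s - y) + indicator ?I s * y)"
    by (intro Bochner_Integration.integral_cong) (auto simp: algebra_simps)
  also have "\<dots> = (LINT s|lborel. indicator ?I s * (g s - y)) + \<delta> * y"
    using i0 i1 int0 by simp
  finally have "lagged_mean \<delta> g k - y = (LINT s|lborel. indicator ?I s * (g s - y)) / \<delta>"
    using \<delta> by (simp add: lagged_mean_def field_simps)
  moreover have "\<bar>LINT s|lborel. indicator ?I s * (g s - y)\<bar> \<le> (LINT s|lborel. indicator ?I s * e)"
  proof -
    have "\<bar>LINT s|lborel. indicator ?I s * (g s - y)\<bar> \<le> (LINT s|lborel. \<bar>indicator ?I s * (g s - y)\<bar>)"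
      using integral_norm_bound[of lborel "\<lambda>s. indicator ?I s * (g s - y)"] by simp
    also have "\<dots> \<le> (LINT s|lborel. indicator ?I s * e)"
      using i1 i0 near by (intro integral_mono integrable_abs) (auto simp: indicator_def)
    finally show ?thesis .
  qed
  ultimately show ?thesis
    unfolding int0 using \<delta> by (simp only: abs_divide abs_of_pos pos_divide_le_eq mult.commute)
qed

lemma lagged_step_eq:
  assumes \<delta>: "0 < \<delta>" and t: "real k * \<delta> < t" "t \<le> real (Suc k) * \<delta>" and k: "k < n"
  shows "lagged_step \<delta> n g t = lagged_mean \<delta> g k"
proof -
  have "indicator {real j * \<delta><..real (Suc j) * \<delta>} t = (if j = k then 1 else (0::real))" for j
  proof (cases j k rule: linorder_cases)
    case less
    then have "real (Suc j) * \<delta> \<le> real k * \<delta>" using \<delta> by (intro mult_right_mono) auto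
    then show ?thesis using t less by (auto simp: indicator_def)
  next
    case greater
    then have "real (Suc k) * \<delta> \<le> real j * \<delta>" using \<delta> by (intro mult_right_mono) auto
    then show ?thesis using t greater by (auto simp: indicator_def)
  qed (use t in auto)
  then have "lagged_step \<delta> n g t = (\<Sum>j<n. if j = k then lagged_mean \<delta> g j else 0)"
    unfolding lagged_step_def by (intro sum.cong) auto
  then show ?thesis using k by simp
qed

lemma grid_cell:
  assumes \<delta>: "0 < \<delta>" and t: "0 < t" "t \<le> real n * \<delta>"
  obtains k where "k < n" "real k * \<delta> < t" "t \<le> real (Suc k) * \<delta>"
proof -
  \<comment> \<open>Ceiling minus one, rather than floor, because the cells are open on the left and
    closed on the right.\<close>
  define k where "k = nat (\<lceil>t / \<delta>\<rceil> - 1)"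
  have pos: "0 < t / \<delta>" using t \<delta> by simp
  then have "real k = real_of_int \<lceil>t / \<delta>\<rceil> - 1" unfolding k_def by (simp add: of_nat_nat)
  then have "real k < t / \<delta>" "t / \<delta> \<le> real (Suc k)" by linarith+
  then have "real k * \<delta> < t" "t \<le> real (Suc k) * \<delta>" using \<delta> by (auto simp: field_simps)
  moreover from this t have "real k * \<delta> < real n * \<delta>" by linarith
  then have "k < n" using \<delta> by simp
  ultimately show thesis using that by blast
qed

lemma lagged_step_bounded:
  assumes g: "g \<in> borel_measurable borel" "\<And>x. \<bar>g x\<bar> \<le> c" and \<delta>: "0 < \<delta>" and t: "0 \<le> t" "t \<le> real n * \<delta>"
  shows "\<bar>lagged_step \<delta> n g t\<bar> \<le> c"
\<comment> \<open>No cell contains 0, so the step function vanishes there.\<close>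
proof (cases "t = 0")
  case True
  then show ?thesis using g(2)[of 0] \<delta> by (simp add: lagged_step_def indicator_def mult_less_0_iff)
next
  case False
  then obtain k where k: "k < n" "real k * \<delta> < t" "t \<le> real (Suc k) * \<delta>"
    using grid_cell[OF \<delta>, of t n] t by auto
  have "\<bar>lagged_mean \<delta> g k - 0\<bar> \<le> c"
    using g \<delta> by (intro lagged_mean_near) auto
  then show ?thesis using lagged_step_eq[OF \<delta> k(2,3,1)] by simp
qed

text \<open>Averaging over a cell does not increase the integral of the absolute value. The windows
  of the first \<open>n\<close> cells tile the interval from \<open>-\<delta>\<close> to
  \<open>(real n - 1) * \<delta>\<close>, one cell to the left of the cells themselves. The bound
  does not depend on the mesh, so an error in \<open>g\<close> is passed on without growth.\<close>

lemma lagged_step_L1: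
  assumes g: "g \<in> borel_measurable borel" "\<And>x. \<bar>g x\<bar> \<le> c" and \<delta>: "0 < \<delta>"
  shows "(\<integral>\<^sup>+t. ennreal \<bar>lagged_step \<delta> n g t\<bar> \<partial>lborel) \<le>
    (\<integral>\<^sup>+t. ennreal \<bar>g t\<bar> * indicator {-\<delta><..(real n - 1) * \<delta>} t \<partial>lborel)"
proof (induction n)
  case (Suc n)
  note g(1)[measurable]
  let ?I = "{(real n - 1) * \<delta><..real n * \<delta>}" and ?J = "{real n * \<delta><..real (Suc n) * \<delta>}"
  have "(\<integral>\<^sup>+t. ennreal \<bar>lagged_step \<delta> (Suc n) g t\<bar> \<partial>lborel) \<le>
    (\<integral>\<^sup>+t. ennreal \<bar>lagged_step \<delta> n g t\<bar> + ennreal \<bar>lagged_mean \<delta> g n\<bar> * indicator ?J t \<partial>lborel)"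
    by (intro nn_integral_mono)
      (auto simp: lagged_step_def indicator_def ennreal_plus[symmetric] simp del: ennreal_plus intro!: ennreal_leI)
  also have "\<dots> = (\<integral>\<^sup>+t. ennreal \<bar>lagged_step \<delta> n g t\<bar> \<partial>lborel) + ennreal \<bar>lagged_mean \<delta> g n\<bar> * ennreal \<delta>"
    using \<delta> by (subst nn_integral_add) (auto simp: nn_integral_cmult_indicator algebra_simps)
  also have "ennreal \<bar>lagged_mean \<delta> g n\<bar> * ennreal \<delta> = ennreal (norm (LINT s|lborel. indicator ?I s * g s))"
    using \<delta> by (simp add: lagged_mean_def ennreal_mult'[symmetric] abs_divide)
  also have "\<dots> \<le> (\<integral>\<^sup>+t. ennreal (norm (indicator ?I t * g t)) \<partial>lborel)"
    using integrable_indicator_bounded[OF g] by (rule integral_norm_bound_ennreal)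
  also have "\<dots> = (\<integral>\<^sup>+t. ennreal \<bar>g t\<bar> * indicator ?I t \<partial>lborel)"
    by (intro nn_integral_cong) (auto simp: indicator_def)
  also have "(\<integral>\<^sup>+t. ennreal \<bar>lagged_step \<delta> n g t\<bar> \<partial>lborel) + (\<integral>\<^sup>+t. ennreal \<bar>g t\<bar> * indicator ?I t \<partial>lborel)
    \<le> (\<integral>\<^sup>+t. ennreal \<bar>g t\<bar> * indicator {-\<delta><..(real n - 1) * \<delta>} t \<partial>lborel)
       + (\<integral>\<^sup>+t. ennreal \<bar>g t\<bar> * indicator ?I t \<partial>lborel)"
    by (intro add_right_mono Suc.IH)
  also have "\<dots> = (\<integral>\<^sup>+t. ennreal \<bar>g t\<bar> * indicator {-\<delta><..(real n - 1) * \<delta>} t + ennreal \<bar>g t\<bar> * indicator ?I t \<partial>lborel)"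
    by (subst nn_integral_add) auto
  also have "\<dots> \<le> (\<integral>\<^sup>+t. ennreal \<bar>g t\<bar> * indicator {-\<delta><..(real (Suc n) - 1) * \<delta>} t \<partial>lborel)"
  proof (intro nn_integral_mono)
    fix t
    have "- \<delta> \<le> (real n - 1) * \<delta>" using \<delta> by (simp add: algebra_simps)
    moreover have "(real n - 1) * \<delta> \<le> real n * \<delta>" using \<delta> by (simp add: algebra_simps)
    ultimately show "ennreal \<bar>g t\<bar> * indicator {-\<delta><..(real n - 1) * \<delta>} t + ennreal \<bar>g t\<bar> * indicator ?I t
      \<le> ennreal \<bar>g t\<bar> * indicator {-\<delta><..(real (Suc n) - 1) * \<delta>} t"
      by (auto simp: indicator_def)
  qed
  finally show ?case by (simp add: add_right_mono)
qed (simp add: lagged_step_def)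

text \<open>A point of a cell and a point of the window before it are less than
  \<open>2 * \<delta>\<close> apart, so uniform continuity applies. It is taken from
  \<open>-T\<close> on, because the first window reaches below 0 and the mesh is at most
  \<open>T\<close>.\<close>

lemma lagged_step_continuous:
  fixes h :: "real \<Rightarrow> real"
  assumes h: "continuous_on UNIV h" and T: "0 < T" and e: "0 < e"
  shows "eventually (\<lambda>n. \<forall>t. 0 < t \<and> t \<le> T \<longrightarrow> \<bar>lagged_step (T / real (Suc n)) (Suc n) h t - h t\<bar> \<le> e) sequentially"
proof -
  have "uniformly_continuous_on {-T..T} h"
    using h by (intro compact_uniformly_continuous continuous_on_subset[OF h]) auto
  then obtain d where d: "0 < d" "\<And>s t. s \<in> {-T..T} \<Longrightarrow> t \<in> {-T..T} \<Longrightarrow> dist s t < d \<Longrightarrow> dist (h s) (h t) < e"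
    using e unfolding uniformly_continuous_on_def by metis
  have hm: "h \<in> borel_measurable borel" using h by (rule borel_measurable_continuous_onI)
  have "(\<lambda>n. 2 * T / real (Suc n)) \<longlonglongrightarrow> 0"
    using LIMSEQ_Suc[OF lim_const_over_n[of "2 * T"]] by simp
  then have "eventually (\<lambda>n. 2 * T / real (Suc n) < d) sequentially"
    using d(1) by (rule order_tendstoD(2))
  then show ?thesis
  proof eventually_elim
    case (elim n)
    define \<delta> where "\<delta> = T / real (Suc n)"
    have \<delta>: "0 < \<delta>" "real (Suc n) * \<delta> = T" "2 * \<delta> < d" "\<delta> \<le> T"
      using T elim unfolding \<delta>_def by (auto simp: field_simps)
    have "\<bar>lagged_step \<delta> (Suc n) h t - h t\<bar> \<le> e" if t: "0 < t" "t \<le> T" for t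
    proof -
      obtain k where k: "k < Suc n" "real k * \<delta> < t" "t \<le> real (Suc k) * \<delta>"
        using grid_cell[OF \<delta>(1) t(1), of "Suc n"] t \<delta>(2) by auto
      have "\<bar>lagged_mean \<delta> h k - h t\<bar> \<le> e"
      proof (rule lagged_mean_near[OF hm \<delta>(1)])
        fix s assume s: "(real k - 1) * \<delta> < s" "s \<le> real k * \<delta>"
        have "- \<delta> \<le> (real k - 1) * \<delta>" using \<delta>(1) by (simp add: algebra_simps)
        moreover have "t - s < 2 * \<delta>" using s k by (simp add: algebra_simps)
        ultimately have "s \<in> {-T..T}" "t \<in> {-T..T}" "dist s t < d"
          using s k t \<delta> by (auto simp: dist_real_def)
        from d(2)[OF this] show "\<bar>h s - h t\<bar> \<le> e" by (simp add: dist_real_def)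
      qed
      then show ?thesis using lagged_step_eq[OF \<delta>(1) k(2,3,1)] by simp
    qed
    then show ?case unfolding \<delta>_def by blast
  qed
qed

text \<open>A density argument: the averages of a continuous function converge uniformly, and
  averaging does not enlarge the L1 distance between \<open>g\<close> and a continuous
  approximation.\<close>

lemma lagged_step_tendsto_L1:
  fixes g :: "real \<Rightarrow> real"
  assumes g: "g \<in> borel_measurable borel" "\<And>x. \<bar>g x\<bar> \<le> c" and T: "0 < T"
  shows "(\<lambda>n. \<integral>\<^sup>+t. ennreal \<bar>lagged_step (T / real (Suc n)) (Suc n) g t - g t\<bar> * indicator {0..T} t \<partial>lborel) \<longlonglongrightarrow> 0"
proof (rule ennreal_tendsto_0I)
  fix e :: real assume e: "0 < e"
  \<comment> \<open>Two L1 errors of size \<open>e'\<close>, one from \<open>g - h\<close> and one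
    from its average, and a uniform error \<open>e'\<close> on an interval of length
    \<open>T\<close> add up to \<open>e\<close>.\<close>
  define e' where "e' = e / (2 + T)"
  have e': "0 < e'" "e' * (2 + T) = e" using e T unfolding e'_def by auto
  obtain h where h: "continuous_on UNIV h" "\<And>x. \<bar>h x\<bar> \<le> c"
    and gh: "(\<integral>\<^sup>+x. ennreal \<bar>g x - h x\<bar> * indicator {-T..T} x \<partial>lborel) \<le> ennreal e'"
    using L1_continuous_approximation[OF g e'(1)] by metis
  have hm [measurable]: "h \<in> borel_measurable borel" using h(1) by (rule borel_measurable_continuous_onI)
  note g(1)[measurable]
  have gh_b: "\<bar>g x - h x\<bar> \<le> 2 * c" for x using g(2)[of x] h(2)[of x] by linarith
  show "eventually (\<lambda>n. (\<integral>\<^sup>+t. ennreal \<bar>lagged_step (T / real (Suc n)) (Suc n) g t - g t\<bar> * indicator {0..T} t \<partial>lborel)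
     \<le> ennreal e) sequentially"
    using lagged_step_continuous[OF h(1) T e'(1)]
  proof eventually_elim
    case (elim n)
    define \<delta> where "\<delta> = T / real (Suc n)"
    have \<delta>: "0 < \<delta>" "real (Suc n) * \<delta> = T" "\<delta> \<le> T" "0 \<le> real n * \<delta>"
      using T unfolding \<delta>_def by (auto simp: field_simps)
    let ?A = "lagged_step \<delta> (Suc n)"
    have "(\<integral>\<^sup>+t. ennreal \<bar>?A g t - g t\<bar> * indicator {0..T} t \<partial>lborel) \<le>
      (\<integral>\<^sup>+t. (ennreal \<bar>?A (\<lambda>x. g x - h x) t\<bar> + ennreal e' * indicator {0..T} t)
         + ennreal \<bar>g t - h t\<bar> * indicator {-T..T} t \<partial>lborel)"
    proof (intro nn_integral_mono_AE)
      show "AE t in lborel. ennreal \<bar>?A g t - g t\<bar> * indicator {0..T} t \<le>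
        (ennreal \<bar>?A (\<lambda>x. g x - h x) t\<bar> + ennreal e' * indicator {0..T} t)
         + ennreal \<bar>g t - h t\<bar> * indicator {-T..T} t"
        \<comment> \<open>Time 0 is set aside because the step function is zero there whatever
          \<open>h\<close> is.\<close>
        using AE_lborel_singleton[of 0]
      proof eventually_elim
        case (elim t)
        show ?case
        proof (cases "t \<in> {0..T}")
          case True
          then have "\<bar>?A h t - h t\<bar> \<le> e'"
            using elim \<open>\<forall>t. 0 < t \<and> t \<le> T \<longrightarrow> \<bar>lagged_step (T / real (Suc n)) (Suc n) h t - h t\<bar> \<le> e'\<close>
            unfolding \<delta>_def by auto
          then have "\<bar>?A g t - g t\<bar> \<le> \<bar>?A (\<lambda>x. g x - h x) t\<bar> + e' + \<bar>g t - h t\<bar>"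
            unfolding lagged_step_diff[OF g(1) hm g(2) h(2)] by linarith
          then show ?thesis
            using True T e'(1) by (auto simp: ennreal_plus[symmetric] simp del: ennreal_plus intro!: ennreal_leI)
        qed simp
      qed
    qed
    also have "\<dots> = (\<integral>\<^sup>+t. ennreal \<bar>?A (\<lambda>x. g x - h x) t\<bar> \<partial>lborel) + ennreal e' * ennreal T
         + (\<integral>\<^sup>+t. ennreal \<bar>g t - h t\<bar> * indicator {-T..T} t \<partial>lborel)"
      using T by (subst nn_integral_add; (subst nn_integral_add)?) (auto simp: nn_integral_cmult_indicator)
    also have "\<dots> \<le> ennreal e' + ennreal e' * ennreal T + ennreal e'"
    proof (intro add_mono order_refl gh)
      have "(\<integral>\<^sup>+t. ennreal \<bar>?A (\<lambda>x. g x - h x) t\<bar> \<partial>lborel) \<le>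
        (\<integral>\<^sup>+t. ennreal \<bar>g t - h t\<bar> * indicator {-\<delta><..(real (Suc n) - 1) * \<delta>} t \<partial>lborel)"
        using gh_b \<delta>(1) by (intro lagged_step_L1) auto
      also have "\<dots> \<le> (\<integral>\<^sup>+t. ennreal \<bar>g t - h t\<bar> * indicator {-T..T} t \<partial>lborel)"
        using \<delta> by (intro nn_integral_mono) (auto simp: indicator_def algebra_simps)
      also note gh
      finally show "(\<integral>\<^sup>+t. ennreal \<bar>?A (\<lambda>x. g x - h x) t\<bar> \<partial>lborel) \<le> ennreal e'" .
    qed
    also have "ennreal e' + ennreal e' * ennreal T + ennreal e' = ennreal (e' + e' * T + e')"
      using e'(1) T by (simp add: ennreal_mult'[symmetric] ennreal_plus[symmetric] del: ennreal_plus)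
    also have "e' + e' * T + e' = e" using e'(2) by (simp add: algebra_simps)
    finally show ?case unfolding \<delta>_def .
  qed
qed

context brownian
begin

sublocale T: pair_sigma_finite lborel P ..

sublocale T': pair_sigma_finite P lborel ..

section \<open>Square-integrable processes and their approximation by elementary ones\<close>

text \<open>Measurability is asked on all of real time, which avoids a restricted time space; a
  process given on \<open>{0..T}\<close> is first extended by zero (see
  \<open>coord\<close>).\<close>

definition measurable_process :: "(real \<Rightarrow> 'w \<Rightarrow> real) \<Rightarrow> bool" where
  "measurable_process f \<longleftrightarrow> (\<lambda>(s, \<omega>). f s \<omega>) \<in> borel_measurable (borel \<Otimes>\<^sub>M P)"

text \<open>The squared L2 norm over times in \<open>S\<close> and the sample space. Being extended
  nonnegative, it can be estimated before it is known to be finite.\<close>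

definition energy :: "real set \<Rightarrow> (real \<Rightarrow> 'w \<Rightarrow> real) \<Rightarrow> ennreal" where
  "energy S f = (\<integral>\<^sup>+\<omega>. (\<integral>\<^sup>+s. ennreal ((f s \<omega>)\<^sup>2) * indicator S s \<partial>lborel) \<partial>P)"

definition moment2 :: "('w \<Rightarrow> real) \<Rightarrow> ennreal" where
  "moment2 Y = (\<integral>\<^sup>+\<omega>. ennreal ((Y \<omega>)\<^sup>2) \<partial>P)"

definition L2_process :: "real \<Rightarrow> (real \<Rightarrow> 'w \<Rightarrow> real) \<Rightarrow> bool" where
  "L2_process T f \<longleftrightarrow> measurable_process f \<and>
     (\<forall>s\<in>{0..T}. f s \<in> borel_measurable (F s)) \<and> energy {0..T} f < \<infinity>"

lemma measurable_process_pair: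
  "measurable_process f \<Longrightarrow> (\<lambda>z. f (fst z) (snd z)) \<in> borel_measurable (borel \<Otimes>\<^sub>M P)"
  unfolding measurable_process_def by (simp add: case_prod_beta')

lemma measurable_process_compose [measurable (raw)]:
  assumes "measurable_process f" "g \<in> M \<rightarrow>\<^sub>M borel" "h \<in> M \<rightarrow>\<^sub>M P"
  shows "(\<lambda>x. f (g x) (h x)) \<in> borel_measurable M"
  using measurable_compose[OF measurable_Pair[OF assms(2,3)] measurable_process_pair[OF assms(1)]] by simp

lemma measurable_process_section:
  "measurable_process f \<Longrightarrow> \<omega> \<in> space P \<Longrightarrow> (\<lambda>s. f s \<omega>) \<in> borel_measurable borel"
  by (rule measurable_process_compose) auto

lemma measurable_process_const: "measurable_process (\<lambda>s \<omega>. c)"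
  unfolding measurable_process_def by simp

lemma measurable_process_add:
  "measurable_process f \<Longrightarrow> measurable_process g \<Longrightarrow> measurable_process (\<lambda>s \<omega>. f s \<omega> + g s \<omega>)"
  unfolding measurable_process_def by (simp add: case_prod_beta')

lemma measurable_process_diff:
  "measurable_process f \<Longrightarrow> measurable_process g \<Longrightarrow> measurable_process (\<lambda>s \<omega>. f s \<omega> - g s \<omega>)"
  unfolding measurable_process_def by (simp add: case_prod_beta')

lemma measurable_process_cmult:
  "measurable_process f \<Longrightarrow> measurable_process (\<lambda>s \<omega>. c * f s \<omega>)"
  unfolding measurable_process_def by (simp add: case_prod_beta')

lemma measurable_process_time:
  assumes "measurable_process f" and [measurable]: "g \<in> borel_measurable borel"
  shows "measurable_process (\<lambda>s \<omega>. g s * f s \<omega>)"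
  using assms(1)[THEN measurable_process_pair] unfolding measurable_process_def by (simp add: case_prod_beta')

lemma energy_product:
  assumes "measurable_process f" "S \<in> sets borel"
  shows "energy S f = (\<integral>\<^sup>+z. ennreal ((f (snd z) (fst z))\<^sup>2) * indicator S (snd z) \<partial>(P \<Otimes>\<^sub>M lborel))"
proof -
  note assms[measurable]
  have "(\<lambda>z. ennreal ((f (snd z) (fst z))\<^sup>2) * indicator S (snd z)) \<in> borel_measurable (P \<Otimes>\<^sub>M lborel)"
    by measurable
  from lborel.nn_integral_fst[OF this] show ?thesis
    unfolding energy_def by simp
qed

text \<open>Tonelli. In this order of integration estimates can be made at each fixed time through
  \<open>moment2\<close>.\<close>

lemma energy_swap:
  assumes "measurable_process f" "S \<in> sets borel"
  shows "energy S f = (\<integral>\<^sup>+s. moment2 (f s) * indicator S s \<partial>lborel)"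
proof -
  note assms[measurable]
  have m: "(\<lambda>(s, \<omega>). ennreal ((f s \<omega>)\<^sup>2) * indicator S s) \<in> borel_measurable (lborel \<Otimes>\<^sub>M P)"
    unfolding case_prod_beta' by measurable
  have m2: "(\<lambda>\<omega>. ennreal ((f s \<omega>)\<^sup>2)) \<in> borel_measurable P" for s
    by measurable
  show ?thesis
    unfolding energy_def T.Fubini'[OF m] moment2_def
    by (simp add: nn_integral_multc[OF m2])
qed

lemma borel_measurable_moment2 [measurable (raw)]:
  assumes "measurable_process f"
  shows "(\<lambda>s. moment2 (f s)) \<in> borel_measurable borel"
proof -
  note assms[measurable]
  have "(\<lambda>(s, \<omega>). ennreal ((f s \<omega>)\<^sup>2)) \<in> borel_measurable (borel \<Otimes>\<^sub>M P)"
    unfolding case_prod_beta' by measurable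
  from borel_measurable_nn_integral[OF this] show ?thesis
    unfolding moment2_def .
qed

text \<open>Takes the place of the triangle inequality of L2 without square roots in extended
  nonnegative arithmetic. Its factor 2 is behind most constants below.\<close>

lemma ennreal_square_add_le: "ennreal ((x + y)\<^sup>2) \<le> 2 * ennreal (x\<^sup>2) + 2 * ennreal (y\<^sup>2)" for x y :: real
proof -
  have "ennreal ((x + y)\<^sup>2) \<le> ennreal (2 * x\<^sup>2 + 2 * y\<^sup>2)"
    using sum_squares_bound[of x y] by (intro ennreal_leI) (simp add: power2_sum)
  also have "\<dots> = 2 * ennreal (x\<^sup>2) + 2 * ennreal (y\<^sup>2)"
    by (simp add: ennreal_mult')
  finally show ?thesis .
qed

lemma moment2_add:
  assumes [measurable]: "X \<in> borel_measurable P" "Y \<in> borel_measurable P"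
  shows "moment2 (\<lambda>\<omega>. X \<omega> + Y \<omega>) \<le> 2 * moment2 X + 2 * moment2 Y"
proof -
  have "moment2 (\<lambda>\<omega>. X \<omega> + Y \<omega>) \<le> (\<integral>\<^sup>+\<omega>. 2 * ennreal ((X \<omega>)\<^sup>2) + 2 * ennreal ((Y \<omega>)\<^sup>2) \<partial>P)"
    unfolding moment2_def by (intro nn_integral_mono ennreal_square_add_le)
  also have "\<dots> = 2 * moment2 X + 2 * moment2 Y"
    unfolding moment2_def by (simp add: nn_integral_add nn_integral_cmult)
  finally show ?thesis .
qed

lemma moment2_cmult:
  assumes [measurable]: "X \<in> borel_measurable P"
  shows "moment2 (\<lambda>\<omega>. c * X \<omega>) = ennreal (c\<^sup>2) * moment2 X"
  unfolding moment2_def by (simp add: nn_integral_cmult power_mult_distrib ennreal_mult')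

lemma moment2_minus_commute: "moment2 (\<lambda>\<omega>. X \<omega> - Y \<omega>) = moment2 (\<lambda>\<omega>. Y \<omega> - X \<omega>)"
  unfolding moment2_def by (simp add: power2_commute)

lemma moment2_cong_AE: "AE \<omega> in P. X \<omega> = Y \<omega> \<Longrightarrow> moment2 X = moment2 Y"
  unfolding moment2_def by (intro nn_integral_cong_AE) (auto elim: eventually_mono)

lemma moment2_eq_0_iff:
  assumes [measurable]: "X \<in> borel_measurable P"
  shows "moment2 X = 0 \<longleftrightarrow> (AE \<omega> in P. X \<omega> = 0)"
  unfolding moment2_def by (subst nn_integral_0_iff_AE) auto

lemma energy_add:
  assumes "measurable_process f" "measurable_process g" "S \<in> sets borel"
  shows "energy S (\<lambda>s \<omega>. f s \<omega> + g s \<omega>) \<le> 2 * energy S f + 2 * energy S g"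
proof -
  note assms[measurable]
  have "energy S (\<lambda>s \<omega>. f s \<omega> + g s \<omega>) \<le>
    (\<integral>\<^sup>+s. 2 * (moment2 (f s) * indicator S s) + 2 * (moment2 (g s) * indicator S s) \<partial>lborel)"
    unfolding energy_swap[OF measurable_process_add[OF assms(1,2)] assms(3)]
  proof (intro nn_integral_mono)
    fix s
    have "moment2 (\<lambda>\<omega>. f s \<omega> + g s \<omega>) \<le> 2 * moment2 (f s) + 2 * moment2 (g s)"
      by (intro moment2_add) measurable
    then show "moment2 (\<lambda>\<omega>. f s \<omega> + g s \<omega>) * indicator S s \<le>
      2 * (moment2 (f s) * indicator S s) + 2 * (moment2 (g s) * indicator S s)"
      by (auto simp: indicator_def)
  qed
  also have "\<dots> = 2 * energy S f + 2 * energy S g"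
    unfolding energy_swap[OF assms(1,3)] energy_swap[OF assms(2,3)]
    by (simp add: nn_integral_add nn_integral_cmult)
  finally show ?thesis .
qed

lemma energy_cmult:
  assumes "measurable_process f" "S \<in> sets borel"
  shows "energy S (\<lambda>s \<omega>. c * f s \<omega>) = ennreal (c\<^sup>2) * energy S f"
proof -
  note assms[measurable]
  have "moment2 (\<lambda>\<omega>. c * f s \<omega>) = ennreal (c\<^sup>2) * moment2 (f s)" for s
    by (intro moment2_cmult) measurable
  then show ?thesis
    unfolding energy_swap[OF measurable_process_cmult[OF assms(1)] assms(2)] energy_swap[OF assms]
    by (simp add: nn_integral_cmult mult.assoc)
qed

lemma energy_minus_commute: "energy S (\<lambda>s \<omega>. f s \<omega> - g s \<omega>) = energy S (\<lambda>s \<omega>. g s \<omega> - f s \<omega>)"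
  unfolding energy_def by (simp add: power2_commute)

lemma energy_mono_set: "S \<subseteq> S' \<Longrightarrow> energy S f \<le> energy S' f"
  unfolding energy_def by (intro nn_integral_mono) (auto simp: indicator_def)

lemma energy_cong_AE:
  assumes "AE \<omega> in P. AE s in lborel. s \<in> S \<longrightarrow> f s \<omega> = g s \<omega>"
  shows "energy S f = energy S g"
  unfolding energy_def
proof (intro nn_integral_cong_AE)
  show "AE \<omega> in P. (\<integral>\<^sup>+s. ennreal ((f s \<omega>)\<^sup>2) * indicator S s \<partial>lborel) = (\<integral>\<^sup>+s. ennreal ((g s \<omega>)\<^sup>2) * indicator S s \<partial>lborel)"
    using assms
  proof eventually_elim
    case (elim \<omega>)
    then show ?case
      by (intro nn_integral_cong_AE) (auto elim!: eventually_mono simp: indicator_def)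
  qed
qed

lemma energy_cong:
  assumes "\<And>s \<omega>. s \<in> S \<Longrightarrow> \<omega> \<in> space P \<Longrightarrow> f s \<omega> = g s \<omega>"
  shows "energy S f = energy S g"
  using assms by (intro energy_cong_AE AE_I2) auto

text \<open>The order of the quantifiers, paths outside and times inside, is the one in which
  uniqueness of solutions is defined.\<close>

lemma energy_eq_0D:
  assumes "measurable_process f" "S \<in> sets borel" "energy S f = 0"
  shows "AE \<omega> in P. AE s in lborel. s \<in> S \<longrightarrow> f s \<omega> = 0"
proof -
  note assms(1,2)[measurable]
  have "(\<lambda>(\<omega>, s). ennreal ((f s \<omega>)\<^sup>2) * indicator S s) \<in> borel_measurable (P \<Otimes>\<^sub>M lborel)"
    unfolding case_prod_beta' by measurable
  from lborel.borel_measurable_nn_integral[OF this]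
  have "(\<lambda>\<omega>. \<integral>\<^sup>+s. ennreal ((f s \<omega>)\<^sup>2) * indicator S s \<partial>lborel) \<in> borel_measurable P" .
  then have "AE \<omega> in P. (\<integral>\<^sup>+s. ennreal ((f s \<omega>)\<^sup>2) * indicator S s \<partial>lborel) = 0"
    using assms(3) unfolding energy_def by (simp add: nn_integral_0_iff_AE)
  then show ?thesis
    using AE_space
  proof eventually_elim
    case (elim \<omega>)
    then have w: "\<omega> \<in> space P" and "(\<integral>\<^sup>+s. ennreal ((f s \<omega>)\<^sup>2) * indicator S s \<partial>lborel) = 0"
      by simp_all
    moreover have "(\<lambda>s. ennreal ((f s \<omega>)\<^sup>2) * indicator S s) \<in> borel_measurable lborel"
      using measurable_process_section[OF assms(1) w] assms(2)
      by (intro borel_measurable_times_ennreal borel_measurable_indicator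
          measurable_compose[OF borel_measurable_power measurable_ennreal]) auto
    ultimately have "AE s in lborel. ennreal ((f s \<omega>)\<^sup>2) * indicator S s = 0"
      by (simp add: nn_integral_0_iff_AE)
    then show ?case
      by (auto elim!: eventually_mono simp: indicator_def split: if_splits)
  qed
qed

lemma L2_processD:
  assumes "L2_process T f"
  shows "measurable_process f" "\<And>s. 0 \<le> s \<Longrightarrow> s \<le> T \<Longrightarrow> f s \<in> borel_measurable (F s)" "energy {0..T} f < \<infinity>"
  using assms unfolding L2_process_def by auto

lemma L2_process_add:
  assumes "L2_process T f" "L2_process T g"
  shows "L2_process T (\<lambda>s \<omega>. f s \<omega> + g s \<omega>)"
proof -
  note f = L2_processD[OF assms(1)] and g = L2_processD[OF assms(2)]
  have "energy {0..T} (\<lambda>s \<omega>. f s \<omega> + g s \<omega>) \<le> 2 * energy {0..T} f + 2 * energy {0..T} g"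
    using f(1) g(1) by (intro energy_add) auto
  also have "\<dots> < \<infinity>" using f(3) g(3) by (simp add: ennreal_mult_less_top)
  finally show ?thesis
    using f g unfolding L2_process_def by (auto intro: measurable_process_add)
qed

lemma L2_process_cmult:
  assumes "L2_process T f"
  shows "L2_process T (\<lambda>s \<omega>. c * f s \<omega>)"
proof -
  note f = L2_processD[OF assms(1)]
  have "energy {0..T} (\<lambda>s \<omega>. c * f s \<omega>) < \<infinity>"
    using f by (subst energy_cmult) (auto simp: ennreal_mult_less_top)
  then show ?thesis
    using f unfolding L2_process_def by (auto intro: measurable_process_cmult)
qed

lemma L2_process_diff:
  assumes "L2_process T f" "L2_process T g"
  shows "L2_process T (\<lambda>s \<omega>. f s \<omega> - g s \<omega>)"
  using L2_process_add[OF assms(1) L2_process_cmult[OF assms(2), of "-1"]] by simp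

lemma L2_process_const: "L2_process T (\<lambda>s \<omega>. c)"
proof -
  have "energy {0..T} (\<lambda>s \<omega>. c) < \<infinity>"
    unfolding energy_def
    by (cases "0 \<le> T") (auto simp: nn_integral_cmult_indicator emeasure_space_1 ennreal_mult_less_top)
  then show ?thesis
    unfolding L2_process_def by (auto intro: measurable_process_const)
qed

lemma L2_process_sum:
  "(\<And>i. i \<in> I \<Longrightarrow> L2_process T (f i)) \<Longrightarrow> L2_process T (\<lambda>s \<omega>. \<Sum>i\<in>I. f i s \<omega>)"
  by (induction I rule: infinite_finite_induct) (auto intro: L2_process_add L2_process_const)

text \<open>Measurable adapted processes are not assumed progressively measurable, so adaptedness of
  their time integrals needs an argument: the integral equals its conditional expectation, because
  both have the same inner product with each value of the process.\<close>

lemma F_measurable_time_integral_bounded: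
  assumes f: "measurable_process f" and ad: "\<And>s. a < s \<Longrightarrow> s \<le> b \<Longrightarrow> f s \<in> borel_measurable (F b)"
    and bdd: "\<And>s \<omega>. \<omega> \<in> space P \<Longrightarrow> \<bar>f s \<omega>\<bar> \<le> c"
  shows "(\<lambda>\<omega>. LINT s|lborel. indicator {a<..b} s * f s \<omega>) \<in> borel_measurable (F b)"
proof -
  note f[measurable]
  define Y where "Y = (\<lambda>\<omega>. LINT s|lborel. indicator {a<..b} s * f s \<omega>)"
  interpret S: sigma_finite_subalgebra P "F b"
    by (intro finite_measure_subalgebra_is_sigma_finite) (simp_all add: finite_measure_subalgebra_def finite_measure_subalgebra_axioms_def finite_measure_axioms subalgebra_F)
  define Z where "Z = real_cond_exp P (F b) Y"
  have "(\<lambda>(\<omega>, s). indicator {a<..b} s * f s \<omega>) \<in> borel_measurable (P \<Otimes>\<^sub>M lborel)"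
    unfolding case_prod_beta' by measurable
  then have Y [measurable]: "Y \<in> borel_measurable P"
    unfolding Y_def by (rule lborel.borel_measurable_lebesgue_integral)
  have c0: "0 \<le> c" using not_empty bdd by (metis abs_ge_zero order_trans ex_in_conv)
  have int_s: "integrable lborel (\<lambda>s. indicator {a<..b} s * f s \<omega>)" if [measurable]: "\<omega> \<in> space P" for \<omega>
    using bdd[OF that] by (intro integrable_indicator_bounded) auto
  have Yb: "\<bar>Y \<omega>\<bar> \<le> c * \<bar>b - a\<bar>" if w: "\<omega> \<in> space P" for \<omega>
  proof -
    have "\<bar>Y \<omega>\<bar> \<le> (LINT s|lborel. \<bar>indicator {a<..b} s * f s \<omega>\<bar>)"
      using integral_norm_bound[of lborel "\<lambda>s. indicator {a<..b} s * f s \<omega>"] unfolding Y_def by simp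
    also have "\<dots> \<le> (LINT s|lborel. c * indicator {a<..b} s)"
      using int_s[OF w] bdd[OF w] integrable_indicator_bounded[of "\<lambda>_. c" a b "\<bar>c\<bar>"]
      by (intro integral_mono integrable_abs) (auto simp: indicator_def mult.commute)
    also have "\<dots> \<le> c * \<bar>b - a\<bar>"
      using c0 by (cases "a \<le> b") auto
    finally show ?thesis .
  qed
  have intY: "integrable P Y"
    using Yb by (intro integrable_const_bound) auto
  have Zm: "Z \<in> borel_measurable (F b)" unfolding Z_def by simp
  then have ZP [measurable]: "Z \<in> borel_measurable P" by (rule F_measurable_imp)
  have intZ: "integrable P Z" unfolding Z_def using intY by (rule S.real_cond_exp_int)
  have int_mult: "integrable P (\<lambda>\<omega>. X \<omega> * g \<omega>)"
    if "integrable P X" "g \<in> borel_measurable P" "\<And>\<omega>. \<omega> \<in> space P \<Longrightarrow> \<bar>g \<omega>\<bar> \<le> d"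
    for X g :: "'w \<Rightarrow> real" and d :: real
  proof (rule Bochner_Integration.integrable_bound)
    show "integrable P (\<lambda>\<omega>. d * X \<omega>)" using that(1) by simp
    show "AE \<omega> in P. norm (X \<omega> * g \<omega>) \<le> norm (d * X \<omega>)"
    proof (rule AE_I2)
      fix \<omega> assume "\<omega> \<in> space P"
      then have "\<bar>X \<omega>\<bar> * \<bar>g \<omega>\<bar> \<le> \<bar>X \<omega>\<bar> * \<bar>d\<bar>"
        using that(3)[of \<omega>] by (intro mult_left_mono) auto
      then show "norm (X \<omega> * g \<omega>) \<le> norm (d * X \<omega>)" by (simp add: abs_mult mult.commute)
    qed
  qed (use that in measurable)
  define \<eta> where "\<eta> = (\<lambda>\<omega>. Y \<omega> - Z \<omega>)"
  have \<eta>: "integrable P \<eta>" "\<eta> \<in> borel_measurable P" unfolding \<eta>_def using intY intZ by auto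
  note \<eta>(2)[measurable]
  have orth: "expectation (\<lambda>\<omega>. \<eta> \<omega> * f s \<omega>) = 0" if s: "a < s" "s \<le> b" for s
  proof -
    have fs: "f s \<in> borel_measurable P" using ad[OF s] by (rule F_measurable_imp)
    have "integrable P (\<lambda>\<omega>. f s \<omega> * Y \<omega>)" "integrable P (\<lambda>\<omega>. f s \<omega> * Z \<omega>)"
      using int_mult[OF intY fs bdd] int_mult[OF intZ fs bdd] by (auto simp: mult.commute)
    moreover from S.real_cond_exp_intg(2)[OF this(1) ad[OF s] Y]
    have "expectation (\<lambda>\<omega>. f s \<omega> * Z \<omega>) = expectation (\<lambda>\<omega>. f s \<omega> * Y \<omega>)" unfolding Z_def .
    ultimately show ?thesis unfolding \<eta>_def by (simp add: algebra_simps)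
  qed
  \<comment> \<open>Fubini: integrating \<open>orth\<close> over \<open>s\<close> replaces the value
    of the process by its time integral \<open>Y\<close>.\<close>
  have EY: "expectation (\<lambda>\<omega>. \<eta> \<omega> * Y \<omega>) = 0"
  proof -
    have m: "(\<lambda>(s, \<omega>). \<eta> \<omega> * (indicator {a<..b} s * f s \<omega>)) \<in> borel_measurable (lborel \<Otimes>\<^sub>M P)"
      unfolding case_prod_beta' by measurable
    have "integrable (P \<Otimes>\<^sub>M lborel) (\<lambda>(\<omega>, s). \<eta> \<omega> * (indicator {a<..b} s * f s \<omega>))"
    proof (rule T'.Fubini_integrable)
      show "(\<lambda>(\<omega>, s). \<eta> \<omega> * (indicator {a<..b} s * f s \<omega>)) \<in> borel_measurable (P \<Otimes>\<^sub>M lborel)"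
        unfolding case_prod_beta' by measurable
      have meas: "(\<lambda>\<omega>. LINT s|lborel. norm (case (\<omega>, s) of (\<omega>, s) \<Rightarrow> \<eta> \<omega> * (indicator {a<..b} s * f s \<omega>))) \<in> borel_measurable P"
        by (rule lborel.borel_measurable_lebesgue_integral) (unfold case_prod_beta', measurable)
      show "integrable P (\<lambda>\<omega>. LINT s|lborel. norm (case (\<omega>, s) of (\<omega>, s) \<Rightarrow> \<eta> \<omega> * (indicator {a<..b} s * f s \<omega>)))"
      proof (rule Bochner_Integration.integrable_bound[OF _ meas])
        show "integrable P (\<lambda>\<omega>. (c * \<bar>b - a\<bar>) * \<eta> \<omega>)" using \<eta> by simp
        show "AE \<omega> in P. norm (LINT s|lborel. norm (case (\<omega>, s) of (\<omega>, s) \<Rightarrow> \<eta> \<omega> * (indicator {a<..b} s * f s \<omega>)))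
            \<le> norm ((c * \<bar>b - a\<bar>) * \<eta> \<omega>)"
        proof (rule AE_I2)
          fix \<omega> assume w: "\<omega> \<in> space P"
          have "(LINT s|lborel. norm (case (\<omega>, s) of (\<omega>, s) \<Rightarrow> \<eta> \<omega> * (indicator {a<..b} s * f s \<omega>)))
            \<le> (LINT s|lborel. \<bar>\<eta> \<omega>\<bar> * (c * indicator {a<..b} s))"
            using int_s[OF w] bdd[OF w] integrable_indicator_bounded[of "\<lambda>_. c" a b "\<bar>c\<bar>"]
            by (intro integral_mono integrable_norm) (auto simp: indicator_def abs_mult intro!: mult_left_mono)
          also have "\<dots> \<le> \<bar>\<eta> \<omega>\<bar> * (c * \<bar>b - a\<bar>)"
            using c0 by (cases "a \<le> b") auto
          finally show "norm (LINT s|lborel. norm (case (\<omega>, s) of (\<omega>, s) \<Rightarrow> \<eta> \<omega> * (indicator {a<..b} s * f s \<omega>)))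
            \<le> norm ((c * \<bar>b - a\<bar>) * \<eta> \<omega>)"
            using c0 by (simp add: abs_mult mult.commute)
        qed
      qed
      show "AE \<omega> in P. integrable lborel (\<lambda>s. case (\<omega>, s) of (\<omega>, s) \<Rightarrow> \<eta> \<omega> * (indicator {a<..b} s * f s \<omega>))"
        using int_s by (intro AE_I2) simp
    qed
    then have "(LINT s|lborel. LINT \<omega>|P. \<eta> \<omega> * (indicator {a<..b} s * f s \<omega>)) =
      (LINT \<omega>|P. LINT s|lborel. \<eta> \<omega> * (indicator {a<..b} s * f s \<omega>))"
      by (rule T'.Fubini_integral)
    moreover have "(LINT \<omega>|P. \<eta> \<omega> * (indicator {a<..b} s * f s \<omega>)) = 0" for s
      using orth[of s] by (cases "s \<in> {a<..b}") auto
    ultimately show ?thesis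
      unfolding Y_def by simp
  qed
  have ZY: "integrable P (\<lambda>\<omega>. Z \<omega> * Y \<omega>)"
    using int_mult[OF intZ Y Yb] .
  have ZZ: "integrable P (\<lambda>\<omega>. Z \<omega> * Z \<omega>)" "expectation (\<lambda>\<omega>. Z \<omega> * Z \<omega>) = expectation (\<lambda>\<omega>. Z \<omega> * Y \<omega>)"
    using S.real_cond_exp_intg[OF ZY Zm Y] unfolding Z_def by auto
  have \<eta>Y: "integrable P (\<lambda>\<omega>. \<eta> \<omega> * Y \<omega>)" using int_mult[OF \<eta>(1) Y Yb] .
  \<comment> \<open>Both terms on the right have mean zero: the first by \<open>EY\<close>, the
    bracket because \<open>Z\<close> is the conditional expectation of \<open>Y\<close> and itself
    measurable for \<open>F b\<close>.\<close>
  have \<eta>2: "(\<eta> \<omega>)\<^sup>2 = \<eta> \<omega> * Y \<omega> - (Z \<omega> * Y \<omega> - Z \<omega> * Z \<omega>)" for \<omega>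
    unfolding \<eta>_def by (simp add: power2_eq_square algebra_simps)
  have "expectation (\<lambda>\<omega>. (\<eta> \<omega>)\<^sup>2) = 0" "integrable P (\<lambda>\<omega>. (\<eta> \<omega>)\<^sup>2)"
    unfolding \<eta>2 using EY ZY ZZ \<eta>Y by simp_all
  then have "AE \<omega> in P. (\<eta> \<omega>)\<^sup>2 = 0"
    by (subst (asm) integral_nonneg_eq_0_iff_AE) auto
  then have "AE \<omega> in P. Z \<omega> = Y \<omega>"
    unfolding \<eta>_def by (auto elim: eventually_mono)
  from F_measurable_AE_cong[OF Zm this] show ?thesis
    unfolding Y_def .
qed

end

lemma ennreal_tendsto_0_le:
  fixes u v :: "nat \<Rightarrow> ennreal"
  assumes "\<And>m. u m \<le> v m" "v \<longlonglongrightarrow> 0"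
  shows "u \<longlonglongrightarrow> 0"
  by (rule tendsto_sandwich[where f="\<lambda>_. 0" and h=v]) (use assms in auto)

context brownian
begin

section \<open>Density of elementary processes\<close>

lemma measurable_process_elementary:
  assumes "elementary P W t k \<tau> \<xi>"
  shows "measurable_process (elementary_process k \<tau> \<xi>)"
proof -
  have [measurable]: "\<xi> i \<in> borel_measurable P" if "i \<in> {..<k}" for i
    using elementary_square_integrable(1)[OF assms] that by simp
  show ?thesis
    unfolding measurable_process_def elementary_process_def case_prod_beta' by measurable
qed

lemma borel_measurable_path_energy:
  assumes "measurable_process f" and [measurable]: "S \<in> sets borel"
  shows "(\<lambda>\<omega>. \<integral>\<^sup>+s. ennreal ((f s \<omega>)\<^sup>2) * indicator S s \<partial>lborel) \<in> borel_measurable P"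
proof -
  note assms(1)[measurable]
  have "(\<lambda>(\<omega>, s). ennreal ((f s \<omega>)\<^sup>2) * indicator S s) \<in> borel_measurable (P \<Otimes>\<^sub>M lborel)"
    unfolding case_prod_beta' by measurable
  from lborel.borel_measurable_nn_integral[OF this] show ?thesis .
qed

text \<open>Each path is replaced by its lagged averages. Convergence in L1 along a path improves to
  L2 because the error is at most \<open>2 * c\<close>, and the same bound gives a dominating
  constant for the integration over paths.\<close>

lemma elementary_dense_bounded:
  assumes f: "measurable_process f" and ad: "\<And>s. 0 \<le> s \<Longrightarrow> s \<le> T \<Longrightarrow> f s \<in> borel_measurable (F s)"
    and supp: "\<And>s. s \<notin> {0..T} \<Longrightarrow> f s = (\<lambda>\<omega>. 0)"
    and bdd: "\<And>s \<omega>. \<omega> \<in> space P \<Longrightarrow> \<bar>f s \<omega>\<bar> \<le> c" and T: "0 < T" and e: "0 < e"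
  shows "\<exists>k \<tau> \<xi>. elementary P W T k \<tau> \<xi> \<and>
    energy {0..T} (\<lambda>s \<omega>. elementary_process k \<tau> \<xi> s \<omega> - f s \<omega>) \<le> ennreal e"
proof -
  define \<delta> where "\<delta> = (\<lambda>n. T / real (Suc n))"
  define \<tau> where "\<tau> = (\<lambda>n k. real k * \<delta> n)"
  define \<xi> where "\<xi> = (\<lambda>n k \<omega>. lagged_mean (\<delta> n) (\<lambda>s. f s \<omega>) k)"
  have \<delta>: "0 < \<delta> n" "real (Suc n) * \<delta> n = T" for n
    using T unfolding \<delta>_def by auto
  have c0: "0 \<le> c" using not_empty bdd by (metis abs_ge_zero order_trans ex_in_conv)
  \<comment> \<open>The first window begins before time 0, where adaptedness says nothing; there
    \<open>f\<close> is zero.\<close>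
  have adF: "f s \<in> borel_measurable (F b)" if "s \<le> b" "b \<le> T" for s b
    using ad[of s] supp[of s] F_mono[OF that(1)] that by (cases "0 \<le> s") auto
  have el: "elementary P W T (Suc n) (\<tau> n) (\<xi> n)" for n
    unfolding elementary_def
  proof (intro conjI allI impI)
    have \<tau>le: "\<tau> n i \<le> T" if "i \<le> Suc n" for i
      using mult_right_mono[of "real i" "real (Suc n)" "\<delta> n"] that \<delta>[of n] unfolding \<tau>_def by auto
    then show "\<tau> n i \<in> {0..T}" if "i \<le> Suc n" for i
      using that \<delta>(1)[of n] unfolding \<tau>_def by auto
    show "\<tau> n i \<le> \<tau> n (Suc i)" for i
      using \<delta>(1)[of n] unfolding \<tau>_def by (intro mult_right_mono) auto
    show "\<xi> n i \<in> borel_measurable (F (\<tau> n i))" if "i < Suc n" for i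
    proof -
      have "(\<lambda>\<omega>. LINT s|lborel. indicator {(real i - 1) * \<delta> n<..\<tau> n i} s * f s \<omega>) \<in> borel_measurable (F (\<tau> n i))"
        using f bdd \<tau>le[of i] that by (intro F_measurable_time_integral_bounded adF) auto
      then show ?thesis
        unfolding \<xi>_def lagged_mean_def \<tau>_def by (intro borel_measurable_divide) auto
    qed
    have "\<bar>lagged_mean (\<delta> n) (\<lambda>s. f s \<omega>) i - 0\<bar> \<le> c" if "\<omega> \<in> space P" for \<omega> i
      using measurable_process_section[OF f that] bdd[OF that] \<delta>(1) by (intro lagged_mean_near) auto
    then show "\<exists>c. \<forall>\<omega>\<in>space P. \<bar>\<xi> n i \<omega>\<bar> \<le> c" for i
      unfolding \<xi>_def by auto
  qed
  have ep: "elementary_process (Suc n) (\<tau> n) (\<xi> n) s \<omega> = lagged_step (\<delta> n) (Suc n) (\<lambda>s. f s \<omega>) s" for n s \<omega>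
    unfolding elementary_process_def lagged_step_def \<tau>_def \<xi>_def by simp
  define u where "u = (\<lambda>n \<omega>. \<integral>\<^sup>+s. ennreal ((elementary_process (Suc n) (\<tau> n) (\<xi> n) s \<omega> - f s \<omega>)\<^sup>2) * indicator {0..T} s \<partial>lborel)"
  have um [measurable]: "u n \<in> borel_measurable P" for n
    unfolding u_def using measurable_process_elementary[OF el] f
    by (intro borel_measurable_path_energy measurable_process_diff) auto
  have pt: "\<bar>lagged_step (\<delta> n) (Suc n) (\<lambda>s. f s \<omega>) s - f s \<omega>\<bar> \<le> 2 * c"
    if w: "\<omega> \<in> space P" and s: "s \<in> {0..T}" for n s \<omega>
  proof -
    have "\<bar>lagged_step (\<delta> n) (Suc n) (\<lambda>s. f s \<omega>) s\<bar> \<le> c"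
      using measurable_process_section[OF f w] bdd[OF w] \<delta>[of n] s by (intro lagged_step_bounded) auto
    then show ?thesis using bdd[OF w, of s] by linarith
  qed
  have u_bound: "u n \<omega> \<le> ennreal ((2 * c)\<^sup>2) * ennreal T" if w: "\<omega> \<in> space P" for n \<omega>
  proof -
    have "u n \<omega> \<le> (\<integral>\<^sup>+s. ennreal ((2 * c)\<^sup>2) * indicator {0..T} s \<partial>lborel)"
      unfolding u_def ep
    proof (intro nn_integral_mono)
      fix s
      have "(lagged_step (\<delta> n) (Suc n) (\<lambda>s. f s \<omega>) s - f s \<omega>)\<^sup>2 \<le> (2 * c)\<^sup>2" if "s \<in> {0..T}"
        using pt[OF w that, of n] c0 by (subst power2_le_iff_abs_le) auto
      then show "ennreal ((lagged_step (\<delta> n) (Suc n) (\<lambda>s. f s \<omega>) s - f s \<omega>)\<^sup>2) * indicator {0..T} s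
        \<le> ennreal ((2 * c)\<^sup>2) * indicator {0..T} s"
        by (cases "s \<in> {0..T}") (auto simp del: power_mult_distrib intro!: ennreal_leI)
    qed
    also have "\<dots> = ennreal ((2 * c)\<^sup>2) * ennreal T"
      using T by (simp add: nn_integral_cmult_indicator)
    finally show ?thesis .
  qed
  have u_lim: "(\<lambda>n. u n \<omega>) \<longlonglongrightarrow> 0" if w: "\<omega> \<in> space P" for \<omega>
  proof -
    let ?v = "\<lambda>n. \<integral>\<^sup>+s. ennreal \<bar>lagged_step (\<delta> n) (Suc n) (\<lambda>s. f s \<omega>) s - f s \<omega>\<bar> * indicator {0..T} s \<partial>lborel"
    have sec [measurable]: "(\<lambda>s. f s \<omega>) \<in> borel_measurable borel" using measurable_process_section[OF f w] .
    have v: "?v \<longlonglongrightarrow> 0"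
      using lagged_step_tendsto_L1[OF sec bdd[OF w] T] unfolding \<delta>_def .
    have "u n \<omega> \<le> ennreal (2 * c) * ?v n" for n
    proof -
      have "u n \<omega> \<le> (\<integral>\<^sup>+s. ennreal (2 * c) * (ennreal \<bar>lagged_step (\<delta> n) (Suc n) (\<lambda>s. f s \<omega>) s - f s \<omega>\<bar> * indicator {0..T} s) \<partial>lborel)"
        unfolding u_def ep
      proof (intro nn_integral_mono)
        fix s
        define x where "x = lagged_step (\<delta> n) (Suc n) (\<lambda>s. f s \<omega>) s - f s \<omega>"
        have "x\<^sup>2 \<le> 2 * c * \<bar>x\<bar>" if "s \<in> {0..T}"
          using mult_right_mono[OF pt[OF w that, of n], of "\<bar>x\<bar>"] unfolding x_def by (simp add: power2_eq_square)
        then have "ennreal (x\<^sup>2) * indicator {0..T} s \<le> ennreal (2 * c) * (ennreal \<bar>x\<bar> * indicator {0..T} s)"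
          using c0 by (auto simp: indicator_def ennreal_mult'[symmetric] intro!: ennreal_leI)
        then show "ennreal ((lagged_step (\<delta> n) (Suc n) (\<lambda>s. f s \<omega>) s - f s \<omega>)\<^sup>2) * indicator {0..T} s
          \<le> ennreal (2 * c) * (ennreal \<bar>lagged_step (\<delta> n) (Suc n) (\<lambda>s. f s \<omega>) s - f s \<omega>\<bar> * indicator {0..T} s)"
          unfolding x_def .
      qed
      also have "\<dots> = ennreal (2 * c) * ?v n"
        using sec
        by (intro nn_integral_cmult borel_measurable_times_ennreal borel_measurable_indicator
            measurable_compose[OF _ measurable_ennreal] borel_measurable_abs borel_measurable_diff) auto
      finally show ?thesis .
    qed
    moreover have "(\<lambda>n. ennreal (2 * c) * ?v n) \<longlonglongrightarrow> 0"
      using ennreal_tendsto_cmult[OF _ v, of "ennreal (2 * c)"] by simp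
    ultimately show ?thesis
      by (rule ennreal_tendsto_0_le)
  qed
  have "(\<lambda>n. \<integral>\<^sup>+\<omega>. u n \<omega> \<partial>P) \<longlonglongrightarrow> (\<integral>\<^sup>+\<omega>. 0 \<partial>P)"
  proof (rule nn_integral_dominated_convergence[where w="\<lambda>_. ennreal ((2 * c)\<^sup>2) * ennreal T"])
    show "(\<integral>\<^sup>+\<omega>. ennreal ((2 * c)\<^sup>2) * ennreal T \<partial>P) < \<infinity>"
      by (simp add: emeasure_space_1 ennreal_mult_less_top)
  qed (use u_bound u_lim in \<open>auto intro!: AE_I2\<close>)
  then have "eventually (\<lambda>n. (\<integral>\<^sup>+\<omega>. u n \<omega> \<partial>P) < ennreal e) sequentially"
    using e by (intro order_tendstoD(2)[where y=0]) auto
  then obtain n where "(\<integral>\<^sup>+\<omega>. u n \<omega> \<partial>P) < ennreal e"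
    by (auto dest: eventually_happens)
  then have "energy {0..T} (\<lambda>s \<omega>. elementary_process (Suc n) (\<tau> n) (\<xi> n) s \<omega> - f s \<omega>) \<le> ennreal e"
    unfolding energy_def u_def by simp
  with el show ?thesis by blast
qed

text \<open>Meets the two extra hypotheses of \<open>elementary_dense_bounded\<close>, boundedness
  and vanishing outside \<open>{0..T}\<close>, without losing adaptedness.\<close>

definition truncated :: "real \<Rightarrow> (real \<Rightarrow> 'w \<Rightarrow> real) \<Rightarrow> nat \<Rightarrow> real \<Rightarrow> 'w \<Rightarrow> real" where
  "truncated T f n s \<omega> = indicator {0..T} s * max (- real n) (min (real n) (f s \<omega>))"

lemma L2_process_truncated:
  assumes f: "L2_process T f"
  defines "g \<equiv> truncated T f"
  shows "measurable_process (g n)" "\<And>s. s \<le> T \<Longrightarrow> g n s \<in> borel_measurable (F s)"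
    "(\<lambda>n. energy {0..T} (\<lambda>s \<omega>. g n s \<omega> - f s \<omega>)) \<longlonglongrightarrow> 0"
proof -
  note D = L2_processD[OF f]
  have fm [measurable]: "(\<lambda>z. f (fst z) (snd z)) \<in> borel_measurable (borel \<Otimes>\<^sub>M P)"
    using measurable_process_pair[OF D(1)] .
  show gm: "measurable_process (g n)" for n
    unfolding measurable_process_def g_def truncated_def case_prod_beta' by measurable
  show "g n s \<in> borel_measurable (F s)" if "s \<le> T" for n s
    unfolding g_def truncated_def[abs_def] using D(2)[of s] that by (cases "0 \<le> s") auto
  have dm: "measurable_process (\<lambda>s \<omega>. g n s \<omega> - f s \<omega>)" for n
    by (intro measurable_process_diff gm D(1))
  note dm[measurable] D(1)[measurable]
  have "(\<lambda>n. \<integral>\<^sup>+z. ennreal ((g n (snd z) (fst z) - f (snd z) (fst z))\<^sup>2) * indicator {0..T} (snd z) \<partial>(P \<Otimes>\<^sub>M lborel))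
     \<longlonglongrightarrow> (\<integral>\<^sup>+z. 0 \<partial>(P \<Otimes>\<^sub>M (lborel :: real measure)))"
  proof (rule nn_integral_dominated_convergence[where w="\<lambda>z. ennreal ((f (snd z) (fst z))\<^sup>2) * indicator {0..T} (snd z)"])
    show "(\<lambda>z. ennreal ((g n (snd z) (fst z) - f (snd z) (fst z))\<^sup>2) * indicator {0..T} (snd z)) \<in> borel_measurable (P \<Otimes>\<^sub>M lborel)" for n
      using measurable_process_compose[OF dm[of n], of snd "P \<Otimes>\<^sub>M lborel" fst] by measurable
    show "(\<lambda>z. ennreal ((f (snd z) (fst z))\<^sup>2) * indicator {0..T} (snd z)) \<in> borel_measurable (P \<Otimes>\<^sub>M lborel)"
      using measurable_process_compose[OF D(1), of snd "P \<Otimes>\<^sub>M lborel" fst] by measurable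
    \<comment> \<open>Clipping moves a number towards 0 and not past it, so the error is dominated
      by the number itself.\<close>
    have *: "(max (- real n) (min (real n) x) - x)\<^sup>2 \<le> x\<^sup>2" for n x
      by (auto simp: abs_le_square_iff[symmetric])
    show "AE z in P \<Otimes>\<^sub>M lborel. ennreal ((g n (snd z) (fst z) - f (snd z) (fst z))\<^sup>2) * indicator {0..T} (snd z)
       \<le> ennreal ((f (snd z) (fst z))\<^sup>2) * indicator {0..T} (snd z)" for n
      unfolding g_def truncated_def using * by (intro AE_I2) (auto simp: indicator_def intro!: ennreal_leI)
    show "(\<integral>\<^sup>+z. ennreal ((f (snd z) (fst z))\<^sup>2) * indicator {0..T} (snd z) \<partial>(P \<Otimes>\<^sub>M lborel)) < \<infinity>"
      using D(3) energy_product[OF D(1), of "{0..T}"] by simp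
    show "AE z in P \<Otimes>\<^sub>M lborel. (\<lambda>n. ennreal ((g n (snd z) (fst z) - f (snd z) (fst z))\<^sup>2) * indicator {0..T} (snd z)) \<longlonglongrightarrow> 0"
    proof (intro AE_I2 tendsto_eventually)
      fix z
      obtain N where "\<bar>f (snd z) (fst z)\<bar> \<le> real N" using real_arch_simple by blast
      then show "eventually (\<lambda>n. ennreal ((g n (snd z) (fst z) - f (snd z) (fst z))\<^sup>2) * indicator {0..T} (snd z) = 0) sequentially"
        by (intro eventually_sequentiallyI[of N]) (auto simp: g_def truncated_def indicator_def)
    qed
  qed simp
  then show "(\<lambda>n. energy {0..T} (\<lambda>s \<omega>. g n s \<omega> - f s \<omega>)) \<longlonglongrightarrow> 0"
    using energy_product[OF dm, of "{0..T}"] by simp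
qed

lemma elementary_dense:
  assumes f: "L2_process T f" and T: "0 < T" and e: "0 < e"
  shows "\<exists>k \<tau> \<xi>. elementary P W T k \<tau> \<xi> \<and>
    energy {0..T} (\<lambda>s \<omega>. elementary_process k \<tau> \<xi> s \<omega> - f s \<omega>) \<le> ennreal e"
proof -
  note D = L2_processD[OF f]
  define g where "g = truncated T f"
  note g = L2_process_truncated[OF f, folded g_def]
  \<comment> \<open>Each of the two errors is doubled by \<open>energy_add\<close>, hence
    \<open>e / 4\<close>.\<close>
  have "eventually (\<lambda>n. energy {0..T} (\<lambda>s \<omega>. g n s \<omega> - f s \<omega>) < ennreal (e / 4)) sequentially"
    using e by (intro order_tendstoD(2)[OF g(3)]) auto
  then obtain n where n: "energy {0..T} (\<lambda>s \<omega>. g n s \<omega> - f s \<omega>) < ennreal (e / 4)"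
    by (auto dest: eventually_happens)
  have "\<bar>g n s \<omega>\<bar> \<le> real n" for s \<omega> unfolding g_def truncated_def by (auto simp: indicator_def)
  then obtain k \<tau> \<xi> where el: "elementary P W T k \<tau> \<xi>"
    and le: "energy {0..T} (\<lambda>s \<omega>. elementary_process k \<tau> \<xi> s \<omega> - g n s \<omega>) \<le> ennreal (e / 4)"
    using elementary_dense_bounded[OF g(1) g(2), of T n "real n" "e / 4"] T e
    by (auto simp: g_def truncated_def fun_eq_iff)
  have "energy {0..T} (\<lambda>s \<omega>. elementary_process k \<tau> \<xi> s \<omega> - f s \<omega>) =
    energy {0..T} (\<lambda>s \<omega>. (elementary_process k \<tau> \<xi> s \<omega> - g n s \<omega>) + (g n s \<omega> - f s \<omega>))"
    by simp
  also have "\<dots> \<le> 2 * energy {0..T} (\<lambda>s \<omega>. elementary_process k \<tau> \<xi> s \<omega> - g n s \<omega>)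
      + 2 * energy {0..T} (\<lambda>s \<omega>. g n s \<omega> - f s \<omega>)"
    using measurable_process_elementary[OF el] g(1) D(1)
    by (intro energy_add measurable_process_diff) auto
  also have "\<dots> \<le> 2 * ennreal (e / 4) + 2 * ennreal (e / 4)"
    using n le by (intro add_mono mult_left_mono) auto
  also have "\<dots> = ennreal e"
    using e by (simp add: ennreal_mult'[symmetric] ennreal_plus[symmetric] ennreal_numeral[symmetric] del: ennreal_plus ennreal_numeral)
  finally show ?thesis using el by blast
qed

section \<open>The Ito integral as a process\<close>

lemma has_ito_integral_iff:
  "has_ito_integral P W f t Y \<longleftrightarrow> Y \<in> borel_measurable P \<and>
     (\<exists>k \<tau> \<xi>. (\<forall>m::nat. elementary P W t (k m) (\<tau> m) (\<xi> m)) \<and>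
        (\<lambda>m. energy {0..t} (\<lambda>s \<omega>. elementary_process (k m) (\<tau> m) (\<xi> m) s \<omega> - f s \<omega>)) \<longlonglongrightarrow> 0 \<and>
        (\<lambda>m. moment2 (\<lambda>\<omega>. elementary_integral W (k m) (\<tau> m) (\<xi> m) \<omega> - Y \<omega>)) \<longlonglongrightarrow> 0)"
  unfolding has_ito_integral_def energy_def moment2_def ..

lemma has_ito_integral_measurable: "has_ito_integral P W f t Y \<Longrightarrow> Y \<in> borel_measurable P"
  unfolding has_ito_integral_def by simp

lemma has_ito_integral_cong:
  assumes "AE \<omega> in P. AE s in lborel. s \<in> {0..t} \<longrightarrow> f s \<omega> = g s \<omega>"
  shows "has_ito_integral P W f t = has_ito_integral P W g t"
proof -
  have "energy {0..t} (\<lambda>s \<omega>. elementary_process k \<tau> \<xi> s \<omega> - f s \<omega>) =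
    energy {0..t} (\<lambda>s \<omega>. elementary_process k \<tau> \<xi> s \<omega> - g s \<omega>)" for k \<tau> \<xi>
    using assms by (intro energy_cong_AE) (auto elim!: eventually_mono)
  then show ?thesis
    unfolding has_ito_integral_iff fun_eq_iff by simp
qed

lemma elementary_integral_measurable:
  "elementary P W t k \<tau> \<xi> \<Longrightarrow> elementary_integral W k \<tau> \<xi> \<in> borel_measurable P"
  using elementary_integral_F_measurable F_measurable_imp by blast

lemma elementary_moment2:
  "elementary P W t k \<tau> \<xi> \<Longrightarrow> moment2 (elementary_integral W k \<tau> \<xi>) = energy {0..t} (elementary_process k \<tau> \<xi>)"
  unfolding moment2_def energy_def by (rule elementary_isometry)

text \<open>The combination of the \<open>m\<close>-th elementary processes is again elementary by
  the common refinement, and its two errors are controlled by those of the given sequences.\<close>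

lemma has_ito_integral_linear:
  assumes f: "measurable_process f" and g: "measurable_process g"
    and Y: "has_ito_integral P W f t Y" and Z: "has_ito_integral P W g t Z"
  shows "has_ito_integral P W (\<lambda>s \<omega>. a * f s \<omega> + b * g s \<omega>) t (\<lambda>\<omega>. a * Y \<omega> + b * Z \<omega>)"
proof -
  obtain k1 \<tau>1 \<xi>1 where 1: "\<And>m::nat. elementary P W t (k1 m) (\<tau>1 m) (\<xi>1 m)"
    "(\<lambda>m. energy {0..t} (\<lambda>s \<omega>. elementary_process (k1 m) (\<tau>1 m) (\<xi>1 m) s \<omega> - f s \<omega>)) \<longlonglongrightarrow> 0"
    "(\<lambda>m. moment2 (\<lambda>\<omega>. elementary_integral W (k1 m) (\<tau>1 m) (\<xi>1 m) \<omega> - Y \<omega>)) \<longlonglongrightarrow> 0"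
    using Y unfolding has_ito_integral_iff by blast
  obtain k2 \<tau>2 \<xi>2 where 2: "\<And>m::nat. elementary P W t (k2 m) (\<tau>2 m) (\<xi>2 m)"
    "(\<lambda>m. energy {0..t} (\<lambda>s \<omega>. elementary_process (k2 m) (\<tau>2 m) (\<xi>2 m) s \<omega> - g s \<omega>)) \<longlonglongrightarrow> 0"
    "(\<lambda>m. moment2 (\<lambda>\<omega>. elementary_integral W (k2 m) (\<tau>2 m) (\<xi>2 m) \<omega> - Z \<omega>)) \<longlonglongrightarrow> 0"
    using Z unfolding has_ito_integral_iff by blast
  let ?c = "\<lambda>x :: real. ennreal (x\<^sup>2)"
  have "\<forall>m. \<exists>k \<tau> \<xi>. elementary P W t k \<tau> \<xi> \<and>
    (\<forall>s \<omega>. elementary_process k \<tau> \<xi> s \<omega> = a * elementary_process (k1 m) (\<tau>1 m) (\<xi>1 m) s \<omega> + b * elementary_process (k2 m) (\<tau>2 m) (\<xi>2 m) s \<omega>) \<and>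
    (\<forall>\<omega>. elementary_integral W k \<tau> \<xi> \<omega> = a * elementary_integral W (k1 m) (\<tau>1 m) (\<xi>1 m) \<omega> + b * elementary_integral W (k2 m) (\<tau>2 m) (\<xi>2 m) \<omega>)"
    using elementary_linear_combination[OF 1(1) 2(1), where a=a and b=b] by metis
  then obtain k \<tau> \<xi> where el: "\<And>m. elementary P W t (k m) (\<tau> m) (\<xi> m)"
    and ep: "\<And>m s \<omega>. elementary_process (k m) (\<tau> m) (\<xi> m) s \<omega> = a * elementary_process (k1 m) (\<tau>1 m) (\<xi>1 m) s \<omega> + b * elementary_process (k2 m) (\<tau>2 m) (\<xi>2 m) s \<omega>"
    and ei: "\<And>m \<omega>. elementary_integral W (k m) (\<tau> m) (\<xi> m) \<omega> = a * elementary_integral W (k1 m) (\<tau>1 m) (\<xi>1 m) \<omega> + b * elementary_integral W (k2 m) (\<tau>2 m) (\<xi>2 m) \<omega>"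
    by metis
  have sandwich: "u \<longlonglongrightarrow> 0" if "\<And>m. u m \<le> 2 * (?c a * v m) + 2 * (?c b * w m)" "v \<longlonglongrightarrow> 0" "w \<longlonglongrightarrow> 0"
    for u v w :: "nat \<Rightarrow> ennreal"
  proof -
    have "(\<lambda>m. 2 * (?c a * v m) + 2 * (?c b * w m)) \<longlonglongrightarrow> 2 * (?c a * 0) + 2 * (?c b * 0)"
      by (intro tendsto_add ennreal_tendsto_cmult that) simp_all
    then show ?thesis
      using ennreal_tendsto_0_le[OF that(1)] by simp
  qed
  have "(\<lambda>m. energy {0..t} (\<lambda>s \<omega>. elementary_process (k m) (\<tau> m) (\<xi> m) s \<omega> - (a * f s \<omega> + b * g s \<omega>))) \<longlonglongrightarrow> 0"
  proof (rule sandwich[OF _ 1(2) 2(2)])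
    fix m
    let ?p = "\<lambda>s \<omega>. elementary_process (k1 m) (\<tau>1 m) (\<xi>1 m) s \<omega> - f s \<omega>"
    let ?q = "\<lambda>s \<omega>. elementary_process (k2 m) (\<tau>2 m) (\<xi>2 m) s \<omega> - g s \<omega>"
    have pq: "measurable_process ?p" "measurable_process ?q"
      using measurable_process_elementary[OF 1(1)] measurable_process_elementary[OF 2(1)] f g
      by (auto intro: measurable_process_diff)
    have "energy {0..t} (\<lambda>s \<omega>. elementary_process (k m) (\<tau> m) (\<xi> m) s \<omega> - (a * f s \<omega> + b * g s \<omega>)) =
      energy {0..t} (\<lambda>s \<omega>. a * ?p s \<omega> + b * ?q s \<omega>)"
      unfolding ep by (simp add: algebra_simps)
    also have "\<dots> \<le> 2 * energy {0..t} (\<lambda>s \<omega>. a * ?p s \<omega>) + 2 * energy {0..t} (\<lambda>s \<omega>. b * ?q s \<omega>)"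
      using pq by (intro energy_add measurable_process_cmult) auto
    finally show "energy {0..t} (\<lambda>s \<omega>. elementary_process (k m) (\<tau> m) (\<xi> m) s \<omega> - (a * f s \<omega> + b * g s \<omega>))
      \<le> 2 * (?c a * energy {0..t} ?p) + 2 * (?c b * energy {0..t} ?q)"
      using pq by (simp add: energy_cmult)
  qed
  moreover have "(\<lambda>m. moment2 (\<lambda>\<omega>. elementary_integral W (k m) (\<tau> m) (\<xi> m) \<omega> - (a * Y \<omega> + b * Z \<omega>))) \<longlonglongrightarrow> 0"
  proof (rule sandwich[OF _ 1(3) 2(3)])
    fix m
    let ?p = "\<lambda>\<omega>. elementary_integral W (k1 m) (\<tau>1 m) (\<xi>1 m) \<omega> - Y \<omega>"
    let ?q = "\<lambda>\<omega>. elementary_integral W (k2 m) (\<tau>2 m) (\<xi>2 m) \<omega> - Z \<omega>"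
    have pq: "?p \<in> borel_measurable P" "?q \<in> borel_measurable P"
      using elementary_integral_measurable[OF 1(1)] elementary_integral_measurable[OF 2(1)]
        has_ito_integral_measurable[OF Y] has_ito_integral_measurable[OF Z] by auto
    have "moment2 (\<lambda>\<omega>. elementary_integral W (k m) (\<tau> m) (\<xi> m) \<omega> - (a * Y \<omega> + b * Z \<omega>)) =
      moment2 (\<lambda>\<omega>. a * ?p \<omega> + b * ?q \<omega>)"
      unfolding ei by (simp add: algebra_simps)
    also have "\<dots> \<le> 2 * moment2 (\<lambda>\<omega>. a * ?p \<omega>) + 2 * moment2 (\<lambda>\<omega>. b * ?q \<omega>)"
      using pq by (intro moment2_add) auto
    finally show "moment2 (\<lambda>\<omega>. elementary_integral W (k m) (\<tau> m) (\<xi> m) \<omega> - (a * Y \<omega> + b * Z \<omega>))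
      \<le> 2 * (?c a * moment2 ?p) + 2 * (?c b * moment2 ?q)"
      using pq by (simp add: moment2_cmult)
  qed
  moreover have "(\<lambda>\<omega>. a * Y \<omega> + b * Z \<omega>) \<in> borel_measurable P"
    using has_ito_integral_measurable[OF Y] has_ito_integral_measurable[OF Z] by auto
  ultimately show ?thesis
    unfolding has_ito_integral_iff using el by blast
qed

text \<open>The factor 4 is harmless below and spares the exact isometry, for which the quasi-triangle
  inequality \<open>(x + y)\<^sup>2 \<le> 2 x\<^sup>2 + 2 y\<^sup>2\<close> would not suffice.\<close>

lemma has_ito_integral_bounds:
  assumes f: "measurable_process f" and Y: "has_ito_integral P W f t Y"
  shows "moment2 Y \<le> 4 * energy {0..t} f" "energy {0..t} f \<le> 4 * moment2 Y"
proof -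
  obtain k \<tau> \<xi> where el: "\<And>m::nat. elementary P W t (k m) (\<tau> m) (\<xi> m)"
    and a: "(\<lambda>m. energy {0..t} (\<lambda>s \<omega>. elementary_process (k m) (\<tau> m) (\<xi> m) s \<omega> - f s \<omega>)) \<longlonglongrightarrow> 0" (is "?a \<longlonglongrightarrow> 0")
    and b: "(\<lambda>m. moment2 (\<lambda>\<omega>. elementary_integral W (k m) (\<tau> m) (\<xi> m) \<omega> - Y \<omega>)) \<longlonglongrightarrow> 0" (is "?b \<longlonglongrightarrow> 0")
    using Y unfolding has_ito_integral_iff by blast
  let ?\<phi> = "\<lambda>m. elementary_process (k m) (\<tau> m) (\<xi> m)" and ?I = "\<lambda>m. elementary_integral W (k m) (\<tau> m) (\<xi> m)"
  have Ym: "Y \<in> borel_measurable P" using has_ito_integral_measurable[OF Y] .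
  have Im: "?I m \<in> borel_measurable P" for m using elementary_integral_measurable[OF el] .
  have \<phi>m: "measurable_process (?\<phi> m)" for m using measurable_process_elementary[OF el] .
  have e1: "energy {0..t} (?\<phi> m) \<le> 2 * ?a m + 2 * energy {0..t} f" for m
    using energy_add[OF measurable_process_diff[OF \<phi>m f] f, of "{0..t}" m] by simp
  have e2: "energy {0..t} f \<le> 2 * ?a m + 2 * energy {0..t} (?\<phi> m)" for m
    using energy_add[OF measurable_process_diff[OF f \<phi>m] \<phi>m, of "{0..t}" m m] energy_minus_commute[of "{0..t}" f "?\<phi> m"]
    by simp
  have m1: "moment2 (?I m) \<le> 2 * ?b m + 2 * moment2 Y" for m
    using moment2_add[of "\<lambda>\<omega>. ?I m \<omega> - Y \<omega>" Y] Ym Im[of m] by simp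
  have m2: "moment2 Y \<le> 2 * ?b m + 2 * moment2 (?I m)" for m
    using moment2_add[of "\<lambda>\<omega>. Y \<omega> - ?I m \<omega>" "?I m"] moment2_minus_commute[of Y "?I m"] Ym Im[of m] by simp
  have iso: "moment2 (?I m) = energy {0..t} (?\<phi> m)" for m
    using elementary_moment2[OF el] .
  have lim: "(\<lambda>m. 2 * u m + 2 * (2 * v m + 2 * c)) \<longlonglongrightarrow> 2 * 0 + 2 * (2 * 0 + 2 * c)"
    if "u \<longlonglongrightarrow> 0" "v \<longlonglongrightarrow> 0" for u v :: "nat \<Rightarrow> ennreal" and c :: ennreal
    by (intro tendsto_add ennreal_tendsto_cmult tendsto_const that) simp_all
  have "moment2 Y \<le> 2 * 0 + 2 * (2 * 0 + 2 * energy {0..t} f)"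
  proof (rule LIMSEQ_le_const[OF lim[OF b a]], intro exI allI impI)
    fix m
    show "moment2 Y \<le> 2 * ?b m + 2 * (2 * ?a m + 2 * energy {0..t} f)"
      using m2[of m] unfolding iso by (rule order_trans) (intro add_left_mono mult_left_mono e1, simp)
  qed
  then show "moment2 Y \<le> 4 * energy {0..t} f" by (simp add: mult.assoc[symmetric])
  have "energy {0..t} f \<le> 2 * 0 + 2 * (2 * 0 + 2 * moment2 Y)"
  proof (rule LIMSEQ_le_const[OF lim[OF a b]], intro exI allI impI)
    fix m
    show "energy {0..t} f \<le> 2 * ?a m + 2 * (2 * ?b m + 2 * moment2 Y)"
      using e2[of m] unfolding iso[symmetric] by (rule order_trans) (intro add_left_mono mult_left_mono m1, simp)
  qed
  then show "energy {0..t} f \<le> 4 * moment2 Y" by (simp add: mult.assoc[symmetric])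
qed

text \<open>By linearity \<open>Y - Z\<close> is an integral of the zero process, and the energy
  bound makes its second moment zero.\<close>

lemma has_ito_integral_unique:
  assumes f: "measurable_process f" and Y: "has_ito_integral P W f t Y" and Z: "has_ito_integral P W f t Z"
  shows "AE \<omega> in P. Y \<omega> = Z \<omega>"
proof -
  have m: "(\<lambda>\<omega>. 1 * Y \<omega> + - 1 * Z \<omega>) \<in> borel_measurable P"
    using has_ito_integral_measurable[OF Y] has_ito_integral_measurable[OF Z] by measurable
  have "moment2 (\<lambda>\<omega>. 1 * Y \<omega> + - 1 * Z \<omega>) \<le> 4 * energy {0..t} (\<lambda>s \<omega>. 1 * f s \<omega> + - 1 * f s \<omega>)"
    using f by (intro has_ito_integral_bounds has_ito_integral_linear Y Z measurable_process_add measurable_process_cmult)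
  also have "\<dots> = 0" by (simp add: energy_def)
  finally have "AE \<omega> in P. 1 * Y \<omega> + - 1 * Z \<omega> = 0"
    using moment2_eq_0_iff[OF m] by simp
  then show ?thesis by (auto elim: eventually_mono)
qed

text \<open>An elementary process on \<open>{0..s}\<close> vanishes afterwards, so the same
  approximating sequence serves the longer interval. This puts integrals up to different times over
  one interval, where linearity gives their increments.\<close>

lemma has_ito_integral_extend:
  assumes Y: "has_ito_integral P W f s Y" and st: "0 \<le> s" "s \<le> t"
  shows "has_ito_integral P W (\<lambda>r \<omega>. indicator {0..s} r * f r \<omega>) t Y"
proof -
  obtain k \<tau> \<xi> where el: "\<And>m::nat. elementary P W s (k m) (\<tau> m) (\<xi> m)"
    and a: "(\<lambda>m. energy {0..s} (\<lambda>r \<omega>. elementary_process (k m) (\<tau> m) (\<xi> m) r \<omega> - f r \<omega>)) \<longlonglongrightarrow> 0"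
    and b: "(\<lambda>m. moment2 (\<lambda>\<omega>. elementary_integral W (k m) (\<tau> m) (\<xi> m) \<omega> - Y \<omega>)) \<longlonglongrightarrow> 0"
    using Y unfolding has_ito_integral_iff by blast
  have "elementary P W t (k m) (\<tau> m) (\<xi> m)" for m
    using el[of m] st unfolding elementary_def by fastforce
  moreover have "energy {0..t} (\<lambda>r \<omega>. elementary_process (k m) (\<tau> m) (\<xi> m) r \<omega> - indicator {0..s} r * f r \<omega>) =
    energy {0..s} (\<lambda>r \<omega>. elementary_process (k m) (\<tau> m) (\<xi> m) r \<omega> - f r \<omega>)" for m
  proof -
    have "\<tau> m (k m) \<le> s" using el[of m] unfolding elementary_def by auto
    then have 0: "elementary_process (k m) (\<tau> m) (\<xi> m) r \<omega> = 0" if "s < r" for r \<omega>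
      using elementary_process_beyond[OF el[of m], of r \<omega>] that by simp
    show ?thesis
      unfolding energy_def using st 0
      by (intro nn_integral_cong) (auto simp: indicator_def)
  qed
  ultimately show ?thesis
    using a b has_ito_integral_measurable[OF Y] unfolding has_ito_integral_iff
    by (intro conjI exI[of _ k] exI[of _ \<tau>] exI[of _ \<xi>]) simp_all
qed

text \<open>At this geometric rate the increments are almost surely summable, so the limit exists
  path by path and can be named by \<open>lim\<close>. A limit named in this way inherits
  measurability in all parameters; Fatou carries the rate over to it.\<close>

lemma moment2_Cauchy_limit:
  assumes Z [measurable]: "\<And>n::nat. Z n \<in> borel_measurable P" and C: "0 \<le> C"
    and Cauchy: "\<And>m n. m \<le> n \<Longrightarrow> moment2 (\<lambda>\<omega>. Z n \<omega> - Z m \<omega>) \<le> ennreal (C * (1/4)^m)"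
  shows "AE \<omega> in P. (\<lambda>n. Z n \<omega>) \<longlonglongrightarrow> lim (\<lambda>n. Z n \<omega>)"
    "moment2 (\<lambda>\<omega>. Z m \<omega> - lim (\<lambda>n. Z n \<omega>)) \<le> ennreal (C * (1/4)^m)"
proof -
  define \<Delta> where "\<Delta> = (\<lambda>n \<omega>. Z (Suc n) \<omega> - Z n \<omega>)"
  have \<Delta> [measurable]: "\<Delta> n \<in> borel_measurable P" for n unfolding \<Delta>_def by measurable
  \<comment> \<open>The weight \<open>2^n\<close> balances the two terms: with a second moment of
    order \<open>(1/4)^n\<close> both become of order \<open>(1/2)^n\<close>, which is
    summable.\<close>
  have abs_le: "\<bar>x\<bar> \<le> (1/2)^n + 2^n * x\<^sup>2" for n and x :: real
  proof -
    have "0 \<le> (1/2)^n * ((2^n * \<bar>x\<bar> - 1)\<^sup>2 + 2^n * \<bar>x\<bar>)" by simp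
    also have "\<dots> = (1/2)^n + 2^n * x\<^sup>2 - \<bar>x\<bar>"
      by (simp add: power2_eq_square algebra_simps power_divide flip: abs_mult)
    finally show ?thesis by simp
  qed
  have E\<Delta>: "(\<integral>\<^sup>+\<omega>. ennreal \<bar>\<Delta> n \<omega>\<bar> \<partial>P) \<le> ennreal ((1 + C) * (1/2)^n)" for n
  proof -
    have "(\<integral>\<^sup>+\<omega>. ennreal \<bar>\<Delta> n \<omega>\<bar> \<partial>P) \<le> (\<integral>\<^sup>+\<omega>. ennreal ((1/2)^n) + ennreal (2^n) * ennreal ((\<Delta> n \<omega>)\<^sup>2) \<partial>P)"
      using abs_le by (intro nn_integral_mono) (auto simp: ennreal_mult'[symmetric] ennreal_plus[symmetric] simp del: ennreal_plus intro!: ennreal_leI)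
    also have "\<dots> = ennreal ((1/2)^n) + ennreal (2^n) * moment2 (\<Delta> n)"
      unfolding moment2_def by (simp add: nn_integral_add nn_integral_cmult emeasure_space_1)
    also have "\<dots> \<le> ennreal ((1/2)^n) + ennreal (2^n) * ennreal (C * (1/4)^n)"
      using Cauchy[of n "Suc n"] unfolding \<Delta>_def by (intro add_left_mono mult_left_mono) auto
    also have "\<dots> = ennreal ((1/2)^n + 2^n * (C * (1/4)^n))"
      using C by (simp add: ennreal_mult'[symmetric] ennreal_plus[symmetric] del: ennreal_plus)
    also have "(1/2)^n + 2^n * (C * (1/4)^n) = (1 + C) * (1/2::real)^n"
    proof -
      have "(2::real)^n * (1/4)^n = (1/2)^n" by (simp flip: power_mult_distrib)
      then show ?thesis by (simp add: algebra_simps)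
    qed
    finally show ?thesis .
  qed
  have "(\<integral>\<^sup>+\<omega>. (\<Sum>n. ennreal \<bar>\<Delta> n \<omega>\<bar>) \<partial>P) = (\<Sum>n. \<integral>\<^sup>+\<omega>. ennreal \<bar>\<Delta> n \<omega>\<bar> \<partial>P)"
    by (rule nn_integral_suminf) measurable
  also have "\<dots> \<le> (\<Sum>n. ennreal ((1 + C) * (1/2)^n))"
    by (intro suminf_le E\<Delta>) auto
  also have "\<dots> = ennreal (\<Sum>n. (1 + C) * (1/2)^n)"
    using C by (intro suminf_ennreal2 summable_mult summable_geometric) auto
  also have "\<dots> < \<infinity>" by simp
  finally have fin: "(\<integral>\<^sup>+\<omega>. (\<Sum>n. ennreal \<bar>\<Delta> n \<omega>\<bar>) \<partial>P) \<noteq> \<infinity>" by simp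
  have "AE \<omega> in P. (\<Sum>n. ennreal \<bar>\<Delta> n \<omega>\<bar>) \<noteq> \<infinity>"
    by (rule nn_integral_PInf_AE[OF _ fin]) measurable
  then show lim: "AE \<omega> in P. (\<lambda>n. Z n \<omega>) \<longlonglongrightarrow> lim (\<lambda>n. Z n \<omega>)"
  proof eventually_elim
    case (elim \<omega>)
    then have "summable (\<lambda>n. \<bar>\<Delta> n \<omega>\<bar>)" by (intro summable_suminf_not_top) auto
    then have "summable (\<lambda>n. Z (Suc n) \<omega> - Z n \<omega>)" unfolding \<Delta>_def by (rule summable_rabs_cancel)
    from summable_LIMSEQ[OF this] have "(\<lambda>n. Z n \<omega> - Z 0 \<omega>) \<longlonglongrightarrow> (\<Sum>n. Z (Suc n) \<omega> - Z n \<omega>)"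
      unfolding sum_lessThan_telescope[of "\<lambda>n. Z n \<omega>"] .
    from tendsto_add[OF this tendsto_const[of "Z 0 \<omega>"]] have "convergent (\<lambda>n. Z n \<omega>)"
      by (auto simp: convergent_def)
    then show ?case by (simp add: convergent_LIMSEQ_iff)
  qed
  have "moment2 (\<lambda>\<omega>. Z m \<omega> - lim (\<lambda>n. Z n \<omega>)) = (\<integral>\<^sup>+\<omega>. liminf (\<lambda>n. ennreal ((Z m \<omega> - Z n \<omega>)\<^sup>2)) \<partial>P)"
    unfolding moment2_def
  proof (rule nn_integral_cong_AE)
    show "AE \<omega> in P. ennreal ((Z m \<omega> - lim (\<lambda>n. Z n \<omega>))\<^sup>2) = liminf (\<lambda>n. ennreal ((Z m \<omega> - Z n \<omega>)\<^sup>2))"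
      using lim
    proof eventually_elim
      case (elim \<omega>)
      have "(\<lambda>n. ennreal ((Z m \<omega> - Z n \<omega>)\<^sup>2)) \<longlonglongrightarrow> ennreal ((Z m \<omega> - lim (\<lambda>n. Z n \<omega>))\<^sup>2)"
        by (intro tendsto_ennrealI tendsto_intros elim)
      from lim_imp_Liminf[OF _ this] show ?case by simp
    qed
  qed
  also have "\<dots> \<le> liminf (\<lambda>n. \<integral>\<^sup>+\<omega>. ennreal ((Z m \<omega> - Z n \<omega>)\<^sup>2) \<partial>P)"
    by (rule nn_integral_liminf) measurable
  also have "\<dots> = liminf (\<lambda>n. moment2 (\<lambda>\<omega>. Z n \<omega> - Z m \<omega>))"
    unfolding moment2_def by (simp add: power2_commute)
  also have "\<dots> \<le> ennreal (C * (1/4)^m)"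
    using Cauchy by (intro Liminf_le eventually_sequentiallyI[of m]) auto
  finally show "moment2 (\<lambda>\<omega>. Z m \<omega> - lim (\<lambda>n. Z n \<omega>)) \<le> ennreal (C * (1/4)^m)" .
qed

text \<open>\<open>W\<close> is measurable at each time and only almost surely continuous, so it
  need not be jointly measurable. Setting the bad paths to zero and freezing time below 0 gives
  continuous paths, which are limits of their values on a grid; the rounded time takes countably
  many values.\<close>

lemma continuous_modification:
  obtains V where "measurable_process V" "AE \<omega> in P. \<forall>t\<ge>0. V t \<omega> = W t \<omega>"
proof -
  have "AE \<omega> in P. continuous_on {0..} (\<lambda>t. W t \<omega>)"
    using brownian_motion unfolding brownian_motion_def by blast
  then obtain N where N: "N \<in> null_sets P" "\<And>\<omega>. \<omega> \<in> space P - N \<Longrightarrow> continuous_on {0..} (\<lambda>t. W t \<omega>)"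
    by (elim AE_E3) blast
  define V where "V = (\<lambda>t \<omega>. if \<omega> \<in> N then 0 else W (max 0 t) \<omega>)"
  have Nm [measurable]: "N \<in> sets P" using N(1) by auto
  have Vm [measurable]: "V t \<in> borel_measurable P" for t unfolding V_def by measurable
  have "measurable_process V"
    unfolding measurable_process_def
  proof (rule borel_measurable_LIMSEQ_metric[where
        f="\<lambda>n z. V (real_of_int \<lfloor>fst z * real (Suc n)\<rfloor> / real (Suc n)) (snd z)"])
    fix n :: nat
    have "(\<lambda>z. V (real_of_int \<lfloor>fst z * real (Suc n)\<rfloor> / real (Suc n)) (snd z)) \<in> borel_measurable (borel \<Otimes>\<^sub>M P)"
    proof (rule measurable_compose_countable[where f="\<lambda>i z. V (real_of_int i / real (Suc n)) (snd z)"])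
      show "(\<lambda>z. V (real_of_int i / real (Suc n)) (snd z)) \<in> borel_measurable (borel \<Otimes>\<^sub>M P)" for i
        using measurable_compose[OF measurable_snd Vm] .
      show "(\<lambda>z. \<lfloor>fst z * real (Suc n)\<rfloor>) \<in> borel \<Otimes>\<^sub>M P \<rightarrow>\<^sub>M count_space UNIV"
        by measurable
    qed
    then show "(\<lambda>z. V (real_of_int \<lfloor>fst z * real (Suc n)\<rfloor> / real (Suc n)) (snd z)) \<in> borel_measurable (borel \<Otimes>\<^sub>M P)" .
  next
    fix z :: "real \<times> 'w" assume "z \<in> space (borel \<Otimes>\<^sub>M P)"
    then have w: "snd z \<in> space P" by (auto simp: space_pair_measure)
    let ?t = "fst z" and ?r = "\<lambda>n. real_of_int \<lfloor>fst z * real (Suc n)\<rfloor> / real (Suc n)"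
    have r: "?r \<longlonglongrightarrow> ?t"
    proof (rule real_tendsto_sandwich[where f="\<lambda>n. ?t - 1 / real (Suc n)" and h="\<lambda>n. ?t"])
      have "(\<lambda>n. ?t - 1 / real (Suc n)) \<longlonglongrightarrow> ?t - 0"
        by (intro tendsto_diff tendsto_const LIMSEQ_Suc[OF lim_const_over_n])
      then show "(\<lambda>n. ?t - 1 / real (Suc n)) \<longlonglongrightarrow> ?t" by simp
      have "?t - 1 / real (Suc n) \<le> ?r n \<and> ?r n \<le> ?t" for n
      proof -
        have "?t * real (Suc n) - 1 \<le> real_of_int \<lfloor>?t * real (Suc n)\<rfloor>" "real_of_int \<lfloor>?t * real (Suc n)\<rfloor> \<le> ?t * real (Suc n)"
          by linarith+
        then have "(?t * real (Suc n) - 1) / real (Suc n) \<le> ?r n" "?r n \<le> ?t"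
          by (auto intro: divide_right_mono simp add: pos_divide_le_eq simp del: of_nat_Suc)
        then show ?thesis by (simp add: diff_divide_distrib del: of_nat_Suc)
      qed
      then show "eventually (\<lambda>n. ?t - 1 / real (Suc n) \<le> ?r n) sequentially"
        "eventually (\<lambda>n. ?r n \<le> ?t) sequentially" by auto
    qed simp
    show "(\<lambda>n. V (?r n) (snd z)) \<longlonglongrightarrow> (case z of (s, \<omega>) \<Rightarrow> V s \<omega>)"
    proof (cases "snd z \<in> N")
      case False
      then have "continuous_on {0..} (\<lambda>t. W t (snd z))" using N(2) w by auto
      moreover have "(\<lambda>n. max 0 (?r n)) \<longlonglongrightarrow> max 0 ?t" by (intro tendsto_intros r)
      ultimately have "(\<lambda>n. W (max 0 (?r n)) (snd z)) \<longlonglongrightarrow> W (max 0 ?t) (snd z)"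
        by (rule continuous_on_tendsto_compose) auto
      then show ?thesis using False unfolding V_def by (simp add: case_prod_beta')
    qed (simp add: V_def case_prod_beta')
  qed
  moreover have "AE \<omega> in P. \<forall>t\<ge>0. V t \<omega> = W t \<omega>"
    using AE_not_in[OF N(1)] by (auto elim!: eventually_mono simp: V_def)
  ultimately show thesis by (rule that)
qed

text \<open>One approximating sequence serves all times at once, which yields a jointly measurable choice
  of the integrals without a maximal inequality.\<close>

lemma ito_integral_process_exists:
  assumes f: "L2_process T f" and T: "0 < T"
  obtains J where "measurable_process J"
    "\<And>t. 0 \<le> t \<Longrightarrow> t \<le> T \<Longrightarrow> J t \<in> borel_measurable (F t)"
    "\<And>t. 0 \<le> t \<Longrightarrow> t \<le> T \<Longrightarrow> has_ito_integral P W f t (J t)"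
proof -
  note D = L2_processD[OF f]
  obtain V where V: "measurable_process V" "AE \<omega> in P. \<forall>t\<ge>0. V t \<omega> = W t \<omega>"
    using continuous_modification .
  \<comment> \<open>The rate \<open>(1/4)^m\<close> is the one under which
    \<open>moment2_Cauchy_limit\<close> produces an almost sure limit.\<close>
  have "\<forall>m. \<exists>k \<tau> \<xi>. elementary P W T k \<tau> \<xi> \<and>
    energy {0..T} (\<lambda>s \<omega>. elementary_process k \<tau> \<xi> s \<omega> - f s \<omega>) \<le> ennreal ((1/4)^m)"
    by (intro allI elementary_dense[OF f T]) simp
  then obtain k \<tau> \<xi> where el: "\<And>m. elementary P W T (k m) (\<tau> m) (\<xi> m)"
    and le: "\<And>m. energy {0..T} (\<lambda>s \<omega>. elementary_process (k m) (\<tau> m) (\<xi> m) s \<omega> - f s \<omega>) \<le> ennreal ((1/4)^m)"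
    by metis
  let ?\<phi> = "\<lambda>m. elementary_process (k m) (\<tau> m) (\<xi> m)"
  define \<tau>' where "\<tau>' = (\<lambda>t m i. min (\<tau> m i) t)"
  define \<xi>' where "\<xi>' = (\<lambda>t m i \<omega>. if \<tau> m i \<le> t then \<xi> m i \<omega> else 0)"
  \<comment> \<open>The stopped integrals are written with the version \<open>V\<close>, which makes
    them jointly measurable in time and path; they agree almost surely with the integrals against
    \<open>W\<close>.\<close>
  define I where "I = (\<lambda>m t \<omega>. \<Sum>i<k m. \<xi> m i \<omega> * (V (min (\<tau> m (Suc i)) t) \<omega> - V (min (\<tau> m i) t) \<omega>))"
  have \<phi>m: "measurable_process (?\<phi> m)" for m using measurable_process_elementary[OF el] .
  have el': "elementary P W t (k m) (\<tau>' t m) (\<xi>' t m)"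
    and proc': "\<And>s \<omega>. s \<le> t \<Longrightarrow> elementary_process (k m) (\<tau>' t m) (\<xi>' t m) s \<omega> = ?\<phi> m s \<omega>"
    and I_eq: "AE \<omega> in P. elementary_integral W (k m) (\<tau>' t m) (\<xi>' t m) \<omega> = I m t \<omega>"
    if t: "0 \<le> t" "t \<le> T" for t m
  proof -
    note st = elementary_stopped[OF el[of m] t]
    show "elementary P W t (k m) (\<tau>' t m) (\<xi>' t m)" unfolding \<tau>'_def \<xi>'_def by (rule st(1))
    show "elementary_process (k m) (\<tau>' t m) (\<xi>' t m) s \<omega> = ?\<phi> m s \<omega>" if "s \<le> t" for s \<omega>
      unfolding \<tau>'_def \<xi>'_def by (rule st(2)[OF that])
    have nonneg: "0 \<le> \<tau> m i" if "i \<le> k m" for i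
      using el[of m] that unfolding elementary_def by auto
    show "AE \<omega> in P. elementary_integral W (k m) (\<tau>' t m) (\<xi>' t m) \<omega> = I m t \<omega>"
      using V(2)
    proof eventually_elim
      case (elim \<omega>)
      then show ?case
        unfolding \<tau>'_def \<xi>'_def st(3) I_def using nonneg t by (intro sum.cong) auto
    qed
  qed
  have Ipm: "measurable_process (I m)" for m
  proof -
    have "(\<lambda>z. \<xi> m i (snd z)) \<in> borel_measurable (borel \<Otimes>\<^sub>M P)" if "i < k m" for i
      using elementary_square_integrable(1)[OF el that] by measurable
    moreover have "(\<lambda>z. V (min c (fst z)) (snd z)) \<in> borel_measurable (borel \<Otimes>\<^sub>M P)" for c
      by (rule measurable_process_compose[OF V(1)]) measurable
    ultimately show ?thesis
      unfolding measurable_process_def I_def case_prod_beta'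
      by (intro borel_measurable_sum borel_measurable_times borel_measurable_diff) auto
  qed
  have IF: "I m t \<in> borel_measurable (F t)" if t: "0 \<le> t" "t \<le> T" for t m
  proof -
    have "\<tau>' t m (k m) \<le> t" using el'[OF t, of m] unfolding elementary_def by auto
    then show ?thesis
      using F_measurable_AE_cong[OF F_mono[OF _ elementary_integral_F_measurable[OF el'[OF t]]] I_eq[OF t]] by blast
  qed
  have IP: "I m t \<in> borel_measurable P" if "0 \<le> t" "t \<le> T" for t m
    using IF[OF that] by (rule F_measurable_imp)
  \<comment> \<open>The error up to time \<open>t\<close> is at most the error over the whole
    interval, so the rate is the same at all times. The constant 4 is 2 + 2 from
    \<open>energy_add\<close>.\<close>
  have Cauchy: "moment2 (\<lambda>\<omega>. I n t \<omega> - I m t \<omega>) \<le> ennreal (4 * (1/4)^m)"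
    if t: "0 \<le> t" "t \<le> T" and mn: "m \<le> n" for t m n
  proof -
    obtain k0 \<tau>0 \<xi>0 where e0: "elementary P W t k0 \<tau>0 \<xi>0"
      and p0: "\<And>s \<omega>. elementary_process k0 \<tau>0 \<xi>0 s \<omega> = 1 * elementary_process (k n) (\<tau>' t n) (\<xi>' t n) s \<omega> + (- 1) * elementary_process (k m) (\<tau>' t m) (\<xi>' t m) s \<omega>"
      and i0: "\<And>\<omega>. elementary_integral W k0 \<tau>0 \<xi>0 \<omega> = 1 * elementary_integral W (k n) (\<tau>' t n) (\<xi>' t n) \<omega> + (- 1) * elementary_integral W (k m) (\<tau>' t m) (\<xi>' t m) \<omega>"
      using elementary_linear_combination[OF el'[OF t, of n] el'[OF t, of m], where a=1 and b="-1"] by metis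
    have "AE \<omega> in P. elementary_integral W k0 \<tau>0 \<xi>0 \<omega> = I n t \<omega> - I m t \<omega>"
      using I_eq[OF t, of n] I_eq[OF t, of m] by eventually_elim (simp add: i0)
    then have "moment2 (\<lambda>\<omega>. I n t \<omega> - I m t \<omega>) = moment2 (elementary_integral W k0 \<tau>0 \<xi>0)"
      by (intro moment2_cong_AE) (auto elim: eventually_mono)
    also have "\<dots> = energy {0..t} (elementary_process k0 \<tau>0 \<xi>0)"
      using elementary_moment2[OF e0] .
    also have "\<dots> = energy {0..t} (\<lambda>s \<omega>. (?\<phi> n s \<omega> - f s \<omega>) + (f s \<omega> - ?\<phi> m s \<omega>))"
      using proc'[OF t] by (intro energy_cong) (simp add: p0)
    also have "\<dots> \<le> energy {0..T} (\<lambda>s \<omega>. (?\<phi> n s \<omega> - f s \<omega>) + (f s \<omega> - ?\<phi> m s \<omega>))"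
      using t by (intro energy_mono_set) auto
    also have "\<dots> \<le> 2 * energy {0..T} (\<lambda>s \<omega>. ?\<phi> n s \<omega> - f s \<omega>) + 2 * energy {0..T} (\<lambda>s \<omega>. f s \<omega> - ?\<phi> m s \<omega>)"
      using \<phi>m D(1) by (intro energy_add measurable_process_diff) auto
    also have "energy {0..T} (\<lambda>s \<omega>. f s \<omega> - ?\<phi> m s \<omega>) = energy {0..T} (\<lambda>s \<omega>. ?\<phi> m s \<omega> - f s \<omega>)"
      by (rule energy_minus_commute)
    also have "2 * energy {0..T} (\<lambda>s \<omega>. ?\<phi> n s \<omega> - f s \<omega>) + 2 * energy {0..T} (\<lambda>s \<omega>. ?\<phi> m s \<omega> - f s \<omega>)
      \<le> 2 * ennreal ((1/4)^m) + 2 * ennreal ((1/4)^m)"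
    proof (intro add_mono mult_left_mono le)
      have "ennreal ((1/4)^n) \<le> ennreal ((1/4)^m)"
        using mn by (intro ennreal_leI power_decreasing) auto
      with le[of n] show "energy {0..T} (\<lambda>s \<omega>. ?\<phi> n s \<omega> - f s \<omega>) \<le> ennreal ((1/4)^m)"
        by (rule order_trans)
    qed auto
    also have "\<dots> = 4 * ennreal ((1/4)^m)"
      by (simp add: mult_2[symmetric] mult.assoc[symmetric])
    also have "\<dots> = ennreal (4 * (1/4)^m)"
      by (simp add: ennreal_mult')
    finally show ?thesis .
  qed
  define J where "J = (\<lambda>t \<omega>. lim (\<lambda>m. I m t \<omega>))"
  show thesis
  proof
    show "measurable_process J"
      unfolding measurable_process_def J_def case_prod_beta'
      using Ipm[THEN measurable_process_pair] by (rule borel_measurable_lim_metric)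
  next
    fix t assume t: "0 \<le> t" "t \<le> T"
    show JF: "J t \<in> borel_measurable (F t)"
      unfolding J_def using IF[OF t] by (rule borel_measurable_lim_metric)
    have J: "moment2 (\<lambda>\<omega>. I m t \<omega> - J t \<omega>) \<le> ennreal (4 * (1/4)^m)" for m
      unfolding J_def using IP[OF t] Cauchy[OF t] by (intro moment2_Cauchy_limit) auto
    have geom: "(\<lambda>m. ennreal (c * (1/4)^m)) \<longlonglongrightarrow> 0" for c
    proof -
      have "(\<lambda>m. c * (1/4)^m) \<longlonglongrightarrow> c * 0" by (intro tendsto_intros LIMSEQ_realpow_zero) auto
      from tendsto_ennrealI[OF this] show ?thesis by simp
    qed
    show "has_ito_integral P W f t (J t)"
      unfolding has_ito_integral_iff
    proof (intro conjI exI allI)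
      show "J t \<in> borel_measurable P" using JF by (rule F_measurable_imp)
      show "elementary P W t (k m) (\<tau>' t m) (\<xi>' t m)" for m using el'[OF t] .
      show "(\<lambda>m. energy {0..t} (\<lambda>s \<omega>. elementary_process (k m) (\<tau>' t m) (\<xi>' t m) s \<omega> - f s \<omega>)) \<longlonglongrightarrow> 0"
      proof (rule ennreal_tendsto_0_le[OF _ geom[of 1]])
        fix m
        have "energy {0..t} (\<lambda>s \<omega>. elementary_process (k m) (\<tau>' t m) (\<xi>' t m) s \<omega> - f s \<omega>) =
          energy {0..t} (\<lambda>s \<omega>. ?\<phi> m s \<omega> - f s \<omega>)"
          using proc'[OF t] by (intro energy_cong) simp
        also have "\<dots> \<le> energy {0..T} (\<lambda>s \<omega>. ?\<phi> m s \<omega> - f s \<omega>)"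
          using t by (intro energy_mono_set) auto
        also note le[of m]
        finally show "energy {0..t} (\<lambda>s \<omega>. elementary_process (k m) (\<tau>' t m) (\<xi>' t m) s \<omega> - f s \<omega>) \<le> ennreal (1 * (1/4)^m)"
          by simp
      qed
      show "(\<lambda>m. moment2 (\<lambda>\<omega>. elementary_integral W (k m) (\<tau>' t m) (\<xi>' t m) \<omega> - J t \<omega>)) \<longlonglongrightarrow> 0"
      proof (rule ennreal_tendsto_0_le[OF _ geom[of 4]])
        fix m
        have "moment2 (\<lambda>\<omega>. elementary_integral W (k m) (\<tau>' t m) (\<xi>' t m) \<omega> - J t \<omega>) = moment2 (\<lambda>\<omega>. I m t \<omega> - J t \<omega>)"
          using I_eq[OF t, of m] by (intro moment2_cong_AE) (auto elim: eventually_mono)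
        then show "moment2 (\<lambda>\<omega>. elementary_integral W (k m) (\<tau>' t m) (\<xi>' t m) \<omega> - J t \<omega>) \<le> ennreal (4 * (1/4)^m)"
          using J[of m] by simp
      qed
    qed
  qed
qed

text \<open>\<open>ito_integral\<close> is a Hilbert choice; the existence of an integral is what
  turns the chosen element into one.\<close>

lemma has_ito_integral_ito_integral:
  assumes "L2_process T f" "0 \<le> t" "t \<le> T" "0 < T"
  shows "has_ito_integral P W f t (ito_integral P W f t)"
proof -
  obtain J where "has_ito_integral P W f t (J t)"
    using ito_integral_process_exists[OF assms(1,4)] assms(2,3) by metis
  then show ?thesis unfolding ito_integral_def by (rule someI[where P="has_ito_integral P W f t"])
qed

text \<open>The equality holds everywhere and not just almost surely: equal predicates have the same
  chosen element.\<close>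

lemma ito_integral_cong:
  "AE \<omega> in P. AE s in lborel. s \<in> {0..t} \<longrightarrow> f s \<omega> = g s \<omega> \<Longrightarrow> ito_integral P W f t = ito_integral P W g t"
  unfolding ito_integral_def by (simp add: has_ito_integral_cong)

section \<open>Time integrals of square-integrable processes\<close>

definition time_integral :: "(real \<Rightarrow> 'w \<Rightarrow> real) \<Rightarrow> real \<Rightarrow> 'w \<Rightarrow> real" where
  "time_integral f t \<omega> = (LINT s|lborel. indicator {0..t} s * f s \<omega>)"

text \<open>On a bounded interval square-integrability implies integrability, because an absolute
  value is at most one plus the square. Off the exceptional paths \<open>time_integral\<close> is
  thus a genuine integral and not the default value 0.\<close>

lemma L2_process_path_integrable:
  assumes f: "L2_process T f"
  shows "AE \<omega> in P. integrable lborel (\<lambda>s. indicator {0..T} s * f s \<omega>)"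
proof -
  note D = L2_processD[OF f]
  have "AE \<omega> in P. (\<integral>\<^sup>+s. ennreal ((f s \<omega>)\<^sup>2) * indicator {0..T} s \<partial>lborel) \<noteq> \<infinity>"
    using D(3) borel_measurable_path_energy[OF D(1), of "{0..T}"]
    by (intro nn_integral_PInf_AE) (auto simp: energy_def)
  then show ?thesis
    using AE_space
  proof eventually_elim
    case (elim \<omega>)
    have sec: "(\<lambda>s. f s \<omega>) \<in> borel_measurable borel"
      using measurable_process_section[OF D(1) elim(2)] .
    have m1: "(\<lambda>s. ennreal ((f s \<omega>)\<^sup>2) * indicator {0..T} s) \<in> borel_measurable lborel"
      using sec by (intro borel_measurable_times_ennreal borel_measurable_indicator
          measurable_compose[OF _ measurable_ennreal] borel_measurable_power) auto
    have m2: "(\<lambda>s. indicator {0..T} s * f s \<omega>) \<in> borel_measurable lborel"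
      using sec by (intro borel_measurable_times borel_measurable_indicator) auto
    have "(\<integral>\<^sup>+s. ennreal (norm (indicator {0..T} s * f s \<omega>)) \<partial>lborel) \<le>
      (\<integral>\<^sup>+s. indicator {0..T} s + ennreal ((f s \<omega>)\<^sup>2) * indicator {0..T} s \<partial>lborel)"
    proof (intro nn_integral_mono)
      fix s
      have "0 \<le> (\<bar>f s \<omega>\<bar> - 1)\<^sup>2 + \<bar>f s \<omega>\<bar>" by simp
      then have "\<bar>f s \<omega>\<bar> \<le> 1 + (f s \<omega>)\<^sup>2"
        by (simp add: power2_eq_square algebra_simps flip: abs_mult)
      then have "ennreal \<bar>f s \<omega>\<bar> \<le> 1 + ennreal ((f s \<omega>)\<^sup>2)"
        by (simp add: ennreal_plus[symmetric] ennreal_1[symmetric] ennreal_leI del: ennreal_plus ennreal_1)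
      then show "ennreal (norm (indicator {0..T} s * f s \<omega>)) \<le> indicator {0..T} s + ennreal ((f s \<omega>)\<^sup>2) * indicator {0..T} s"
        by (auto simp: indicator_def)
    qed
    also have "\<dots> = emeasure lborel {0..T} + (\<integral>\<^sup>+s. ennreal ((f s \<omega>)\<^sup>2) * indicator {0..T} s \<partial>lborel)"
      by (subst nn_integral_add) (use m1 in auto)
    also have "\<dots> < \<infinity>" using elim(1) by (cases "0 \<le> T") (auto simp: less_top)
    finally show ?case by (intro integrableI_bounded m2)
  qed
qed

lemma measurable_process_time_integral:
  assumes f: "measurable_process f"
  shows "measurable_process (time_integral f)"
proof -
  have "(\<lambda>w. f (snd w) (snd (fst w))) \<in> borel_measurable (((borel :: real measure) \<Otimes>\<^sub>M P) \<Otimes>\<^sub>M lborel)"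
    by (rule measurable_process_compose[OF f]) measurable
  \<comment> \<open>The upper limit of integration is itself a variable; to see joint measurability
    the indicator is factored into the conditions that \<open>s\<close> and \<open>t - s\<close> are
    nonnegative.\<close>
  moreover have "(\<lambda>w. indicator {0..fst (fst w)} (snd w) :: real) \<in> borel_measurable (((borel :: real measure) \<Otimes>\<^sub>M P) \<Otimes>\<^sub>M lborel)"
  proof -
    have snd: "snd \<in> borel_measurable (((borel :: real measure) \<Otimes>\<^sub>M P) \<Otimes>\<^sub>M (lborel :: real measure))"
      using measurable_snd[of "(borel :: real measure) \<Otimes>\<^sub>M P" "lborel :: real measure"] by simp
    have diff: "(\<lambda>w. fst (fst w) - snd w) \<in> borel_measurable (((borel :: real measure) \<Otimes>\<^sub>M P) \<Otimes>\<^sub>M (lborel :: real measure))"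
      by (intro borel_measurable_diff snd measurable_compose[OF measurable_fst measurable_fst])
    have ind: "(indicator {0..} :: real \<Rightarrow> real) \<in> borel_measurable borel"
      by (rule borel_measurable_indicator) simp
    have "(\<lambda>w. indicator {0..} (snd w) * indicator {0..} (fst (fst w) - snd w) :: real)
      \<in> borel_measurable (((borel :: real measure) \<Otimes>\<^sub>M P) \<Otimes>\<^sub>M lborel)"
      by (intro borel_measurable_times measurable_compose[OF snd ind] measurable_compose[OF diff ind])
    moreover have "indicator {0..fst (fst w)} (snd w) = (indicator {0..} (snd w) * indicator {0..} (fst (fst w) - snd w) :: real)"
      for w :: "(real \<times> 'w) \<times> real"
      by (auto simp: indicator_def)
    ultimately show ?thesis by simp
  qed
  ultimately have "(\<lambda>(z, s). indicator {0..fst z} s * f s (snd z)) \<in> borel_measurable (((borel :: real measure) \<Otimes>\<^sub>M P) \<Otimes>\<^sub>M lborel)"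
    unfolding case_prod_beta' by (rule borel_measurable_times[rotated])
  from lborel.borel_measurable_lebesgue_integral[OF this] show ?thesis
    unfolding measurable_process_def time_integral_def case_prod_beta' .
qed

text \<open>Truncation reduces this to bounded processes; the truncated integrals converge along
  almost every path by dominated convergence.\<close>

lemma time_integral_F_measurable:
  assumes f: "L2_process T f" and t: "0 \<le> t" "t \<le> T"
  shows "time_integral f t \<in> borel_measurable (F t)"
proof -
  note D = L2_processD[OF f]
  define g where "g = truncated T f"
  note g = L2_process_truncated[OF f, folded g_def]
  have gb: "\<bar>g n s \<omega>\<bar> \<le> real n" for n s \<omega> unfolding g_def truncated_def by (auto simp: indicator_def)
  \<comment> \<open>The bounded case is stated for half-open intervals; starting at -1 includes time
    0, and the truncations vanish before it.\<close>
  have m: "(\<lambda>\<omega>. LINT s|lborel. indicator {-1<..t} s * g n s \<omega>) \<in> borel_measurable (F t)" for n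
    using g(1) gb t F_mono[OF _ g(2)] by (intro F_measurable_time_integral_bounded) auto
  have "AE \<omega> in P. lim (\<lambda>n. LINT s|lborel. indicator {-1<..t} s * g n s \<omega>) = time_integral f t \<omega>"
    using L2_process_path_integrable[OF f] AE_space
  proof eventually_elim
    case (elim \<omega>)
    have sec: "(\<lambda>s. f s \<omega>) \<in> borel_measurable borel" "\<And>n. (\<lambda>s. g n s \<omega>) \<in> borel_measurable borel"
      using measurable_process_section[OF D(1) elim(2)] measurable_process_section[OF g(1) elim(2)] by auto
    have "(\<lambda>n. LINT s|lborel. indicator {-1<..t} s * g n s \<omega>) \<longlonglongrightarrow> (LINT s|lborel. indicator {0..t} s * f s \<omega>)"
    proof (rule integral_dominated_convergence)
      show "integrable lborel (\<lambda>s. \<bar>indicator {0..T} s * f s \<omega>\<bar>)" using elim(1) by (rule integrable_abs)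
      show "(\<lambda>s. indicator {0..t} s * f s \<omega>) \<in> borel_measurable lborel"
        using sec by (intro borel_measurable_times borel_measurable_indicator) auto
      show "(\<lambda>s. indicator {-1<..t} s * g n s \<omega>) \<in> borel_measurable lborel" for n
        using sec(2)[of n] by (intro borel_measurable_times borel_measurable_indicator) auto
      show "AE s in lborel. norm (indicator {-1<..t} s * g n s \<omega>) \<le> \<bar>indicator {0..T} s * f s \<omega>\<bar>" for n
        by (intro AE_I2) (auto simp: g_def truncated_def indicator_def)
      show "AE s in lborel. (\<lambda>n. indicator {-1<..t} s * g n s \<omega>) \<longlonglongrightarrow> indicator {0..t} s * f s \<omega>"
      proof (intro AE_I2 tendsto_eventually)
        fix s
        obtain N where "\<bar>f s \<omega>\<bar> \<le> real N" using real_arch_simple by blast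
        then show "eventually (\<lambda>n. indicator {-1<..t} s * g n s \<omega> = indicator {0..t} s * f s \<omega>) sequentially"
          using t by (intro eventually_sequentiallyI[of N]) (auto simp: g_def truncated_def indicator_def)
      qed
    qed
    then show ?case unfolding time_integral_def by (rule limI)
  qed
  with borel_measurable_lim_metric[OF m] show ?thesis
    by (rule F_measurable_AE_cong)
qed

text \<open>Cauchy-Schwarz along each path. The factor \<open>t - s\<close>, absent from the
  corresponding bounds for Ito integrals, is what separates drift from diffusion.\<close>

lemma time_integral_increment_moment2:
  assumes f: "L2_process T f" and st: "0 \<le> s" "s \<le> t" "t \<le> T"
  shows "moment2 (\<lambda>\<omega>. time_integral f t \<omega> - time_integral f s \<omega>) \<le> ennreal (t - s) * energy {s<..t} f"
proof -
  note D = L2_processD[OF f]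
  have "moment2 (\<lambda>\<omega>. time_integral f t \<omega> - time_integral f s \<omega>) \<le>
    (\<integral>\<^sup>+\<omega>. ennreal (t - s) * (\<integral>\<^sup>+r. ennreal ((f r \<omega>)\<^sup>2) * indicator {s<..t} r \<partial>lborel) \<partial>P)"
    unfolding moment2_def
  proof (rule nn_integral_mono_AE)
    show "AE \<omega> in P. ennreal ((time_integral f t \<omega> - time_integral f s \<omega>)\<^sup>2) \<le>
      ennreal (t - s) * (\<integral>\<^sup>+r. ennreal ((f r \<omega>)\<^sup>2) * indicator {s<..t} r \<partial>lborel)"
      using L2_process_path_integrable[OF f] AE_space
    proof eventually_elim
      case (elim \<omega>)
      have sec: "(\<lambda>s. f s \<omega>) \<in> borel_measurable borel"
        using measurable_process_section[OF D(1) elim(2)] .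
      have int: "integrable lborel (\<lambda>r. indicator A r * f r \<omega>)" if "A \<subseteq> {0..T}" "A \<in> sets borel" for A
      proof (rule Bochner_Integration.integrable_bound[OF elim(1)])
        show "(\<lambda>r. indicator A r * f r \<omega>) \<in> borel_measurable lborel"
          using sec that(2) by (intro borel_measurable_times borel_measurable_indicator) auto
        show "AE r in lborel. norm (indicator A r * f r \<omega>) \<le> norm (indicator {0..T} r * f r \<omega>)"
          using that(1) by (intro AE_I2) (auto simp: indicator_def)
      qed
      have "time_integral f t \<omega> - time_integral f s \<omega> = (LINT r|lborel. indicator {0..t} r * f r \<omega> - indicator {0..s} r * f r \<omega>)"
        unfolding time_integral_def using st by (intro Bochner_Integration.integral_diff[symmetric] int) auto
      also have "\<dots> = (LINT r|lborel. indicator {s<..t} r * f r \<omega>)"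
        using st by (intro Bochner_Integration.integral_cong) (auto simp: indicator_def)
      finally have eq: "time_integral f t \<omega> - time_integral f s \<omega> = (LINT r|lborel. indicator {s<..t} r * f r \<omega>)" .
      have sub: "{s<..t} \<subseteq> {0..T}" using st by auto
      have "ennreal \<bar>LINT r|lborel. indicator {s<..t} r * f r \<omega>\<bar> \<le> (\<integral>\<^sup>+r. ennreal \<bar>indicator {s<..t} r * f r \<omega>\<bar> \<partial>lborel)"
        using integral_norm_bound_ennreal[OF int[OF sub]] by simp
      also have "\<dots> = (\<integral>\<^sup>+r. indicator {s<..t} r * ennreal \<bar>indicator {s<..t} r * f r \<omega>\<bar> \<partial>lborel)"
        by (intro nn_integral_cong) (auto simp: indicator_def)
      finally have le: "ennreal \<bar>LINT r|lborel. indicator {s<..t} r * f r \<omega>\<bar> \<le> (\<integral>\<^sup>+r. indicator {s<..t} r * ennreal \<bar>indicator {s<..t} r * f r \<omega>\<bar> \<partial>lborel)" .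
      have m: "(\<lambda>r. ennreal \<bar>indicator {s<..t} r * f r \<omega>\<bar>) \<in> borel_measurable lborel"
        using sec by (intro measurable_compose[OF _ measurable_ennreal] borel_measurable_abs borel_measurable_times borel_measurable_indicator) auto
      have "ennreal ((time_integral f t \<omega> - time_integral f s \<omega>)\<^sup>2) = (ennreal \<bar>LINT r|lborel. indicator {s<..t} r * f r \<omega>\<bar>)\<^sup>2"
        unfolding eq by (simp add: ennreal_power)
      also have "\<dots> \<le> (\<integral>\<^sup>+r. indicator {s<..t} r * ennreal \<bar>indicator {s<..t} r * f r \<omega>\<bar> \<partial>lborel)\<^sup>2"
        using le by (intro power_mono) auto
      also have "\<dots> \<le> (\<integral>\<^sup>+r. (indicator {s<..t} r)\<^sup>2 \<partial>lborel) * (\<integral>\<^sup>+r. (ennreal \<bar>indicator {s<..t} r * f r \<omega>\<bar>)\<^sup>2 \<partial>lborel)"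
        using m by (intro Cauchy_Schwarz_nn_integral) auto
      also have "(\<integral>\<^sup>+r. (indicator {s<..t} r :: ennreal)\<^sup>2 \<partial>lborel) = (\<integral>\<^sup>+r. indicator {s<..t} r \<partial>lborel)"
        by (intro nn_integral_cong) (auto simp: indicator_def)
      also have "\<dots> = ennreal (t - s)" using st by simp
      also have "(\<integral>\<^sup>+r. (ennreal \<bar>indicator {s<..t} r * f r \<omega>\<bar>)\<^sup>2 \<partial>lborel) = (\<integral>\<^sup>+r. ennreal ((f r \<omega>)\<^sup>2) * indicator {s<..t} r \<partial>lborel)"
        by (intro nn_integral_cong) (auto simp: indicator_def ennreal_power)
      finally show ?case .
    qed
  qed
  also have "\<dots> = ennreal (t - s) * energy {s<..t} f"
    unfolding energy_def using borel_measurable_path_energy[OF D(1), of "{s<..t}"]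
    by (intro nn_integral_cmult) auto
  finally show ?thesis .
qed

end

text \<open>Otherwise the interval would be a null set. This provides good times arbitrarily close
  to a given one.\<close>

lemma AE_lborel_interval_witness:
  assumes "AE x in lborel. Q x" "a < (b::real)"
  obtains x where "a < x" "x < b" "Q x"
proof (rule ccontr)
  assume no: "\<not> thesis"
  have "AE x in lborel. x \<notin> {a<..<b}"
    using assms(1) by eventually_elim (use no that in auto)
  then have "emeasure lborel {a<..<b} = 0"
    by (subst (asm) AE_iff_measurable[where N="{a<..<b}"]) auto
  with \<open>a < b\<close> show False by simp
qed

context brownian
begin

section \<open>Uniqueness of drift and diffusion\<close>

lemma energy_Un_disjoint:
  assumes "measurable_process f" "A \<in> sets borel" "B \<in> sets borel" "A \<inter> B = {}"
  shows "energy (A \<union> B) f = energy A f + energy B f"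
proof -
  note assms(1-3)[measurable]
  have "energy (A \<union> B) f = (\<integral>\<^sup>+s. moment2 (f s) * indicator A s + moment2 (f s) * indicator B s \<partial>lborel)"
    unfolding energy_swap[OF assms(1) sets.Un[OF assms(2,3)]]
    using assms(4) by (intro nn_integral_cong) (auto simp: indicator_def)
  then show ?thesis
    unfolding energy_swap[OF assms(1,2)] energy_swap[OF assms(1,3)]
    by (simp add: nn_integral_add)
qed

lemma energy_Icc_eq_Ioc:
  assumes "measurable_process f"
  shows "energy {a..b} f = energy {a<..b} f"
proof -
  have "energy {a..b} f = (\<integral>\<^sup>+s. moment2 (f s) * indicator {a<..b} s \<partial>lborel)"
    unfolding energy_swap[OF assms atLeastAtMost_borel]
    using AE_lborel_singleton[of a]
    by (intro nn_integral_cong_AE) (auto elim!: eventually_mono simp: indicator_def)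
  then show ?thesis by (simp add: energy_swap[OF assms])
qed

text \<open>The increment is the integral of \<open>b\<close> with its values up to \<open>s\<close>
  removed, obtained by extending the integral up to \<open>s\<close> by zero. The upper bound gives
  mean-square continuity, the lower one recovers the energy from the increments.\<close>

lemma ito_integral_increment_bounds:
  assumes b: "L2_process T b" and st: "0 \<le> s" "s \<le> t" "t \<le> T" "0 < T"
  shows "moment2 (\<lambda>\<omega>. ito_integral P W b t \<omega> - ito_integral P W b s \<omega>) \<le> 4 * energy {s<..t} b"
    "energy {s<..t} b \<le> 4 * moment2 (\<lambda>\<omega>. ito_integral P W b t \<omega> - ito_integral P W b s \<omega>)"
proof -
  note D = L2_processD[OF b]
  let ?M = "ito_integral P W b"
  have it: "has_ito_integral P W b t (?M t)" and iS: "has_ito_integral P W b s (?M s)"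
    using st by (auto intro!: has_ito_integral_ito_integral[OF b])
  have m: "measurable_process (\<lambda>r \<omega>. indicator {0..s} r * b r \<omega>)"
    by (intro measurable_process_time D(1)) simp
  have d: "has_ito_integral P W (\<lambda>r \<omega>. 1 * b r \<omega> + - 1 * (indicator {0..s} r * b r \<omega>)) t (\<lambda>\<omega>. 1 * ?M t \<omega> + - 1 * ?M s \<omega>)"
    using st by (intro has_ito_integral_linear D(1) m it has_ito_integral_extend iS)
  have eq: "energy {0..t} (\<lambda>r \<omega>. 1 * b r \<omega> + - 1 * (indicator {0..s} r * b r \<omega>)) = energy {s<..t} b"
    unfolding energy_def using st by (intro nn_integral_cong) (auto simp: indicator_def)
  have dm: "measurable_process (\<lambda>r \<omega>. 1 * b r \<omega> + - 1 * (indicator {0..s} r * b r \<omega>))"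
    by (intro measurable_process_add measurable_process_cmult D(1) m)
  show "moment2 (\<lambda>\<omega>. ?M t \<omega> - ?M s \<omega>) \<le> 4 * energy {s<..t} b"
    "energy {s<..t} b \<le> 4 * moment2 (\<lambda>\<omega>. ?M t \<omega> - ?M s \<omega>)"
    using has_ito_integral_bounds[OF dm d] unfolding eq by simp_all
qed

lemma ito_integral_measurable:
  assumes "L2_process T b" "0 \<le> t" "t \<le> T" "0 < T"
  shows "ito_integral P W b t \<in> borel_measurable P"
  using has_ito_integral_ito_integral[OF assms] by (rule has_ito_integral_measurable)

lemma time_integral_measurable:
  assumes "L2_process T a" "0 \<le> t" "t \<le> T"
  shows "time_integral a t \<in> borel_measurable P"
  using time_integral_F_measurable[OF assms] by (rule F_measurable_imp)

lemma time_integral_0: "time_integral a 0 \<omega> = 0"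
proof -
  have "AE s in lborel. indicator {0..0} s * a s \<omega> = 0"
    using AE_lborel_singleton[of "0::real"] by eventually_elim (auto simp: indicator_def)
  then show ?thesis unfolding time_integral_def by (rule integral_eq_zero_AE)
qed

text \<open>Dominated convergence. Together with the increment bounds it makes both kinds of
  integrals mean-square continuous from the left.\<close>

lemma energy_Ioc_tendsto_0:
  assumes f: "measurable_process f" and fin: "energy {0..T} f < \<infinity>" and t: "t \<le> T"
    and s: "\<And>n. 0 \<le> s n" "s \<longlonglongrightarrow> t"
  shows "(\<lambda>n. energy {s n<..t} f) \<longlonglongrightarrow> 0"
proof -
  note f[measurable]
  have "(\<lambda>n. \<integral>\<^sup>+r. moment2 (f r) * indicator {s n<..t} r \<partial>lborel) \<longlonglongrightarrow> (\<integral>\<^sup>+r. 0 \<partial>(lborel :: real measure))"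
  proof (rule nn_integral_dominated_convergence[where w="\<lambda>r. moment2 (f r) * indicator {0..T} r"])
    show "AE r in lborel. moment2 (f r) * indicator {s n<..t} r \<le> moment2 (f r) * indicator {0..T} r" for n
      using s(1)[of n] t by (intro AE_I2) (auto simp: indicator_def)
    show "(\<integral>\<^sup>+r. moment2 (f r) * indicator {0..T} r \<partial>lborel) < \<infinity>"
      using fin energy_swap[OF f, of "{0..T}"] by simp
    show "AE r in lborel. (\<lambda>n. moment2 (f r) * indicator {s n<..t} r) \<longlonglongrightarrow> 0"
      using AE_lborel_singleton[of t]
    proof eventually_elim
      case (elim r)
      have "eventually (\<lambda>n. moment2 (f r) * indicator {s n<..t} r = 0) sequentially"
      proof (cases "r < t")
        case True
        with s(2) have "eventually (\<lambda>n. r < s n) sequentially" by (rule order_tendstoD(1))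
        then show ?thesis by eventually_elim (auto simp: indicator_def)
      qed (use elim in auto)
      then show ?case by (rule tendsto_eventually)
    qed
  qed auto
  then show ?thesis by (simp add: energy_swap[OF f])
qed

text \<open>A martingale that is a time integral has vanishing quadratic variation: over a partition of mesh
  \<open>\<delta>\<close> the squared increments of a time integral add up to \<open>O(\<delta>)\<close>, those of an Ito integral to
  its energy.\<close>

lemma energy_diffusion_zero:
  assumes a: "L2_process T a" and b: "L2_process T b" and T: "0 < T"
    and eq: "\<And>t. 0 \<le> t \<Longrightarrow> t \<le> T \<Longrightarrow> AE \<omega> in P. time_integral a t \<omega> + ito_integral P W b t \<omega> = 0"
  shows "energy {0..T} b = 0"
proof -
  note Da = L2_processD[OF a] and Db = L2_processD[OF b]
  have step: "energy {s<..t} b \<le> ennreal (4 * (t - s)) * energy {s<..t} a" if st: "0 \<le> s" "s \<le> t" "t \<le> T" for s t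
  proof -
    have "energy {s<..t} b \<le> 4 * moment2 (\<lambda>\<omega>. ito_integral P W b t \<omega> - ito_integral P W b s \<omega>)"
      using st T by (intro ito_integral_increment_bounds[OF b])
    also have "moment2 (\<lambda>\<omega>. ito_integral P W b t \<omega> - ito_integral P W b s \<omega>) =
      moment2 (\<lambda>\<omega>. time_integral a s \<omega> - time_integral a t \<omega>)"
    proof (rule moment2_cong_AE)
      have "AE \<omega> in P. time_integral a t \<omega> + ito_integral P W b t \<omega> = 0"
        "AE \<omega> in P. time_integral a s \<omega> + ito_integral P W b s \<omega> = 0"
        using eq[of t] eq[of s] st by auto
      then show "AE \<omega> in P. ito_integral P W b t \<omega> - ito_integral P W b s \<omega> = time_integral a s \<omega> - time_integral a t \<omega>"
        by eventually_elim linarith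
    qed
    also have "\<dots> = moment2 (\<lambda>\<omega>. time_integral a t \<omega> - time_integral a s \<omega>)"
      by (rule moment2_minus_commute)
    also have "\<dots> \<le> ennreal (t - s) * energy {s<..t} a"
      using st by (intro time_integral_increment_moment2[OF a])
    finally have "energy {s<..t} b \<le> 4 * (ennreal (t - s) * energy {s<..t} a)"
      by (simp add: mult_left_mono)
    moreover have "4 * (ennreal (t - s) * energy {s<..t} a) = ennreal (4 * (t - s)) * energy {s<..t} a"
      using ennreal_mult'[of 4 "t - s"] by (simp only: mult.assoc[symmetric] ennreal_numeral zero_le_numeral)
    ultimately show ?thesis by simp
  qed
  have "energy {0<..T} b \<le> ennreal (4 * (T / real (Suc n))) * energy {0..T} a" for n
  proof -
    define \<delta> where "\<delta> = T / real (Suc n)"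
    have \<delta>: "0 < \<delta>" "real (Suc n) * \<delta> = T" using T unfolding \<delta>_def by auto
    \<comment> \<open>The one-step estimate is added up over the cells by induction; the mesh stays
      as a common factor.\<close>
    have "k \<le> Suc n \<Longrightarrow> energy {0<..real k * \<delta>} b \<le> ennreal (4 * \<delta>) * energy {0<..real k * \<delta>} a" for k
    proof (induction k)
      case 0
      then show ?case by (simp add: energy_def)
    next
      case (Suc k)
      let ?s = "real k * \<delta>" and ?t = "real (Suc k) * \<delta>"
      have st: "0 \<le> ?s" "?s \<le> ?t" "?t \<le> T" "?t - ?s = \<delta>"
        using \<delta> mult_right_mono[of "real (Suc k)" "real (Suc n)" \<delta>] Suc.prems
        by (auto simp: algebra_simps)
      have split: "energy {0<..?t} f = energy {0<..?s} f + energy {?s<..?t} f" if "measurable_process f" for f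
      proof -
        have "x \<in> {0<..?t} \<longleftrightarrow> x \<in> {0<..?s} \<union> {?s<..?t}" for x
          using st(1,2) by (simp only: Un_iff greaterThanAtMost_iff) linarith
        then have "{0<..?t} = {0<..?s} \<union> {?s<..?t}" by blast
        then show ?thesis using energy_Un_disjoint[OF that, of "{0<..?s}" "{?s<..?t}"] by auto
      qed
      have "energy {0<..?t} b \<le> ennreal (4 * \<delta>) * energy {0<..?s} a + ennreal (4 * \<delta>) * energy {?s<..?t} a"
        unfolding split[OF Db(1)] using step[OF st(1-3)] Suc unfolding st(4) by (intro add_mono) auto
      then show ?case unfolding split[OF Da(1)] by (simp add: distrib_left)
    qed
    from this[of "Suc n"] have "energy {0<..T} b \<le> ennreal (4 * \<delta>) * energy {0<..T} a"
      unfolding \<delta>(2) by simp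
    also have "\<dots> \<le> ennreal (4 * \<delta>) * energy {0..T} a"
      by (intro mult_left_mono energy_mono_set) auto
    finally show ?thesis unfolding \<delta>_def .
  qed
  moreover have "(\<lambda>n. ennreal (4 * (T / real (Suc n))) * energy {0..T} a) \<longlonglongrightarrow> 0"
  proof -
    have "(\<lambda>n. T / real (Suc n)) \<longlonglongrightarrow> 0"
      using LIMSEQ_Suc[OF lim_const_over_n[of T]] by simp
    then have "(\<lambda>n. 4 * (T / real (Suc n))) \<longlonglongrightarrow> 4 * 0" by (intro tendsto_intros)
    from ennreal_tendsto_cmult[OF _ tendsto_ennrealI[OF this], of "energy {0..T} a"] Da(3)
    show ?thesis by (simp add: mult.commute)
  qed
  ultimately have "energy {0<..T} b \<le> 0"
    by (intro LIMSEQ_le_const) auto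
  then show ?thesis by (simp add: energy_Icc_eq_Ioc[OF Db(1)])
qed

text \<open>Along a fixed path the values of the elementary process are constants, so if the
  integral of \<open>f\<close> vanishes at all nodes, \<open>f\<close> is orthogonal to the step
  function. By Pythagoras \<open>f\<close> is then no larger than its distance from that step
  function.\<close>

lemma elementary_process_orthogonal_path:
  assumes el: "elementary P W T k \<tau> \<xi>" and w: "\<omega> \<in> space P"
    and sec: "(\<lambda>s. f s \<omega>) \<in> borel_measurable borel"
    and int: "integrable lborel (\<lambda>s. indicator {0..T} s * f s \<omega>)"
    and fin: "(\<integral>\<^sup>+s. ennreal ((f s \<omega>)\<^sup>2) * indicator {0..T} s \<partial>lborel) < \<infinity>"
    and zero: "\<And>i. i \<le> k \<Longrightarrow> time_integral f (\<tau> i) \<omega> = 0"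
  shows "(\<integral>\<^sup>+s. ennreal ((f s \<omega>)\<^sup>2) * indicator {0..T} s \<partial>lborel) \<le>
    (\<integral>\<^sup>+s. ennreal ((elementary_process k \<tau> \<xi> s \<omega> - f s \<omega>)\<^sup>2) * indicator {0..T} s \<partial>lborel)"
proof -
  let ?\<phi> = "\<lambda>s. elementary_process k \<tau> \<xi> s \<omega>" and ?I = "indicator {0..T} :: real \<Rightarrow> real"
  have \<tau>: "\<tau> i \<in> {0..T}" if "i \<le> k" for i using el that unfolding elementary_def by auto
  have mono: "\<tau> i \<le> \<tau> (Suc i)" if "i < k" for i using el that unfolding elementary_def by auto
  have \<phi>sec: "?\<phi> \<in> borel_measurable borel"
    using measurable_process_section[OF measurable_process_elementary[OF el] w] .
  have intA: "integrable lborel (\<lambda>r. indicator A r * f r \<omega>)" if "A \<subseteq> {0..T}" "A \<in> sets borel" for A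
  proof (rule Bochner_Integration.integrable_bound[OF int])
    show "(\<lambda>r. indicator A r * f r \<omega>) \<in> borel_measurable lborel"
      using sec that(2) by (intro borel_measurable_times borel_measurable_indicator) auto
    show "AE r in lborel. norm (indicator A r * f r \<omega>) \<le> norm (?I r * f r \<omega>)"
      using that(1) by (intro AE_I2) (auto simp: indicator_def)
  qed
  have cell: "integrable lborel (\<lambda>s. \<xi> i \<omega> * (indicator {\<tau> i<..\<tau> (Suc i)} s * f s \<omega>))"
    "(LINT s|lborel. \<xi> i \<omega> * (indicator {\<tau> i<..\<tau> (Suc i)} s * f s \<omega>)) = 0" if i: "i < k" for i
  proof -
    have sub: "{\<tau> i<..\<tau> (Suc i)} \<subseteq> {0..T}" "{0..\<tau> i} \<subseteq> {0..T}" "{0..\<tau> (Suc i)} \<subseteq> {0..T}"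
      using \<tau>[of i] \<tau>[of "Suc i"] i by auto
    show "integrable lborel (\<lambda>s. \<xi> i \<omega> * (indicator {\<tau> i<..\<tau> (Suc i)} s * f s \<omega>))"
      using intA[OF sub(1)] by simp
    have "(LINT s|lborel. indicator {\<tau> i<..\<tau> (Suc i)} s * f s \<omega>) =
      (LINT s|lborel. indicator {0..\<tau> (Suc i)} s * f s \<omega> - indicator {0..\<tau> i} s * f s \<omega>)"
      using mono[OF i] \<tau>[of i] i by (intro Bochner_Integration.integral_cong) (auto simp: indicator_def)
    also have "\<dots> = time_integral f (\<tau> (Suc i)) \<omega> - time_integral f (\<tau> i) \<omega>"
      unfolding time_integral_def by (intro Bochner_Integration.integral_diff intA sub) auto
    also have "\<dots> = 0" using zero i by simp
    finally show "(LINT s|lborel. \<xi> i \<omega> * (indicator {\<tau> i<..\<tau> (Suc i)} s * f s \<omega>)) = 0" by simp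
  qed
  have \<phi>f: "?I s * (?\<phi> s * f s \<omega>) = (\<Sum>i<k. \<xi> i \<omega> * (indicator {\<tau> i<..\<tau> (Suc i)} s * f s \<omega>))" for s
  proof -
    have "?I s * indicator {\<tau> i<..\<tau> (Suc i)} s = (indicator {\<tau> i<..\<tau> (Suc i)} s :: real)" if "i < k" for i
      using \<tau>[of i] \<tau>[of "Suc i"] that by (auto simp: indicator_def)
    then show ?thesis
      unfolding elementary_process_def sum_distrib_left sum_distrib_right
      by (intro sum.cong) (auto simp: mult.left_commute mult.assoc)
  qed
  have i\<phi>f: "integrable lborel (\<lambda>s. ?I s * (?\<phi> s * f s \<omega>))"
    unfolding \<phi>f using cell(1) by (intro Bochner_Integration.integrable_sum) auto
  have "(LINT s|lborel. ?I s * (?\<phi> s * f s \<omega>)) =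
    (\<Sum>i<k. LINT s|lborel. \<xi> i \<omega> * (indicator {\<tau> i<..\<tau> (Suc i)} s * f s \<omega>))"
    unfolding \<phi>f using cell(1) by (intro Bochner_Integration.integral_sum) auto
  also have "\<dots> = 0"
    using cell(2) by (intro sum.neutral) auto
  finally have i\<phi>f0: "(LINT s|lborel. ?I s * (?\<phi> s * f s \<omega>)) = 0" .
  have nn: "(\<integral>\<^sup>+s. ennreal ((g s)\<^sup>2) * indicator {0..T} s \<partial>lborel) = (\<integral>\<^sup>+s. ennreal (?I s * (g s)\<^sup>2) \<partial>lborel)" for g
    by (intro nn_integral_cong) (auto simp: indicator_def)
  have sq: "integrable lborel (\<lambda>s. ?I s * (g s)\<^sup>2)"
    if "g \<in> borel_measurable borel" "(\<integral>\<^sup>+s. ennreal ((g s)\<^sup>2) * indicator {0..T} s \<partial>lborel) < \<infinity>" for g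
  proof (rule integrableI_bounded)
    show "(\<lambda>s. ?I s * (g s)\<^sup>2) \<in> borel_measurable lborel"
      using that(1) by (intro borel_measurable_times borel_measurable_indicator borel_measurable_power) auto
    show "(\<integral>\<^sup>+s. ennreal (norm (?I s * (g s)\<^sup>2)) \<partial>lborel) < \<infinity>"
      using that(2) unfolding nn by (simp add: abs_mult)
  qed
  have if2: "integrable lborel (\<lambda>s. ?I s * (f s \<omega>)\<^sup>2)" using sq[OF sec fin] .
  have i\<phi>2: "integrable lborel (\<lambda>s. ?I s * (?\<phi> s)\<^sup>2)"
    using elementary_process_energy[OF el, of \<omega>] by (intro sq[OF \<phi>sec]) simp
  have expand: "?I s * (?\<phi> s - f s \<omega>)\<^sup>2 = ?I s * (?\<phi> s)\<^sup>2 - 2 * (?I s * (?\<phi> s * f s \<omega>)) + ?I s * (f s \<omega>)\<^sup>2" for s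
    by (simp add: power2_eq_square algebra_simps)
  have id: "integrable lborel (\<lambda>s. ?I s * (?\<phi> s - f s \<omega>)\<^sup>2)"
    unfolding expand using if2 i\<phi>2 i\<phi>f i\<phi>f0 by simp
  note i2 = integrable_mult_right[OF i\<phi>f, of 2]
  have nonneg: "0 \<le> (LINT s|lborel. ?I s * (?\<phi> s)\<^sup>2)"
    by (rule integral_nonneg_AE) simp
  have "(LINT s|lborel. 2 * (?I s * (?\<phi> s * f s \<omega>))) = 0"
    by (simp only: integral_mult_right_zero i\<phi>f0 mult_zero_right)
  then have "(LINT s|lborel. ?I s * (?\<phi> s - f s \<omega>)\<^sup>2) =
    (LINT s|lborel. ?I s * (?\<phi> s)\<^sup>2) + (LINT s|lborel. ?I s * (f s \<omega>)\<^sup>2)"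
    by (simp only: expand Bochner_Integration.integral_add[OF Bochner_Integration.integrable_diff[OF i\<phi>2 i2] if2]
        Bochner_Integration.integral_diff[OF i\<phi>2 i2] diff_zero)
  then have "(LINT s|lborel. ?I s * (f s \<omega>)\<^sup>2) \<le> (LINT s|lborel. ?I s * (?\<phi> s - f s \<omega>)\<^sup>2)"
    using nonneg by linarith
  then show ?thesis
    unfolding nn using nn_integral_eq_integral[OF if2] nn_integral_eq_integral[OF id]
    by (simp add: ennreal_leI)
qed

text \<open>The null set on which \<open>time_integral a t\<close> fails to vanish may depend on
  \<open>t\<close>. An elementary approximation has finitely many nodes, so one null set suffices
  for it, and the energy of \<open>a\<close> is at most the approximation error.\<close>

lemma energy_drift_zero:
  assumes a: "L2_process T a" and T: "0 < T"
    and eq: "\<And>t. 0 \<le> t \<Longrightarrow> t \<le> T \<Longrightarrow> AE \<omega> in P. time_integral a t \<omega> = 0"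
  shows "energy {0..T} a = 0"
proof -
  note D = L2_processD[OF a]
  \<comment> \<open>The summand 0 gives the inequality the shape that
    \<open>ennreal_le_epsilon\<close> expects.\<close>
  have "energy {0..T} a \<le> 0 + ennreal e" if e: "0 < e" for e
  proof -
    obtain k \<tau> \<xi> where el: "elementary P W T k \<tau> \<xi>"
      and le: "energy {0..T} (\<lambda>s \<omega>. elementary_process k \<tau> \<xi> s \<omega> - a s \<omega>) \<le> ennreal e"
      using elementary_dense[OF a T e] by blast
    have "AE \<omega> in P. i \<le> k \<longrightarrow> time_integral a (\<tau> i) \<omega> = 0" for i
      using eq[of "\<tau> i"] el unfolding elementary_def by (cases "i \<le> k") auto
    then have zero: "AE \<omega> in P. \<forall>i. i \<le> k \<longrightarrow> time_integral a (\<tau> i) \<omega> = 0"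
      by (simp add: AE_all_countable)
    have fin: "AE \<omega> in P. (\<integral>\<^sup>+s. ennreal ((a s \<omega>)\<^sup>2) * indicator {0..T} s \<partial>lborel) \<noteq> \<infinity>"
      using D(3) borel_measurable_path_energy[OF D(1), of "{0..T}"]
      by (intro nn_integral_PInf_AE) (auto simp: energy_def)
    have "energy {0..T} a \<le> energy {0..T} (\<lambda>s \<omega>. elementary_process k \<tau> \<xi> s \<omega> - a s \<omega>)"
      unfolding energy_def
    proof (rule nn_integral_mono_AE)
      show "AE \<omega> in P. (\<integral>\<^sup>+s. ennreal ((a s \<omega>)\<^sup>2) * indicator {0..T} s \<partial>lborel) \<le>
        (\<integral>\<^sup>+s. ennreal ((elementary_process k \<tau> \<xi> s \<omega> - a s \<omega>)\<^sup>2) * indicator {0..T} s \<partial>lborel)"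
        using zero fin L2_process_path_integrable[OF a] AE_space
      proof eventually_elim
        case (elim \<omega>)
        then show ?case
          using measurable_process_section[OF D(1) elim(4)]
          by (intro elementary_process_orthogonal_path[OF el]) (auto simp: less_top)
      qed
    qed
    with le show ?thesis by simp
  qed
  then have "energy {0..T} a \<le> 0" by (rule ennreal_le_epsilon)
  then show ?thesis by simp
qed

text \<open>The hypothesis is for almost every time only, since that is how vanishing left-hand
  sides are known inside a Jordan block. Mean-square continuity extends it to every time; then the
  diffusion vanishes, and the drift alone remains.\<close>

lemma drift_diffusion_zero:
  assumes a: "L2_process T a" and b: "L2_process T b" and T: "0 < T"
    and eq: "AE t in lborel. t \<in> {0..T} \<longrightarrow> (AE \<omega> in P. time_integral a t \<omega> + ito_integral P W b t \<omega> = 0)"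
  shows "energy {0..T} a = 0" "energy {0..T} b = 0"
proof -
  note Da = L2_processD[OF a] and Db = L2_processD[OF b]
  define R where "R = (\<lambda>t \<omega>. time_integral a t \<omega> + ito_integral P W b t \<omega>)"
  have Rm: "R t \<in> borel_measurable P" if "0 \<le> t" "t \<le> T" for t
    unfolding R_def using time_integral_measurable[OF a that] ito_integral_measurable[OF b that T] by measurable
  have inc: "moment2 (\<lambda>\<omega>. R t \<omega> - R s \<omega>) \<le> 2 * (ennreal T * energy {s<..t} a) + 2 * (4 * energy {s<..t} b)"
    if st: "0 \<le> s" "s \<le> t" "t \<le> T" for s t
  proof -
    let ?A = "\<lambda>\<omega>. time_integral a t \<omega> - time_integral a s \<omega>"
    let ?M = "\<lambda>\<omega>. ito_integral P W b t \<omega> - ito_integral P W b s \<omega>"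
    have "moment2 (\<lambda>\<omega>. R t \<omega> - R s \<omega>) = moment2 (\<lambda>\<omega>. ?A \<omega> + ?M \<omega>)"
      unfolding R_def by (simp add: algebra_simps)
    also have "\<dots> \<le> 2 * moment2 ?A + 2 * moment2 ?M"
      using st T by (intro moment2_add borel_measurable_diff time_integral_measurable[OF a] ito_integral_measurable[OF b]) auto
    also have "\<dots> \<le> 2 * (ennreal T * energy {s<..t} a) + 2 * (4 * energy {s<..t} b)"
    proof (intro add_mono mult_left_mono)
      have "moment2 ?A \<le> ennreal (t - s) * energy {s<..t} a"
        using st by (intro time_integral_increment_moment2[OF a])
      also have "\<dots> \<le> ennreal T * energy {s<..t} a"
        using st by (intro mult_right_mono ennreal_leI) auto
      finally show "moment2 ?A \<le> ennreal T * energy {s<..t} a" .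
      show "moment2 ?M \<le> 4 * energy {s<..t} b"
        using ito_integral_increment_bounds(1)[OF b st T] .
    qed auto
    finally show ?thesis .
  qed
  have R0: "AE \<omega> in P. R t \<omega> = 0" if t: "0 \<le> t" "t \<le> T" for t
  \<comment> \<open>At time 0 there is no room to approach from the left, but there both integrals
    are over a null interval.\<close>
  proof (cases "t = 0")
    case True
    have "moment2 (ito_integral P W b 0) \<le> 4 * energy {0..0} b"
      using T by (intro has_ito_integral_bounds(1) Db(1) has_ito_integral_ito_integral[OF b]) auto
    also have "energy {0..0} b = 0"
      unfolding energy_Icc_eq_Ioc[OF Db(1)] by (simp add: energy_def)
    finally have "AE \<omega> in P. ito_integral P W b 0 \<omega> = 0"
      using moment2_eq_0_iff[OF ito_integral_measurable[OF b _ _ T, of 0]] T by simp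
    then show ?thesis unfolding True R_def by (simp add: time_integral_0)
  next
    case False
    \<comment> \<open>Good times are chosen to the left of \<open>t\<close>, at distance less than
      \<open>1 / real (Suc n)\<close> and without leaving \<open>{0..T}\<close>.\<close>
    have "\<exists>s. max 0 (t - 1 / real (Suc n)) < s \<and> s < t \<and> (AE \<omega> in P. R s \<omega> = 0)" for n
    proof -
      obtain s where "max 0 (t - 1 / real (Suc n)) < s" "s < t"
        "s \<in> {0..T} \<longrightarrow> (AE \<omega> in P. time_integral a s \<omega> + ito_integral P W b s \<omega> = 0)"
        using AE_lborel_interval_witness[OF eq, of "max 0 (t - 1 / real (Suc n))" t] t False by auto
      then show ?thesis using t unfolding R_def by auto
    qed
    then obtain s where s: "\<And>n. max 0 (t - 1 / real (Suc n)) < s n" "\<And>n. s n < t"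
      "\<And>n. AE \<omega> in P. R (s n) \<omega> = 0" by metis
    have lo: "t - 1 / real (Suc n) \<le> s n" "0 \<le> s n" and hi: "s n \<le> t" for n
      using s(1)[of n] s(2)[of n] by (simp_all only: max_less_iff_conj less_imp_le)
    have "(\<lambda>n. t - 1 / real (Suc n)) \<longlonglongrightarrow> t - 0"
      by (intro tendsto_diff tendsto_const LIMSEQ_Suc[OF lim_const_over_n])
    then have "(\<lambda>n. t - 1 / real (Suc n)) \<longlonglongrightarrow> t" by simp
    then have st: "s \<longlonglongrightarrow> t"
      by (rule real_tendsto_sandwich[OF _ _ _ tendsto_const, rotated 2]) (simp_all only: lo hi eventually_True)
    have lim: "(\<lambda>n. energy {s n<..t} f) \<longlonglongrightarrow> 0" if "measurable_process f" "energy {0..T} f < \<infinity>" for f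
      using energy_Ioc_tendsto_0[OF that t(2) lo(2) st] .
    have "moment2 (R t) \<le> 2 * (ennreal T * energy {s n<..t} a) + 2 * (4 * energy {s n<..t} b)" for n
    proof -
      have "moment2 (R t) = moment2 (\<lambda>\<omega>. R t \<omega> - R (s n) \<omega>)"
        using s(3)[of n] by (intro moment2_cong_AE) (auto elim: eventually_mono)
      also have "\<dots> \<le> 2 * (ennreal T * energy {s n<..t} a) + 2 * (4 * energy {s n<..t} b)"
        by (rule inc[OF lo(2) hi t(2)])
      finally show ?thesis .
    qed
    moreover have "(\<lambda>n. 2 * (ennreal T * energy {s n<..t} a) + 2 * (4 * energy {s n<..t} b)) \<longlonglongrightarrow> 2 * (ennreal T * 0) + 2 * (4 * 0)"
      by (intro tendsto_add ennreal_tendsto_cmult lim Da Db) simp_all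
    ultimately have "moment2 (R t) \<le> 2 * (ennreal T * 0) + 2 * (4 * 0)"
      by (intro LIMSEQ_le_const[of _ _ "moment2 (R t)"]) auto
    then show ?thesis using moment2_eq_0_iff[OF Rm[OF t]] by simp
  qed
  show b0: "energy {0..T} b = 0"
    using R0 unfolding R_def by (intro energy_diffusion_zero[OF a b T])
  show "energy {0..T} a = 0"
  proof (rule energy_drift_zero[OF a T])
    fix t assume t: "0 \<le> t" "t \<le> T"
    have "moment2 (ito_integral P W b t) \<le> 4 * energy {0..t} b"
      using t T by (intro has_ito_integral_bounds(1) Db(1) has_ito_integral_ito_integral[OF b]) auto
    also have "\<dots> \<le> 4 * energy {0..T} b"
      using t by (intro mult_left_mono energy_mono_set) auto
    finally have "AE \<omega> in P. ito_integral P W b t \<omega> = 0"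
      using moment2_eq_0_iff[OF ito_integral_measurable[OF b t T]] b0 by simp
    then show "AE \<omega> in P. time_integral a t \<omega> = 0"
      using R0[OF t] unfolding R_def by eventually_elim simp
  qed
qed

section \<open>Linear stochastic differential equations\<close>

definition total_moment2 :: "nat \<Rightarrow> (nat \<Rightarrow> 'w \<Rightarrow> real) \<Rightarrow> ennreal" where
  "total_moment2 h Y = (\<Sum>i<h. moment2 (Y i))"

lemma moment2_linear_combination:
  assumes Y: "\<And>j. j < h \<Longrightarrow> Y j \<in> borel_measurable P"
  shows "moment2 (\<lambda>\<omega>. \<Sum>j<h. \<alpha> j * Y j \<omega>) \<le> ennreal (\<Sum>j<h. (\<alpha> j)\<^sup>2) * (\<Sum>j<h. moment2 (Y j))"
proof -
  have "moment2 (\<lambda>\<omega>. \<Sum>j<h. \<alpha> j * Y j \<omega>) \<le> (\<integral>\<^sup>+\<omega>. ennreal (\<Sum>j<h. (\<alpha> j)\<^sup>2) * (\<Sum>j<h. ennreal ((Y j \<omega>)\<^sup>2)) \<partial>P)"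
    unfolding moment2_def
  proof (intro nn_integral_mono)
    fix \<omega>
    have "ennreal ((\<Sum>j<h. \<alpha> j * Y j \<omega>)\<^sup>2) \<le> ennreal ((\<Sum>j<h. (\<alpha> j)\<^sup>2) * (\<Sum>j<h. (Y j \<omega>)\<^sup>2))"
      by (intro ennreal_leI Cauchy_Schwarz_ineq_sum)
    also have "\<dots> = ennreal (\<Sum>j<h. (\<alpha> j)\<^sup>2) * (\<Sum>j<h. ennreal ((Y j \<omega>)\<^sup>2))"
      by (simp add: ennreal_mult sum_nonneg sum_ennreal)
    finally show "ennreal ((\<Sum>j<h. \<alpha> j * Y j \<omega>)\<^sup>2) \<le> ennreal (\<Sum>j<h. (\<alpha> j)\<^sup>2) * (\<Sum>j<h. ennreal ((Y j \<omega>)\<^sup>2))" .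
  qed
  also have "\<dots> = ennreal (\<Sum>j<h. (\<alpha> j)\<^sup>2) * (\<Sum>j<h. moment2 (Y j))"
  proof -
    have m: "(\<lambda>\<omega>. ennreal ((Y j \<omega>)\<^sup>2)) \<in> borel_measurable P" if "j < h" for j
      using Y[OF that] by measurable
    then have 1: "(\<lambda>\<omega>. \<Sum>j<h. ennreal ((Y j \<omega>)\<^sup>2)) \<in> borel_measurable P"
      by (intro borel_measurable_sum) auto
    have 2: "(\<integral>\<^sup>+\<omega>. (\<Sum>j<h. ennreal ((Y j \<omega>)\<^sup>2)) \<partial>P) = (\<Sum>j<h. \<integral>\<^sup>+\<omega>. ennreal ((Y j \<omega>)\<^sup>2) \<partial>P)"
      using m by (intro nn_integral_sum) auto
    show ?thesis
      unfolding moment2_def nn_integral_cmult[OF 1] 2 ..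
  qed
  finally show ?thesis .
qed

lemma energy_linear_combination:
  assumes f: "\<And>j. j < h \<Longrightarrow> measurable_process (f j)" and S: "S \<in> sets borel"
  shows "energy S (\<lambda>s \<omega>. \<Sum>j<h. \<alpha> j * f j s \<omega>) \<le>
    ennreal (\<Sum>j<h. (\<alpha> j)\<^sup>2) * (\<integral>\<^sup>+s. total_moment2 h (\<lambda>j. f j s) * indicator S s \<partial>lborel)"
proof -
  have sec: "f j s \<in> borel_measurable P" if "j < h" for j s
    using measurable_process_compose[OF f[OF that], of "\<lambda>_. s" P "\<lambda>\<omega>. \<omega>"] by simp
  have m: "(\<lambda>s. total_moment2 h (\<lambda>j. f j s)) \<in> borel_measurable borel"
    unfolding total_moment2_def using f by (intro borel_measurable_sum borel_measurable_moment2) auto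
  have pm: "measurable_process (\<lambda>s \<omega>. \<Sum>j<h. \<alpha> j * f j s \<omega>)"
    unfolding measurable_process_def case_prod_beta'
    using f[THEN measurable_process_pair] by (intro borel_measurable_sum borel_measurable_times) auto
  have "energy S (\<lambda>s \<omega>. \<Sum>j<h. \<alpha> j * f j s \<omega>) \<le>
    (\<integral>\<^sup>+s. ennreal (\<Sum>j<h. (\<alpha> j)\<^sup>2) * (total_moment2 h (\<lambda>j. f j s) * indicator S s) \<partial>lborel)"
    unfolding energy_swap[OF pm S] total_moment2_def mult.assoc[symmetric]
    using sec by (intro nn_integral_mono mult_right_mono moment2_linear_combination) auto
  also have "\<dots> = ennreal (\<Sum>j<h. (\<alpha> j)\<^sup>2) * (\<integral>\<^sup>+s. total_moment2 h (\<lambda>j. f j s) * indicator S s \<partial>lborel)"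
    using m S by (intro nn_integral_cmult borel_measurable_times_ennreal borel_measurable_indicator) auto
  finally show ?thesis .
qed

text \<open>\<open>ito_integral\<close> chooses separately at each time, so nothing ensures that it
  is measurable in time. One choice of the whole process is needed for the Picard iterates to be
  processes again.\<close>

definition ito_version :: "real \<Rightarrow> (real \<Rightarrow> 'w \<Rightarrow> real) \<Rightarrow> real \<Rightarrow> 'w \<Rightarrow> real" where
  "ito_version T f = (SOME J. measurable_process J \<and>
     (\<forall>t\<in>{0..T}. J t \<in> borel_measurable (F t) \<and> has_ito_integral P W f t (J t)))"

lemma ito_version:
  assumes f: "L2_process T f" and T: "0 < T"
  shows "measurable_process (ito_version T f)"
    "\<And>t. 0 \<le> t \<Longrightarrow> t \<le> T \<Longrightarrow> ito_version T f t \<in> borel_measurable (F t)"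
    "\<And>t. 0 \<le> t \<Longrightarrow> t \<le> T \<Longrightarrow> has_ito_integral P W f t (ito_version T f t)"
    "\<And>t. 0 \<le> t \<Longrightarrow> t \<le> T \<Longrightarrow> AE \<omega> in P. ito_version T f t \<omega> = ito_integral P W f t \<omega>"
proof -
  have "\<exists>J. measurable_process J \<and>
     (\<forall>t\<in>{0..T}. J t \<in> borel_measurable (F t) \<and> has_ito_integral P W f t (J t))"
    using ito_integral_process_exists[OF f T] by (metis atLeastAtMost_iff)
  from someI_ex[OF this] have J: "measurable_process (ito_version T f) \<and>
     (\<forall>t\<in>{0..T}. ito_version T f t \<in> borel_measurable (F t) \<and> has_ito_integral P W f t (ito_version T f t))"
    unfolding ito_version_def .
  then show "measurable_process (ito_version T f)"
    "\<And>t. 0 \<le> t \<Longrightarrow> t \<le> T \<Longrightarrow> ito_version T f t \<in> borel_measurable (F t)"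
    and h: "\<And>t. 0 \<le> t \<Longrightarrow> t \<le> T \<Longrightarrow> has_ito_integral P W f t (ito_version T f t)"
    by auto
  show "AE \<omega> in P. ito_version T f t \<omega> = ito_integral P W f t \<omega>" if "0 \<le> t" "t \<le> T" for t
    using L2_processD(1)[OF f] h[OF that] has_ito_integral_ito_integral[OF f that T]
    by (rule has_ito_integral_unique)
qed

lemma time_integral_moment2:
  assumes "L2_process T f" "0 \<le> t" "t \<le> T"
  shows "moment2 (time_integral f t) \<le> ennreal T * energy {0..t} f"
proof -
  have "moment2 (time_integral f t) = moment2 (\<lambda>\<omega>. time_integral f t \<omega> - time_integral f 0 \<omega>)"
    by (simp add: time_integral_0)
  also have "\<dots> \<le> ennreal (t - 0) * energy {0<..t} f"
    using assms by (intro time_integral_increment_moment2[OF assms(1)]) auto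
  also have "\<dots> \<le> ennreal T * energy {0..t} f"
    using assms by (intro mult_mono ennreal_leI energy_mono_set) auto
  finally show ?thesis .
qed

lemma time_integral_diff:
  assumes f: "L2_process T f" and g: "L2_process T g" and t: "t \<le> T"
  shows "AE \<omega> in P. time_integral (\<lambda>s \<omega>. f s \<omega> - g s \<omega>) t \<omega> = time_integral f t \<omega> - time_integral g t \<omega>"
  using L2_process_path_integrable[OF f] L2_process_path_integrable[OF g] AE_space
proof eventually_elim
  case (elim \<omega>)
  have "integrable lborel (\<lambda>s. indicator {0..t} s * k s \<omega>)"
    if "measurable_process k" "integrable lborel (\<lambda>s. indicator {0..T} s * k s \<omega>)" for k
  proof (rule Bochner_Integration.integrable_bound[OF that(2)])
    show "(\<lambda>s. indicator {0..t} s * k s \<omega>) \<in> borel_measurable lborel"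
      using measurable_process_section[OF that(1) elim(3)]
      by (intro borel_measurable_times borel_measurable_indicator) auto
    show "AE s in lborel. norm (indicator {0..t} s * k s \<omega>) \<le> norm (indicator {0..T} s * k s \<omega>)"
      using t by (intro AE_I2) (auto simp: indicator_def)
  qed
  then show ?case
    using elim L2_processD(1)[OF f] L2_processD(1)[OF g]
    by (simp add: time_integral_def right_diff_distrib)
qed

end

text \<open>The SDE \<open>dX\<^sub>i = (\<Sum>\<^sub>j a\<^sub>i\<^sub>j X\<^sub>j + f\<^sub>i) dt + (\<Sum>\<^sub>j c\<^sub>i\<^sub>j X\<^sub>j + g\<^sub>i) dW\<close> is the fixed point equation of
  the Picard operator \<open>\<Phi>\<close>.\<close>

locale linear_sde = brownian P W for P :: "'w measure" and W +
  fixes T :: real and h :: nat and a c :: "nat \<Rightarrow> nat \<Rightarrow> real"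
    and f g :: "nat \<Rightarrow> real \<Rightarrow> 'w \<Rightarrow> real" and x0 :: "nat \<Rightarrow> real"
  assumes T_pos: "0 < T"
    and f_L2: "\<And>i. i < h \<Longrightarrow> L2_process T (f i)" and g_L2: "\<And>i. i < h \<Longrightarrow> L2_process T (g i)"
begin

section \<open>Picard iteration\<close>

definition drift :: "(nat \<Rightarrow> real \<Rightarrow> 'w \<Rightarrow> real) \<Rightarrow> nat \<Rightarrow> real \<Rightarrow> 'w \<Rightarrow> real" where
  "drift X i s \<omega> = (\<Sum>j<h. a i j * X j s \<omega>) + f i s \<omega>"

definition diffusion :: "(nat \<Rightarrow> real \<Rightarrow> 'w \<Rightarrow> real) \<Rightarrow> nat \<Rightarrow> real \<Rightarrow> 'w \<Rightarrow> real" where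
  "diffusion X i s \<omega> = (\<Sum>j<h. c i j * X j s \<omega>) + g i s \<omega>"

definition \<Phi> :: "(nat \<Rightarrow> real \<Rightarrow> 'w \<Rightarrow> real) \<Rightarrow> nat \<Rightarrow> real \<Rightarrow> 'w \<Rightarrow> real" where
  "\<Phi> X i t \<omega> = x0 i + time_integral (drift X i) t \<omega> + ito_version T (diffusion X i) t \<omega>"

abbreviation L2_family :: "(nat \<Rightarrow> real \<Rightarrow> 'w \<Rightarrow> real) \<Rightarrow> bool" where
  "L2_family X \<equiv> \<forall>i<h. L2_process T (X i)"

abbreviation dist2 :: "(nat \<Rightarrow> real \<Rightarrow> 'w \<Rightarrow> real) \<Rightarrow> (nat \<Rightarrow> real \<Rightarrow> 'w \<Rightarrow> real) \<Rightarrow> real \<Rightarrow> ennreal" where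
  "dist2 X Y t \<equiv> total_moment2 h (\<lambda>i \<omega>. X i t \<omega> - Y i t \<omega>)"

text \<open>Each row collects \<open>T\<close> from the time integral and 4 from the Ito bound, both
  doubled by \<open>moment2_add\<close>, times the squared length of the coefficient row from
  Cauchy-Schwarz.\<close>

definition Lip :: real where
  "Lip = (\<Sum>i<h. 2 * T * (\<Sum>j<h. (a i j)\<^sup>2) + 8 * (\<Sum>j<h. (c i j)\<^sup>2))"

lemma Lip_nonneg: "0 \<le> Lip"
  unfolding Lip_def using T_pos by (intro sum_nonneg add_nonneg_nonneg mult_nonneg_nonneg) auto

lemma drift_L2: "L2_family X \<Longrightarrow> i < h \<Longrightarrow> L2_process T (drift X i)"
  unfolding drift_def[abs_def] by (intro L2_process_add L2_process_sum L2_process_cmult f_L2) auto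

lemma diffusion_L2: "L2_family X \<Longrightarrow> i < h \<Longrightarrow> L2_process T (diffusion X i)"
  unfolding diffusion_def[abs_def] by (intro L2_process_add L2_process_sum L2_process_cmult g_L2) auto

lemma \<Phi>_measurable:
  assumes X: "L2_family X" and i: "i < h"
  shows "measurable_process (\<Phi> X i)" "\<And>t. 0 \<le> t \<Longrightarrow> t \<le> T \<Longrightarrow> \<Phi> X i t \<in> borel_measurable (F t)"
proof -
  note d = drift_L2[OF X i] and s = diffusion_L2[OF X i]
  show "measurable_process (\<Phi> X i)"
    unfolding \<Phi>_def[abs_def]
    by (intro measurable_process_add measurable_process_const measurable_process_time_integral
        L2_processD(1)[OF d] ito_version(1)[OF s T_pos])
  show "\<Phi> X i t \<in> borel_measurable (F t)" if "0 \<le> t" "t \<le> T" for t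
    unfolding \<Phi>_def[abs_def]
    by (intro borel_measurable_add borel_measurable_const time_integral_F_measurable[OF d that]
        ito_version(2)[OF s T_pos that])
qed

text \<open>The bound does not involve \<open>t\<close>; it makes the energy of the image finite and
  bounds the first Picard step.\<close>

lemma \<Phi>_moment2:
  assumes X: "L2_family X" and i: "i < h" and t: "0 \<le> t" "t \<le> T"
  shows "moment2 (\<Phi> X i t) \<le>
    2 * ennreal ((x0 i)\<^sup>2) + 2 * (2 * (ennreal T * energy {0..T} (drift X i)) + 2 * (4 * energy {0..T} (diffusion X i)))"
proof -
  note d = drift_L2[OF X i] and s = diffusion_L2[OF X i]
  have dm: "time_integral (drift X i) t \<in> borel_measurable P" by (rule time_integral_measurable[OF d t])
  have sm: "ito_version T (diffusion X i) t \<in> borel_measurable P"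
    using ito_version(2)[OF s T_pos t] by (rule F_measurable_imp)
  have "moment2 (\<Phi> X i t) = moment2 (\<lambda>\<omega>. x0 i + (time_integral (drift X i) t \<omega> + ito_version T (diffusion X i) t \<omega>))"
    unfolding \<Phi>_def by (simp add: add.assoc)
  also have "\<dots> \<le> 2 * moment2 (\<lambda>\<omega>. x0 i) + 2 * moment2 (\<lambda>\<omega>. time_integral (drift X i) t \<omega> + ito_version T (diffusion X i) t \<omega>)"
    using dm sm by (intro moment2_add) auto
  also have "moment2 (\<lambda>\<omega>. x0 i) = ennreal ((x0 i)\<^sup>2)"
    unfolding moment2_def by (simp add: emeasure_space_1)
  also have "2 * ennreal ((x0 i)\<^sup>2) + 2 * moment2 (\<lambda>\<omega>. time_integral (drift X i) t \<omega> + ito_version T (diffusion X i) t \<omega>)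
    \<le> 2 * ennreal ((x0 i)\<^sup>2) + 2 * (2 * (ennreal T * energy {0..T} (drift X i)) + 2 * (4 * energy {0..T} (diffusion X i)))"
  proof (intro add_left_mono mult_left_mono)
    have "moment2 (time_integral (drift X i) t) \<le> ennreal T * energy {0..t} (drift X i)"
      using t by (rule time_integral_moment2[OF d])
    also have "\<dots> \<le> ennreal T * energy {0..T} (drift X i)"
      using t by (intro mult_left_mono energy_mono_set) auto
    finally have 1: "moment2 (time_integral (drift X i) t) \<le> ennreal T * energy {0..T} (drift X i)" .
    have "moment2 (ito_version T (diffusion X i) t) \<le> 4 * energy {0..t} (diffusion X i)"
      by (intro has_ito_integral_bounds(1) L2_processD(1)[OF s] ito_version(3)[OF s T_pos t])
    also have "\<dots> \<le> 4 * energy {0..T} (diffusion X i)"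
      using t by (intro mult_left_mono energy_mono_set) auto
    finally have 2: "moment2 (ito_version T (diffusion X i) t) \<le> 4 * energy {0..T} (diffusion X i)" .
    show "moment2 (\<lambda>\<omega>. time_integral (drift X i) t \<omega> + ito_version T (diffusion X i) t \<omega>) \<le>
      2 * (ennreal T * energy {0..T} (drift X i)) + 2 * (4 * energy {0..T} (diffusion X i))"
      using moment2_add[OF dm sm] by (rule order_trans) (intro add_mono mult_left_mono 1 2; simp)
  qed simp
  finally show ?thesis .
qed

lemma L2_processI_moment2:
  assumes "measurable_process X" "\<And>t. 0 \<le> t \<Longrightarrow> t \<le> T \<Longrightarrow> X t \<in> borel_measurable (F t)"
    and "\<And>t. 0 \<le> t \<Longrightarrow> t \<le> T \<Longrightarrow> moment2 (X t) \<le> b" and "b < \<infinity>"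
  shows "L2_process T X"
proof -
  have "energy {0..T} X \<le> (\<integral>\<^sup>+t. b * indicator {0..T} t \<partial>lborel)"
    unfolding energy_swap[OF assms(1) atLeastAtMost_borel]
    using assms(3) by (intro nn_integral_mono) (auto simp: indicator_def)
  also have "\<dots> = b * ennreal T"
    using T_pos by (simp add: nn_integral_cmult_indicator)
  also have "\<dots> < \<infinity>" using assms(4) by (simp add: ennreal_mult_less_top)
  finally show ?thesis using assms(1,2) unfolding L2_process_def by auto
qed

lemma \<Phi>_L2:
  assumes X: "L2_family X"
  shows "L2_family (\<Phi> X)"
proof (intro allI impI)
  fix i assume i: "i < h"
  show "L2_process T (\<Phi> X i)"
  proof (rule L2_processI_moment2[OF \<Phi>_measurable[OF X i] \<Phi>_moment2[OF X i]])
    show "2 * ennreal ((x0 i)\<^sup>2) + 2 * (2 * (ennreal T * energy {0..T} (drift X i)) + 2 * (4 * energy {0..T} (diffusion X i))) < \<infinity>"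
      using L2_processD(3)[OF drift_L2[OF X i]] L2_processD(3)[OF diffusion_L2[OF X i]]
      by (simp add: ennreal_mult_less_top)
  qed
qed

text \<open>Only times up to \<open>t\<close> enter on the right. This Volterra structure lets the
  iteration converge for every horizon \<open>T\<close>, however large the coefficients are.\<close>

lemma \<Phi>_Lipschitz:
  assumes X: "L2_family X" and Y: "L2_family Y" and t: "0 \<le> t" "t \<le> T"
  shows "dist2 (\<Phi> X) (\<Phi> Y) t \<le> ennreal Lip * (\<integral>\<^sup>+s. dist2 X Y s * indicator {0..t} s \<partial>lborel)"
proof -
  define S where "S = (\<integral>\<^sup>+s. dist2 X Y s * indicator {0..t} s \<partial>lborel)"
  have dp: "measurable_process (\<lambda>s \<omega>. X j s \<omega> - Y j s \<omega>)" if "j < h" for j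
    using X Y that by (intro measurable_process_diff L2_processD(1)) auto
  have one: "moment2 (\<lambda>\<omega>. \<Phi> X i t \<omega> - \<Phi> Y i t \<omega>) \<le>
      ennreal (2 * T * (\<Sum>j<h. (a i j)\<^sup>2) + 8 * (\<Sum>j<h. (c i j)\<^sup>2)) * S" if i: "i < h" for i
  proof -
    note dX = drift_L2[OF X i] and dY = drift_L2[OF Y i]
    note sX = diffusion_L2[OF X i] and sY = diffusion_L2[OF Y i]
    let ?d = "\<lambda>s \<omega>. drift X i s \<omega> - drift Y i s \<omega>"
    let ?s = "\<lambda>s \<omega>. 1 * diffusion X i s \<omega> + - 1 * diffusion Y i s \<omega>"
    let ?J = "\<lambda>\<omega>. 1 * ito_version T (diffusion X i) t \<omega> + - 1 * ito_version T (diffusion Y i) t \<omega>"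
    have d: "L2_process T ?d" by (rule L2_process_diff[OF dX dY])
    have sm: "measurable_process ?s"
      by (intro measurable_process_add measurable_process_cmult L2_processD(1)[OF sX] L2_processD(1)[OF sY])
    have J: "has_ito_integral P W ?s t ?J"
      by (intro has_ito_integral_linear L2_processD(1)[OF sX] L2_processD(1)[OF sY]
          ito_version(3)[OF sX T_pos t] ito_version(3)[OF sY T_pos t])
    have "energy {0..t} ?d = energy {0..t} (\<lambda>s \<omega>. \<Sum>j<h. a i j * (X j s \<omega> - Y j s \<omega>))"
      unfolding drift_def by (simp add: right_diff_distrib sum_subtractf)
    also have "\<dots> \<le> ennreal (\<Sum>j<h. (a i j)\<^sup>2) * S"
      unfolding S_def using dp by (intro energy_linear_combination) auto
    finally have ed: "energy {0..t} ?d \<le> ennreal (\<Sum>j<h. (a i j)\<^sup>2) * S" .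
    have "energy {0..t} ?s = energy {0..t} (\<lambda>s \<omega>. \<Sum>j<h. c i j * (X j s \<omega> - Y j s \<omega>))"
      unfolding diffusion_def by (simp add: right_diff_distrib sum_subtractf)
    also have "\<dots> \<le> ennreal (\<Sum>j<h. (c i j)\<^sup>2) * S"
      unfolding S_def using dp by (intro energy_linear_combination) auto
    finally have es: "energy {0..t} ?s \<le> ennreal (\<Sum>j<h. (c i j)\<^sup>2) * S" .
    have "moment2 (\<lambda>\<omega>. \<Phi> X i t \<omega> - \<Phi> Y i t \<omega>) = moment2 (\<lambda>\<omega>. time_integral ?d t \<omega> + ?J \<omega>)"
      using time_integral_diff[OF dX dY t(2)]
      by (intro moment2_cong_AE) (auto elim!: eventually_mono simp: \<Phi>_def)
    also have "\<dots> \<le> 2 * moment2 (time_integral ?d t) + 2 * moment2 ?J"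
      by (intro moment2_add time_integral_measurable[OF d t] has_ito_integral_measurable[OF J])
    also have "\<dots> \<le> 2 * (ennreal T * (ennreal (\<Sum>j<h. (a i j)\<^sup>2) * S)) + 2 * (4 * (ennreal (\<Sum>j<h. (c i j)\<^sup>2) * S))"
    proof (intro add_mono mult_left_mono)
      show "moment2 (time_integral ?d t) \<le> ennreal T * (ennreal (\<Sum>j<h. (a i j)\<^sup>2) * S)"
        using time_integral_moment2[OF d t] by (rule order_trans) (intro mult_left_mono ed; simp)
      show "moment2 ?J \<le> 4 * (ennreal (\<Sum>j<h. (c i j)\<^sup>2) * S)"
        using has_ito_integral_bounds(1)[OF sm J] by (rule order_trans) (intro mult_left_mono es; simp)
    qed simp_all
    also have "\<dots> = (2 * ennreal T * ennreal (\<Sum>j<h. (a i j)\<^sup>2) + 8 * ennreal (\<Sum>j<h. (c i j)\<^sup>2)) * S"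
      by (simp add: distrib_right mult.assoc[symmetric])
    also have "2 * ennreal T * ennreal (\<Sum>j<h. (a i j)\<^sup>2) + 8 * ennreal (\<Sum>j<h. (c i j)\<^sup>2) =
      ennreal (2 * T * (\<Sum>j<h. (a i j)\<^sup>2) + 8 * (\<Sum>j<h. (c i j)\<^sup>2))"
      using T_pos by (simp add: ennreal_mult' sum_nonneg)
    finally show ?thesis .
  qed
  have "dist2 (\<Phi> X) (\<Phi> Y) t \<le> (\<Sum>i<h. ennreal (2 * T * (\<Sum>j<h. (a i j)\<^sup>2) + 8 * (\<Sum>j<h. (c i j)\<^sup>2)) * S)"
    unfolding total_moment2_def using one by (intro sum_mono) auto
  also have "\<dots> = ennreal Lip * S"
    unfolding sum_distrib_right[symmetric] Lip_def using T_pos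
    by (subst sum_ennreal) (auto intro!: add_nonneg_nonneg mult_nonneg_nonneg sum_nonneg)
  finally show ?thesis unfolding S_def .
qed

text \<open>The weight \<open>exp (rate * t)\<close> turns the Volterra estimate of \<open>\<Phi>_Lipschitz\<close> into a contraction.\<close>

definition rate :: real where "rate = 4 * (Lip + 1)"

lemma rate_pos: "0 < rate"
  unfolding rate_def using Lip_nonneg by simp

text \<open>Integrating the exponential gains the factor \<open>1 / rate\<close>, and
  \<open>rate\<close> is chosen to make \<open>Lip / rate\<close> at most 1/4, the ratio that
  \<open>moment2_Cauchy_limit\<close> asks for. The 1 added to \<open>Lip\<close> keeps
  \<open>rate\<close> positive when all coefficients vanish.\<close>

lemma Volterra_contraction:
  assumes d: "\<And>s. 0 \<le> s \<Longrightarrow> s \<le> T \<Longrightarrow> d s \<le> ennreal (M * exp (rate * s))" and M: "0 \<le> M" and t: "0 \<le> t" "t \<le> T"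
  shows "ennreal Lip * (\<integral>\<^sup>+s. d s * indicator {0..t} s \<partial>lborel) \<le> ennreal (M / 4 * exp (rate * t))"
proof -
  have "(\<integral>\<^sup>+s. d s * indicator {0..t} s \<partial>lborel) \<le> (\<integral>\<^sup>+s. ennreal (M * exp (rate * s)) * indicator {0..t} s \<partial>lborel)"
    using d t by (intro nn_integral_mono) (auto simp: indicator_def)
  also have "\<dots> = ennreal (M / rate * exp (rate * t) - M / rate * exp (rate * 0))"
    using t M rate_pos
    by (intro nn_integral_FTC_Icc) (auto intro!: derivative_eq_intros)
  also have "\<dots> \<le> ennreal (M / rate * exp (rate * t))"
    using M rate_pos by (intro ennreal_leI) simp
  finally have "ennreal Lip * (\<integral>\<^sup>+s. d s * indicator {0..t} s \<partial>lborel) \<le> ennreal Lip * ennreal (M / rate * exp (rate * t))"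
    by (intro mult_left_mono) auto
  also have "\<dots> = ennreal (Lip / rate * (M * exp (rate * t)))"
    using Lip_nonneg by (simp add: ennreal_mult'[symmetric] field_simps)
  also have "\<dots> \<le> ennreal (1 / 4 * (M * exp (rate * t)))"
  proof (intro ennreal_leI mult_right_mono)
    show "Lip / rate \<le> 1 / 4" using Lip_nonneg unfolding rate_def by (simp add: field_simps)
  qed (use M in simp)
  finally show ?thesis by simp
qed

definition picard :: "nat \<Rightarrow> nat \<Rightarrow> real \<Rightarrow> 'w \<Rightarrow> real" where
  "picard n = (\<Phi> ^^ n) (\<lambda>i s \<omega>. 0)"

lemma picard_Suc: "picard (Suc n) = \<Phi> (picard n)"
  unfolding picard_def by simp

lemma picard_L2: "L2_family (picard n)"
proof (induction n)
  case 0
  then show ?case by (simp add: picard_def L2_process_const)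
next
  case (Suc n)
  then show ?case unfolding picard_Suc by (rule \<Phi>_L2)
qed

lemma L2_family_moment2_measurable:
  assumes "L2_family X" "i < h" "0 \<le> t" "t \<le> T"
  shows "X i t \<in> borel_measurable P"
  using assms L2_processD(2) F_measurable_imp by blast

lemma dist2_triangle:
  assumes X: "L2_family X" and Y: "L2_family Y" and Z: "L2_family Z" and t: "0 \<le> t" "t \<le> T"
  shows "dist2 X Z t \<le> 2 * dist2 X Y t + 2 * dist2 Y Z t"
proof -
  have "moment2 (\<lambda>\<omega>. X i t \<omega> - Z i t \<omega>) \<le> 2 * moment2 (\<lambda>\<omega>. X i t \<omega> - Y i t \<omega>) + 2 * moment2 (\<lambda>\<omega>. Y i t \<omega> - Z i t \<omega>)"
    if i: "i < h" for i
  proof -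
    have "moment2 (\<lambda>\<omega>. (X i t \<omega> - Y i t \<omega>) + (Y i t \<omega> - Z i t \<omega>)) \<le>
      2 * moment2 (\<lambda>\<omega>. X i t \<omega> - Y i t \<omega>) + 2 * moment2 (\<lambda>\<omega>. Y i t \<omega> - Z i t \<omega>)"
      using L2_family_moment2_measurable[OF X i t] L2_family_moment2_measurable[OF Y i t]
        L2_family_moment2_measurable[OF Z i t] by (intro moment2_add borel_measurable_diff)
    then show ?thesis by simp
  qed
  then show ?thesis
    unfolding total_moment2_def sum_distrib_left sum.distrib[symmetric] by (intro sum_mono) auto
qed

text \<open>All iterates stay within one multiple of the exponential from the zeroth one; applying
  the contraction \<open>m\<close> times to \<open>picard k\<close> and \<open>picard 0\<close> then
  gains \<open>(1/4)^m\<close>. The bound is carried at each time, in place of a weighted supremum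
  norm.\<close>

lemma picard_bound:
  "\<exists>M\<ge>0. \<forall>m n t. m \<le> n \<and> 0 \<le> t \<and> t \<le> T \<longrightarrow> dist2 (picard n) (picard m) t \<le> ennreal (M * (1/4)^m * exp (rate * t))"
proof -
  let ?Z = "\<lambda>(i::nat) (s::real) (\<omega>::'w). 0 :: real"
  have Z: "L2_family ?Z" by (simp add: L2_process_const)
  define B where "B = (\<Sum>i<h. 2 * ennreal ((x0 i)\<^sup>2) +
    2 * (2 * (ennreal T * energy {0..T} (drift ?Z i)) + 2 * (4 * energy {0..T} (diffusion ?Z i))))"
  have "B < \<infinity>"
    unfolding B_def using L2_processD(3)[OF drift_L2[OF Z]] L2_processD(3)[OF diffusion_L2[OF Z]]
    by (auto simp: ennreal_mult_less_top less_top)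
  then obtain b where b: "0 \<le> b" "B = ennreal b" by (cases B) auto
  have p0: "picard 0 = ?Z" unfolding picard_def by simp
  have base: "dist2 (picard 1) (picard 0) t \<le> ennreal b" if t: "0 \<le> t" "t \<le> T" for t
    using \<Phi>_moment2[OF Z _ t] unfolding b(2)[symmetric] B_def total_moment2_def p0 One_nat_def picard_Suc
    by (intro sum_mono) simp
  \<comment> \<open>With this \<open>M\<close> the doubled contraction \<open>2 * (M / 4)\<close>
    and the doubled first step \<open>2 * b\<close> are each \<open>M / 2\<close>, so the bound
    reproduces itself.\<close>
  define M where "M = 4 * b"
  have M: "0 \<le> M" using b unfolding M_def by simp
  have exp_ge: "1 \<le> exp (rate * t)" if "0 \<le> t" for t using rate_pos that by simp
  have step: "dist2 (\<Phi> X) (\<Phi> Y) t \<le> ennreal (M' / 4 * exp (rate * t))"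
    if "L2_family X" "L2_family Y" "0 \<le> M'"
      "\<And>s. 0 \<le> s \<Longrightarrow> s \<le> T \<Longrightarrow> dist2 X Y s \<le> ennreal (M' * exp (rate * s))" "0 \<le> t" "t \<le> T" for X Y M' t
    using \<Phi>_Lipschitz[OF that(1,2,5,6)] Volterra_contraction[OF that(4,3,5,6)] by (rule order_trans)
  have zero: "dist2 (picard n) (picard 0) t \<le> ennreal (M * exp (rate * t))" if "0 \<le> t" "t \<le> T" for n t
    using that
  proof (induction n arbitrary: t)
    case 0
    then show ?case using M by (simp add: total_moment2_def moment2_def)
  next
    case (Suc n)
    have "dist2 (picard (Suc n)) (picard 0) t \<le> 2 * dist2 (picard (Suc n)) (picard 1) t + 2 * dist2 (picard 1) (picard 0) t"
      using Suc.prems by (intro dist2_triangle picard_L2)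
    also have "\<dots> \<le> 2 * ennreal (M / 4 * exp (rate * t)) + 2 * ennreal b"
      unfolding picard_Suc One_nat_def
      using Suc base[OF Suc.prems] M unfolding picard_Suc One_nat_def
      by (intro add_mono mult_left_mono step picard_L2) auto
    also have "\<dots> = ennreal (M / 2 * exp (rate * t) + M / 2)"
      using M b unfolding M_def
      by (simp add: ennreal_mult'[symmetric] ennreal_plus[symmetric] ennreal_numeral[symmetric] del: ennreal_plus ennreal_numeral)
    also have "\<dots> \<le> ennreal (M * exp (rate * t))"
      using M mult_left_mono[OF exp_ge[OF Suc.prems(1)], of "M / 2"] by (intro ennreal_leI) simp
    finally show ?case .
  qed
  have shift: "dist2 (picard (k + m)) (picard m) t \<le> ennreal (M * (1/4)^m * exp (rate * t))" if "0 \<le> t" "t \<le> T" for k m t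
    using that
  proof (induction m arbitrary: t)
    case 0
    then show ?case using zero by simp
  next
    case (Suc m)
    have "dist2 (\<Phi> (picard (k + m))) (\<Phi> (picard m)) t \<le> ennreal (M * (1/4)^m / 4 * exp (rate * t))"
      using Suc M by (intro step picard_L2) auto
    then show ?case by (simp add: picard_Suc)
  qed
  show ?thesis
  proof (intro exI[of _ M] conjI allI impI)
    show "0 \<le> M" by (rule M)
    fix m n :: nat and t assume "m \<le> n \<and> 0 \<le> t \<and> t \<le> T"
    then show "dist2 (picard n) (picard m) t \<le> ennreal (M * (1/4)^m * exp (rate * t))"
      using shift[of t "n - m" m] by simp
  qed
qed

lemma dist2_0_AE:
  assumes X: "L2_family X" and Y: "L2_family Y" and t: "0 \<le> t" "t \<le> T" and i: "i < h" and 0: "dist2 X Y t = 0"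
  shows "AE \<omega> in P. X i t \<omega> = Y i t \<omega>"
proof -
  have m: "(\<lambda>\<omega>. X i t \<omega> - Y i t \<omega>) \<in> borel_measurable P"
    using L2_family_moment2_measurable[OF X i t] L2_family_moment2_measurable[OF Y i t] by measurable
  have "moment2 (\<lambda>\<omega>. X i t \<omega> - Y i t \<omega>) = 0"
    using 0 i unfolding total_moment2_def by simp
  then show ?thesis using moment2_eq_0_iff[OF m] by simp
qed

text \<open>The limit is an explicit \<open>lim\<close> at each time and is close to the iterates in
  second moment. Comparing both the limit and its image under \<open>\<Phi>\<close> with
  \<open>picard (Suc m)\<close> bounds their distance by a multiple of
  \<open>(1/4)^m\<close>.\<close>

lemma fixed_point_exists:
  "\<exists>X. L2_family X \<and> (\<forall>i<h. \<forall>t. 0 \<le> t \<and> t \<le> T \<longrightarrow> (AE \<omega> in P. X i t \<omega> = \<Phi> X i t \<omega>))"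
proof -
  obtain M where M: "0 \<le> M"
    and bound: "\<And>m n t. m \<le> n \<Longrightarrow> 0 \<le> t \<Longrightarrow> t \<le> T \<Longrightarrow> dist2 (picard n) (picard m) t \<le> ennreal (M * (1/4)^m * exp (rate * t))"
    using picard_bound by blast
  define C where "C = M * exp (rate * T)"
  have C: "0 \<le> C" unfolding C_def using M by simp
  have boundC: "dist2 (picard n) (picard m) t \<le> ennreal (C * (1/4)^m)" if "m \<le> n" "0 \<le> t" "t \<le> T" for m n t
  proof -
    have "M * (1/4)^m * exp (rate * t) \<le> M * (1/4)^m * exp (rate * T)"
      using that rate_pos M by (intro mult_left_mono) auto
    then show ?thesis
      using order_trans[OF bound[OF that] ennreal_leI] unfolding C_def by (simp add: mult_ac)
  qed
  define X where "X = (\<lambda>i t \<omega>. lim (\<lambda>n. picard n i t \<omega>))"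
  have pm: "picard n i t \<in> borel_measurable P" if "i < h" "0 \<le> t" "t \<le> T" for n i t
    using L2_family_moment2_measurable[OF picard_L2 that] .
  have Xm: "moment2 (\<lambda>\<omega>. picard m i t \<omega> - X i t \<omega>) \<le> ennreal (C * (1/4)^m)"
    if i: "i < h" and t: "0 \<le> t" "t \<le> T" for m i t
    unfolding X_def
  proof (rule moment2_Cauchy_limit(2)[OF pm[OF i t] C])
    fix m n :: nat assume "m \<le> n"
    have "moment2 (\<lambda>\<omega>. picard n i t \<omega> - picard m i t \<omega>) \<le> dist2 (picard n) (picard m) t"
      unfolding total_moment2_def using i by (intro member_le_sum) auto
    also note boundC[OF \<open>m \<le> n\<close> t]
    finally show "moment2 (\<lambda>\<omega>. picard n i t \<omega> - picard m i t \<omega>) \<le> ennreal (C * (1/4)^m)" .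
  qed
  have XL2: "L2_family X"
  proof (intro allI impI)
    fix i assume i: "i < h"
    show "L2_process T (X i)"
    proof (rule L2_processI_moment2[where b="ennreal C"])
      show "measurable_process (X i)"
        unfolding measurable_process_def X_def case_prod_beta'
        using picard_L2 i by (intro borel_measurable_lim_metric measurable_process_pair L2_processD(1)) auto
      show "X i t \<in> borel_measurable (F t)" if "0 \<le> t" "t \<le> T" for t
        unfolding X_def using picard_L2 i that by (intro borel_measurable_lim_metric L2_processD(2)) auto
      show "moment2 (X i t) \<le> ennreal C" if "0 \<le> t" "t \<le> T" for t
        using Xm[OF i that, of 0] by (simp add: picard_def moment2_def)
    qed simp
  qed
  have "AE \<omega> in P. X i t \<omega> = \<Phi> X i t \<omega>" if i: "i < h" and t: "0 \<le> t" "t \<le> T" for i t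
  proof -
    have dX: "dist2 (picard m) X s \<le> ennreal (real h * C * (1/4)^m)" if "0 \<le> s" "s \<le> T" for m s
    proof -
      have "dist2 (picard m) X s \<le> (\<Sum>i<h. ennreal (C * (1/4)^m))"
        unfolding total_moment2_def using Xm that by (intro sum_mono) auto
      also have "\<dots> = ennreal (\<Sum>i<h. C * (1/4)^m)"
        using C by (intro sum_ennreal) auto
      finally show ?thesis by (simp add: mult.assoc)
    qed
    have small: "dist2 X (\<Phi> X) t \<le> ennreal ((2 * real h * C / 4 + 2 * (real h * C / 4 * exp (rate * t))) * (1/4)^m)" for m
    proof -
      have "dist2 X (\<Phi> X) t \<le> 2 * dist2 X (picard (Suc m)) t + 2 * dist2 (picard (Suc m)) (\<Phi> X) t"
        by (intro dist2_triangle XL2 picard_L2 \<Phi>_L2 t)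
      also have "dist2 X (picard (Suc m)) t = dist2 (picard (Suc m)) X t"
        unfolding total_moment2_def by (intro sum.cong refl moment2_minus_commute)
      also have "2 * dist2 (picard (Suc m)) X t + 2 * dist2 (picard (Suc m)) (\<Phi> X) t \<le>
        2 * ennreal (real h * C * (1/4)^Suc m) + 2 * ennreal (real h * C * (1/4)^m / 4 * exp (rate * t))"
      proof (intro add_mono mult_left_mono dX t)
        have "dist2 (\<Phi> (picard m)) (\<Phi> X) t \<le> ennreal Lip * (\<integral>\<^sup>+s. dist2 (picard m) X s * indicator {0..t} s \<partial>lborel)"
          by (intro \<Phi>_Lipschitz picard_L2 XL2 t)
        also have "\<dots> \<le> ennreal (real h * C * (1/4)^m / 4 * exp (rate * t))"
        proof (rule Volterra_contraction[OF _ _ t])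
          fix s assume s: "0 \<le> s" "s \<le> T"
          have "real h * C * (1/4)^m * 1 \<le> real h * C * (1/4)^m * exp (rate * s)"
            using s C rate_pos by (intro mult_left_mono) auto
          then show "dist2 (picard m) X s \<le> ennreal (real h * C * (1/4)^m * exp (rate * s))"
            using order_trans[OF dX[OF s] ennreal_leI] by simp
        qed (use C in simp)
        finally show "dist2 (picard (Suc m)) (\<Phi> X) t \<le> ennreal (real h * C * (1/4)^m / 4 * exp (rate * t))"
          unfolding picard_Suc .
      qed simp_all
      also have "\<dots> = ennreal ((2 * real h * C / 4 + 2 * (real h * C / 4 * exp (rate * t))) * (1/4)^m)"
        using C by (simp add: ennreal_mult'[symmetric] ennreal_plus[symmetric] ennreal_numeral[symmetric] algebra_simps
            del: ennreal_plus ennreal_numeral)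
      finally show ?thesis .
    qed
    have "(\<lambda>m. (2 * real h * C / 4 + 2 * (real h * C / 4 * exp (rate * t))) * (1/4)^m) \<longlonglongrightarrow>
      (2 * real h * C / 4 + 2 * (real h * C / 4 * exp (rate * t))) * 0"
      by (intro tendsto_intros LIMSEQ_realpow_zero) auto
    from tendsto_ennrealI[OF this] small have "dist2 X (\<Phi> X) t \<le> 0"
      by (intro LIMSEQ_le_const[of _ 0 "dist2 X (\<Phi> X) t"]) auto
    then show ?thesis
      by (intro dist2_0_AE XL2 \<Phi>_L2 t i) simp
  qed
  with XL2 show ?thesis by blast
qed

text \<open>Two solutions are at first known to have finite energy, not bounded second moments. One
  use of the Lipschitz estimate turns finite energy into a bound uniform in time; each further use
  shrinks it by 1/4.\<close>

lemma fixed_point_unique: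
  assumes X: "L2_family X" "\<And>i t. i < h \<Longrightarrow> 0 \<le> t \<Longrightarrow> t \<le> T \<Longrightarrow> AE \<omega> in P. X i t \<omega> = \<Phi> X i t \<omega>"
    and Y: "L2_family Y" "\<And>i t. i < h \<Longrightarrow> 0 \<le> t \<Longrightarrow> t \<le> T \<Longrightarrow> AE \<omega> in P. Y i t \<omega> = \<Phi> Y i t \<omega>"
    and i: "i < h" and t: "0 \<le> t" "t \<le> T"
  shows "AE \<omega> in P. X i t \<omega> = Y i t \<omega>"
proof -
  have fix_eq: "dist2 X Y t = dist2 (\<Phi> X) (\<Phi> Y) t" if t: "0 \<le> t" "t \<le> T" for t
    unfolding total_moment2_def
  proof (intro sum.cong refl moment2_cong_AE)
    fix i assume "i \<in> {..<h}"
    then have i: "i < h" by simp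
    show "AE \<omega> in P. X i t \<omega> - Y i t \<omega> = \<Phi> X i t \<omega> - \<Phi> Y i t \<omega>"
      using X(2)[OF i t] Y(2)[OF i t] by eventually_elim simp
  qed
  have dm: "measurable_process (\<lambda>s \<omega>. X j s \<omega> - Y j s \<omega>)" "energy {0..T} (\<lambda>s \<omega>. X j s \<omega> - Y j s \<omega>) < \<infinity>" if "j < h" for j
    using X(1) Y(1) that L2_processD[OF L2_process_diff[of T "X j" "Y j"]] by auto
  have "(\<integral>\<^sup>+s. dist2 X Y s * indicator {0..T} s \<partial>lborel) = (\<Sum>j<h. energy {0..T} (\<lambda>s \<omega>. X j s \<omega> - Y j s \<omega>))"
  proof -
    have "(\<Sum>j<h. energy {0..T} (\<lambda>s \<omega>. X j s \<omega> - Y j s \<omega>)) =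
      (\<Sum>j<h. \<integral>\<^sup>+s. moment2 (\<lambda>\<omega>. X j s \<omega> - Y j s \<omega>) * indicator {0..T} s \<partial>lborel)"
      using energy_swap[OF dm(1)] by (intro sum.cong) auto
    also have "\<dots> = (\<integral>\<^sup>+s. (\<Sum>j<h. moment2 (\<lambda>\<omega>. X j s \<omega> - Y j s \<omega>) * indicator {0..T} s) \<partial>lborel)"
      using borel_measurable_moment2[OF dm(1)]
      by (intro nn_integral_sum[symmetric] borel_measurable_times_ennreal borel_measurable_indicator) auto
    finally show ?thesis unfolding total_moment2_def by (simp add: sum_distrib_right)
  qed
  also have "\<dots> < \<infinity>" using dm(2) by (simp add: less_top)
  finally have "ennreal Lip * (\<integral>\<^sup>+s. dist2 X Y s * indicator {0..T} s \<partial>lborel) < \<infinity>"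
    by (simp add: ennreal_mult_less_top)
  then obtain B where B: "0 \<le> B" "ennreal Lip * (\<integral>\<^sup>+s. dist2 X Y s * indicator {0..T} s \<partial>lborel) = ennreal B"
    by (cases "ennreal Lip * (\<integral>\<^sup>+s. dist2 X Y s * indicator {0..T} s \<partial>lborel)") auto
  have "dist2 X Y t \<le> ennreal (B * (1/4)^k * exp (rate * t))" if "0 \<le> t" "t \<le> T" for k t
    using that
  proof (induction k arbitrary: t)
    case 0
    have "dist2 X Y t \<le> ennreal Lip * (\<integral>\<^sup>+s. dist2 X Y s * indicator {0..t} s \<partial>lborel)"
      unfolding fix_eq[OF 0] by (rule \<Phi>_Lipschitz[OF X(1) Y(1) 0])
    also have "\<dots> \<le> ennreal Lip * (\<integral>\<^sup>+s. dist2 X Y s * indicator {0..T} s \<partial>lborel)"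
      using 0 by (intro mult_left_mono nn_integral_mono) (auto simp: indicator_def)
    also have "\<dots> \<le> ennreal (B * exp (rate * t))"
      unfolding B(2) using B(1) 0 rate_pos mult_left_mono[of 1 "exp (rate * t)" B] by (intro ennreal_leI) simp
    finally show ?case by simp
  next
    case (Suc k)
    have "dist2 X Y t \<le> ennreal Lip * (\<integral>\<^sup>+s. dist2 X Y s * indicator {0..t} s \<partial>lborel)"
      unfolding fix_eq[OF Suc.prems] by (rule \<Phi>_Lipschitz[OF X(1) Y(1) Suc.prems])
    also have "\<dots> \<le> ennreal (B * (1/4)^k / 4 * exp (rate * t))"
      using Suc B(1) by (intro Volterra_contraction) auto
    finally show ?case by simp
  qed
  note small = this[OF t]
  have "(\<lambda>k. B * (1/4)^k * exp (rate * t)) \<longlonglongrightarrow> B * 0 * exp (rate * t)"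
    by (intro tendsto_intros LIMSEQ_realpow_zero) auto
  from tendsto_ennrealI[OF this] small have "dist2 X Y t \<le> 0"
    by (intro LIMSEQ_le_const[of _ 0 "dist2 X Y t"]) auto
  then show ?thesis by (intro dist2_0_AE X(1) Y(1) t i) simp
qed

end

section \<open>Nilpotent systems\<close>

text \<open>Marks the rows of the nilpotent matrix that contain a 1, that is, all rows but the last
  of each block.\<close>

fun superdiag :: "nat list \<Rightarrow> nat \<Rightarrow> bool" where
  "superdiag [] i = False"
| "superdiag (m # ms) i = (if i < m then Suc i < m else superdiag ms (i - m))"

lemma nilpotent_jordan_index:
  "i < sum_list ms \<Longrightarrow> j < sum_list ms \<Longrightarrow>
    diag_block_mat (map (\<lambda>m. jordan_block m (0::real)) ms) $$ (i, j) = of_bool (j = Suc i \<and> superdiag ms i)"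
proof (induction ms arbitrary: i j)
  case (Cons m ms)
  let ?D = "diag_block_mat (map (\<lambda>m. jordan_block m (0::real)) ms)"
  have dim: "dim_row ?D = sum_list ms" "dim_col ?D = sum_list ms"
    by (simp_all add: dim_diag_block_mat o_def)
  show ?case
  proof (cases "i < m")
    case True
    then show ?thesis using Cons.prems dim by (auto simp: Let_def)
  next
    case False
    then show ?thesis using Cons.prems dim Cons.IH[of "i - m" "j - m"] by (auto simp: Let_def)
  qed
qed simp

lemma dim_nilpotent_jordan:
  "diag_block_mat (map (\<lambda>m. jordan_block m (0::real)) ms) \<in> carrier_mat (sum_list ms) (sum_list ms)"
  by (rule carrier_matI) (simp_all add: dim_diag_block_mat o_def)

text \<open>Passes to block number and offset, the form in which \<open>structure_conditions\<close>
  describes \<open>B2\<close>: the row after a marked row has a positive offset in its block, so it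
  is a zero row of \<open>B2\<close>.\<close>

lemma superdiag_block:
  "superdiag ms i \<Longrightarrow> \<exists>k p. k < length ms \<and> Suc p < ms ! k \<and> i = sum_list (take k ms) + p"
proof (induction ms arbitrary: i)
  case (Cons m ms)
  show ?case
  proof (cases "i < m")
    case True
    then show ?thesis using Cons.prems by (intro exI[of _ 0] exI[of _ i]) auto
  next
    case False
    then have "superdiag ms (i - m)" using Cons.prems by simp
    from Cons.IH[OF this] obtain k p where kp: "k < length ms" "Suc p < ms ! k" "i - m = sum_list (take k ms) + p"
      by blast
    then have "i = m + (sum_list (take k ms) + p)" using False by linarith
    then show ?thesis using kp(1,2) by (intro exI[of _ "Suc k"] exI[of _ p]) simp
  qed
qed simp

lemma superdiag_less: "superdiag ms i \<Longrightarrow> Suc i < sum_list ms"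
proof (induction ms arbitrary: i)
  case (Cons m ms)
  show ?case
  proof (cases "i < m")
    case False
    then have "Suc (i - m) < sum_list ms" using Cons.prems by (intro Cons.IH) simp
    then show ?thesis using False by simp
  qed (use Cons.prems in simp)
qed simp

lemma nilpotent_jordan_mult_vec:
  assumes "v \<in> carrier_vec (sum_list ms)" "i < sum_list ms"
  shows "(diag_block_mat (map (\<lambda>m. jordan_block m (0::real)) ms) *\<^sub>v v) $ i = (if superdiag ms i then v $ Suc i else 0)"
proof -
  let ?D = "diag_block_mat (map (\<lambda>m. jordan_block m (0::real)) ms)"
  have dim: "dim_row ?D = sum_list ms" "dim_col ?D = sum_list ms"
    by (simp_all add: dim_diag_block_mat o_def)
  have "(?D *\<^sub>v v) $ i = (\<Sum>j\<in>{0..<sum_list ms}. of_bool (j = Suc i \<and> superdiag ms i) * v $ j)"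
    using assms dim nilpotent_jordan_index[OF assms(2)] by (simp add: scalar_prod_def)
  also have "\<dots> = (\<Sum>j\<in>{0..<sum_list ms}. if j = Suc i then of_bool (superdiag ms i) * v $ j else 0)"
    by (intro sum.cong) auto
  also have "\<dots> = (if superdiag ms i then v $ Suc i else 0)"
    using superdiag_less[of ms i] by auto
  finally show ?thesis .
qed

context brownian
begin

section \<open>Calculus of Ito processes\<close>

text \<open>No path regularity is asked of \<open>e\<close>, because it will be a component of
  \<open>G *\<^sub>v z2\<close>, where \<open>z2\<close> is merely an adapted square-integrable
  process.\<close>

definition ito_process :: "real \<Rightarrow> real \<Rightarrow> (real \<Rightarrow> 'w \<Rightarrow> real) \<Rightarrow> (real \<Rightarrow> 'w \<Rightarrow> real) \<Rightarrow> (real \<Rightarrow> 'w \<Rightarrow> real) \<Rightarrow> bool" where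
  "ito_process T z e a b \<longleftrightarrow>
     (\<forall>t\<in>{0..T}. AE \<omega> in P. e t \<omega> = z + time_integral a t \<omega> + ito_integral P W b t \<omega>)"

lemma L2_process_cong:
  assumes "\<And>s \<omega>. \<omega> \<in> space P \<Longrightarrow> f s \<omega> = g s \<omega>"
  shows "L2_process T f \<longleftrightarrow> L2_process T g"
proof -
  have "measurable_process f \<longleftrightarrow> measurable_process g"
    unfolding measurable_process_def using assms by (intro measurable_cong) (auto simp: space_pair_measure)
  moreover have "f s \<in> borel_measurable (F s) \<longleftrightarrow> g s \<in> borel_measurable (F s)" for s
    using assms by (intro measurable_cong) auto
  moreover have "energy {0..T} f = energy {0..T} g"
    using assms by (intro energy_cong) auto
  ultimately show ?thesis unfolding L2_process_def by simp
qed

lemma time_integral_cong_AE: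
  assumes f: "measurable_process f" and g: "measurable_process g"
    and eq: "AE \<omega> in P. AE s in lborel. s \<in> {0..T} \<longrightarrow> f s \<omega> = g s \<omega>" and t: "t \<le> T"
  shows "AE \<omega> in P. time_integral f t \<omega> = time_integral g t \<omega>"
  using eq AE_space
proof eventually_elim
  case (elim \<omega>)
  have m: "(\<lambda>s. indicator {0..t} s * k s \<omega>) \<in> borel_measurable lborel" if "measurable_process k" for k
    using measurable_process_section[OF that elim(2)]
    by (intro borel_measurable_times borel_measurable_indicator) auto
  show ?case
    unfolding time_integral_def
    using elim(1) t by (intro integral_cong_AE m f g) (auto elim!: eventually_mono simp: indicator_def)
qed

text \<open>The left-hand side must agree at each time, the coefficients only for almost every time.
  The asymmetry matters: \<open>z2\<close> may be exchanged for \<open>- B2 *\<^sub>v v\<close> in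
  the coefficients but not on the left.\<close>

lemma ito_process_cong:
  assumes a: "measurable_process a" "measurable_process a'"
    and e: "\<And>t. 0 \<le> t \<Longrightarrow> t \<le> T \<Longrightarrow> AE \<omega> in P. e t \<omega> = e' t \<omega>"
    and aeq: "AE \<omega> in P. AE s in lborel. s \<in> {0..T} \<longrightarrow> a s \<omega> = a' s \<omega>"
    and beq: "AE \<omega> in P. AE s in lborel. s \<in> {0..T} \<longrightarrow> b s \<omega> = b' s \<omega>"
    and p: "ito_process T z e a b"
  shows "ito_process T z e' a' b'"
  unfolding ito_process_def
proof
  fix t assume t: "t \<in> {0..T}"
  have "ito_integral P W b t = ito_integral P W b' t"
  proof (rule ito_integral_cong)
    show "AE \<omega> in P. AE s in lborel. s \<in> {0..t} \<longrightarrow> b s \<omega> = b' s \<omega>"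
      using beq
    proof eventually_elim
      case (elim \<omega>)
      then show ?case by eventually_elim (use t in auto)
    qed
  qed
  moreover have "AE \<omega> in P. time_integral a t \<omega> = time_integral a' t \<omega>"
    using t by (intro time_integral_cong_AE[OF a aeq]) auto
  moreover have "AE \<omega> in P. e t \<omega> = e' t \<omega>" using e[of t] t by auto
  moreover have "AE \<omega> in P. e t \<omega> = z + time_integral a t \<omega> + ito_integral P W b t \<omega>"
    using p t unfolding ito_process_def by blast
  ultimately show "AE \<omega> in P. e' t \<omega> = z + time_integral a' t \<omega> + ito_integral P W b' t \<omega>"
    by (auto elim!: eventually_elim2)
qed

lemma ito_integral_linear:
  assumes f: "L2_process T f" and g: "L2_process T g" and t: "0 \<le> t" "t \<le> T" "0 < T"
  shows "AE \<omega> in P. ito_integral P W (\<lambda>s \<omega>. a * f s \<omega> + b * g s \<omega>) t \<omega> =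
    a * ito_integral P W f t \<omega> + b * ito_integral P W g t \<omega>"
proof (rule has_ito_integral_unique)
  have L: "L2_process T (\<lambda>s \<omega>. a * f s \<omega> + b * g s \<omega>)"
    by (intro L2_process_add L2_process_cmult f g)
  then show "measurable_process (\<lambda>s \<omega>. a * f s \<omega> + b * g s \<omega>)" by (rule L2_processD)
  show "has_ito_integral P W (\<lambda>s \<omega>. a * f s \<omega> + b * g s \<omega>) t (ito_integral P W (\<lambda>s \<omega>. a * f s \<omega> + b * g s \<omega>) t)"
    by (rule has_ito_integral_ito_integral[OF L t])
  show "has_ito_integral P W (\<lambda>s \<omega>. a * f s \<omega> + b * g s \<omega>) t (\<lambda>\<omega>. a * ito_integral P W f t \<omega> + b * ito_integral P W g t \<omega>)"
    by (intro has_ito_integral_linear L2_processD(1)[OF f] L2_processD(1)[OF g]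
        has_ito_integral_ito_integral[OF f t] has_ito_integral_ito_integral[OF g t])
qed

lemma time_integral_cmult: "time_integral (\<lambda>s \<omega>. c * f s \<omega>) t \<omega> = c * time_integral f t \<omega>"
proof -
  have "(\<lambda>s. indicator {0..t} s * (c * f s \<omega>)) = (\<lambda>s. c * (indicator {0..t} s * f s \<omega>))"
    by (intro ext) (rule mult.left_commute)
  then show ?thesis by (simp only: time_integral_def integral_mult_right_zero)
qed

lemma time_integral_linear:
  assumes f: "L2_process T f" and g: "L2_process T g" and t: "t \<le> T"
  shows "AE \<omega> in P. time_integral (\<lambda>s \<omega>. a * f s \<omega> + b * g s \<omega>) t \<omega> =
    a * time_integral f t \<omega> + b * time_integral g t \<omega>"
proof -
  have eq: "(\<lambda>s \<omega>. a * f s \<omega> - - b * g s \<omega>) = (\<lambda>s \<omega>. a * f s \<omega> + b * g s \<omega>)"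
    by (intro ext) simp
  from time_integral_diff[OF L2_process_cmult[OF f, of a] L2_process_cmult[OF g, of "- b"] t]
  show ?thesis
    unfolding eq unfolding time_integral_cmult[of a] time_integral_cmult[of "- b"]
    unfolding mult_minus_left diff_minus_eq_add .
qed

lemma ito_process_linear:
  assumes T: "0 < T" and a: "L2_process T a1" "L2_process T a2" and b: "L2_process T b1" "L2_process T b2"
    and p: "ito_process T z1 e1 a1 b1" "ito_process T z2 e2 a2 b2"
  shows "ito_process T (\<alpha> * z1 + \<beta> * z2) (\<lambda>t \<omega>. \<alpha> * e1 t \<omega> + \<beta> * e2 t \<omega>)
    (\<lambda>s \<omega>. \<alpha> * a1 s \<omega> + \<beta> * a2 s \<omega>) (\<lambda>s \<omega>. \<alpha> * b1 s \<omega> + \<beta> * b2 s \<omega>)"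
  unfolding ito_process_def
proof
  fix t assume t: "t \<in> {0..T}"
  have "AE \<omega> in P. e1 t \<omega> = z1 + time_integral a1 t \<omega> + ito_integral P W b1 t \<omega>"
    "AE \<omega> in P. e2 t \<omega> = z2 + time_integral a2 t \<omega> + ito_integral P W b2 t \<omega>"
    using p t unfolding ito_process_def by blast+
  moreover have "AE \<omega> in P. time_integral (\<lambda>s \<omega>. \<alpha> * a1 s \<omega> + \<beta> * a2 s \<omega>) t \<omega> =
    \<alpha> * time_integral a1 t \<omega> + \<beta> * time_integral a2 t \<omega>"
    using t by (intro time_integral_linear[OF a]) auto
  moreover have "AE \<omega> in P. ito_integral P W (\<lambda>s \<omega>. \<alpha> * b1 s \<omega> + \<beta> * b2 s \<omega>) t \<omega> =
    \<alpha> * ito_integral P W b1 t \<omega> + \<beta> * ito_integral P W b2 t \<omega>"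
    using t T by (intro ito_integral_linear[OF b]) auto
  ultimately show "AE \<omega> in P. \<alpha> * e1 t \<omega> + \<beta> * e2 t \<omega> = \<alpha> * z1 + \<beta> * z2 +
      time_integral (\<lambda>s \<omega>. \<alpha> * a1 s \<omega> + \<beta> * a2 s \<omega>) t \<omega> +
      ito_integral P W (\<lambda>s \<omega>. \<alpha> * b1 s \<omega> + \<beta> * b2 s \<omega>) t \<omega>"
    by eventually_elim (simp add: algebra_simps)
qed

lemma ito_process_zero:
  assumes T: "0 < T"
  shows "ito_process T 0 (\<lambda>t \<omega>. 0) (\<lambda>s \<omega>. 0) (\<lambda>s \<omega>. 0)"
  unfolding ito_process_def
proof
  fix t assume t: "t \<in> {0..T}"
  have L: "L2_process T (\<lambda>s \<omega>. 0)" by (rule L2_process_const)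
  have "AE \<omega> in P. ito_integral P W (\<lambda>s \<omega>. 0) t \<omega> = 0"
    using ito_integral_linear[OF L L, of t 0 0] t T by simp
  then show "AE \<omega> in P. 0 = 0 + time_integral (\<lambda>s \<omega>. 0) t \<omega> + ito_integral P W (\<lambda>s \<omega>. 0) t \<omega>"
    by (auto elim!: eventually_mono simp: time_integral_def)
qed

text \<open>Multiplying a vector equation by a matrix from the left takes such combinations of its
  rows.\<close>

lemma ito_process_sum:
  assumes T: "0 < T" and "finite I"
    and "\<And>k. k \<in> I \<Longrightarrow> L2_process T (a k)" "\<And>k. k \<in> I \<Longrightarrow> L2_process T (b k)"
    and "\<And>k. k \<in> I \<Longrightarrow> ito_process T (z k) (e k) (a k) (b k)"
  shows "ito_process T (\<Sum>k\<in>I. c k * z k) (\<lambda>t \<omega>. \<Sum>k\<in>I. c k * e k t \<omega>)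
    (\<lambda>s \<omega>. \<Sum>k\<in>I. c k * a k s \<omega>) (\<lambda>s \<omega>. \<Sum>k\<in>I. c k * b k s \<omega>)"
  using assms(2-)
proof (induction I rule: finite_induct)
  case empty
  then show ?case using ito_process_zero[OF T] by simp
next
  case (insert k I)
  have "ito_process T (c k * z k + 1 * (\<Sum>k\<in>I. c k * z k)) (\<lambda>t \<omega>. c k * e k t \<omega> + 1 * (\<Sum>k\<in>I. c k * e k t \<omega>))
    (\<lambda>s \<omega>. c k * a k s \<omega> + 1 * (\<Sum>k\<in>I. c k * a k s \<omega>)) (\<lambda>s \<omega>. c k * b k s \<omega> + 1 * (\<Sum>k\<in>I. c k * b k s \<omega>))"
    using insert by (intro ito_process_linear T L2_process_sum L2_process_cmult) auto
  then show ?case using insert by simp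
qed

text \<open>Compared with \<open>energy_eq_0D\<close> the quantifiers are exchanged; this form feeds
  \<open>drift_diffusion_zero\<close>.\<close>

lemma energy_eq_0_AE_time:
  assumes f: "measurable_process f" and 0: "energy {0..T} f = 0"
  shows "AE t in lborel. t \<in> {0..T} \<longrightarrow> (AE \<omega> in P. f t \<omega> = 0)"
proof -
  note f[measurable]
  have sec: "f t \<in> borel_measurable P" for t
    using measurable_process_compose[OF f, of "\<lambda>_. t" P "\<lambda>\<omega>. \<omega>"] by simp
  have "(\<integral>\<^sup>+t. moment2 (f t) * indicator {0..T} t \<partial>lborel) = 0"
    using 0 energy_swap[OF f, of "{0..T}"] by simp
  then have "AE t in lborel. moment2 (f t) * indicator {0..T} t = 0"
    by (subst (asm) nn_integral_0_iff_AE) auto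
  then show ?thesis
    by eventually_elim (auto simp: indicator_def moment2_eq_0_iff[OF sec])
qed

text \<open>Backward induction along each Jordan block: a row whose left-hand side vanishes forces drift and
  diffusion to vanish, hence the left-hand side of the row above it.\<close>

lemma nilpotent_system_zero:
  assumes T: "0 < T" and y: "\<And>i. i < q \<Longrightarrow> L2_process T (y i)" and b: "\<And>i. i < q \<Longrightarrow> L2_process T (b i)"
    and \<sigma>: "\<And>i. \<sigma> i \<Longrightarrow> Suc i < q"
    and eq: "\<And>i. i < q \<Longrightarrow> ito_process T 0 (\<lambda>t \<omega>. if \<sigma> i then y (Suc i) t \<omega> else 0) (y i) (b i)"
    and i: "i < q"
  shows "energy {0..T} (y i) = 0 \<and> energy {0..T} (b i) = 0"
  using i
proof (induction "q - i" arbitrary: i rule: less_induct)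
  case less
  have "AE t in lborel. t \<in> {0..T} \<longrightarrow> (AE \<omega> in P. (if \<sigma> i then y (Suc i) t \<omega> else 0) = 0)"
  proof (cases "\<sigma> i")
    case True
    then have s: "Suc i < q" by (rule \<sigma>)
    have "energy {0..T} (y (Suc i)) = 0" using less.hyps[of "Suc i"] s less.prems by auto
    from energy_eq_0_AE_time[OF L2_processD(1)[OF y[OF s]] this] show ?thesis using True by simp
  qed simp
  then have "AE t in lborel. t \<in> {0..T} \<longrightarrow> (AE \<omega> in P. time_integral (y i) t \<omega> + ito_integral P W (b i) t \<omega> = 0)"
  proof eventually_elim
    case (elim t)
    show ?case
    proof
      assume t: "t \<in> {0..T}"
      then have "AE \<omega> in P. (if \<sigma> i then y (Suc i) t \<omega> else 0) = 0 + time_integral (y i) t \<omega> + ito_integral P W (b i) t \<omega>"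
        using eq[OF less.prems] unfolding ito_process_def by blast
      moreover have "AE \<omega> in P. (if \<sigma> i then y (Suc i) t \<omega> else 0) = 0" using elim t by blast
      ultimately show "AE \<omega> in P. time_integral (y i) t \<omega> + ito_integral P W (b i) t \<omega> = 0"
        by eventually_elim simp
    qed
  qed
  then show ?case using drift_diffusion_zero[OF y[OF less.prems] b[OF less.prems] T] by blast
qed

end

context linear_sde
begin

text \<open>At each fixed time the chosen version and \<open>ito_integral\<close> agree almost
  surely, so fixed points of \<open>\<Phi>\<close> are solutions in the original sense.\<close>

lemma fixed_point_iff_ito_process:
  assumes X: "L2_family X" and i: "i < h"
  shows "(\<forall>t. 0 \<le> t \<and> t \<le> T \<longrightarrow> (AE \<omega> in P. X i t \<omega> = \<Phi> X i t \<omega>)) \<longleftrightarrow>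
    ito_process T (x0 i) (X i) (drift X i) (diffusion X i)"
proof -
  have "(AE \<omega> in P. X i t \<omega> = \<Phi> X i t \<omega>) \<longleftrightarrow>
    (AE \<omega> in P. X i t \<omega> = x0 i + time_integral (drift X i) t \<omega> + ito_integral P W (diffusion X i) t \<omega>)"
    if t: "0 \<le> t" "t \<le> T" for t
    using ito_version(4)[OF diffusion_L2[OF X i] T_pos t] unfolding \<Phi>_def
    by (auto elim: eventually_elim2)
  then show ?thesis unfolding ito_process_def by auto
qed

lemma ito_solution_exists:
  "\<exists>X. L2_family X \<and> (\<forall>i<h. ito_process T (x0 i) (X i) (drift X i) (diffusion X i))"
proof -
  obtain X where X: "L2_family X"
    and fp: "\<forall>i<h. \<forall>t. 0 \<le> t \<and> t \<le> T \<longrightarrow> (AE \<omega> in P. X i t \<omega> = \<Phi> X i t \<omega>)"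
    using fixed_point_exists by blast
  have "ito_process T (x0 i) (X i) (drift X i) (diffusion X i)" if "i < h" for i
    using fixed_point_iff_ito_process[OF X that] fp that by blast
  with X show ?thesis by blast
qed

lemma ito_solution_unique:
  assumes X: "L2_family X" "\<And>i. i < h \<Longrightarrow> ito_process T (x0 i) (X i) (drift X i) (diffusion X i)"
    and Y: "L2_family Y" "\<And>i. i < h \<Longrightarrow> ito_process T (x0 i) (Y i) (drift Y i) (diffusion Y i)"
    and i: "i < h" and t: "0 \<le> t" "t \<le> T"
  shows "AE \<omega> in P. X i t \<omega> = Y i t \<omega>"
proof (rule fixed_point_unique[OF X(1) _ Y(1) _ i t])
  fix i t assume i: "i < h" and t: "0 \<le> t" "t \<le> T"
  show "AE \<omega> in P. X i t \<omega> = \<Phi> X i t \<omega>"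
    using fixed_point_iff_ito_process[OF X(1) i] X(2)[OF i] t by blast
  show "AE \<omega> in P. Y i t \<omega> = \<Phi> Y i t \<omega>"
    using fixed_point_iff_ito_process[OF Y(1) i] Y(2)[OF i] t by blast
qed

end

section \<open>Vector-valued equations\<close>

lemma index_mult_mat_vec_sum:
  assumes "A \<in> carrier_mat d n" "x \<in> carrier_vec n" "i < d"
  shows "(A *\<^sub>v x) $ i = (\<Sum>j<n. A $$ (i, j) * x $ j)"
  using assms by (simp add: scalar_prod_def lessThan_atLeast0)

context brownian
begin

text \<open>Outside \<open>{0..T}\<close> the vectors may have any dimension and nothing is
  measurable, so the component is extended by zero.\<close>

definition coord :: "real \<Rightarrow> (real \<Rightarrow> 'w \<Rightarrow> real vec) \<Rightarrow> nat \<Rightarrow> real \<Rightarrow> 'w \<Rightarrow> real" where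
  "coord T x i s \<omega> = indicator {0..T} s * x s \<omega> $ i"

text \<open>Connects the restricted time space of \<open>L2_adapted\<close> with extension by zero.
  Forward, the restricted product space maps measurably into the product with restricted time;
  backward, the indicator is 1 on the restricted times.\<close>

lemma measurable_restrict_time_iff:
  fixes g :: "real \<Rightarrow> 'w \<Rightarrow> real"
  shows "(\<lambda>(t, \<omega>). g t \<omega>) \<in> borel_measurable (restrict_space borel {0..T} \<Otimes>\<^sub>M P) \<longleftrightarrow>
    measurable_process (\<lambda>t \<omega>. indicator {0..T} t * g t \<omega>)"
proof
  let ?B = "borel :: real measure"
  let ?R = "restrict_space ?B {0..T}" and ?S = "{0..T} \<times> space P"
  assume g: "(\<lambda>(t, \<omega>). g t \<omega>) \<in> borel_measurable (?R \<Otimes>\<^sub>M P)"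
  have S: "?S \<in> sets (?B \<Otimes>\<^sub>M P)" by (intro pair_measureI) auto
  have fst: "fst \<in> restrict_space (?B \<Otimes>\<^sub>M P) ?S \<rightarrow>\<^sub>M ?R"
  proof (rule measurable_restrict_space2)
    show "fst \<in> space (restrict_space (?B \<Otimes>\<^sub>M P) ?S) \<rightarrow> {0..T}"
      by (auto simp: space_restrict_space)
    show "fst \<in> restrict_space (?B \<Otimes>\<^sub>M P) ?S \<rightarrow>\<^sub>M ?B"
      by (intro measurable_restrict_space1 measurable_fst)
  qed
  have snd: "snd \<in> restrict_space (?B \<Otimes>\<^sub>M P) ?S \<rightarrow>\<^sub>M P"
    by (intro measurable_restrict_space1 measurable_snd)
  have "(\<lambda>z. (fst z, snd z)) \<in> restrict_space (?B \<Otimes>\<^sub>M P) ?S \<rightarrow>\<^sub>M ?R \<Otimes>\<^sub>M P"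
    using fst snd by (rule measurable_Pair)
  from measurable_compose[OF this g]
  have "(\<lambda>z. g (fst z) (snd z)) \<in> borel_measurable (restrict_space (?B \<Otimes>\<^sub>M P) ?S)"
    by (simp add: case_prod_beta')
  then have m: "(\<lambda>z. indicator ?S z *\<^sub>R g (fst z) (snd z)) \<in> borel_measurable (?B \<Otimes>\<^sub>M P)"
    using borel_measurable_restrict_space_iff[of ?S "?B \<Otimes>\<^sub>M P" "\<lambda>z. g (fst z) (snd z)"] S
    by (simp add: space_pair_measure Int_absorb2 Times_subset_cancel2)
  show "measurable_process (\<lambda>t \<omega>. indicator {0..T} t * g t \<omega>)"
    unfolding measurable_process_def case_prod_beta'
    by (rule measurable_cong[THEN iffD1, OF _ m]) (auto simp: space_pair_measure indicator_def)
next
  let ?R = "restrict_space (borel :: real measure) {0..T}"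
  assume g: "measurable_process (\<lambda>t \<omega>. indicator {0..T} t * g t \<omega>)"
  have "fst \<in> borel_measurable (?R \<Otimes>\<^sub>M P)"
    using measurable_compose[OF measurable_fst measurable_restrict_space1[OF measurable_ident]] by simp
  then have "(\<lambda>z. indicator {0..T} (fst z) * g (fst z) (snd z)) \<in> borel_measurable (?R \<Otimes>\<^sub>M P)"
    by (intro measurable_process_compose[OF g] measurable_snd)
  then show "(\<lambda>(t, \<omega>). g t \<omega>) \<in> borel_measurable (?R \<Otimes>\<^sub>M P)"
    unfolding case_prod_beta'
    by (rule measurable_cong[THEN iffD1, rotated]) (auto simp: space_pair_measure space_restrict_space)
qed

lemma scalar_prod_self_energy:
  assumes x: "\<And>t \<omega>. t \<in> {0..T} \<Longrightarrow> \<omega> \<in> space P \<Longrightarrow> x t \<omega> \<in> carrier_vec k"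
    and m: "\<And>i. i < k \<Longrightarrow> measurable_process (coord T x i)"
  shows "(\<integral>\<^sup>+\<omega>. (\<integral>\<^sup>+t. ennreal (x t \<omega> \<bullet> x t \<omega>) * indicator {0..T} t \<partial>lborel) \<partial>P) =
    (\<Sum>i<k. energy {0..T} (coord T x i))"
proof -
  have eq: "ennreal (x t \<omega> \<bullet> x t \<omega>) * indicator {0..T} t = (\<Sum>i<k. ennreal ((coord T x i t \<omega>)\<^sup>2) * indicator {0..T} t)"
    if w: "\<omega> \<in> space P" for t \<omega>
  proof (cases "t \<in> {0..T}")
    case True
    then have "dim_vec (x t \<omega>) = k" using x[OF True w] by auto
    then have "x t \<omega> \<bullet> x t \<omega> = (\<Sum>i<k. (coord T x i t \<omega>)\<^sup>2)"
      using True by (simp add: scalar_prod_def coord_def power2_eq_square lessThan_atLeast0)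
    then show ?thesis using True by (simp add: sum_nonneg)
  qed simp
  have "(\<integral>\<^sup>+t. ennreal (x t \<omega> \<bullet> x t \<omega>) * indicator {0..T} t \<partial>lborel) =
    (\<Sum>i<k. \<integral>\<^sup>+t. ennreal ((coord T x i t \<omega>)\<^sup>2) * indicator {0..T} t \<partial>lborel)" if w: "\<omega> \<in> space P" for \<omega>
  proof -
    have "(\<lambda>t. ennreal ((coord T x i t \<omega>)\<^sup>2) * indicator {0..T} t) \<in> borel_measurable lborel" if "i < k" for i
      using measurable_process_section[OF m[OF that] w]
      by (intro borel_measurable_times_ennreal borel_measurable_indicator
          measurable_compose[OF _ measurable_ennreal] borel_measurable_power) auto
    then show ?thesis
      unfolding eq[OF w] by (intro nn_integral_sum) auto
  qed
  then have "(\<integral>\<^sup>+\<omega>. (\<integral>\<^sup>+t. ennreal (x t \<omega> \<bullet> x t \<omega>) * indicator {0..T} t \<partial>lborel) \<partial>P) =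
    (\<integral>\<^sup>+\<omega>. (\<Sum>i<k. \<integral>\<^sup>+t. ennreal ((coord T x i t \<omega>)\<^sup>2) * indicator {0..T} t \<partial>lborel) \<partial>P)"
    by (intro nn_integral_cong)
  also have "\<dots> = (\<Sum>i<k. energy {0..T} (coord T x i))"
    unfolding energy_def using borel_measurable_path_energy[OF m] by (intro nn_integral_sum) auto
  finally show ?thesis .
qed

lemma L2_adapted_iff:
  "x \<in> L2_adapted P W T k \<longleftrightarrow>
     (\<forall>t\<in>{0..T}. \<forall>\<omega>\<in>space P. x t \<omega> \<in> carrier_vec k) \<and> (\<forall>i<k. L2_process T (coord T x i))"
proof -
  have m: "(\<lambda>(t, \<omega>). x t \<omega> $ i) \<in> borel_measurable (restrict_space borel {0..T} \<Otimes>\<^sub>M P) \<longleftrightarrow> measurable_process (coord T x i)" for i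
    unfolding measurable_restrict_time_iff coord_def[abs_def] ..
  have a: "(\<lambda>\<omega>. x t \<omega> $ i) \<in> borel_measurable (F t) \<longleftrightarrow> coord T x i t \<in> borel_measurable (F t)" if "t \<in> {0..T}" for t i
    using that unfolding coord_def[abs_def] by simp
  show ?thesis
  \<comment> \<open>The energy identity rests on dimensions and measurability; without them both
    sides of the equivalence are false.\<close>
  proof (cases "(\<forall>t\<in>{0..T}. \<forall>\<omega>\<in>space P. x t \<omega> \<in> carrier_vec k) \<and> (\<forall>i<k. measurable_process (coord T x i))")
    case True
    then have "(\<integral>\<^sup>+\<omega>. (\<integral>\<^sup>+t. ennreal (x t \<omega> \<bullet> x t \<omega>) * indicator {0..T} t \<partial>lborel) \<partial>P) = (\<Sum>i<k. energy {0..T} (coord T x i))"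
      by (intro scalar_prod_self_energy) auto
    then have "(\<integral>\<^sup>+\<omega>. (\<integral>\<^sup>+t. ennreal (x t \<omega> \<bullet> x t \<omega>) * indicator {0..T} t \<partial>lborel) \<partial>P) < \<infinity> \<longleftrightarrow>
      (\<forall>i<k. energy {0..T} (coord T x i) < \<infinity>)"
      by (auto simp: less_top)
    then show ?thesis
      unfolding L2_adapted_def L2_process_def mem_Collect_eq m using a by blast
  next
    case False
    then show ?thesis
      unfolding L2_adapted_def L2_process_def mem_Collect_eq m by blast
  qed
qed

lemma L2_adapted_carrier:
  "x \<in> L2_adapted P W T k \<Longrightarrow> t \<in> {0..T} \<Longrightarrow> \<omega> \<in> space P \<Longrightarrow> x t \<omega> \<in> carrier_vec k"
  unfolding L2_adapted_iff by blast

lemma L2_adapted_coord: "x \<in> L2_adapted P W T k \<Longrightarrow> i < k \<Longrightarrow> L2_process T (coord T x i)"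
  unfolding L2_adapted_iff by blast

lemma L2_adaptedI:
  assumes "\<And>t \<omega>. t \<in> {0..T} \<Longrightarrow> \<omega> \<in> space P \<Longrightarrow> x t \<omega> \<in> carrier_vec k"
    and "\<And>i. i < k \<Longrightarrow> L2_process T (f i)"
    and "\<And>i t \<omega>. i < k \<Longrightarrow> \<omega> \<in> space P \<Longrightarrow> coord T x i t \<omega> = f i t \<omega>"
  shows "x \<in> L2_adapted P W T k"
  unfolding L2_adapted_iff
proof (intro conjI ballI allI impI)
  fix i assume i: "i < k"
  have "L2_process T (coord T x i) \<longleftrightarrow> L2_process T (f i)"
    by (rule L2_process_cong) (rule assms(3)[OF i])
  then show "L2_process T (coord T x i)" using assms(2)[OF i] by simp
qed (rule assms(1))

lemma coord_mult_mat_vec: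
  assumes x: "x \<in> L2_adapted P W T n" and A: "A \<in> carrier_mat d n" and i: "i < d" and w: "\<omega> \<in> space P"
  shows "coord T (\<lambda>t \<omega>. A *\<^sub>v x t \<omega>) i t \<omega> = (\<Sum>j<n. A $$ (i, j) * coord T x j t \<omega>)"
proof (cases "t \<in> {0..T}")
  case True
  then show ?thesis
    using index_mult_mat_vec_sum[OF A L2_adapted_carrier[OF x True w] i] by (simp add: coord_def)
qed (simp add: coord_def)

lemma L2_adapted_mult_mat_vec:
  assumes x: "x \<in> L2_adapted P W T n" and A: "A \<in> carrier_mat d n"
  shows "(\<lambda>t \<omega>. A *\<^sub>v x t \<omega>) \<in> L2_adapted P W T d"
proof (rule L2_adaptedI)
  show "L2_process T (\<lambda>s \<omega>. \<Sum>j<n. A $$ (i, j) * coord T x j s \<omega>)" for i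
    using L2_adapted_coord[OF x] by (intro L2_process_sum L2_process_cmult) auto
  show "A *\<^sub>v x t \<omega> \<in> carrier_vec d" for t \<omega>
    using A by (intro carrier_vecI) simp
qed (rule coord_mult_mat_vec[OF x A])

lemma coord_add:
  assumes "x \<in> L2_adapted P W T n" "y \<in> L2_adapted P W T n" "i < n" "\<omega> \<in> space P"
  shows "coord T (\<lambda>t \<omega>. x t \<omega> + y t \<omega>) i t \<omega> = coord T x i t \<omega> + coord T y i t \<omega>"
  using L2_adapted_carrier[OF assms(1) _ assms(4), of t] L2_adapted_carrier[OF assms(2) _ assms(4), of t] assms(3)
  by (cases "t \<in> {0..T}") (auto simp: coord_def)

lemma L2_adapted_add:
  assumes x: "x \<in> L2_adapted P W T n" and y: "y \<in> L2_adapted P W T n"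
  shows "(\<lambda>t \<omega>. x t \<omega> + y t \<omega>) \<in> L2_adapted P W T n"
proof (rule L2_adaptedI)
  show "L2_process T (\<lambda>s \<omega>. coord T x i s \<omega> + coord T y i s \<omega>)" if "i < n" for i
    using L2_adapted_coord[OF x that] L2_adapted_coord[OF y that] by (rule L2_process_add)
qed (use coord_add[OF x y] L2_adapted_carrier[OF x] L2_adapted_carrier[OF y] in auto)

lemma L2_adapted_append:
  assumes x: "x \<in> L2_adapted P W T n" and y: "y \<in> L2_adapted P W T k"
  shows "(\<lambda>t \<omega>. x t \<omega> @\<^sub>v y t \<omega>) \<in> L2_adapted P W T (n + k)"
proof (rule L2_adaptedI)
  show "L2_process T (if i < n then coord T x i else coord T y (i - n))" if "i < n + k" for i
    using L2_adapted_coord[OF x] L2_adapted_coord[OF y] that by auto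
  show "x t \<omega> @\<^sub>v y t \<omega> \<in> carrier_vec (n + k)" if "t \<in> {0..T}" "\<omega> \<in> space P" for t \<omega>
    using L2_adapted_carrier[OF x that] L2_adapted_carrier[OF y that] by simp
  show "coord T (\<lambda>t \<omega>. x t \<omega> @\<^sub>v y t \<omega>) i t \<omega> = (if i < n then coord T x i else coord T y (i - n)) t \<omega>"
    if "i < n + k" "\<omega> \<in> space P" for i t \<omega>
    using L2_adapted_carrier[OF x _ that(2), of t] L2_adapted_carrier[OF y _ that(2), of t] that
    by (cases "t \<in> {0..T}") (auto simp: coord_def)
qed

lemma L2_adapted_vec_first:
  assumes x: "x \<in> L2_adapted P W T (n + k)"
  shows "(\<lambda>t \<omega>. vec_first (x t \<omega>) n) \<in> L2_adapted P W T n"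
proof (rule L2_adaptedI)
  show "L2_process T (coord T x i)" if "i < n" for i using L2_adapted_coord[OF x] that by auto
  show "coord T (\<lambda>t \<omega>. vec_first (x t \<omega>) n) i t \<omega> = coord T x i t \<omega>" if "i < n" "\<omega> \<in> space P" for i t \<omega>
    using that by (simp add: coord_def vec_first_def)
qed auto

lemma L2_adapted_vec_last:
  assumes x: "x \<in> L2_adapted P W T (n + k)"
  shows "(\<lambda>t \<omega>. vec_last (x t \<omega>) k) \<in> L2_adapted P W T k"
proof (rule L2_adaptedI)
  show "L2_process T (coord T x (n + i))" if "i < k" for i using L2_adapted_coord[OF x] that by auto
  show "coord T (\<lambda>t \<omega>. vec_last (x t \<omega>) k) i t \<omega> = coord T x (n + i) t \<omega>" if "i < k" "\<omega> \<in> space P" for i t \<omega>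
    using L2_adapted_carrier[OF x _ that(2), of t] that
    by (cases "t \<in> {0..T}") (auto simp: coord_def vec_last_def)
qed auto

lemma L2_adapted_cong:
  assumes "\<And>t \<omega>. t \<in> {0..T} \<Longrightarrow> \<omega> \<in> space P \<Longrightarrow> x t \<omega> = y t \<omega>"
  shows "x \<in> L2_adapted P W T n \<longleftrightarrow> y \<in> L2_adapted P W T n"
proof -
  have "L2_process T (coord T x i) \<longleftrightarrow> L2_process T (coord T y i)" for i
    using assms by (intro L2_process_cong) (auto simp: coord_def indicator_def)
  then show ?thesis unfolding L2_adapted_iff using assms by auto
qed

text \<open>There are finitely many rows, so the exceptional set can be chosen row by row. The
  cutoff in \<open>coord\<close> changes no integral up to a time in \<open>{0..T}\<close>.\<close>

lemma sde_solution_iff: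
  assumes E: "E \<in> carrier_mat d n" and x0: "x0 \<in> carrier_vec d"
  shows "sde_solution P W T E A B C D x0 u x \<longleftrightarrow> x \<in> L2_adapted P W T n \<and>
    (\<forall>i<d. ito_process T (x0 $ i) (\<lambda>t \<omega>. (E *\<^sub>v x t \<omega>) $ i)
       (coord T (\<lambda>s \<omega>. A *\<^sub>v x s \<omega> + B *\<^sub>v u s \<omega>) i) (coord T (\<lambda>s \<omega>. C *\<^sub>v x s \<omega> + D *\<^sub>v u s \<omega>) i))"
proof -
  let ?a = "\<lambda>s \<omega>. A *\<^sub>v x s \<omega> + B *\<^sub>v u s \<omega>" and ?c = "\<lambda>s \<omega>. C *\<^sub>v x s \<omega> + D *\<^sub>v u s \<omega>"
  have "(AE \<omega> in P. E *\<^sub>v x t \<omega> = x0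
          + vec (dim_row E) (\<lambda>i. LBINT s:{0..t}. (A *\<^sub>v x s \<omega> + B *\<^sub>v u s \<omega>) $ i)
          + vec (dim_row E) (\<lambda>i. ito_integral P W (\<lambda>s \<omega>'. (C *\<^sub>v x s \<omega>' + D *\<^sub>v u s \<omega>') $ i) t \<omega>)) \<longleftrightarrow>
    (\<forall>i<d. AE \<omega> in P. (E *\<^sub>v x t \<omega>) $ i = x0 $ i + time_integral (coord T ?a i) t \<omega> + ito_integral P W (coord T ?c i) t \<omega>)"
    if t: "t \<in> {0..T}" for t
  proof -
    have ti: "(LBINT s:{0..t}. ?a s \<omega> $ i) = time_integral (coord T ?a i) t \<omega>" for i \<omega>
      unfolding set_lebesgue_integral_def time_integral_def
      using t by (intro Bochner_Integration.integral_cong) (auto simp: coord_def indicator_def)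
    have ii: "ito_integral P W (\<lambda>s \<omega>'. ?c s \<omega>' $ i) t = ito_integral P W (coord T ?c i) t" for i
      using t by (intro ito_integral_cong AE_I2) (auto simp: coord_def)
    have vec: "E *\<^sub>v x t \<omega> = x0
          + vec (dim_row E) (\<lambda>i. LBINT s:{0..t}. (A *\<^sub>v x s \<omega> + B *\<^sub>v u s \<omega>) $ i)
          + vec (dim_row E) (\<lambda>i. ito_integral P W (\<lambda>s \<omega>'. (C *\<^sub>v x s \<omega>' + D *\<^sub>v u s \<omega>') $ i) t \<omega>) \<longleftrightarrow>
      (\<forall>i\<in>{..<d}. (E *\<^sub>v x t \<omega>) $ i = x0 $ i + time_integral (coord T ?a i) t \<omega> + ito_integral P W (coord T ?c i) t \<omega>)" for \<omega>
      unfolding ti ii vec_eq_iff using E x0 by auto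
    have "(AE \<omega> in P. \<forall>i\<in>{..<d}. (E *\<^sub>v x t \<omega>) $ i = x0 $ i + time_integral (coord T ?a i) t \<omega> + ito_integral P W (coord T ?c i) t \<omega>) \<longleftrightarrow>
      (\<forall>i\<in>{..<d}. AE \<omega> in P. (E *\<^sub>v x t \<omega>) $ i = x0 $ i + time_integral (coord T ?a i) t \<omega> + ito_integral P W (coord T ?c i) t \<omega>)"
      by (rule AE_ball_countable) simp
    then show ?thesis unfolding vec by auto
  qed
  then show ?thesis
    using E unfolding sde_solution_def ito_process_def by auto
qed

text \<open>Allows feedback matrix and control to be changed together, as long as drift and
  diffusion along the given state stay the same.\<close>

lemma sde_solution_cong:
  assumes "\<And>t \<omega>. t \<in> {0..T} \<Longrightarrow> \<omega> \<in> space P \<Longrightarrow> A *\<^sub>v x t \<omega> + B *\<^sub>v u t \<omega> = A' *\<^sub>v x t \<omega> + B' *\<^sub>v u' t \<omega>"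
    and "\<And>t \<omega>. t \<in> {0..T} \<Longrightarrow> \<omega> \<in> space P \<Longrightarrow> C *\<^sub>v x t \<omega> + D *\<^sub>v u t \<omega> = C' *\<^sub>v x t \<omega> + D' *\<^sub>v u' t \<omega>"
    and sol: "sde_solution P W T E A B C D x0 u x"
  shows "sde_solution P W T E A' B' C' D' x0 u' x"
proof -
  have 1: "(LBINT s:{0..t}. (A *\<^sub>v x s \<omega> + B *\<^sub>v u s \<omega>) $ i) = (LBINT s:{0..t}. (A' *\<^sub>v x s \<omega> + B' *\<^sub>v u' s \<omega>) $ i)"
    if "t \<in> {0..T}" "\<omega> \<in> space P" for t \<omega> i
    unfolding set_lebesgue_integral_def
    using that assms(1)[OF _ that(2)] by (intro Bochner_Integration.integral_cong) (auto simp: indicator_def)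
  have 2: "ito_integral P W (\<lambda>s \<omega>'. (C *\<^sub>v x s \<omega>' + D *\<^sub>v u s \<omega>') $ i) t =
      ito_integral P W (\<lambda>s \<omega>'. (C' *\<^sub>v x s \<omega>' + D' *\<^sub>v u' s \<omega>') $ i) t" if "t \<in> {0..T}" for t i
    using that assms(2) by (intro ito_integral_cong AE_I2) auto
  show ?thesis
    unfolding sde_solution_def
  proof (intro conjI ballI)
    show "x \<in> L2_adapted P W T (dim_col E)" using sol unfolding sde_solution_def by blast
    fix t assume t: "t \<in> {0..T}"
    from sol t have "AE \<omega> in P. E *\<^sub>v x t \<omega> = x0
          + vec (dim_row E) (\<lambda>i. LBINT s:{0..t}. (A *\<^sub>v x s \<omega> + B *\<^sub>v u s \<omega>) $ i)
          + vec (dim_row E) (\<lambda>i. ito_integral P W (\<lambda>s \<omega>'. (C *\<^sub>v x s \<omega>' + D *\<^sub>v u s \<omega>') $ i) t \<omega>)"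
      unfolding sde_solution_def by blast
    then show "AE \<omega> in P. E *\<^sub>v x t \<omega> = x0
          + vec (dim_row E) (\<lambda>i. LBINT s:{0..t}. (A' *\<^sub>v x s \<omega> + B' *\<^sub>v u' s \<omega>) $ i)
          + vec (dim_row E) (\<lambda>i. ito_integral P W (\<lambda>s \<omega>'. (C' *\<^sub>v x s \<omega>' + D' *\<^sub>v u' s \<omega>') $ i) t \<omega>)"
      using AE_space by eventually_elim (simp add: 1[OF t] 2[OF t])
  qed
qed

text \<open>Stated in one direction; for an invertible matrix the converse is the same lemma applied
  to the inverse.\<close>

lemma sde_solution_mult_left:
  assumes T: "0 < T" and M: "M \<in> carrier_mat d d"
    and c: "E \<in> carrier_mat d n" "A \<in> carrier_mat d n" "C \<in> carrier_mat d n" "B \<in> carrier_mat d r" "D \<in> carrier_mat d r"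
    and x0: "x0 \<in> carrier_vec d" and u: "u \<in> L2_adapted P W T r"
    and sol: "sde_solution P W T E A B C D x0 u x"
  shows "sde_solution P W T (M * E) (M * A) (M * B) (M * C) (M * D) (M *\<^sub>v x0) u x"
proof -
  have x: "x \<in> L2_adapted P W T n"
    and p: "\<And>i. i < d \<Longrightarrow> ito_process T (x0 $ i) (\<lambda>t \<omega>. (E *\<^sub>v x t \<omega>) $ i)
       (coord T (\<lambda>s \<omega>. A *\<^sub>v x s \<omega> + B *\<^sub>v u s \<omega>) i) (coord T (\<lambda>s \<omega>. C *\<^sub>v x s \<omega> + D *\<^sub>v u s \<omega>) i)"
    using sol unfolding sde_solution_iff[OF c(1) x0] by auto
  have L2: "(\<lambda>s \<omega>. G *\<^sub>v x s \<omega> + G' *\<^sub>v u s \<omega>) \<in> L2_adapted P W T d"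
    if "G \<in> carrier_mat d n" "G' \<in> carrier_mat d r" for G G'
    by (rule L2_adapted_add[OF L2_adapted_mult_mat_vec[OF x that(1)] L2_adapted_mult_mat_vec[OF u that(2)]])
  have lin: "coord T (\<lambda>s \<omega>. (M * G) *\<^sub>v x s \<omega> + (M * G') *\<^sub>v u s \<omega>) i s \<omega> =
      (\<Sum>k<d. M $$ (i, k) * coord T (\<lambda>s \<omega>. G *\<^sub>v x s \<omega> + G' *\<^sub>v u s \<omega>) k s \<omega>)"
    if G: "G \<in> carrier_mat d n" "G' \<in> carrier_mat d r" and i: "i < d" and w: "\<omega> \<in> space P" for G G' i s \<omega>
  proof -
    have "(M * G) *\<^sub>v x s \<omega> + (M * G') *\<^sub>v u s \<omega> = M *\<^sub>v (G *\<^sub>v x s \<omega> + G' *\<^sub>v u s \<omega>)" if "s \<in> {0..T}"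
      using M G L2_adapted_carrier[OF x that w] L2_adapted_carrier[OF u that w]
      by (simp add: mult_add_distrib_mat_vec[of M d d])
    then have "coord T (\<lambda>s \<omega>. (M * G) *\<^sub>v x s \<omega> + (M * G') *\<^sub>v u s \<omega>) i s \<omega> =
      coord T (\<lambda>s \<omega>. M *\<^sub>v (G *\<^sub>v x s \<omega> + G' *\<^sub>v u s \<omega>)) i s \<omega>"
      by (auto simp: coord_def indicator_def)
    then show ?thesis using coord_mult_mat_vec[OF L2[OF G] M i w] by simp
  qed
  have "ito_process T ((M *\<^sub>v x0) $ i) (\<lambda>t \<omega>. ((M * E) *\<^sub>v x t \<omega>) $ i)
       (coord T (\<lambda>s \<omega>. (M * A) *\<^sub>v x s \<omega> + (M * B) *\<^sub>v u s \<omega>) i) (coord T (\<lambda>s \<omega>. (M * C) *\<^sub>v x s \<omega> + (M * D) *\<^sub>v u s \<omega>) i)"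
    if i: "i < d" for i
  proof (rule ito_process_cong)
    show "ito_process T ((M *\<^sub>v x0) $ i) (\<lambda>t \<omega>. \<Sum>k<d. M $$ (i, k) * (E *\<^sub>v x t \<omega>) $ k)
      (\<lambda>s \<omega>. \<Sum>k<d. M $$ (i, k) * coord T (\<lambda>s \<omega>. A *\<^sub>v x s \<omega> + B *\<^sub>v u s \<omega>) k s \<omega>)
      (\<lambda>s \<omega>. \<Sum>k<d. M $$ (i, k) * coord T (\<lambda>s \<omega>. C *\<^sub>v x s \<omega> + D *\<^sub>v u s \<omega>) k s \<omega>)"
    proof -
      have "(M *\<^sub>v x0) $ i = (\<Sum>k<d. M $$ (i, k) * x0 $ k)"
        using M x0 i by (rule index_mult_mat_vec_sum)
      then show ?thesis
        using L2_adapted_coord[OF L2[OF c(2,4)]] L2_adapted_coord[OF L2[OF c(3,5)]] p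
        by (auto intro!: ito_process_sum[OF T])
    qed
    show "measurable_process (\<lambda>s \<omega>. \<Sum>k<d. M $$ (i, k) * coord T (\<lambda>s \<omega>. A *\<^sub>v x s \<omega> + B *\<^sub>v u s \<omega>) k s \<omega>)"
      using L2_adapted_coord[OF L2[OF c(2,4)]]
      by (intro L2_processD(1)[of T] L2_process_sum L2_process_cmult) auto
    have "(\<lambda>s \<omega>. (M * A) *\<^sub>v x s \<omega> + (M * B) *\<^sub>v u s \<omega>) \<in> L2_adapted P W T d"
      using M c by (intro L2) auto
    from L2_processD(1)[OF L2_adapted_coord[OF this i]]
    show "measurable_process (coord T (\<lambda>s \<omega>. (M * A) *\<^sub>v x s \<omega> + (M * B) *\<^sub>v u s \<omega>) i)" .
    show "AE \<omega> in P. (\<Sum>k<d. M $$ (i, k) * (E *\<^sub>v x t \<omega>) $ k) = ((M * E) *\<^sub>v x t \<omega>) $ i" if "0 \<le> t" "t \<le> T" for t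
    proof (rule AE_I2)
      fix \<omega> assume "\<omega> \<in> space P"
      then have "x t \<omega> \<in> carrier_vec n" using L2_adapted_carrier[OF x] that by auto
      then have "((M * E) *\<^sub>v x t \<omega>) $ i = (M *\<^sub>v (E *\<^sub>v x t \<omega>)) $ i" using M c by simp
      also have "\<dots> = (\<Sum>k<d. M $$ (i, k) * (E *\<^sub>v x t \<omega>) $ k)"
        using M c i by (intro index_mult_mat_vec_sum) (auto intro: carrier_vecI)
      finally show "(\<Sum>k<d. M $$ (i, k) * (E *\<^sub>v x t \<omega>) $ k) = ((M * E) *\<^sub>v x t \<omega>) $ i" by simp
    qed
    show "AE \<omega> in P. AE s in lborel. s \<in> {0..T} \<longrightarrow>
      (\<Sum>k<d. M $$ (i, k) * coord T (\<lambda>s \<omega>. A *\<^sub>v x s \<omega> + B *\<^sub>v u s \<omega>) k s \<omega>) =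
      coord T (\<lambda>s \<omega>. (M * A) *\<^sub>v x s \<omega> + (M * B) *\<^sub>v u s \<omega>) i s \<omega>"
      using lin[OF c(2,4) i] by (intro AE_I2) simp
    show "AE \<omega> in P. AE s in lborel. s \<in> {0..T} \<longrightarrow>
      (\<Sum>k<d. M $$ (i, k) * coord T (\<lambda>s \<omega>. C *\<^sub>v x s \<omega> + D *\<^sub>v u s \<omega>) k s \<omega>) =
      coord T (\<lambda>s \<omega>. (M * C) *\<^sub>v x s \<omega> + (M * D) *\<^sub>v u s \<omega>) i s \<omega>"
      using lin[OF c(3,5) i] by (intro AE_I2) simp
  qed
  moreover have "M * E \<in> carrier_mat d n" "M *\<^sub>v x0 \<in> carrier_vec d" using M c x0 by auto
  ultimately show ?thesis using x by (simp add: sde_solution_iff)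
qed

text \<open>A change of unknown: by associativity the two equations contain the same vectors at
  every time and path.\<close>

lemma sde_solution_mult_right:
  assumes N: "N \<in> carrier_mat n n"
    and c: "E \<in> carrier_mat d n" "A \<in> carrier_mat d n" "C \<in> carrier_mat d n"
    and x0: "x0 \<in> carrier_vec d" and z: "z \<in> L2_adapted P W T n"
  shows "sde_solution P W T E A B C D x0 u (\<lambda>t \<omega>. N *\<^sub>v z t \<omega>) \<longleftrightarrow>
    sde_solution P W T (E * N) (A * N) B (C * N) D x0 u z"
proof -
  have assoc: "(G * N) *\<^sub>v z t \<omega> = G *\<^sub>v (N *\<^sub>v z t \<omega>)" if "t \<in> {0..T}" "\<omega> \<in> space P" "G \<in> carrier_mat d n" for t \<omega> G
    using that N L2_adapted_carrier[OF z that(1,2)] by simp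
  have Nz: "(\<lambda>t \<omega>. N *\<^sub>v z t \<omega>) \<in> L2_adapted P W T n"
    using z N by (rule L2_adapted_mult_mat_vec)
  have EN: "E * N \<in> carrier_mat d n" using N c by auto
  have 1: "(LBINT s:{0..t}. (A *\<^sub>v (N *\<^sub>v z s \<omega>) + B *\<^sub>v u s \<omega>) $ i) = (LBINT s:{0..t}. ((A * N) *\<^sub>v z s \<omega> + B *\<^sub>v u s \<omega>) $ i)"
    if "t \<in> {0..T}" "\<omega> \<in> space P" for t \<omega> i
    unfolding set_lebesgue_integral_def
    using that assoc[OF _ that(2) c(2)] by (intro Bochner_Integration.integral_cong) (auto simp: indicator_def)
  have 2: "ito_integral P W (\<lambda>s \<omega>'. (C *\<^sub>v (N *\<^sub>v z s \<omega>') + D *\<^sub>v u s \<omega>') $ i) t =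
      ito_integral P W (\<lambda>s \<omega>'. ((C * N) *\<^sub>v z s \<omega>' + D *\<^sub>v u s \<omega>') $ i) t" if "t \<in> {0..T}" for t i
    using that assoc[OF _ _ c(3)] by (intro ito_integral_cong AE_I2) auto
  have dims: "dim_row (E * N) = dim_row E" "dim_col E = n" "dim_col (E * N) = n" using N c by auto
  have "(AE \<omega> in P. E *\<^sub>v (N *\<^sub>v z t \<omega>) = x0
          + vec (dim_row E) (\<lambda>i. LBINT s:{0..t}. (A *\<^sub>v (N *\<^sub>v z s \<omega>) + B *\<^sub>v u s \<omega>) $ i)
          + vec (dim_row E) (\<lambda>i. ito_integral P W (\<lambda>s \<omega>'. (C *\<^sub>v (N *\<^sub>v z s \<omega>') + D *\<^sub>v u s \<omega>') $ i) t \<omega>)) \<longleftrightarrow>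
    (AE \<omega> in P. (E * N) *\<^sub>v z t \<omega> = x0
          + vec (dim_row E) (\<lambda>i. LBINT s:{0..t}. ((A * N) *\<^sub>v z s \<omega> + B *\<^sub>v u s \<omega>) $ i)
          + vec (dim_row E) (\<lambda>i. ito_integral P W (\<lambda>s \<omega>'. ((C * N) *\<^sub>v z s \<omega>' + D *\<^sub>v u s \<omega>') $ i) t \<omega>))"
    if t: "t \<in> {0..T}" for t
    unfolding 2[OF t] using 1[OF t] assoc[OF t _ c(1)] by (intro AE_cong) simp
  then show ?thesis
    unfolding sde_solution_def dims using Nz z by simp
qed

text \<open>Uniqueness is stated at each time, which is stronger than for almost every time and is
  what the terminal cost needs.\<close>

lemma linear_sde_vec:
  assumes T: "0 < T" and A: "A \<in> carrier_mat h h" and C: "C \<in> carrier_mat h h"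
    and B: "B \<in> carrier_mat h r" and D: "D \<in> carrier_mat h r"
    and x0: "x0 \<in> carrier_vec h" and v: "v \<in> L2_adapted P W T r"
  shows "\<exists>x. sde_solution P W T (1\<^sub>m h) A B C D x0 v x"
    "\<And>x y t. sde_solution P W T (1\<^sub>m h) A B C D x0 v x \<Longrightarrow> sde_solution P W T (1\<^sub>m h) A B C D x0 v y \<Longrightarrow>
      t \<in> {0..T} \<Longrightarrow> AE \<omega> in P. x t \<omega> = y t \<omega>"
proof -
  let ?f = "coord T (\<lambda>s \<omega>. B *\<^sub>v v s \<omega>)" and ?g = "coord T (\<lambda>s \<omega>. D *\<^sub>v v s \<omega>)"
  have Bv: "(\<lambda>s \<omega>. B *\<^sub>v v s \<omega>) \<in> L2_adapted P W T h" using v B by (rule L2_adapted_mult_mat_vec)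
  have Dv: "(\<lambda>s \<omega>. D *\<^sub>v v s \<omega>) \<in> L2_adapted P W T h" using v D by (rule L2_adapted_mult_mat_vec)
  interpret S: linear_sde P W T h "\<lambda>i j. A $$ (i, j)" "\<lambda>i j. C $$ (i, j)" ?f ?g "\<lambda>i. x0 $ i"
    using T L2_adapted_coord[OF Bv] L2_adapted_coord[OF Dv] by unfold_locales auto
  have coord_rhs: "coord T (\<lambda>s \<omega>. G *\<^sub>v x s \<omega> + G' *\<^sub>v v s \<omega>) i s \<omega> =
      (\<Sum>j<h. G $$ (i, j) * coord T x j s \<omega>) + coord T (\<lambda>s \<omega>. G' *\<^sub>v v s \<omega>) i s \<omega>"
    if "x \<in> L2_adapted P W T h" "G \<in> carrier_mat h h" "G' \<in> carrier_mat h r" "i < h" "\<omega> \<in> space P" for x G G' i s \<omega>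
    using coord_add[OF L2_adapted_mult_mat_vec[OF that(1,2)] L2_adapted_mult_mat_vec[OF v that(3)] that(4,5)]
      coord_mult_mat_vec[OF that(1,2,4,5)] by simp
  have iff: "sde_solution P W T (1\<^sub>m h) A B C D x0 v x \<longleftrightarrow>
     (\<forall>i<h. ito_process T (x0 $ i) (coord T x i) (S.drift (coord T x) i) (S.diffusion (coord T x) i))"
    if x: "x \<in> L2_adapted P W T h" for x
  proof -
    have L: "S.L2_family (coord T x)" using L2_adapted_coord[OF x] by blast
    have "ito_process T (x0 $ i) (\<lambda>t \<omega>. (1\<^sub>m h *\<^sub>v x t \<omega>) $ i)
       (coord T (\<lambda>s \<omega>. A *\<^sub>v x s \<omega> + B *\<^sub>v v s \<omega>) i) (coord T (\<lambda>s \<omega>. C *\<^sub>v x s \<omega> + D *\<^sub>v v s \<omega>) i) \<longleftrightarrow>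
      ito_process T (x0 $ i) (coord T x i) (S.drift (coord T x) i) (S.diffusion (coord T x) i)" if i: "i < h" for i
    proof -
      have m1: "measurable_process (coord T (\<lambda>s \<omega>. A *\<^sub>v x s \<omega> + B *\<^sub>v v s \<omega>) i)"
        using L2_processD(1)[OF L2_adapted_coord[OF L2_adapted_add[OF L2_adapted_mult_mat_vec[OF x A] Bv] i]] .
      have m2: "measurable_process (S.drift (coord T x) i)"
        using L2_processD(1)[OF S.drift_L2[OF L i]] .
      have e: "(1\<^sub>m h *\<^sub>v x t \<omega>) $ i = coord T x i t \<omega>" if "0 \<le> t" "t \<le> T" "\<omega> \<in> space P" for t \<omega>
        using L2_adapted_carrier[OF x _ that(3), of t] that i by (simp add: coord_def)
      have a: "coord T (\<lambda>s \<omega>. A *\<^sub>v x s \<omega> + B *\<^sub>v v s \<omega>) i s \<omega> = S.drift (coord T x) i s \<omega>" if "\<omega> \<in> space P" for s \<omega>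
        using coord_rhs[OF x A B i that] by (simp add: S.drift_def)
      have b: "coord T (\<lambda>s \<omega>. C *\<^sub>v x s \<omega> + D *\<^sub>v v s \<omega>) i s \<omega> = S.diffusion (coord T x) i s \<omega>" if "\<omega> \<in> space P" for s \<omega>
        using coord_rhs[OF x C D i that] by (simp add: S.diffusion_def)
      show ?thesis
        by (rule iffI; erule ito_process_cong[rotated -1]) (use m1 m2 e a b in \<open>auto intro!: AE_I2\<close>)
    qed
    then show ?thesis
      using x by (simp add: sde_solution_iff[OF one_carrier_mat x0])
  qed
  obtain X where X: "S.L2_family X" "\<And>i. i < h \<Longrightarrow> ito_process T (x0 $ i) (X i) (S.drift X i) (S.diffusion X i)"
    using S.ito_solution_exists by blast
  define x where "x = (\<lambda>t \<omega>. vec h (\<lambda>i. X i t \<omega>))"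
  have cx: "coord T x i s \<omega> = indicator {0..T} s * X i s \<omega>" if "i < h" for i s \<omega>
    using that by (simp add: coord_def x_def)
  have x: "x \<in> L2_adapted P W T h"
  proof (rule L2_adaptedI[OF _ _ cx])
    show "L2_process T (\<lambda>s \<omega>. indicator {0..T} s * X i s \<omega>)" if i: "i < h" for i
    proof -
      note D = L2_processD[OF X(1)[rule_format, OF i]]
      have "energy {0..T} (\<lambda>s \<omega>. indicator {0..T} s * X i s \<omega>) = energy {0..T} (X i)"
        by (intro energy_cong) simp
      then show ?thesis
        using D unfolding L2_process_def by (auto intro!: measurable_process_time)
    qed
  qed (auto simp: x_def)
  have "sde_solution P W T (1\<^sub>m h) A B C D x0 v x"
    unfolding iff[OF x]
  proof (intro allI impI)
    fix i assume i: "i < h"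
    have L: "S.L2_family (coord T x)" using L2_adapted_coord[OF x] by blast
    show "ito_process T (x0 $ i) (coord T x i) (S.drift (coord T x) i) (S.diffusion (coord T x) i)"
    proof (rule ito_process_cong[OF _ _ _ _ _ X(2)[OF i]])
      show "measurable_process (S.drift X i)" using L2_processD(1)[OF S.drift_L2[OF X(1) i]] .
      show "measurable_process (S.drift (coord T x) i)" using L2_processD(1)[OF S.drift_L2[OF L i]] .
    qed (use i cx in \<open>auto intro!: AE_I2 simp: S.drift_def S.diffusion_def\<close>)
  qed
  then show "\<exists>x. sde_solution P W T (1\<^sub>m h) A B C D x0 v x" by blast
  fix x y t
  assume sx: "sde_solution P W T (1\<^sub>m h) A B C D x0 v x" and sy: "sde_solution P W T (1\<^sub>m h) A B C D x0 v y"
    and t: "t \<in> {0..T}"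
  have x: "x \<in> L2_adapted P W T h" and y: "y \<in> L2_adapted P W T h"
    using sx sy by (auto simp: sde_solution_iff[OF one_carrier_mat x0])
  have "AE \<omega> in P. coord T x i t \<omega> = coord T y i t \<omega>" if i: "i < h" for i
  proof (rule S.ito_solution_unique[OF _ _ _ _ i])
    show "S.L2_family (coord T x)" "S.L2_family (coord T y)"
      using L2_adapted_coord[OF x] L2_adapted_coord[OF y] by blast+
  qed (use sx sy iff[OF x] iff[OF y] t in auto)
  then have "AE \<omega> in P. \<forall>i\<in>{..<h}. coord T x i t \<omega> = coord T y i t \<omega>"
    by (subst AE_ball_countable) auto
  then show "AE \<omega> in P. x t \<omega> = y t \<omega>"
    using AE_space
  proof eventually_elim
    case (elim \<omega>)
    then show ?case
      using L2_adapted_carrier[OF x t, of \<omega>] L2_adapted_carrier[OF y t, of \<omega>] t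
      by (intro eq_vecI) (auto simp: coord_def)
  qed
qed

end

section \<open>Vectors, block matrices and quadratic forms\<close>

lemma zero_mat_mult_vec: "x \<in> carrier_vec n \<Longrightarrow> 0\<^sub>m d n *\<^sub>v x = 0\<^sub>v d"
  for x :: "'a :: semiring_0 vec"
  by (intro eq_vecI) (auto simp: scalar_prod_def)

lemma append_vec_assoc: "(x @\<^sub>v y) @\<^sub>v z = x @\<^sub>v (y @\<^sub>v z)"
  by (intro eq_vecI) auto

lemma quadratic_form_congruence:
  fixes M :: "real mat"
  assumes M: "M \<in> carrier_mat a b" and S: "S \<in> carrier_mat a a" and w: "w \<in> carrier_vec b"
  shows "w \<bullet> ((transpose_mat M * S * M) *\<^sub>v w) = (M *\<^sub>v w) \<bullet> (S *\<^sub>v (M *\<^sub>v w))"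
proof -
  have e: "(transpose_mat M * S * M) *\<^sub>v w = transpose_mat M *\<^sub>v (S *\<^sub>v (M *\<^sub>v w))"
    using M S w by (simp add: assoc_mult_mat_vec[of _ b a _ b] assoc_mult_mat_vec[of _ b a _ a])
  have "w \<bullet> ((transpose_mat M * S * M) *\<^sub>v w) = (transpose_mat M *\<^sub>v (S *\<^sub>v (M *\<^sub>v w))) \<bullet> w"
    unfolding e using M S w by (intro comm_scalar_prod[of _ b]) auto
  also have "\<dots> = (S *\<^sub>v (M *\<^sub>v w)) \<bullet> (M *\<^sub>v w)"
    using M S w by (intro transpose_vec_mult_scalar) auto
  also have "\<dots> = (M *\<^sub>v w) \<bullet> (S *\<^sub>v (M *\<^sub>v w))"
    using M S w by (intro comm_scalar_prod[of _ a]) auto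
  finally show ?thesis .
qed

text \<open>\<open>invertible_mat\<close> asks for some two-sided inverse, while
  \<open>mat_inverse\<close> is computed; membership in the units of \<open>ring_mat\<close>
  connects them.\<close>

lemma mat_inverse_invertible:
  fixes M :: "'a :: field mat"
  assumes M: "M \<in> carrier_mat n n" and inv: "invertible_mat M"
  shows "the (mat_inverse M) \<in> carrier_mat n n" "M * the (mat_inverse M) = 1\<^sub>m n" "the (mat_inverse M) * M = 1\<^sub>m n"
proof -
  obtain N where N: "M * N = 1\<^sub>m (dim_row M)" "N * M = 1\<^sub>m (dim_row N)"
    using inv unfolding invertible_mat_def inverts_mat_def by blast
  have "dim_col N = n" using arg_cong[OF N(1), of dim_col] M by simp
  moreover have "dim_row N = n" using arg_cong[OF N(2), of dim_col] M by simp
  ultimately have "N \<in> carrier_mat n n" by auto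
  then have "M \<in> Units (ring_mat TYPE('a) n ())"
    using N M unfolding Units_def ring_mat_def by auto
  then obtain N' where "mat_inverse M = Some N'"
    using mat_inverse(1)[OF M, where b="()"] by (cases "mat_inverse M") auto
  with mat_inverse(2)[OF M this]
  show "the (mat_inverse M) \<in> carrier_mat n n" "M * the (mat_inverse M) = 1\<^sub>m n" "the (mat_inverse M) * M = 1\<^sub>m n"
    by auto
qed

lemma transpose_selector_mult_vec:
  fixes y :: "real vec"
  assumes y: "y \<in> carrier_vec (h + q)"
  shows "transpose_mat (1\<^sub>m h @\<^sub>r 0\<^sub>m q h) *\<^sub>v y = vec_first y h"
    "transpose_mat (0\<^sub>m h q @\<^sub>r 1\<^sub>m q) *\<^sub>v y = vec_last y q"
proof -
  have J: "(1\<^sub>m h :: real mat) @\<^sub>r 0\<^sub>m q h \<in> carrier_mat (h + q) h" "(0\<^sub>m h q :: real mat) @\<^sub>r 1\<^sub>m q \<in> carrier_mat (h + q) q"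
    by (intro carrier_append_rows; simp)+
  show "transpose_mat (1\<^sub>m h @\<^sub>r 0\<^sub>m q h) *\<^sub>v y = vec_first y h"
  proof (rule eq_vecI)
    fix i assume "i < dim_vec (vec_first y h)"
    then have i: "i < h" by simp
    have "(transpose_mat (1\<^sub>m h @\<^sub>r 0\<^sub>m q h) *\<^sub>v y) $ i = (\<Sum>j<h + q. transpose_mat (1\<^sub>m h @\<^sub>r 0\<^sub>m q h) $$ (i, j) * y $ j)"
      using J(1) y i by (intro index_mult_mat_vec_sum) auto
    also have "\<dots> = (\<Sum>j<h + q. if j = i then y $ j else 0)"
      using J(1) i by (intro sum.cong) (auto simp: append_rows_def)
    also have "\<dots> = vec_first y h $ i" using i by (simp add: vec_first_def)
    finally show "(transpose_mat (1\<^sub>m h @\<^sub>r 0\<^sub>m q h) *\<^sub>v y) $ i = vec_first y h $ i" .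
  qed (simp add: carrier_matD[OF J(1)])
  show "transpose_mat (0\<^sub>m h q @\<^sub>r 1\<^sub>m q) *\<^sub>v y = vec_last y q"
  proof (rule eq_vecI)
    fix i assume "i < dim_vec (vec_last y q)"
    then have i: "i < q" by simp
    have "(transpose_mat (0\<^sub>m h q @\<^sub>r 1\<^sub>m q) *\<^sub>v y) $ i = (\<Sum>j<h + q. transpose_mat (0\<^sub>m h q @\<^sub>r 1\<^sub>m q) $$ (i, j) * y $ j)"
      using J(2) y i by (intro index_mult_mat_vec_sum) auto
    also have "\<dots> = (\<Sum>j<h + q. if j = h + i then y $ j else 0)"
      using J(2) i by (intro sum.cong) (auto simp: append_rows_def)
    also have "\<dots> = vec_last y q $ i" using i y by (simp add: vec_last_def)
    finally show "(transpose_mat (0\<^sub>m h q @\<^sub>r 1\<^sub>m q) *\<^sub>v y) $ i = vec_last y q $ i" .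
  qed (simp add: carrier_matD[OF J(2)])
qed

context brownian
begin

section \<open>Almost everywhere equality of vector processes\<close>

lemma ito_process_pointwise:
  assumes "\<And>t \<omega>. t \<in> {0..T} \<Longrightarrow> \<omega> \<in> space P \<Longrightarrow> e t \<omega> = e' t \<omega>"
    and "\<And>t \<omega>. t \<in> {0..T} \<Longrightarrow> \<omega> \<in> space P \<Longrightarrow> a t \<omega> = a' t \<omega>"
    and "\<And>t \<omega>. t \<in> {0..T} \<Longrightarrow> \<omega> \<in> space P \<Longrightarrow> b t \<omega> = b' t \<omega>"
  shows "ito_process T z e a b \<longleftrightarrow> ito_process T z e' a' b'"
  unfolding ito_process_def
proof (intro ball_cong refl AE_cong)
  fix t \<omega> assume t: "t \<in> {0..T}" and w: "\<omega> \<in> space P"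
  have "time_integral a t \<omega> = time_integral a' t \<omega>"
    unfolding time_integral_def using t assms(2)[OF _ w]
    by (intro Bochner_Integration.integral_cong) (auto simp: indicator_def)
  moreover have "ito_integral P W b t = ito_integral P W b' t"
    using t assms(3) by (intro ito_integral_cong AE_I2) auto
  ultimately show "(e t \<omega> = z + time_integral a t \<omega> + ito_integral P W b t \<omega>) =
      (e' t \<omega> = z + time_integral a' t \<omega> + ito_integral P W b' t \<omega>)"
    using assms(1)[OF t w] by simp
qed

lemma L2_adapted_AE_zero:
  assumes y: "y \<in> L2_adapted P W T k" and 0: "\<And>i. i < k \<Longrightarrow> energy {0..T} (coord T y i) = 0"
  shows "AE \<omega> in P. AE s in lborel. s \<in> {0..T} \<longrightarrow> y s \<omega> = 0\<^sub>v k"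
proof -
  have "AE \<omega> in P. AE s in lborel. s \<in> {0..T} \<longrightarrow> coord T y i s \<omega> = 0" if "i \<in> {..<k}" for i
    using that 0 L2_processD(1)[OF L2_adapted_coord[OF y]] by (intro energy_eq_0D) auto
  then have "AE \<omega> in P. \<forall>i\<in>{..<k}. AE s in lborel. s \<in> {0..T} \<longrightarrow> coord T y i s \<omega> = 0"
    by (subst AE_ball_countable) auto
  then show ?thesis
    using AE_space
  proof eventually_elim
    case (elim \<omega>)
    then have "AE s in lborel. \<forall>i\<in>{..<k}. s \<in> {0..T} \<longrightarrow> coord T y i s \<omega> = 0"
      by (subst AE_ball_countable) auto
    then show ?case
    proof eventually_elim
      case (elim s)
      show ?case
      proof
        assume s: "s \<in> {0..T}"
        then have "y s \<omega> \<in> carrier_vec k" using L2_adapted_carrier[OF y s] \<open>\<omega> \<in> space P\<close> by blast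
        then show "y s \<omega> = 0\<^sub>v k"
          using elim s by (intro eq_vecI) (auto simp: coord_def)
      qed
    qed
  qed
qed

text \<open>The exceptional set in the hypothesis may depend on the time; Tonelli, through
  \<open>energy_swap\<close>, exchanges the two almost-everywhere statements.\<close>

lemma L2_adapted_AE_eq:
  assumes x: "x \<in> L2_adapted P W T k" and y: "y \<in> L2_adapted P W T k"
    and eq: "\<And>t. t \<in> {0..T} \<Longrightarrow> AE \<omega> in P. x t \<omega> = y t \<omega>"
  shows "AE \<omega> in P. AE s in lborel. s \<in> {0..T} \<longrightarrow> x s \<omega> = y s \<omega>"
proof -
  have "AE \<omega> in P. AE s in lborel. s \<in> {0..T} \<longrightarrow> coord T x i s \<omega> - coord T y i s \<omega> = 0" if i: "i \<in> {..<k}" for i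
  proof (rule energy_eq_0D)
    show m: "measurable_process (\<lambda>s \<omega>. coord T x i s \<omega> - coord T y i s \<omega>)"
      using i by (intro measurable_process_diff L2_processD(1)[OF L2_adapted_coord[OF x]]
          L2_processD(1)[OF L2_adapted_coord[OF y]]) auto
    have "moment2 (\<lambda>\<omega>. coord T x i s \<omega> - coord T y i s \<omega>) = 0" if "s \<in> {0..T}" for s
    proof -
      have "moment2 (\<lambda>\<omega>. coord T x i s \<omega> - coord T y i s \<omega>) = moment2 (\<lambda>\<omega>. 0)"
      proof (rule moment2_cong_AE)
        show "AE \<omega> in P. coord T x i s \<omega> - coord T y i s \<omega> = 0"
          using eq[OF that] by eventually_elim (simp add: coord_def)
      qed
      then show ?thesis by (simp add: moment2_def)
    qed
    then have "(\<integral>\<^sup>+s. moment2 (\<lambda>\<omega>. coord T x i s \<omega> - coord T y i s \<omega>) * indicator {0..T} s \<partial>lborel) = (\<integral>\<^sup>+s. 0 \<partial>(lborel :: real measure))"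
      by (intro nn_integral_cong) (auto simp: indicator_def)
    then show "energy {0..T} (\<lambda>s \<omega>. coord T x i s \<omega> - coord T y i s \<omega>) = 0"
      using energy_swap[OF m, of "{0..T}"] by simp
  qed simp
  then have "AE \<omega> in P. \<forall>i\<in>{..<k}. AE s in lborel. s \<in> {0..T} \<longrightarrow> coord T x i s \<omega> - coord T y i s \<omega> = 0"
    by (subst AE_ball_countable) auto
  then show ?thesis
    using AE_space
  proof eventually_elim
    case (elim \<omega>)
    then have "AE s in lborel. \<forall>i\<in>{..<k}. s \<in> {0..T} \<longrightarrow> coord T x i s \<omega> - coord T y i s \<omega> = 0"
      by (subst AE_ball_countable) auto
    then show ?case
    proof eventually_elim
      case (elim s)
      show ?case
      proof
        assume s: "s \<in> {0..T}"
        then have "x s \<omega> \<in> carrier_vec k" "y s \<omega> \<in> carrier_vec k"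
          using L2_adapted_carrier[OF x s] L2_adapted_carrier[OF y s] \<open>\<omega> \<in> space P\<close> by blast+
        then show "x s \<omega> = y s \<omega>"
          using elim s by (intro eq_vecI) (auto simp: coord_def)
      qed
    qed
  qed
qed

text \<open>The cutoff makes the product jointly measurable on all of real time, since the vectors
  are controlled on \<open>{0..T}\<close> only.\<close>

definition cut_prod :: "real \<Rightarrow> (real \<Rightarrow> 'w \<Rightarrow> real vec) \<Rightarrow> (real \<Rightarrow> 'w \<Rightarrow> real vec) \<Rightarrow> real \<Rightarrow> 'w \<Rightarrow> real" where
  "cut_prod T x y s \<omega> = indicator {0..T} s * (x s \<omega> \<bullet> y s \<omega>)"

lemma measurable_process_cut_prod:
  assumes x: "x \<in> L2_adapted P W T k" and y: "y \<in> L2_adapted P W T k"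
  shows "measurable_process (cut_prod T x y)"
proof -
  have eq: "cut_prod T x y s \<omega> = (\<Sum>i<k. coord T x i s \<omega> * coord T y i s \<omega>)" if w: "\<omega> \<in> space P" for s \<omega>
  proof (cases "s \<in> {0..T}")
    case True
    then show ?thesis
      using L2_adapted_carrier[OF y True w] by (simp add: cut_prod_def coord_def scalar_prod_def lessThan_atLeast0)
  qed (simp add: cut_prod_def coord_def)
  have "(\<lambda>z. \<Sum>i<k. coord T x i (fst z) (snd z) * coord T y i (fst z) (snd z)) \<in> borel_measurable (borel \<Otimes>\<^sub>M P)"
    using L2_processD(1)[OF L2_adapted_coord[OF x], THEN measurable_process_pair]
      L2_processD(1)[OF L2_adapted_coord[OF y], THEN measurable_process_pair]
    by (intro borel_measurable_sum borel_measurable_times) auto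
  then show ?thesis
    unfolding measurable_process_def case_prod_beta'
    by (rule measurable_cong[THEN iffD2, rotated]) (auto simp: eq space_pair_measure)
qed

lemma measurable_process_at:
  "measurable_process f \<Longrightarrow> f t \<in> borel_measurable P"
  using measurable_process_compose[of f "\<lambda>_. t" P "\<lambda>\<omega>. \<omega>"] by simp

text \<open>Measurable integrands that agree almost everywhere have equal Bochner integrals, also
  where these take their default value, so costs that are not integrable are covered.\<close>

lemma expected_time_integral_cong:
  assumes f: "measurable_process f" and g: "measurable_process g"
    and eq: "AE \<omega> in P. AE s in lborel. s \<in> {0..T} \<longrightarrow> f s \<omega> = g s \<omega>"
  shows "(LINT \<omega>|P. time_integral f T \<omega>) = (LINT \<omega>|P. time_integral g T \<omega>)"
  by (intro integral_cong_AE measurable_process_at measurable_process_time_integral f g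
      time_integral_cong_AE[OF f g eq]) simp

lemma sde_solution_cong_state:
  assumes E: "E \<in> carrier_mat d n" and x0: "x0 \<in> carrier_vec d"
    and eq: "\<And>t \<omega>. t \<in> {0..T} \<Longrightarrow> \<omega> \<in> space P \<Longrightarrow> x t \<omega> = y t \<omega>"
  shows "sde_solution P W T E A B C D x0 u x \<longleftrightarrow> sde_solution P W T E A B C D x0 u y"
proof -
  have "ito_process T (x0 $ i) (\<lambda>t \<omega>. (E *\<^sub>v x t \<omega>) $ i)
       (coord T (\<lambda>s \<omega>. A *\<^sub>v x s \<omega> + B *\<^sub>v u s \<omega>) i) (coord T (\<lambda>s \<omega>. C *\<^sub>v x s \<omega> + D *\<^sub>v u s \<omega>) i) \<longleftrightarrow>
    ito_process T (x0 $ i) (\<lambda>t \<omega>. (E *\<^sub>v y t \<omega>) $ i)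
       (coord T (\<lambda>s \<omega>. A *\<^sub>v y s \<omega> + B *\<^sub>v u s \<omega>) i) (coord T (\<lambda>s \<omega>. C *\<^sub>v y s \<omega> + D *\<^sub>v u s \<omega>) i)" for i
    by (rule ito_process_pointwise) (simp_all add: coord_def eq)
  moreover have "x \<in> L2_adapted P W T n \<longleftrightarrow> y \<in> L2_adapted P W T n"
    using eq by (rule L2_adapted_cong)
  ultimately show ?thesis unfolding sde_solution_iff[OF E x0] by simp
qed

end

section \<open>Equivalence of the two control problems\<close>

locale structured_problem = brownian P W for P :: "'w measure" and W +
  fixes T :: real and n r h :: nat and ms :: "nat list"
    and E A B C D Q H R K M1 N1 A1 B1 B2 C11 C12 C22 D1 D2 :: "real mat"
    and x0 :: "real vec"
  assumes T_pos: "0 < T"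
    and E: "E \<in> carrier_mat n n" and A: "A \<in> carrier_mat n n" and C: "C \<in> carrier_mat n n"
    and B: "B \<in> carrier_mat n r" and D: "D \<in> carrier_mat n r"
    and x0: "x0 \<in> carrier_vec n"
    and Q: "Q \<in> carrier_mat n n" and H: "H \<in> carrier_mat n n" and R: "R \<in> carrier_mat r r"
    and K: "K \<in> carrier_mat r n"
    and struct: "structure_conditions n r E A B C D K M1 N1 h ms A1 B1 B2 C11 C12 C22 D1 D2"
    and initial: "vec_last (M1 *\<^sub>v x0) (n - h) = 0\<^sub>v (n - h)"
begin

section \<open>Blocks and inverses of the structured problem\<close>

definition q :: nat where "q = n - h"

definition G :: "real mat" where "G = diag_block_mat (map (\<lambda>m. jordan_block m 0) ms)"

definition x10 :: "real vec" where "x10 = vec_first (M1 *\<^sub>v x0) h"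

definition M1i :: "real mat" where "M1i = the (mat_inverse M1)"

definition N1i :: "real mat" where "N1i = the (mat_inverse N1)"

lemma n_eq: "n = h + q"
  using struct unfolding structure_conditions_def q_def by simp

lemma blocks:
  shows M1: "M1 \<in> carrier_mat n n" and N1: "N1 \<in> carrier_mat n n"
    and A1: "A1 \<in> carrier_mat h h" and C11: "C11 \<in> carrier_mat h h" and C12: "C12 \<in> carrier_mat h q"
    and C22: "C22 \<in> carrier_mat q q" and B1: "B1 \<in> carrier_mat h r" and D1: "D1 \<in> carrier_mat h r"
    and B2: "B2 \<in> carrier_mat q r" and D2: "D2 \<in> carrier_mat q r" and ms: "sum_list ms = q"
    and E_blocks: "M1 * E * N1 = four_block_mat (1\<^sub>m h) (0\<^sub>m h q) (0\<^sub>m q h) G"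
    and A_blocks: "M1 * (A + B * K) * N1 = four_block_mat A1 (0\<^sub>m h q) (0\<^sub>m q h) (1\<^sub>m q)"
    and B_blocks: "M1 * B = B1 @\<^sub>r B2"
    and C_blocks: "M1 * (C + D * K) * N1 = four_block_mat C11 C12 (0\<^sub>m q h) C22"
    and D_blocks: "M1 * D = D1 @\<^sub>r D2"
    and CB: "C22 * B2 = D2"
  using struct unfolding structure_conditions_def q_def G_def by auto

lemma G: "G \<in> carrier_mat q q"
  unfolding G_def using dim_nilpotent_jordan[of ms] ms by simp

lemma inverses:
  shows M1i: "M1i \<in> carrier_mat n n" and N1i: "N1i \<in> carrier_mat n n"
    and M1i_M1: "M1i * M1 = 1\<^sub>m n" and N1i_N1: "N1i * N1 = 1\<^sub>m n" and N1_N1i: "N1 * N1i = 1\<^sub>m n"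
proof -
  have "invertible_mat M1" "invertible_mat N1"
    using struct unfolding structure_conditions_def by auto
  then show "M1i \<in> carrier_mat n n" "N1i \<in> carrier_mat n n" "M1i * M1 = 1\<^sub>m n" "N1i * N1 = 1\<^sub>m n" "N1 * N1i = 1\<^sub>m n"
    unfolding M1i_def N1i_def using mat_inverse_invertible M1 N1 by auto
qed

lemma x10: "x10 \<in> carrier_vec h"
  unfolding x10_def by simp

lemma M1_x0: "M1 *\<^sub>v x0 = x10 @\<^sub>v 0\<^sub>v q"
proof -
  have "M1 *\<^sub>v x0 \<in> carrier_vec (h + q)" using M1 x0 n_eq by (metis mult_mat_vec_carrier)
  from vec_first_last_append[OF this] show ?thesis
    using initial unfolding x10_def q_def by simp
qed

text \<open>Where \<open>G\<close> has a 1 it reads off the next component, which is never the first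
  of its block, and outside the first rows \<open>B2\<close> is zero.\<close>

lemma B2_row_zero:
  assumes "superdiag ms i" "w \<in> carrier_vec r"
  shows "(B2 *\<^sub>v w) $ Suc i = 0"
proof -
  obtain k p where kp: "k < length ms" "Suc p < ms ! k" "i = sum_list (take k ms) + p"
    using superdiag_block[OF assms(1)] by blast
  have "\<forall>k<length ms. \<forall>i. 1 \<le> i \<and> i < ms ! k \<longrightarrow> (\<forall>j<r. B2 $$ (sum_list (take k ms) + i, j) = 0)"
    using struct unfolding structure_conditions_def by blast
  from this[rule_format, OF kp(1), of "Suc p"] kp have "\<And>j. j < r \<Longrightarrow> B2 $$ (Suc i, j) = 0" by simp
  moreover have "Suc i < q" using superdiag_less[OF assms(1)] ms by simp
  ultimately show ?thesis
    using index_mult_mat_vec_sum[OF B2 assms(2), of "Suc i"] by simp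
qed

lemma G_index:
  "b \<in> carrier_vec q \<Longrightarrow> i < q \<Longrightarrow> (G *\<^sub>v b) $ i = (if superdiag ms i then b $ Suc i else 0)"
  unfolding G_def using nilpotent_jordan_mult_vec[of b ms i] ms by simp

section \<open>Splitting the closed loop\<close>

text \<open>On the left of the second group \<open>z2\<close> appears only through \<open>G\<close>,
  so the first component of each block is constrained through the integrands alone.\<close>

definition split_solution ::
  "(real \<Rightarrow> 'w \<Rightarrow> real vec) \<Rightarrow> (real \<Rightarrow> 'w \<Rightarrow> real vec) \<Rightarrow> (real \<Rightarrow> 'w \<Rightarrow> real vec) \<Rightarrow> bool" where
  "split_solution v z1 z2 \<longleftrightarrow>
     (\<forall>i<h. ito_process T (x10 $ i) (\<lambda>t \<omega>. z1 t \<omega> $ i) (coord T (\<lambda>s \<omega>. A1 *\<^sub>v z1 s \<omega> + B1 *\<^sub>v v s \<omega>) i)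
        (coord T (\<lambda>s \<omega>. C11 *\<^sub>v z1 s \<omega> + C12 *\<^sub>v z2 s \<omega> + D1 *\<^sub>v v s \<omega>) i)) \<and>
     (\<forall>i<q. ito_process T 0 (\<lambda>t \<omega>. (G *\<^sub>v z2 t \<omega>) $ i) (coord T (\<lambda>s \<omega>. z2 s \<omega> + B2 *\<^sub>v v s \<omega>) i)
        (coord T (\<lambda>s \<omega>. C22 *\<^sub>v z2 s \<omega> + D2 *\<^sub>v v s \<omega>) i))"

abbreviation closed_loop_solution :: "(real \<Rightarrow> 'w \<Rightarrow> real vec) \<Rightarrow> (real \<Rightarrow> 'w \<Rightarrow> real vec) \<Rightarrow> bool" where
  "closed_loop_solution v x \<equiv> sde_solution P W T E (A + B * K) B (C + D * K) D x0 v x"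

abbreviation reduced_solution :: "(real \<Rightarrow> 'w \<Rightarrow> real vec) \<Rightarrow> (real \<Rightarrow> 'w \<Rightarrow> real vec) \<Rightarrow> bool" where
  "reduced_solution v x1 \<equiv> sde_solution P W T (1\<^sub>m h) A1 B1 C11 (D1 - C12 * B2) x10 v x1"

lemma block_products:
  assumes a: "a \<in> carrier_vec h" and b: "b \<in> carrier_vec q" and w: "w \<in> carrier_vec r"
  shows "(M1 * E * N1) *\<^sub>v (a @\<^sub>v b) = a @\<^sub>v (G *\<^sub>v b)"
    "(M1 * (A + B * K) * N1) *\<^sub>v (a @\<^sub>v b) + (M1 * B) *\<^sub>v w = (A1 *\<^sub>v a + B1 *\<^sub>v w) @\<^sub>v (b + B2 *\<^sub>v w)"
    "(M1 * (C + D * K) * N1) *\<^sub>v (a @\<^sub>v b) + (M1 * D) *\<^sub>v w =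
      (C11 *\<^sub>v a + C12 *\<^sub>v b + D1 *\<^sub>v w) @\<^sub>v (C22 *\<^sub>v b + D2 *\<^sub>v w)"
proof -
  show "(M1 * E * N1) *\<^sub>v (a @\<^sub>v b) = a @\<^sub>v (G *\<^sub>v b)"
    unfolding E_blocks using mult_mat_vec_split[OF one_carrier_mat G a b] a by simp
  have "(M1 * (A + B * K) * N1) *\<^sub>v (a @\<^sub>v b) = (A1 *\<^sub>v a) @\<^sub>v b"
    unfolding A_blocks using mult_mat_vec_split[OF A1 one_carrier_mat a b] b by simp
  moreover have "(M1 * B) *\<^sub>v w = (B1 *\<^sub>v w) @\<^sub>v (B2 *\<^sub>v w)"
    unfolding B_blocks by (rule mat_mult_append[OF B1 B2 w])
  ultimately show "(M1 * (A + B * K) * N1) *\<^sub>v (a @\<^sub>v b) + (M1 * B) *\<^sub>v w = (A1 *\<^sub>v a + B1 *\<^sub>v w) @\<^sub>v (b + B2 *\<^sub>v w)"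
    using append_vec_add[of "A1 *\<^sub>v a" h "B1 *\<^sub>v w" b q "B2 *\<^sub>v w"] a b w A1 B1 B2 by simp
  have "(M1 * (C + D * K) * N1) *\<^sub>v (a @\<^sub>v b) = (C11 *\<^sub>v a + C12 *\<^sub>v b) @\<^sub>v (C22 *\<^sub>v b)"
    unfolding C_blocks using four_block_mat_mult_vec[OF C11 C12 zero_carrier_mat C22 a b]
      zero_mat_mult_vec[OF a, of q] left_zero_vec[of "C22 *\<^sub>v b" q] C22 b by simp
  moreover have "(M1 * D) *\<^sub>v w = (D1 *\<^sub>v w) @\<^sub>v (D2 *\<^sub>v w)"
    unfolding D_blocks by (rule mat_mult_append[OF D1 D2 w])
  ultimately show "(M1 * (C + D * K) * N1) *\<^sub>v (a @\<^sub>v b) + (M1 * D) *\<^sub>v w =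
      (C11 *\<^sub>v a + C12 *\<^sub>v b + D1 *\<^sub>v w) @\<^sub>v (C22 *\<^sub>v b + D2 *\<^sub>v w)"
    using append_vec_add[of "C11 *\<^sub>v a + C12 *\<^sub>v b" h "D1 *\<^sub>v w" "C22 *\<^sub>v b" q "D2 *\<^sub>v w"] a b w C11 C12 C22 D1 D2
    by simp
qed

text \<open>Both transformations are invertible. Undoing \<open>M1\<close> is left multiplication
  once more, by \<open>M1i\<close>; the factor \<open>N1\<close> is a change of unknown.\<close>

lemma closed_loop_iff_split:
  assumes z1: "z1 \<in> L2_adapted P W T h" and z2: "z2 \<in> L2_adapted P W T q" and v: "v \<in> L2_adapted P W T r"
  shows "closed_loop_solution v (\<lambda>t \<omega>. N1 *\<^sub>v (z1 t \<omega> @\<^sub>v z2 t \<omega>)) \<longleftrightarrow> split_solution v z1 z2"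
proof -
  let ?z = "\<lambda>t \<omega>. z1 t \<omega> @\<^sub>v z2 t \<omega>"
  let ?x = "\<lambda>t \<omega>. N1 *\<^sub>v ?z t \<omega>"
  have z: "?z \<in> L2_adapted P W T n"
    using L2_adapted_append[OF z1 z2] n_eq by simp
  have AK: "A + B * K \<in> carrier_mat n n" and CK: "C + D * K \<in> carrier_mat n n"
    using A B C D K by auto
  have M1x0: "M1 *\<^sub>v x0 \<in> carrier_vec n" using M1 x0 by simp
  have cancel: "M1i * (M1 * X) = X" if "X \<in> carrier_mat n k" for X k
  proof -
    have "M1i * (M1 * X) = (M1i * M1) * X" by (rule assoc_mult_mat[symmetric, OF M1i M1 that])
    then show ?thesis using that M1i_M1 by simp
  qed
  have cancel_vec: "M1i *\<^sub>v (M1 *\<^sub>v x0) = x0"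
    using assoc_mult_mat_vec[OF M1i M1 x0] M1i_M1 x0 by simp
  have "closed_loop_solution v ?x \<longleftrightarrow>
    sde_solution P W T (M1 * E) (M1 * (A + B * K)) (M1 * B) (M1 * (C + D * K)) (M1 * D) (M1 *\<^sub>v x0) v ?x"
  proof
    assume "closed_loop_solution v ?x"
    then show "sde_solution P W T (M1 * E) (M1 * (A + B * K)) (M1 * B) (M1 * (C + D * K)) (M1 * D) (M1 *\<^sub>v x0) v ?x"
      by (rule sde_solution_mult_left[OF T_pos M1 E AK CK B D x0 v])
  next
    assume s: "sde_solution P W T (M1 * E) (M1 * (A + B * K)) (M1 * B) (M1 * (C + D * K)) (M1 * D) (M1 *\<^sub>v x0) v ?x"
    have "sde_solution P W T (M1i * (M1 * E)) (M1i * (M1 * (A + B * K))) (M1i * (M1 * B)) (M1i * (M1 * (C + D * K)))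
        (M1i * (M1 * D)) (M1i *\<^sub>v (M1 *\<^sub>v x0)) v ?x"
      by (rule sde_solution_mult_left[OF T_pos M1i _ _ _ _ _ M1x0 v s])
        (rule mult_carrier_mat[OF M1], rule E AK CK B D)+
    then show "closed_loop_solution v ?x"
      unfolding cancel[OF E] cancel[OF AK] cancel[OF B] cancel[OF CK] cancel[OF D] cancel_vec .
  qed
  also have "\<dots> \<longleftrightarrow> sde_solution P W T (M1 * E * N1) (M1 * (A + B * K) * N1) (M1 * B) (M1 * (C + D * K) * N1) (M1 * D) (M1 *\<^sub>v x0) v ?z"
    using M1 E AK CK by (intro sde_solution_mult_right[OF N1 _ _ _ M1x0 z]) auto
  also have "\<dots> \<longleftrightarrow> (\<forall>i<n. ito_process T ((M1 *\<^sub>v x0) $ i) (\<lambda>t \<omega>. ((M1 * E * N1) *\<^sub>v ?z t \<omega>) $ i)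
       (coord T (\<lambda>s \<omega>. (M1 * (A + B * K) * N1) *\<^sub>v ?z s \<omega> + (M1 * B) *\<^sub>v v s \<omega>) i)
       (coord T (\<lambda>s \<omega>. (M1 * (C + D * K) * N1) *\<^sub>v ?z s \<omega> + (M1 * D) *\<^sub>v v s \<omega>) i))" (is "_ \<longleftrightarrow> (\<forall>i<n. ?S i)")
  proof -
    have "M1 * E * N1 \<in> carrier_mat n n" using M1 E N1 by simp
    from sde_solution_iff[OF this M1x0] show ?thesis using z by simp
  qed
  also have "\<dots> \<longleftrightarrow> (\<forall>i<h. ?S i) \<and> (\<forall>i<q. ?S (h + i))"
  proof -
    have "(\<forall>i<h + q. p i) \<longleftrightarrow> (\<forall>i<h. p i) \<and> (\<forall>i<q. p (h + i))" for p
    proof (intro iffI conjI allI impI)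
      fix i assume "(\<forall>i<h. p i) \<and> (\<forall>i<q. p (h + i))" "i < h + q"
      then show "p i" by (cases "i < h") (auto dest: spec[of _ "i - h"])
    qed auto
    moreover have "i < n \<longleftrightarrow> i < h + q" for i using n_eq by linarith
    ultimately show ?thesis by (simp only:)
  qed
  also have "\<dots> \<longleftrightarrow> split_solution v z1 z2"
  proof -
    have dims: "z1 t \<omega> \<in> carrier_vec h" "z2 t \<omega> \<in> carrier_vec q" "v t \<omega> \<in> carrier_vec r"
      if "t \<in> {0..T}" "\<omega> \<in> space P" for t \<omega>
      using L2_adapted_carrier[OF z1 that] L2_adapted_carrier[OF z2 that] L2_adapted_carrier[OF v that] by auto
    note prods = block_products[OF dims]
    have cs: "G *\<^sub>v z2 t \<omega> \<in> carrier_vec q" "A1 *\<^sub>v z1 t \<omega> + B1 *\<^sub>v v t \<omega> \<in> carrier_vec h"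
      "z2 t \<omega> + B2 *\<^sub>v v t \<omega> \<in> carrier_vec q"
      "C11 *\<^sub>v z1 t \<omega> + C12 *\<^sub>v z2 t \<omega> + D1 *\<^sub>v v t \<omega> \<in> carrier_vec h"
      "C22 *\<^sub>v z2 t \<omega> + D2 *\<^sub>v v t \<omega> \<in> carrier_vec q"
      if "t \<in> {0..T}" "\<omega> \<in> space P" for t \<omega>
      using dims[OF that] by (intro add_carrier_vec mult_mat_vec_carrier[OF G] mult_mat_vec_carrier[OF A1]
          mult_mat_vec_carrier[OF B1] mult_mat_vec_carrier[OF B2] mult_mat_vec_carrier[OF C11]
          mult_mat_vec_carrier[OF C12] mult_mat_vec_carrier[OF C22] mult_mat_vec_carrier[OF D1] mult_mat_vec_carrier[OF D2]; simp)+
    have append_index: "i < h \<Longrightarrow> (a @\<^sub>v b) $ i = a $ i" "i < q \<Longrightarrow> (a @\<^sub>v b) $ (h + i) = b $ i"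
      if "a \<in> carrier_vec h" "b \<in> carrier_vec q" for a b :: "real vec" and i
      using that by auto
    have dimv: "dim_vec x10 = h" using x10 by auto
    have 1: "?S i \<longleftrightarrow> ito_process T (x10 $ i) (\<lambda>t \<omega>. z1 t \<omega> $ i) (coord T (\<lambda>s \<omega>. A1 *\<^sub>v z1 s \<omega> + B1 *\<^sub>v v s \<omega>) i)
        (coord T (\<lambda>s \<omega>. C11 *\<^sub>v z1 s \<omega> + C12 *\<^sub>v z2 s \<omega> + D1 *\<^sub>v v s \<omega>) i)" if i: "i < h" for i
    proof -
      have "(M1 *\<^sub>v x0) $ i = x10 $ i" unfolding M1_x0 using i dimv by simp
      moreover have "?S i \<longleftrightarrow> ito_process T ((M1 *\<^sub>v x0) $ i) (\<lambda>t \<omega>. z1 t \<omega> $ i) (coord T (\<lambda>s \<omega>. A1 *\<^sub>v z1 s \<omega> + B1 *\<^sub>v v s \<omega>) i)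
        (coord T (\<lambda>s \<omega>. C11 *\<^sub>v z1 s \<omega> + C12 *\<^sub>v z2 s \<omega> + D1 *\<^sub>v v s \<omega>) i)"
        by (rule ito_process_pointwise)
          (simp_all only: coord_def prods append_index(1)[OF dims(1) cs(1) i]
            append_index(1)[OF cs(2) cs(3) i] append_index(1)[OF cs(4) cs(5) i])
      ultimately show ?thesis by simp
    qed
    have 2: "?S (h + i) \<longleftrightarrow> ito_process T 0 (\<lambda>t \<omega>. (G *\<^sub>v z2 t \<omega>) $ i) (coord T (\<lambda>s \<omega>. z2 s \<omega> + B2 *\<^sub>v v s \<omega>) i)
        (coord T (\<lambda>s \<omega>. C22 *\<^sub>v z2 s \<omega> + D2 *\<^sub>v v s \<omega>) i)" if i: "i < q" for i
    proof -
      have "(M1 *\<^sub>v x0) $ (h + i) = 0" unfolding M1_x0 using i dimv by simp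
      moreover have "?S (h + i) \<longleftrightarrow> ito_process T ((M1 *\<^sub>v x0) $ (h + i)) (\<lambda>t \<omega>. (G *\<^sub>v z2 t \<omega>) $ i) (coord T (\<lambda>s \<omega>. z2 s \<omega> + B2 *\<^sub>v v s \<omega>) i)
        (coord T (\<lambda>s \<omega>. C22 *\<^sub>v z2 s \<omega> + D2 *\<^sub>v v s \<omega>) i)"
        by (rule ito_process_pointwise)
          (simp_all only: coord_def prods append_index(2)[OF dims(1) cs(1) i]
            append_index(2)[OF cs(2) cs(3) i] append_index(2)[OF cs(4) cs(5) i])
      ultimately show ?thesis by simp
    qed
    show ?thesis unfolding split_solution_def using 1 2 by auto
  qed
  finally show ?thesis .
qed

lemma reduced_iff:
  assumes z1: "z1 \<in> L2_adapted P W T h"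
  shows "reduced_solution v z1 \<longleftrightarrow>
    (\<forall>i<h. ito_process T (x10 $ i) (\<lambda>t \<omega>. z1 t \<omega> $ i) (coord T (\<lambda>s \<omega>. A1 *\<^sub>v z1 s \<omega> + B1 *\<^sub>v v s \<omega>) i)
        (coord T (\<lambda>s \<omega>. C11 *\<^sub>v z1 s \<omega> + (D1 - C12 * B2) *\<^sub>v v s \<omega>) i))"
proof -
  have e: "ito_process T (x10 $ i) (\<lambda>t \<omega>. (1\<^sub>m h *\<^sub>v z1 t \<omega>) $ i) a b \<longleftrightarrow> ito_process T (x10 $ i) (\<lambda>t \<omega>. z1 t \<omega> $ i) a b" for i a b
    using L2_adapted_carrier[OF z1] by (intro ito_process_pointwise) auto
  show ?thesis
    unfolding sde_solution_iff[OF one_carrier_mat x10] e using z1 by blast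
qed

lemma D1_tilde: "D1 - C12 * B2 \<in> carrier_mat h r"
  using D1 C12 B2 by (intro minus_carrier_mat mult_carrier_mat)

text \<open>The source of the modified control matrix: the algebraic part feeds the control back
  into the diffusion through \<open>C12\<close>.\<close>

lemma diffusion_reduced:
  assumes a: "a \<in> carrier_vec h" and w: "w \<in> carrier_vec r"
  shows "C11 *\<^sub>v a + C12 *\<^sub>v (- B2 *\<^sub>v w) + D1 *\<^sub>v w = C11 *\<^sub>v a + (D1 - C12 * B2) *\<^sub>v w"
proof -
  have B2w: "B2 *\<^sub>v w \<in> carrier_vec q" using B2 w by simp
  have 1: "(- B2) *\<^sub>v w = - (B2 *\<^sub>v w)" using B2 w by simp
  have 2: "(D1 - C12 * B2) *\<^sub>v w = D1 *\<^sub>v w - C12 *\<^sub>v (B2 *\<^sub>v w)"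
    using minus_mult_distrib_mat_vec[OF D1 mult_carrier_mat[OF C12 B2] w] assoc_mult_mat_vec[OF C12 B2 w] by simp
  have 3: "C12 *\<^sub>v (- (B2 *\<^sub>v w)) = - (C12 *\<^sub>v (B2 *\<^sub>v w))"
    using C12 B2w by (intro eq_vecI) (auto simp: scalar_prod_def sum_negf)
  show ?thesis unfolding 1 2 3 using C11 C12 D1 a w B2w by (intro eq_vecI) auto
qed

text \<open>In terms of \<open>Y = z2 + B2 v\<close> the second group becomes
  \<open>G dY = Y dt + b dW\<close>: the drift is \<open>Y\<close> by design, and on the left
  \<open>B2 v\<close> may be added because \<open>G\<close> only sees components where it vanishes.
  This is the shape of \<open>nilpotent_system_zero\<close>. The last conclusion holds at every
  time, because the terminal cost needs it at \<open>T\<close>.\<close>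

lemma split_solution_slaved:
  assumes z1: "z1 \<in> L2_adapted P W T h" and z2: "z2 \<in> L2_adapted P W T q" and v: "v \<in> L2_adapted P W T r"
    and s: "split_solution v z1 z2"
  shows "reduced_solution v z1"
    "AE \<omega> in P. AE t in lborel. t \<in> {0..T} \<longrightarrow> z2 t \<omega> = - B2 *\<^sub>v v t \<omega>"
    "t \<in> {0..T} \<Longrightarrow> AE \<omega> in P. G *\<^sub>v z2 t \<omega> = 0\<^sub>v q"
proof -
  let ?Y = "\<lambda>t \<omega>. z2 t \<omega> + B2 *\<^sub>v v t \<omega>" and ?b = "\<lambda>t \<omega>. C22 *\<^sub>v z2 t \<omega> + D2 *\<^sub>v v t \<omega>"
  have Y: "?Y \<in> L2_adapted P W T q"
    by (intro L2_adapted_add z2 L2_adapted_mult_mat_vec[OF v B2])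
  have b: "?b \<in> L2_adapted P W T q"
    by (intro L2_adapted_add L2_adapted_mult_mat_vec[OF z2 C22] L2_adapted_mult_mat_vec[OF v D2])
  have rows: "ito_process T 0 (\<lambda>t \<omega>. (G *\<^sub>v z2 t \<omega>) $ i) (coord T ?Y i) (coord T ?b i)" if "i < q" for i
    using s that unfolding split_solution_def by blast
  have zero: "energy {0..T} (coord T ?Y i) = 0 \<and> energy {0..T} (coord T ?b i) = 0" if i: "i < q" for i
  proof (rule nilpotent_system_zero[OF T_pos _ _ _ _ i])
    show "L2_process T (coord T ?Y i)" "L2_process T (coord T ?b i)" if "i < q" for i
      using L2_adapted_coord[OF Y that] L2_adapted_coord[OF b that] by auto
    show "superdiag ms i \<Longrightarrow> Suc i < q" for i using superdiag_less[of ms i] ms by simp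
    fix i assume i: "i < q"
    have "(G *\<^sub>v z2 t \<omega>) $ i = (if superdiag ms i then coord T ?Y (Suc i) t \<omega> else 0)"
      if t: "t \<in> {0..T}" and w: "\<omega> \<in> space P" for t \<omega>
    proof (cases "superdiag ms i")
      case True
      have "Suc i < q" using superdiag_less[OF True] ms by simp
      then show ?thesis
        using True t G_index[OF L2_adapted_carrier[OF z2 t w] i] B2_row_zero[OF True L2_adapted_carrier[OF v t w]]
          L2_adapted_carrier[OF z2 t w] B2 by (simp add: coord_def)
    next
      case False
      then show ?thesis using G_index[OF L2_adapted_carrier[OF z2 t w] i] by simp
    qed
    then show "ito_process T 0 (\<lambda>t \<omega>. if superdiag ms i then coord T ?Y (Suc i) t \<omega> else 0) (coord T ?Y i) (coord T ?b i)"
      using rows[OF i] by (subst ito_process_pointwise[symmetric]) auto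
  qed
  have "AE \<omega> in P. AE t in lborel. t \<in> {0..T} \<longrightarrow> ?Y t \<omega> = 0\<^sub>v q"
    using zero by (intro L2_adapted_AE_zero[OF Y]) auto
  then show slaved: "AE \<omega> in P. AE t in lborel. t \<in> {0..T} \<longrightarrow> z2 t \<omega> = - B2 *\<^sub>v v t \<omega>"
    using AE_space
  proof eventually_elim
    case (elim \<omega>)
    from elim(1) show ?case
    proof eventually_elim
      case (elim t)
      show ?case
      proof
        assume t: "t \<in> {0..T}"
        have c: "z2 t \<omega> \<in> carrier_vec q" "v t \<omega> \<in> carrier_vec r"
          using L2_adapted_carrier[OF z2 t] L2_adapted_carrier[OF v t] \<open>\<omega> \<in> space P\<close> by auto
        have e: "z2 t \<omega> + B2 *\<^sub>v v t \<omega> = 0\<^sub>v q" using elim t by blast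
        show "z2 t \<omega> = - B2 *\<^sub>v v t \<omega>"
        proof (rule eq_vecI)
          fix i assume "i < dim_vec (- B2 *\<^sub>v v t \<omega>)"
          then have i: "i < q" using B2 by simp
          then have "z2 t \<omega> $ i + (B2 *\<^sub>v v t \<omega>) $ i = 0"
            using arg_cong[OF e, of "\<lambda>x. x $ i"] B2 c by simp
          then show "z2 t \<omega> $ i = (- B2 *\<^sub>v v t \<omega>) $ i" using i B2 c by simp
        qed (use c B2 in auto)
      qed
    qed
  qed
  show "AE \<omega> in P. G *\<^sub>v z2 t \<omega> = 0\<^sub>v q" if t: "t \<in> {0..T}" for t
  proof -
    have "AE \<omega> in P. (G *\<^sub>v z2 t \<omega>) $ i = 0" if "i \<in> {..<q}" for i
    proof -
      have i: "i < q" using that by simp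
      \<comment> \<open>Knowing \<open>z2\<close> for almost every time would not settle a single
        time. With coefficients of energy zero, however, the left-hand side is almost surely zero at
        every time.\<close>
      have "ito_process T 0 (\<lambda>t \<omega>. (G *\<^sub>v z2 t \<omega>) $ i) (\<lambda>s \<omega>. 0) (\<lambda>s \<omega>. 0)"
      proof (rule ito_process_cong[OF _ _ _ _ _ rows[OF i]])
        show m: "measurable_process (coord T ?Y i)" using L2_processD(1)[OF L2_adapted_coord[OF Y i]] .
        show "AE \<omega> in P. AE s in lborel. s \<in> {0..T} \<longrightarrow> coord T ?Y i s \<omega> = 0"
          using zero[OF i] by (intro energy_eq_0D m) auto
        show "AE \<omega> in P. AE s in lborel. s \<in> {0..T} \<longrightarrow> coord T ?b i s \<omega> = 0"
          using zero[OF i] L2_processD(1)[OF L2_adapted_coord[OF b i]] by (intro energy_eq_0D) auto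
      qed (auto intro: measurable_process_const)
      moreover note ito_process_zero[OF T_pos]
      ultimately have "AE \<omega> in P. (G *\<^sub>v z2 t \<omega>) $ i = 0 + time_integral (\<lambda>s \<omega>. 0) t \<omega> + ito_integral P W (\<lambda>s \<omega>. 0) t \<omega>"
        "AE \<omega> in P. 0 = 0 + time_integral (\<lambda>s \<omega>. 0) t \<omega> + ito_integral P W (\<lambda>s \<omega>. 0) t \<omega>"
        using t unfolding ito_process_def by blast+
      then show ?thesis by eventually_elim simp
    qed
    then have "AE \<omega> in P. \<forall>i\<in>{..<q}. (G *\<^sub>v z2 t \<omega>) $ i = 0"
      by (subst AE_ball_countable) auto
    then show ?thesis
    proof eventually_elim
      case (elim \<omega>)
      show ?case
      proof (rule eq_vecI)
        fix i assume "i < dim_vec (0\<^sub>v q :: real vec)"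
        then show "(G *\<^sub>v z2 t \<omega>) $ i = 0\<^sub>v q $ i" using elim by auto
      qed (use G in auto)
    qed
  qed
  show "reduced_solution v z1"
    unfolding reduced_iff[OF z1]
  proof (intro allI impI)
    fix i assume i: "i < h"
    have a: "(\<lambda>s \<omega>. A1 *\<^sub>v z1 s \<omega> + B1 *\<^sub>v v s \<omega>) \<in> L2_adapted P W T h"
      by (intro L2_adapted_add L2_adapted_mult_mat_vec[OF z1 A1] L2_adapted_mult_mat_vec[OF v B1])
    note m = L2_processD(1)[OF L2_adapted_coord[OF a i]]
    have p: "ito_process T (x10 $ i) (\<lambda>t \<omega>. z1 t \<omega> $ i) (coord T (\<lambda>s \<omega>. A1 *\<^sub>v z1 s \<omega> + B1 *\<^sub>v v s \<omega>) i)
        (coord T (\<lambda>s \<omega>. C11 *\<^sub>v z1 s \<omega> + C12 *\<^sub>v z2 s \<omega> + D1 *\<^sub>v v s \<omega>) i)"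
      using s i unfolding split_solution_def by blast
    show "ito_process T (x10 $ i) (\<lambda>t \<omega>. z1 t \<omega> $ i) (coord T (\<lambda>s \<omega>. A1 *\<^sub>v z1 s \<omega> + B1 *\<^sub>v v s \<omega>) i)
        (coord T (\<lambda>s \<omega>. C11 *\<^sub>v z1 s \<omega> + (D1 - C12 * B2) *\<^sub>v v s \<omega>) i)"
    proof (rule ito_process_cong[OF m m _ _ _ p])
      show "AE \<omega> in P. AE t in lborel. t \<in> {0..T} \<longrightarrow>
        coord T (\<lambda>s \<omega>. C11 *\<^sub>v z1 s \<omega> + C12 *\<^sub>v z2 s \<omega> + D1 *\<^sub>v v s \<omega>) i t \<omega> =
        coord T (\<lambda>s \<omega>. C11 *\<^sub>v z1 s \<omega> + (D1 - C12 * B2) *\<^sub>v v s \<omega>) i t \<omega>"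
        using slaved AE_space
      proof eventually_elim
        case (elim \<omega>)
        from elim(1) show ?case
        proof eventually_elim
          case (elim t)
          show ?case
          proof
            assume t: "t \<in> {0..T}"
            have c: "z1 t \<omega> \<in> carrier_vec h" "v t \<omega> \<in> carrier_vec r"
              using L2_adapted_carrier[OF z1 t] L2_adapted_carrier[OF v t] \<open>\<omega> \<in> space P\<close> by auto
            have "z2 t \<omega> = - B2 *\<^sub>v v t \<omega>" using elim t by blast
            then show "coord T (\<lambda>s \<omega>. C11 *\<^sub>v z1 s \<omega> + C12 *\<^sub>v z2 s \<omega> + D1 *\<^sub>v v s \<omega>) i t \<omega> =
              coord T (\<lambda>s \<omega>. C11 *\<^sub>v z1 s \<omega> + (D1 - C12 * B2) *\<^sub>v v s \<omega>) i t \<omega>"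
              unfolding coord_def using diffusion_reduced[OF c] by simp
          qed
        qed
      qed
    qed auto
  qed
qed

text \<open>Here the hypotheses on \<open>B2\<close> act: \<open>G (B2 v) = 0\<close> because of its
  zero rows, the drift cancels, and \<open>C22 * B2 = D2\<close> cancels the diffusion, so each
  algebraic row reads 0 = 0.\<close>

lemma reduced_imp_split:
  assumes z1: "z1 \<in> L2_adapted P W T h" and v: "v \<in> L2_adapted P W T r" and s: "reduced_solution v z1"
  shows "split_solution v z1 (\<lambda>t \<omega>. - B2 *\<^sub>v v t \<omega>)"
  unfolding split_solution_def
proof (intro conjI allI impI)
  fix i assume i: "i < h"
  have "ito_process T (x10 $ i) (\<lambda>t \<omega>. z1 t \<omega> $ i) (coord T (\<lambda>s \<omega>. A1 *\<^sub>v z1 s \<omega> + B1 *\<^sub>v v s \<omega>) i)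
        (coord T (\<lambda>s \<omega>. C11 *\<^sub>v z1 s \<omega> + (D1 - C12 * B2) *\<^sub>v v s \<omega>) i)"
    using s i unfolding reduced_iff[OF z1] by blast
  moreover have "coord T (\<lambda>s \<omega>. C11 *\<^sub>v z1 s \<omega> + C12 *\<^sub>v (- B2 *\<^sub>v v s \<omega>) + D1 *\<^sub>v v s \<omega>) i t \<omega> =
      coord T (\<lambda>s \<omega>. C11 *\<^sub>v z1 s \<omega> + (D1 - C12 * B2) *\<^sub>v v s \<omega>) i t \<omega>" if "t \<in> {0..T}" "\<omega> \<in> space P" for t \<omega>
    using diffusion_reduced[OF L2_adapted_carrier[OF z1 that] L2_adapted_carrier[OF v that]] by (simp add: coord_def)
  ultimately show "ito_process T (x10 $ i) (\<lambda>t \<omega>. z1 t \<omega> $ i) (coord T (\<lambda>s \<omega>. A1 *\<^sub>v z1 s \<omega> + B1 *\<^sub>v v s \<omega>) i)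
        (coord T (\<lambda>s \<omega>. C11 *\<^sub>v z1 s \<omega> + C12 *\<^sub>v (- B2 *\<^sub>v v s \<omega>) + D1 *\<^sub>v v s \<omega>) i)"
    by (subst ito_process_pointwise) auto
next
  fix i assume i: "i < q"
  have zero: "(G *\<^sub>v (- B2 *\<^sub>v v t \<omega>)) $ i = 0"
    "coord T (\<lambda>s \<omega>. - B2 *\<^sub>v v s \<omega> + B2 *\<^sub>v v s \<omega>) i t \<omega> = 0"
    "coord T (\<lambda>s \<omega>. C22 *\<^sub>v (- B2 *\<^sub>v v s \<omega>) + D2 *\<^sub>v v s \<omega>) i t \<omega> = 0"
    if t: "t \<in> {0..T}" and w: "\<omega> \<in> space P" for t \<omega>
  proof -
    have c: "v t \<omega> \<in> carrier_vec r" using L2_adapted_carrier[OF v t w] .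
    have B2v: "B2 *\<^sub>v v t \<omega> \<in> carrier_vec q" "- B2 *\<^sub>v v t \<omega> \<in> carrier_vec q" using B2 c by auto
    have neg: "- B2 *\<^sub>v v t \<omega> = - (B2 *\<^sub>v v t \<omega>)" using B2 c by simp
    show "(G *\<^sub>v (- B2 *\<^sub>v v t \<omega>)) $ i = 0"
    proof (cases "superdiag ms i")
      case True
      have "Suc i < q" using superdiag_less[OF True] ms by simp
      then show ?thesis
        using True G_index[OF B2v(2) i] B2_row_zero[OF True c] B2v(1) by (simp only: neg index_uminus_vec carrier_vecD if_True minus_zero)
    qed (simp add: G_index[OF B2v(2) i])
    show "coord T (\<lambda>s \<omega>. - B2 *\<^sub>v v s \<omega> + B2 *\<^sub>v v s \<omega>) i t \<omega> = 0"
      unfolding coord_def neg using i B2 B2v by simp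
    have "C22 *\<^sub>v (- (B2 *\<^sub>v v t \<omega>)) = - (C22 *\<^sub>v (B2 *\<^sub>v v t \<omega>))"
      using C22 B2v by (intro eq_vecI) (auto simp: scalar_prod_def sum_negf)
    also have "C22 *\<^sub>v (B2 *\<^sub>v v t \<omega>) = D2 *\<^sub>v v t \<omega>"
      using assoc_mult_mat_vec[OF C22 B2 c] CB by simp
    finally show "coord T (\<lambda>s \<omega>. C22 *\<^sub>v (- B2 *\<^sub>v v s \<omega>) + D2 *\<^sub>v v s \<omega>) i t \<omega> = 0"
      unfolding coord_def neg using i D2 c by simp
  qed
  show "ito_process T 0 (\<lambda>t \<omega>. (G *\<^sub>v (- B2 *\<^sub>v v t \<omega>)) $ i) (coord T (\<lambda>s \<omega>. - B2 *\<^sub>v v s \<omega> + B2 *\<^sub>v v s \<omega>) i)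
        (coord T (\<lambda>s \<omega>. C22 *\<^sub>v (- B2 *\<^sub>v v s \<omega>) + D2 *\<^sub>v v s \<omega>) i)"
    using ito_process_zero[OF T_pos] by (subst ito_process_pointwise[OF zero])
qed

lemma closed_loop_decompose:
  assumes v: "v \<in> L2_adapted P W T r" and s: "closed_loop_solution v x"
  obtains z1 z2 where "z1 \<in> L2_adapted P W T h" "z2 \<in> L2_adapted P W T q" "split_solution v z1 z2"
    "\<And>t \<omega>. t \<in> {0..T} \<Longrightarrow> \<omega> \<in> space P \<Longrightarrow> x t \<omega> = N1 *\<^sub>v (z1 t \<omega> @\<^sub>v z2 t \<omega>)"
proof -
  have x: "x \<in> L2_adapted P W T n" using s E unfolding sde_solution_def by auto
  let ?z = "\<lambda>t \<omega>. N1i *\<^sub>v x t \<omega>"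
  have z: "?z \<in> L2_adapted P W T (h + q)"
    using L2_adapted_mult_mat_vec[OF x N1i] n_eq by simp
  let ?z1 = "\<lambda>t \<omega>. vec_first (?z t \<omega>) h" and ?z2 = "\<lambda>t \<omega>. vec_last (?z t \<omega>) q"
  have z1: "?z1 \<in> L2_adapted P W T h" using z by (rule L2_adapted_vec_first)
  have z2: "?z2 \<in> L2_adapted P W T q" using z by (rule L2_adapted_vec_last)
  have eq: "x t \<omega> = N1 *\<^sub>v (?z1 t \<omega> @\<^sub>v ?z2 t \<omega>)" if "t \<in> {0..T}" "\<omega> \<in> space P" for t \<omega>
  proof -
    have "N1 *\<^sub>v (?z1 t \<omega> @\<^sub>v ?z2 t \<omega>) = N1 *\<^sub>v ?z t \<omega>"
      using vec_first_last_append[OF L2_adapted_carrier[OF z that]] by simp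
    also have "\<dots> = (N1 * N1i) *\<^sub>v x t \<omega>"
      by (rule assoc_mult_mat_vec[symmetric, OF N1 N1i L2_adapted_carrier[OF x that]])
    finally show ?thesis using N1_N1i L2_adapted_carrier[OF x that] by simp
  qed
  have "closed_loop_solution v (\<lambda>t \<omega>. N1 *\<^sub>v (?z1 t \<omega> @\<^sub>v ?z2 t \<omega>))"
    using s sde_solution_cong_state[OF E x0, of T x "\<lambda>t \<omega>. N1 *\<^sub>v (?z1 t \<omega> @\<^sub>v ?z2 t \<omega>)", OF eq] by blast
  then have "split_solution v ?z1 ?z2"
    using closed_loop_iff_split[OF z1 z2 v] by blast
  with z1 z2 show thesis using eq by (rule that)
qed

lemma reduced_L2: "reduced_solution v x1 \<Longrightarrow> x1 \<in> L2_adapted P W T h"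
  unfolding sde_solution_def by simp

lemma reduced_exists: "v \<in> L2_adapted P W T r \<Longrightarrow> \<exists>x1. reduced_solution v x1"
  by (rule linear_sde_vec(1)[OF T_pos A1 C11 B1 D1_tilde x10])

lemma reduced_unique:
  "v \<in> L2_adapted P W T r \<Longrightarrow> reduced_solution v x \<Longrightarrow> reduced_solution v y \<Longrightarrow> t \<in> {0..T} \<Longrightarrow> AE \<omega> in P. x t \<omega> = y t \<omega>"
  by (rule linear_sde_vec(2)[OF T_pos A1 C11 B1 D1_tilde x10])

text \<open>Makes every \<open>v\<close> occur in an admissible pair. Uniqueness is reached for
  almost every time, the sense in which \<open>z2\<close> is tied to \<open>v\<close>.\<close>

lemma closed_loop_unique_solution_exists:
  assumes v: "v \<in> L2_adapted P W T r"
  shows "\<exists>x. unique_sde_solution P W T E (A + B * K) B (C + D * K) D x0 v x"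
proof -
  obtain z1 where s: "reduced_solution v z1" using reduced_exists[OF v] by blast
  have z1: "z1 \<in> L2_adapted P W T h" using s by (rule reduced_L2)
  let ?z2 = "\<lambda>t \<omega>. - B2 *\<^sub>v v t \<omega>"
  have z2: "?z2 \<in> L2_adapted P W T q"
    using v by (rule L2_adapted_mult_mat_vec) (use B2 in simp)
  let ?x = "\<lambda>t \<omega>. N1 *\<^sub>v (z1 t \<omega> @\<^sub>v ?z2 t \<omega>)"
  have "closed_loop_solution v ?x"
    using closed_loop_iff_split[OF z1 z2 v] reduced_imp_split[OF z1 v s] by blast
  moreover have "AE \<omega> in P. AE t in lborel. t \<in> {0..T} \<longrightarrow> y t \<omega> = ?x t \<omega>" if y: "closed_loop_solution v y" for y
  proof -
    obtain y1 y2 where y1: "y1 \<in> L2_adapted P W T h" and y2: "y2 \<in> L2_adapted P W T q" and sy: "split_solution v y1 y2"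
      and eq: "\<And>t \<omega>. t \<in> {0..T} \<Longrightarrow> \<omega> \<in> space P \<Longrightarrow> y t \<omega> = N1 *\<^sub>v (y1 t \<omega> @\<^sub>v y2 t \<omega>)"
      using closed_loop_decompose[OF v y] by metis
    note sl = split_solution_slaved[OF y1 y2 v sy]
    have "AE \<omega> in P. AE t in lborel. t \<in> {0..T} \<longrightarrow> y1 t \<omega> = z1 t \<omega>"
      by (rule L2_adapted_AE_eq[OF y1 z1 reduced_unique[OF v sl(1) s]])
    with sl(2) show ?thesis
      using AE_space
    proof eventually_elim
      case (elim \<omega>)
      from elim(1,2) show ?case
        by eventually_elim (simp add: eq[OF _ elim(3)])
    qed
  qed
  ultimately show ?thesis unfolding unique_sde_solution_def by blast
qed

section \<open>Equality of the costs\<close>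

text \<open>\<open>fpk_Theta\<close> sends \<open>(x1, v)\<close> to \<open>(x, u)\<close>: its
  right factor inserts \<open>z2 = - B2 v\<close>, its left factor returns to the original
  coordinates and applies the feedback.\<close>

lemma Theta_mult_vec:
  assumes a: "a \<in> carrier_vec h" and w: "w \<in> carrier_vec r"
  defines "x \<equiv> N1 *\<^sub>v (a @\<^sub>v (- B2 *\<^sub>v w))"
  shows "fpk_Theta n r h K N1 B2 *\<^sub>v (a @\<^sub>v w) = x @\<^sub>v (K *\<^sub>v x + w)"
    and "fpk_Theta n r h K N1 B2 \<in> carrier_mat (n + r) (h + r)"
proof -
  let ?L = "four_block_mat N1 (0\<^sub>m n r) (K * N1) (1\<^sub>m r)"
  let ?P = "four_block_mat (1\<^sub>m h) (0\<^sub>m h r) (0\<^sub>m q h @\<^sub>r 0\<^sub>m r h) (- B2 @\<^sub>r 1\<^sub>m r)"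
  have nq: "h + (q + r) = n + r" using n_eq by simp
  have b: "- B2 *\<^sub>v w \<in> carrier_vec q" and mB2: "- B2 \<in> carrier_mat q r" using B2 w by auto
  have zr: "(0\<^sub>m q h :: real mat) @\<^sub>r 0\<^sub>m r h \<in> carrier_mat (q + r) h" and br: "- B2 @\<^sub>r 1\<^sub>m r \<in> carrier_mat (q + r) r"
    by (rule carrier_append_rows[OF zero_carrier_mat zero_carrier_mat] carrier_append_rows[OF mB2 one_carrier_mat])+
  have L: "?L \<in> carrier_mat (n + r) (n + r)" using N1 by simp
  have P: "?P \<in> carrier_mat (n + r) (h + r)"
    using four_block_carrier_mat[OF one_carrier_mat[of h] br] by (simp only: nq)
  have Theta: "fpk_Theta n r h K N1 B2 = ?L * ?P" unfolding fpk_Theta_def q_def ..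
  show "fpk_Theta n r h K N1 B2 \<in> carrier_mat (n + r) (h + r)"
    unfolding Theta using L P by (rule mult_carrier_mat)
  have ab: "a @\<^sub>v (- B2 *\<^sub>v w) \<in> carrier_vec n" using append_carrier_vec[OF a b] n_eq by simp
  then have x: "x \<in> carrier_vec n" unfolding x_def using N1 by simp
  have "?P *\<^sub>v (a @\<^sub>v w) = (1\<^sub>m h *\<^sub>v a + 0\<^sub>m h r *\<^sub>v w) @\<^sub>v ((0\<^sub>m q h @\<^sub>r 0\<^sub>m r h) *\<^sub>v a + (- B2 @\<^sub>r 1\<^sub>m r) *\<^sub>v w)"
    by (rule four_block_mat_mult_vec[OF one_carrier_mat zero_carrier_mat zr br a w])
  also have "1\<^sub>m h *\<^sub>v a + 0\<^sub>m h r *\<^sub>v w = a" using a zero_mat_mult_vec[OF w, of h] by simp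
  also have "(0\<^sub>m q h @\<^sub>r 0\<^sub>m r h) *\<^sub>v a = (0\<^sub>v q :: real vec) @\<^sub>v 0\<^sub>v r"
    using mat_mult_append[OF zero_carrier_mat zero_carrier_mat a, of q r] zero_mat_mult_vec[OF a] by simp
  also have "(- B2 @\<^sub>r 1\<^sub>m r) *\<^sub>v w = (- B2 *\<^sub>v w) @\<^sub>v w"
    using mat_mult_append[OF mB2 one_carrier_mat w] w by simp
  also have "(0\<^sub>v q @\<^sub>v 0\<^sub>v r) + ((- B2 *\<^sub>v w) @\<^sub>v w) = (- B2 *\<^sub>v w) @\<^sub>v w"
    using append_vec_add[OF zero_carrier_vec b zero_carrier_vec w] left_zero_vec[OF b] left_zero_vec[OF w] by metis
  also have "a @\<^sub>v ((- B2 *\<^sub>v w) @\<^sub>v w) = (a @\<^sub>v (- B2 *\<^sub>v w)) @\<^sub>v w" by (rule append_vec_assoc[symmetric])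
  finally have Pw: "?P *\<^sub>v (a @\<^sub>v w) = (a @\<^sub>v (- B2 *\<^sub>v w)) @\<^sub>v w" .
  have "fpk_Theta n r h K N1 B2 *\<^sub>v (a @\<^sub>v w) = ?L *\<^sub>v (?P *\<^sub>v (a @\<^sub>v w))"
    unfolding Theta by (rule assoc_mult_mat_vec[OF L P]) (use a w in simp)
  also have "\<dots> = (N1 *\<^sub>v (a @\<^sub>v (- B2 *\<^sub>v w)) + 0\<^sub>m n r *\<^sub>v w) @\<^sub>v ((K * N1) *\<^sub>v (a @\<^sub>v (- B2 *\<^sub>v w)) + 1\<^sub>m r *\<^sub>v w)"
    unfolding Pw by (rule four_block_mat_mult_vec[OF N1 zero_carrier_mat mult_carrier_mat[OF K N1] one_carrier_mat ab w])
  also have "\<dots> = x @\<^sub>v (K *\<^sub>v x + w)"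
    using zero_mat_mult_vec[OF w, of n] w x assoc_mult_mat_vec[OF K N1 ab] unfolding x_def[symmetric] by simp
  finally show "fpk_Theta n r h K N1 B2 *\<^sub>v (a @\<^sub>v w) = x @\<^sub>v (K *\<^sub>v x + w)" .
qed

lemma weight_quadratic_form:
  assumes a: "a \<in> carrier_vec h" and w: "w \<in> carrier_vec r"
  defines "x \<equiv> N1 *\<^sub>v (a @\<^sub>v (- B2 *\<^sub>v w))"
  shows "(a @\<^sub>v w) \<bullet> (fpk_weight n r h K N1 B2 Q R *\<^sub>v (a @\<^sub>v w)) =
    x \<bullet> (Q *\<^sub>v x) + (K *\<^sub>v x + w) \<bullet> (R *\<^sub>v (K *\<^sub>v x + w))"
proof -
  let ?S = "four_block_mat Q (0\<^sub>m n r) (0\<^sub>m r n) R"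
  note T = Theta_mult_vec[OF a w, folded x_def]
  have S: "?S \<in> carrier_mat (n + r) (n + r)" using Q R by simp
  have "- B2 *\<^sub>v w \<in> carrier_vec q" using B2 w by auto
  then have "a @\<^sub>v (- B2 *\<^sub>v w) \<in> carrier_vec n" using append_carrier_vec[OF a] n_eq by metis
  then have x: "x \<in> carrier_vec n" unfolding x_def using N1 by simp
  then have u: "K *\<^sub>v x + w \<in> carrier_vec r" using K w by simp
  have "(a @\<^sub>v w) \<bullet> (fpk_weight n r h K N1 B2 Q R *\<^sub>v (a @\<^sub>v w)) = (x @\<^sub>v (K *\<^sub>v x + w)) \<bullet> (?S *\<^sub>v (x @\<^sub>v (K *\<^sub>v x + w)))"
    unfolding fpk_weight_def Let_def T(1)[symmetric]
    by (rule quadratic_form_congruence[OF T(2) S]) (use a w in simp)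
  also have "?S *\<^sub>v (x @\<^sub>v (K *\<^sub>v x + w)) = (Q *\<^sub>v x) @\<^sub>v (R *\<^sub>v (K *\<^sub>v x + w))"
    by (rule mult_mat_vec_split[OF Q R x u])
  also have "(x @\<^sub>v (K *\<^sub>v x + w)) \<bullet> \<dots> = x \<bullet> (Q *\<^sub>v x) + (K *\<^sub>v x + w) \<bullet> (R *\<^sub>v (K *\<^sub>v x + w))"
    by (rule scalar_prod_append[OF x u mult_mat_vec_carrier[OF Q x] mult_mat_vec_carrier[OF R u]])
  finally show ?thesis .
qed

lemma weight_carrier: "fpk_weight n r h K N1 B2 Q R \<in> carrier_mat (h + r) (h + r)"
  unfolding fpk_weight_def Let_def
  using Theta_mult_vec(2)[OF zero_carrier_vec zero_carrier_vec] Q R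
  by (intro mult_carrier_mat[of _ _ "n + r"]) auto

text \<open>When \<open>G z2 = 0\<close>, the vector \<open>M1i (a, 0)\<close> is
  \<open>E x\<close>, so the right-hand side is the original terminal weight evaluated at
  \<open>x\<close>.\<close>

lemma Hhat_quadratic_form:
  assumes a: "a \<in> carrier_vec h"
  shows "a \<bullet> (fpk_Hhat n h M1 H *\<^sub>v a) = (M1i *\<^sub>v (a @\<^sub>v 0\<^sub>v q)) \<bullet> (H *\<^sub>v (M1i *\<^sub>v (a @\<^sub>v 0\<^sub>v q)))"
    and "fpk_Hhat n h M1 H \<in> carrier_mat h h"
proof -
  let ?J = "(1\<^sub>m h :: real mat) @\<^sub>r 0\<^sub>m q h"
  have J: "?J \<in> carrier_mat n h"
    using carrier_append_rows[OF one_carrier_mat[of h] zero_carrier_mat[of q h]] n_eq by metis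
  have Ja: "?J *\<^sub>v a = a @\<^sub>v 0\<^sub>v q"
    using mat_mult_append[OF one_carrier_mat zero_carrier_mat a, of q] a zero_mat_mult_vec[OF a] by simp
  have MJ: "M1i * ?J \<in> carrier_mat n h" using M1i J by simp
  have "fpk_Hhat n h M1 H = transpose_mat ?J * transpose_mat M1i * H * M1i * ?J"
    unfolding fpk_Hhat_def Let_def q_def M1i_def ..
  also have "\<dots> = transpose_mat ?J * transpose_mat M1i * H * (M1i * ?J)"
    using M1i J H by (intro assoc_mult_mat[of _ h n]) auto
  also have "transpose_mat ?J * transpose_mat M1i = transpose_mat (M1i * ?J)"
    using transpose_mult[OF M1i J] by simp
  finally have e: "fpk_Hhat n h M1 H = transpose_mat (M1i * ?J) * H * (M1i * ?J)" .
  show "fpk_Hhat n h M1 H \<in> carrier_mat h h" unfolding e using MJ H by simp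
  have "(M1i * ?J) *\<^sub>v a = M1i *\<^sub>v (a @\<^sub>v 0\<^sub>v q)"
    using assoc_mult_mat_vec[OF M1i J a] Ja by simp
  then show "a \<bullet> (fpk_Hhat n h M1 H *\<^sub>v a) = (M1i *\<^sub>v (a @\<^sub>v 0\<^sub>v q)) \<bullet> (H *\<^sub>v (M1i *\<^sub>v (a @\<^sub>v 0\<^sub>v q)))"
    unfolding e using quadratic_form_congruence[OF MJ H a] by simp
qed

text \<open>\<open>fpk_state\<close> is some solution of the reduced equation; uniqueness at each
  time makes the choice harmless. The running costs agree because \<open>x = N1 (x1, - B2 v)\<close>
  almost everywhere, the terminal ones because \<open>E x(T)\<close> is determined although
  \<open>x(T)\<close> is not.\<close>

lemma fsp_cost_eq_fpk_cost:
  assumes v: "v \<in> L2_adapted P W T r" and s: "closed_loop_solution v x"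
    and fb: "\<And>t \<omega>. t \<in> {0..T} \<Longrightarrow> \<omega> \<in> space P \<Longrightarrow> u t \<omega> = K *\<^sub>v x t \<omega> + v t \<omega>"
  shows "fsp_cost P T E Q R H u x = fpk_cost P W T n r h Q R H K M1 N1 A1 B1 B2 C11 C12 D1 x10 v"
proof -
  define x1 where "x1 = fpk_state P W T h A1 B1 B2 C11 C12 D1 x10 v"
  have red: "reduced_solution v x1"
    unfolding x1_def fpk_state_def by (rule someI_ex[OF reduced_exists[OF v]])
  note x1 = reduced_L2[OF red]
  have x: "x \<in> L2_adapted P W T n" using s E unfolding sde_solution_def by simp
  have u: "u \<in> L2_adapted P W T r"
    using L2_adapted_cong[of T u "\<lambda>t \<omega>. K *\<^sub>v x t \<omega> + v t \<omega>" r, OF fb]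
      L2_adapted_add[OF L2_adapted_mult_mat_vec[OF x K] v] by blast
  obtain z1 z2 where z1: "z1 \<in> L2_adapted P W T h" and z2: "z2 \<in> L2_adapted P W T q" and sp: "split_solution v z1 z2"
    and xz: "\<And>t \<omega>. t \<in> {0..T} \<Longrightarrow> \<omega> \<in> space P \<Longrightarrow> x t \<omega> = N1 *\<^sub>v (z1 t \<omega> @\<^sub>v z2 t \<omega>)"
    using closed_loop_decompose[OF v s] by metis
  note sl = split_solution_slaved[OF z1 z2 v sp]
  note z1x1 = reduced_unique[OF v sl(1) red]
  have z1_eq: "AE \<omega> in P. AE t in lborel. t \<in> {0..T} \<longrightarrow> z1 t \<omega> = x1 t \<omega>"
    by (rule L2_adapted_AE_eq[OF z1 x1 z1x1])
  let ?W = "fpk_weight n r h K N1 B2 Q R"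
  let ?w = "\<lambda>t \<omega>. x1 t \<omega> @\<^sub>v v t \<omega>"
  have w: "?w \<in> L2_adapted P W T (h + r)" by (rule L2_adapted_append[OF x1 v])
  let ?f = "\<lambda>s \<omega>. cut_prod T x (\<lambda>s \<omega>. Q *\<^sub>v x s \<omega>) s \<omega> + cut_prod T u (\<lambda>s \<omega>. R *\<^sub>v u s \<omega>) s \<omega>"
  let ?g = "cut_prod T ?w (\<lambda>s \<omega>. ?W *\<^sub>v ?w s \<omega>)"
  have f: "measurable_process ?f"
    by (intro measurable_process_add measurable_process_cut_prod[OF x] measurable_process_cut_prod[OF u]
        L2_adapted_mult_mat_vec[OF x Q] L2_adapted_mult_mat_vec[OF u R])
  have g: "measurable_process ?g"
    by (intro measurable_process_cut_prod[OF w] L2_adapted_mult_mat_vec[OF w weight_carrier])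
  have "AE \<omega> in P. AE t in lborel. t \<in> {0..T} \<longrightarrow> ?f t \<omega> = ?g t \<omega>"
    using sl(2) z1_eq AE_space
  proof eventually_elim
    case (elim \<omega>)
    from elim(1,2) show ?case
    proof eventually_elim
      case (elim t)
      show ?case
      proof
        assume t: "t \<in> {0..T}"
        have "x t \<omega> = N1 *\<^sub>v (x1 t \<omega> @\<^sub>v (- B2 *\<^sub>v v t \<omega>))"
          using xz[OF t \<open>\<omega> \<in> space P\<close>] elim t by simp
        moreover have "x1 t \<omega> \<in> carrier_vec h" "v t \<omega> \<in> carrier_vec r"
          using L2_adapted_carrier[OF x1 t] L2_adapted_carrier[OF v t] \<open>\<omega> \<in> space P\<close> by auto
        ultimately show "?f t \<omega> = ?g t \<omega>"
          using weight_quadratic_form[of "x1 t \<omega>" "v t \<omega>"] fb[OF t \<open>\<omega> \<in> space P\<close>] t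
          by (simp add: cut_prod_def)
      qed
    qed
  qed
  from expected_time_integral_cong[OF f g this]
  have "(LINT \<omega>|P. time_integral ?f T \<omega>) = (LINT \<omega>|P. time_integral ?g T \<omega>)" .
  moreover have "(LBINT t:{0..T}. x t \<omega> \<bullet> (Q *\<^sub>v x t \<omega>) + u t \<omega> \<bullet> (R *\<^sub>v u t \<omega>)) = time_integral ?f T \<omega>" for \<omega>
    unfolding time_integral_def set_lebesgue_integral_def
    by (intro Bochner_Integration.integral_cong) (auto simp: cut_prod_def indicator_def)
  moreover have "(LBINT t:{0..T}. ?w t \<omega> \<bullet> (?W *\<^sub>v ?w t \<omega>)) = time_integral ?g T \<omega>" for \<omega>
    unfolding time_integral_def set_lebesgue_integral_def
    by (intro Bochner_Integration.integral_cong) (auto simp: cut_prod_def indicator_def)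
  ultimately have running: "(LINT \<omega>|P. (LBINT t:{0..T}. x t \<omega> \<bullet> (Q *\<^sub>v x t \<omega>) + u t \<omega> \<bullet> (R *\<^sub>v u t \<omega>))) =
      (LINT \<omega>|P. (LBINT t:{0..T}. ?w t \<omega> \<bullet> (?W *\<^sub>v ?w t \<omega>)))"
    by (simp only:)
  have TT: "T \<in> {0..T}" using T_pos by simp
  let ?HE = "transpose_mat E * H * E" and ?Hh = "fpk_Hhat n h M1 H"
  have HE: "?HE \<in> carrier_mat n n" using E H by simp
  have terminal: "(LINT \<omega>|P. x T \<omega> \<bullet> (?HE *\<^sub>v x T \<omega>)) = (LINT \<omega>|P. x1 T \<omega> \<bullet> (?Hh *\<^sub>v x1 T \<omega>))"
  proof (rule integral_cong_AE)
    show "(\<lambda>\<omega>. x T \<omega> \<bullet> (?HE *\<^sub>v x T \<omega>)) \<in> borel_measurable P"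
      using measurable_process_at[OF measurable_process_cut_prod[OF x L2_adapted_mult_mat_vec[OF x HE]], of T] TT
      by (simp add: cut_prod_def[abs_def])
    show "(\<lambda>\<omega>. x1 T \<omega> \<bullet> (?Hh *\<^sub>v x1 T \<omega>)) \<in> borel_measurable P"
      using measurable_process_at[OF measurable_process_cut_prod[OF x1 L2_adapted_mult_mat_vec[OF x1 Hhat_quadratic_form(2)[OF zero_carrier_vec]]], of T] TT
      by (simp add: cut_prod_def[abs_def])
    show "AE \<omega> in P. x T \<omega> \<bullet> (?HE *\<^sub>v x T \<omega>) = x1 T \<omega> \<bullet> (?Hh *\<^sub>v x1 T \<omega>)"
      using sl(3)[OF TT] z1x1[OF TT] AE_space
    proof eventually_elim
      case (elim \<omega>)
      have c: "x T \<omega> \<in> carrier_vec n" "z1 T \<omega> \<in> carrier_vec h" "z2 T \<omega> \<in> carrier_vec q" "x1 T \<omega> \<in> carrier_vec h"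
          "v T \<omega> \<in> carrier_vec r"
        using elim(3) L2_adapted_carrier[OF x TT] L2_adapted_carrier[OF z1 TT] L2_adapted_carrier[OF z2 TT]
          L2_adapted_carrier[OF x1 TT] L2_adapted_carrier[OF v TT] by auto
      have z: "z1 T \<omega> @\<^sub>v z2 T \<omega> \<in> carrier_vec n" using append_carrier_vec[OF c(2,3)] n_eq by simp
      have Ex: "E *\<^sub>v x T \<omega> \<in> carrier_vec n" using E c by simp
      have "M1 *\<^sub>v (E *\<^sub>v x T \<omega>) = (M1 * E * N1) *\<^sub>v (z1 T \<omega> @\<^sub>v z2 T \<omega>)"
        using xz[OF TT elim(3)] assoc_mult_mat_vec[OF mult_carrier_mat[OF M1 E] N1 z]
          assoc_mult_mat_vec[OF M1 E c(1)] by simp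
      also have "\<dots> = x1 T \<omega> @\<^sub>v 0\<^sub>v q" using block_products(1)[OF c(2,3,5)] elim(1,2) by simp
      finally have "E *\<^sub>v x T \<omega> = M1i *\<^sub>v (x1 T \<omega> @\<^sub>v 0\<^sub>v q)"
        using assoc_mult_mat_vec[OF M1i M1 Ex] M1i_M1 Ex by simp
      then show ?case
        unfolding quadratic_form_congruence[OF E H c(1)] Hhat_quadratic_form(1)[OF c(4)] by simp
    qed
  qed
  show ?thesis
    unfolding fsp_cost_def fpk_cost_def Let_def x1_def[symmetric] running terminal ..
qed

section \<open>Equality of the infima\<close>

lemma feedback_closed_loop_solution:
  assumes F: "F' \<in> carrier_mat r n" and v': "v' \<in> L2_adapted P W T r"
    and fb: "\<And>t \<omega>. t \<in> {0..T} \<Longrightarrow> \<omega> \<in> space P \<Longrightarrow> u t \<omega> = F' *\<^sub>v x t \<omega> + v' t \<omega>"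
    and s: "sde_solution P W T E (A + B * F') B (C + D * F') D x0 v' x"
  obtains v where "v \<in> L2_adapted P W T r" "closed_loop_solution v x"
    "\<And>t \<omega>. t \<in> {0..T} \<Longrightarrow> \<omega> \<in> space P \<Longrightarrow> u t \<omega> = K *\<^sub>v x t \<omega> + v t \<omega>"
proof -
  have x: "x \<in> L2_adapted P W T n" using s E unfolding sde_solution_def by simp
  have mK: "- K \<in> carrier_mat r n" using K by simp
  \<comment> \<open>This is \<open>u - K x\<close>, expanded so that square-integrability and
    adaptedness follow from those of \<open>x\<close> and \<open>v'\<close>.\<close>
  define v where "v = (\<lambda>t \<omega>. F' *\<^sub>v x t \<omega> + v' t \<omega> + (- K) *\<^sub>v x t \<omega>)"
  have v: "v \<in> L2_adapted P W T r"
    unfolding v_def by (intro L2_adapted_add L2_adapted_mult_mat_vec[OF x F] v' L2_adapted_mult_mat_vec[OF x mK])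
  have eq: "F' *\<^sub>v x t \<omega> + v' t \<omega> = K *\<^sub>v x t \<omega> + v t \<omega>" if "t \<in> {0..T}" "\<omega> \<in> space P" for t \<omega>
    unfolding v_def using L2_adapted_carrier[OF x that] L2_adapted_carrier[OF v' that] F K by (intro eq_vecI) auto
  have expand: "(X + Y * L) *\<^sub>v y + Y *\<^sub>v w = X *\<^sub>v y + Y *\<^sub>v (L *\<^sub>v y + w)"
    if "X \<in> carrier_mat n n" "Y \<in> carrier_mat n r" "L \<in> carrier_mat r n" "y \<in> carrier_vec n" "w \<in> carrier_vec r"
    for X Y L :: "real mat" and y w
  proof -
    have "(X + Y * L) *\<^sub>v y = X *\<^sub>v y + Y *\<^sub>v (L *\<^sub>v y)"
      using add_mult_distrib_mat_vec[OF that(1) mult_carrier_mat[OF that(2,3)] that(4)] assoc_mult_mat_vec[OF that(2-4)] by simp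
    moreover have "Y *\<^sub>v (L *\<^sub>v y + w) = Y *\<^sub>v (L *\<^sub>v y) + Y *\<^sub>v w"
      using that by (intro mult_add_distrib_mat_vec) auto
    ultimately show ?thesis
      using assoc_add_vec[of "X *\<^sub>v y" n "Y *\<^sub>v (L *\<^sub>v y)" "Y *\<^sub>v w"] that by simp
  qed
  have "closed_loop_solution v x"
  proof (rule sde_solution_cong[OF _ _ s])
    fix t \<omega> assume t: "t \<in> {0..T}" and w: "\<omega> \<in> space P"
    note c = L2_adapted_carrier[OF x t w] and cv = L2_adapted_carrier[OF v t w] and cv' = L2_adapted_carrier[OF v' t w]
    show "(A + B * F') *\<^sub>v x t \<omega> + B *\<^sub>v v' t \<omega> = (A + B * K) *\<^sub>v x t \<omega> + B *\<^sub>v v t \<omega>"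
      unfolding expand[OF A B F c cv'] expand[OF A B K c cv] eq[OF t w] ..
    show "(C + D * F') *\<^sub>v x t \<omega> + D *\<^sub>v v' t \<omega> = (C + D * K) *\<^sub>v x t \<omega> + D *\<^sub>v v t \<omega>"
      unfolding expand[OF C D F c cv'] expand[OF C D K c cv] eq[OF t w] ..
  qed
  then show thesis using that[OF v] fb eq by simp
qed

text \<open>Each competitor on one side has a partner of the same cost on the other, so the infima
  agree whether or not they are attained or finite.\<close>

lemma INF_cost_eq:
  "(INF (u, x) \<in> admissible_pairs P W T E A B C D x0. ereal (fsp_cost P T E Q R H u x)) =
    (INF v \<in> L2_adapted P W T r. ereal (fpk_cost P W T n r h Q R H K M1 N1 A1 B1 B2 C11 C12 D1 x10 v))"
  (is "_ = (INF v \<in> _. ereal (?J1 v))")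
proof (rule antisym)
  have dims: "dim_col B = r" "dim_col E = n" using B E by auto
  show "(INF (u, x) \<in> admissible_pairs P W T E A B C D x0. ereal (fsp_cost P T E Q R H u x)) \<le>
      (INF v \<in> L2_adapted P W T r. ereal (?J1 v))"
  proof (rule INF_greatest)
    fix v assume v: "v \<in> L2_adapted P W T r"
    obtain x where ux: "unique_sde_solution P W T E (A + B * K) B (C + D * K) D x0 v x"
      using closed_loop_unique_solution_exists[OF v] by blast
    then have s: "closed_loop_solution v x" unfolding unique_sde_solution_def by blast
    then have x: "x \<in> L2_adapted P W T n" using E unfolding sde_solution_def by simp
    let ?u = "\<lambda>t \<omega>. K *\<^sub>v x t \<omega> + v t \<omega>"
    have "?u \<in> L2_adapted P W T r" by (intro L2_adapted_add L2_adapted_mult_mat_vec[OF x K] v)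
    then have "(?u, x) \<in> admissible_pairs P W T E A B C D x0"
      unfolding admissible_pairs_def dims using K v ux by blast
    then have "(INF (u, x) \<in> admissible_pairs P W T E A B C D x0. ereal (fsp_cost P T E Q R H u x)) \<le>
        ereal (fsp_cost P T E Q R H ?u x)"
      by (rule INF_lower2) simp
    then show "(INF (u, x) \<in> admissible_pairs P W T E A B C D x0. ereal (fsp_cost P T E Q R H u x)) \<le> ereal (?J1 v)"
      using fsp_cost_eq_fpk_cost[OF v s, of ?u] by simp
  qed
  show "(INF v \<in> L2_adapted P W T r. ereal (?J1 v)) \<le>
      (INF (u, x) \<in> admissible_pairs P W T E A B C D x0. ereal (fsp_cost P T E Q R H u x))"
  proof (rule INF_greatest, safe)
    fix u x assume "(u, x) \<in> admissible_pairs P W T E A B C D x0"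
    then obtain F' v' where F: "F' \<in> carrier_mat r n" and v': "v' \<in> L2_adapted P W T r"
      and fb: "\<And>t \<omega>. t \<in> {0..T} \<Longrightarrow> \<omega> \<in> space P \<Longrightarrow> u t \<omega> = F' *\<^sub>v x t \<omega> + v' t \<omega>"
      and s: "sde_solution P W T E (A + B * F') B (C + D * F') D x0 v' x"
      unfolding admissible_pairs_def unique_sde_solution_def dims by blast
    obtain v where v: "v \<in> L2_adapted P W T r" and cl: "closed_loop_solution v x"
      and fbK: "\<And>t \<omega>. t \<in> {0..T} \<Longrightarrow> \<omega> \<in> space P \<Longrightarrow> u t \<omega> = K *\<^sub>v x t \<omega> + v t \<omega>"
      using feedback_closed_loop_solution[OF F v' fb s] by metis
    have "(INF v \<in> L2_adapted P W T r. ereal (?J1 v)) \<le> ereal (?J1 v)" using v by (rule INF_lower)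
    also have "\<dots> = ereal (fsp_cost P T E Q R H u x)" using fsp_cost_eq_fpk_cost[OF v cl fbK] by simp
    finally show "(INF v \<in> L2_adapted P W T r. ereal (?J1 v)) \<le> ereal (fsp_cost P T E Q R H u x)" .
  qed
qed

end

theorem lemma4p1:
  fixes P :: "'w measure" and W :: "real \<Rightarrow> 'w \<Rightarrow> real" and T :: real
    and n r m h :: nat and ms :: "nat list"
    and E A B C D Q H R K M1 N1 A1 B1 B2 C11 C12 C22 D1 D2 :: "real mat"
    and x0 :: "real vec"
  assumes "prob_space P" and "complete_measure P" and "brownian_motion P W"
    and "0 < T"
    and "E \<in> carrier_mat n n" and "A \<in> carrier_mat n n" and "C \<in> carrier_mat n n"
    and "B \<in> carrier_mat n r" and "D \<in> carrier_mat n r"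
    and "x0 \<in> carrier_vec n"
    and "vec_space.rank n E = m" and "m < n"
    and "Q \<in> carrier_mat n n" and "H \<in> carrier_mat n n" and "R \<in> carrier_mat r r"
    and "transpose_mat Q = Q" and "transpose_mat H = H" and "transpose_mat R = R"
    and "K \<in> carrier_mat r n"
    and "structure_conditions n r E A B C D K M1 N1 h ms A1 B1 B2 C11 C12 C22 D1 D2"
    and "transpose_mat (0\<^sub>m h (n - h) @\<^sub>r 1\<^sub>m (n - h)) *\<^sub>v (M1 *\<^sub>v x0) = 0\<^sub>v (n - h)"
  shows "(INF (u, x) \<in> admissible_pairs P W T E A B C D x0. ereal (fsp_cost P T E Q R H u x)) =
    (INF v \<in> L2_adapted P W T r.
       ereal (fpk_cost P W T n r h Q R H K M1 N1 A1 B1 B2 C11 C12 D1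
                (transpose_mat (1\<^sub>m h @\<^sub>r 0\<^sub>m (n - h) h) *\<^sub>v (M1 *\<^sub>v x0)) v))"
proof -
  have carriers: "M1 \<in> carrier_mat n n" and h: "h \<le> n"
    using assms(20) unfolding structure_conditions_def by auto
  have M1x0: "M1 *\<^sub>v x0 \<in> carrier_vec (h + (n - h))"
    using carriers h assms(10) by simp
  interpret structured_problem P W T n r h ms E A B C D Q H R K M1 N1 A1 B1 B2 C11 C12 C22 D1 D2 x0
  proof (intro structured_problem.intro brownian.intro brownian_axioms.intro structured_problem_axioms.intro)
    \<comment> \<open>Condition (I), read off the transposed selector matrix.\<close>
    show "vec_last (M1 *\<^sub>v x0) (n - h) = 0\<^sub>v (n - h)"
      using assms(21) unfolding transpose_selector_mult_vec(2)[OF M1x0] .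
  qed (fact assms)+
  show ?thesis
    using INF_cost_eq unfolding x10_def transpose_selector_mult_vec(1)[OF M1x0] .
qed

end
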